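(* Let $V=\operatorname{Spec}(A)$ be an affine toric surface over $\mathbb{C}$, with its effective action of the 2-torus $\mathbb{T}\cong\mathbb{C}^*\times\mathbb{C}^*$. If $\mathbb{C}^*$ acts effectively on $V$, then this action is conjugate in $\operatorname{Aut}(V)$ to the action of a subtorus of $\mathbb{T}$.
   Context: An affine toric surface is a normal affine surface over $\mathbb{C}$ with an effective algebraic action of a 2-dimensional torus $\mathbb{T}$ (which then has an open orbit). Any such surface is isomorphic to $\mathbb{C}^*\times\mathbb{C}^*$, $\mathbb{A}^1_{\mathbb{C}}\times\mathbb{C}^*$ or $V_{d,e}=\operatorname{Spec}\mathbb{C}[X,Y]^{\mathbb{Z}_d}$, where $0\le e<d$, $\gcd(e,d)=1$ and $\mathbb{Z}_d=\langle\zeta\rangle$, the group of $d$-th roots of unity, acts by $\zeta.X=\zeta X$, $\zeta.Y=\zeta^eY$. In the last case $\mathbb{T}$ is the quotient of the standard torus $\mathbb{C}^*\times\mathbb{C}^*$ acting diagonally on $\mathbb{A}^2_{\mathbb{C}}$ by the kernel of the induced action on $V_{d,e}$. $\mathbb{C}^*$-actions are algebraic. *)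

theory Defs
  imports
    Complex_Main
    "HOL-Library.Poly_Mapping"
    "HOL-Computational_Algebra.Polynomial"
    "HOL-Algebra.Ring"
    "HOL-Algebra.Group_Action"
    "HOL-Algebra.Divisibility"
begin

text \<open>
  Complex affine varieties are treated classically: a variety is a set of (closed) points together
  with its algebra of regular functions. Regular functions are extensional on the set of points, so
  that two of them are equal as soon as they agree at every point. For \<open>V = Spec A\<close> with \<open>A\<close> a
  reduced finitely generated complex algebra, the points are the closed points of \<open>V\<close>, and
  \<open>A\<close> is identified with the algebra of regular functions.
\<close>

section \<open>Polynomials in several variables\<close>

type_synonym mpoly = "(nat \<Rightarrow>\<^sub>0 nat) \<Rightarrow>\<^sub>0 complex"

definition mpolys :: "nat \<Rightarrow> mpoly set" where
  "mpolys n = {p. \<forall>m \<in> Poly_Mapping.keys p. Poly_Mapping.keys m \<subseteq> {..<n}}"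

definition mpoly_eval :: "mpoly \<Rightarrow> (nat \<Rightarrow> complex) \<Rightarrow> complex" where
  "mpoly_eval p a =
     (\<Sum>m \<in> Poly_Mapping.keys p. Poly_Mapping.lookup p m *
        (\<Prod>i \<in> Poly_Mapping.keys m. a i ^ Poly_Mapping.lookup m i))"

section \<open>Affine varieties and morphisms\<close>

record 'a variety =
  points :: "'a set"
  regular :: "('a \<Rightarrow> complex) set"

text \<open>
  An affine variety is (isomorphic to) a Zariski closed subset of some affine \<open>n\<close>-space, its regular
  functions being the restrictions of the polynomials in the coordinates \<open>f 0, \<dots>, f (n - 1)\<close>.
  Irreducibility is not required here.
\<close>

definition affine_variety :: "'a variety \<Rightarrow> bool" where
  "affine_variety V \<longleftrightarrow>
     (\<exists>(n::nat) (f :: nat \<Rightarrow> 'a \<Rightarrow> complex) I. I \<subseteq> mpolys n \<and>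
        bij_betw (\<lambda>x. \<lambda>i\<in>{..<n}. f i x) (points V)
          {a \<in> {..<n} \<rightarrow>\<^sub>E UNIV. \<forall>p\<in>I. mpoly_eval p a = 0} \<and>
        regular V = {\<lambda>x\<in>points V. mpoly_eval p (\<lambda>i. f i x) | p. p \<in> mpolys n})"

definition morphism :: "'a variety \<Rightarrow> 'b variety \<Rightarrow> ('a \<Rightarrow> 'b) \<Rightarrow> bool" where
  "morphism V W \<phi> \<longleftrightarrow>
     \<phi> \<in> points V \<rightarrow> points W \<and> (\<forall>g\<in>regular W. compose (points V) g \<phi> \<in> regular V)"

definition variety_iso :: "'a variety \<Rightarrow> 'b variety \<Rightarrow> ('a \<Rightarrow> 'b) \<Rightarrow> bool" where
  "variety_iso V W \<phi> \<longleftrightarrow>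
     bij_betw \<phi> (points V) (points W) \<and> morphism V W \<phi> \<and>
     morphism W V (inv_into (points V) \<phi>)"

text \<open>The regular functions on a product form the tensor product of the two algebras.\<close>

definition variety_prod :: "'a variety \<Rightarrow> 'b variety \<Rightarrow> ('a \<times> 'b) variety" where
  "variety_prod V W =
     \<lparr>points = points V \<times> points W,
      regular = {\<lambda>z\<in>points V \<times> points W. \<Sum>i<n. f i (fst z) * g i (snd z) |
        (n::nat) f g. (\<forall>i<n. f i \<in> regular V) \<and> (\<forall>i<n. g i \<in> regular W)}\<rparr>"

definition zariski_closed :: "'a variety \<Rightarrow> 'a set \<Rightarrow> bool" where
  "zariski_closed V S \<longleftrightarrow> (\<exists>F \<subseteq> regular V. S = {x \<in> points V. \<forall>f\<in>F. f x = 0})"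

text \<open>The reduced structure on a subset; it is only used for Zariski closed subsets.\<close>

definition subvariety :: "'a variety \<Rightarrow> 'a set \<Rightarrow> 'a variety" where
  "subvariety V S = \<lparr>points = S, regular = (\<lambda>f. restrict f S) ` regular V\<rparr>"

definition Aut_group :: "'a variety \<Rightarrow> ('a \<Rightarrow> 'a) monoid" where
  "Aut_group V =
     (BijGroup (points V))\<lparr>carrier := {\<alpha> \<in> Bij (points V). variety_iso V V \<alpha>}\<rparr>"

section \<open>Normal affine surfaces\<close>

definition coordinate_ring :: "'a variety \<Rightarrow> ('a \<Rightarrow> complex) ring" where
  "coordinate_ring V =
     \<lparr>carrier = regular V,
      mult = (\<lambda>f g. \<lambda>x\<in>points V. f x * g x),
      one = (\<lambda>x\<in>points V. 1),
      zero = (\<lambda>x\<in>points V. 0),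
      add = (\<lambda>f g. \<lambda>x\<in>points V. f x + g x)\<rparr>"

text \<open>
  A domain is integrally closed if every fraction \<open>a / b\<close> which is a root of a monic polynomial
  \<open>X^n + c (n - 1) X^(n - 1) + \<dots> + c 0\<close> over the ring lies in the ring. The equation is written
  after multiplication by \<open>b^n\<close>.
\<close>

definition integrally_closed :: "('r, 'm) ring_scheme \<Rightarrow> bool" where
  "integrally_closed R \<longleftrightarrow>
     (\<forall>a \<in> carrier R. \<forall>b \<in> carrier R - {\<zero>\<^bsub>R\<^esub>}.
        (\<exists>(n::nat) (c :: nat \<Rightarrow> 'r). c \<in> {..<n} \<rightarrow> carrier R \<and>
           a [^]\<^bsub>R\<^esub> n \<oplus>\<^bsub>R\<^esub>
             (\<Oplus>\<^bsub>R\<^esub>i\<in>{..<n}. c i \<otimes>\<^bsub>R\<^esub> (a [^]\<^bsub>R\<^esub> i \<otimes>\<^bsub>R\<^esub> b [^]\<^bsub>R\<^esub> (n - i))) = \<zero>\<^bsub>R\<^esub>)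
        \<longrightarrow> b divides\<^bsub>R\<^esub> a)"

definition normal_variety :: "'a variety \<Rightarrow> bool" where
  "normal_variety V \<longleftrightarrow>
     domain (coordinate_ring V) \<and> integrally_closed (coordinate_ring V)"

definition alg_independent :: "'a variety \<Rightarrow> nat \<Rightarrow> (nat \<Rightarrow> 'a \<Rightarrow> complex) \<Rightarrow> bool" where
  "alg_independent V n f \<longleftrightarrow>
     (\<forall>i<n. f i \<in> regular V) \<and>
     (\<forall>p \<in> mpolys n. (\<forall>x \<in> points V. mpoly_eval p (\<lambda>i. f i x) = 0) \<longrightarrow> p = 0)"

text \<open>
  The dimension of an irreducible affine variety is the transcendence degree of its coordinate ring
  (equivalently of its function field, which has a transcendence basis of regular functions).
\<close>

definition has_dimension :: "'a variety \<Rightarrow> nat \<Rightarrow> bool" where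
  "has_dimension V d \<longleftrightarrow>
     (\<exists>f. alg_independent V d f) \<and> (\<nexists>f. alg_independent V (Suc d) f)"

definition normal_affine_surface :: "'a variety \<Rightarrow> bool" where
  "normal_affine_surface V \<longleftrightarrow>
     affine_variety V \<and> normal_variety V \<and> has_dimension V 2"

section \<open>Algebraic groups, tori and their actions\<close>

text \<open>An affine algebraic group is given by its group structure and its variety structure.\<close>

definition algebraic_group :: "('g, 'm) monoid_scheme \<Rightarrow> 'g variety \<Rightarrow> bool" where
  "algebraic_group G W \<longleftrightarrow>
     group G \<and> affine_variety W \<and> points W = carrier G \<and>
     morphism (variety_prod W W) W (\<lambda>(g, h). g \<otimes>\<^bsub>G\<^esub> h) \<and>
     morphism W W (\<lambda>g. inv\<^bsub>G\<^esub> g)"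

definition Gm_group :: "complex monoid" where
  "Gm_group = \<lparr>carrier = UNIV - {0}, mult = (*), one = 1\<rparr>"

text \<open>The regular functions on the multiplicative group are the Laurent polynomials.\<close>

definition Gm_variety :: "complex variety" where
  "Gm_variety =
     \<lparr>points = UNIV - {0},
      regular = {\<lambda>z\<in>UNIV - {0}. poly p z / z ^ k | (p :: complex poly) (k :: nat). True}\<rparr>"

definition algebraic_group_iso ::
    "('g, 'm) monoid_scheme \<Rightarrow> 'g variety \<Rightarrow> ('h, 'n) monoid_scheme \<Rightarrow> 'h variety \<Rightarrow> ('g \<Rightarrow> 'h) \<Rightarrow> bool"
  where
  "algebraic_group_iso G W H U \<psi> \<longleftrightarrow> \<psi> \<in> iso G H \<and> variety_iso W U \<psi>"

definition two_torus :: "('g, 'm) monoid_scheme \<Rightarrow> 'g variety \<Rightarrow> bool" where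
  "two_torus T W \<longleftrightarrow>
     algebraic_group T W \<and>
     (\<exists>\<psi>. algebraic_group_iso (Gm_group \<times>\<times> Gm_group) (variety_prod Gm_variety Gm_variety) T W \<psi>)"

text \<open>
  A one-dimensional subtorus \<open>S\<close> of \<open>T\<close>: a closed subgroup isomorphic, as an algebraic group, to the
  multiplicative group. The isomorphism \<open>\<psi>\<close> is kept as a parameter, since it turns the action of
  \<open>S\<close> into an action of the multiplicative group.
\<close>

definition parametrized_subtorus ::
    "('g, 'm) monoid_scheme \<Rightarrow> 'g variety \<Rightarrow> 'g set \<Rightarrow> (complex \<Rightarrow> 'g) \<Rightarrow> bool" where
  "parametrized_subtorus T W S \<psi> \<longleftrightarrow>
     subgroup S T \<and> zariski_closed W S \<and>
     algebraic_group_iso Gm_group Gm_variety (T\<lparr>carrier := S\<rparr>) (subvariety W S) \<psi>"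

text \<open>
  An action is effective if only the unit element acts as the identity, i.e. if it is a
  \<open>faithful_action\<close>; it is algebraic if the action map is a morphism.
\<close>

definition effective_algebraic_action ::
    "('g, 'm) monoid_scheme \<Rightarrow> 'g variety \<Rightarrow> 'a variety \<Rightarrow> ('g \<Rightarrow> 'a \<Rightarrow> 'a) \<Rightarrow> bool" where
  "effective_algebraic_action G W V \<sigma> \<longleftrightarrow>
     faithful_action G (points V) \<sigma> \<and>
     morphism (variety_prod W V) V (\<lambda>(g, x). \<sigma> g x)"

definition affine_toric_surface ::
    "'a variety \<Rightarrow> ('g, 'm) monoid_scheme \<Rightarrow> 'g variety \<Rightarrow> ('g \<Rightarrow> 'a \<Rightarrow> 'a) \<Rightarrow> bool" where
  "affine_toric_surface V T W \<sigma> \<longleftrightarrow>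
     normal_affine_surface V \<and> two_torus T W \<and> effective_algebraic_action T W V \<sigma>"

end

theory Submission
  imports Defs "HOL-Library.Product_Plus" "HOL-Computational_Algebra.Fundamental_Theorem_Algebra"
begin

text \<open>
  The torus action splits the coordinate ring of \<open>V\<close> into weight spaces. Since \<open>V\<close> has dimension
  two, these are at most one-dimensional; since \<open>V\<close> is normal, the weights form a saturated semigroup
  \<open>S\<close> in the lattice \<open>\<int>\<^sup>2\<close>, which therefore is cut out by at most two inequalities
  \<open>dot p1 u \<ge> 0\<close> and \<open>dot p2 u \<ge> 0\<close> with primitive \<open>p1\<close> and \<open>p2\<close>
  (\<open>S_saturated\<close>, \<open>is_plane_cone\<close>). So the coordinate ring is the algebra \<open>Alg S\<close> of the Laurent
  polynomials with exponents in \<open>S\<close>, and the three kinds of toric surfaces, given by no, one or two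
  inequalities, are treated together. An action of the multiplicative group is encoded by its
  infinitesimal generator \<open>d\<close>, a derivation of \<open>Alg S\<close> such that every element is a sum of
  eigenvectors with integer eigenvalues.

  The heart of the proof (\<open>semisimple_diagonalizable\<close>) is purely algebraic: after an automorphism
  \<open>\<phi>\<close> of \<open>Alg S\<close> all the characters \<open>chi u\<close> become eigenvectors of \<open>d\<close>. Let \<open>E1\<close> and \<open>E2\<close> be
  the Euler fields, which multiply \<open>chi u\<close> by \<open>dot p1 u\<close> and \<open>dot p2 u\<close>. Every derivation is a vector
  field \<open>A * E1 + B * E2\<close> with Laurent polynomials \<open>A\<close> and \<open>B\<close>. An exponent \<open>m\<close> of \<open>A\<close> or \<open>B\<close>
  outside \<open>S\<close> is a root: it violates one inequality by exactly one, and occurs only in the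
  corresponding component. For a grading in which the top part of \<open>d\<close> has positive degree, this
  top part is locally nilpotent, because the iterates \<open>(d ^^ j) (chi u)\<close> stay in a
  finite-dimensional space; hence a lexicographically largest exponent, if positive, is a root
  (\<open>lex_top_is_root\<close>), and the roots control the Newton polygon of \<open>d\<close>. A root \<open>m\<close> with
  \<open>dot p1 m = -1\<close> gives the triangular automorphisms
  \<open>chi u \<mapsto> chi u * (1 + c * chi m) ^ dot p1 u\<close>. If the roots lie on one side only, these automorphisms
  remove them one by one (\<open>one_sided\<close>). Otherwise consider the edge of the Newton polygon between
  the farthest roots of the two kinds. If its degree is positive, the edge part is locally nilpotent,
  and counting multiplicities of roots of polynomials in one variable (\<open>edge_collapses\<close>) shows that
  a suitable iterate is, up to a monomial, a power of a linear form; a triangular automorphism then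
  shortens the edge. In the remaining cases the degree is zero, and a suitable \<open>c\<close> is the solution of an
  equation in one unknown. Induction on the distances of the two roots finishes the argument
  (\<open>two_sided\<close>).

  Finally, the eigenvalue of \<open>\<phi> (chi u)\<close> is additive in \<open>u\<close>, hence of the form \<open>dot q u\<close>, and \<open>q\<close> is
  primitive because the action is effective. So the automorphism of \<open>V\<close> corresponding to \<open>\<phi>\<close> carries
  the given action to the one of \<open>t \<mapsto> (t powi fst q, t powi snd q)\<close>, which is an isomorphism from the
  multiplicative group to a closed subgroup of the torus.
\<close>


section \<open>Laurent polynomials in two variables\<close>

type_synonym lattice = "int \<times> int"
type_synonym laurent = "lattice \<Rightarrow>\<^sub>0 complex"

abbreviation lookup :: "laurent \<Rightarrow> lattice \<Rightarrow> complex" where "lookup \<equiv> Poly_Mapping.lookup"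
abbreviation keys :: "laurent \<Rightarrow> lattice set" where "keys \<equiv> Poly_Mapping.keys"
abbreviation chi :: "lattice \<Rightarrow> laurent" where "chi u \<equiv> Poly_Mapping.single u 1"
abbreviation cst :: "complex \<Rightarrow> laurent" where "cst c \<equiv> Poly_Mapping.single 0 c"

definition dot :: "lattice \<Rightarrow> lattice \<Rightarrow> int" where
  "dot p u = fst p * fst u + snd p * snd u"

definition smul :: "int \<Rightarrow> lattice \<Rightarrow> lattice" where
  "smul k u = (k * fst u, k * snd u)"

lemma dot_simps [simp]:
  "dot p (u + v) = dot p u + dot p v" "dot p (u - v) = dot p u - dot p v" "dot p (- u) = - dot p u"
  "dot p 0 = 0" "dot p (smul k u) = k * dot p u"
  "dot (p + q) u = dot p u + dot q u" "dot (smul k p) u = k * dot p u" "dot (- p) u = - dot p u"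
  by (simp_all add: dot_def smul_def algebra_simps)

lemma smul_simps [simp]: "smul 0 u = 0" "smul 1 u = u" "smul k 0 = 0"
  "smul (-1) u = - u" "smul j (smul k u) = smul (j * k) u"
  by (simp_all add: smul_def zero_prod_def uminus_prod_def)

lemma smul_add: "smul (j + k) u = smul j u + smul k u" "smul (j - k) u = smul j u - smul k u"
  "smul k (u + v) = smul k u + smul k v" "smul k (u - v) = smul k u - smul k v"
  "smul (- k) u = - smul k u"
  by (simp_all add: smul_def algebra_simps)

lemma smul_eq_0_iff: "smul k u = 0 \<longleftrightarrow> k = 0 \<or> u = 0"
  by (auto simp: smul_def zero_prod_def prod_eq_iff)

lemma smul_inj: "u \<noteq> 0 \<Longrightarrow> smul j u = smul k u \<longleftrightarrow> j = k"
  using smul_eq_0_iff[of "j - k" u] by (auto simp: smul_add)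

lemma chi_mult: "chi u * chi v = chi (u + v)"
  by (simp add: mult_single)

lemma chi_power: "chi u ^ n = chi (smul (int n) u)"
  by (induction n) (simp_all add: chi_mult smul_add add.commute)

lemma lookup_single_mult: "lookup (Poly_Mapping.single u c * f) w = c * lookup f (w - u)"
proof -
  have "lookup (Poly_Mapping.single u c * f) w =
     (\<Sum>l. (c when u = l) * (\<Sum>q. lookup f q when w = l + q))"
    by (simp add: lookup_mult lookup_single)
  also have "\<dots> = (\<Sum>l. c * (\<Sum>q. lookup f q when w = l + q) when l = u)"
    by (rule Sum_any.cong) (simp add: when_def)
  also have "\<dots> = c * (\<Sum>q. lookup f q when w = u + q)" by simp
  also have "(\<Sum>q. lookup f q when w = u + q) = (\<Sum>q. lookup f q when q = w - u)"
  proof (rule Sum_any.cong)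
    fix q :: lattice
    have "w = u + q \<longleftrightarrow> q = w - u"
      by (metis add_diff_cancel_left' add.commute diff_add_cancel)
    then show "(lookup f q when w = u + q) = (lookup f q when q = w - u)" by (rule arg_cong)
  qed
  finally show ?thesis by simp
qed

lemma keys_chi_mult: "keys (chi u * f) = (+) u ` keys f"
proof -
  have "w \<in> keys (chi u * f) \<longleftrightarrow> w - u \<in> keys f" for w
    by (simp add: in_keys_iff lookup_single_mult)
  moreover have "w \<in> (+) u ` keys f \<longleftrightarrow> w - u \<in> keys f" for w
  proof
    assume "w - u \<in> keys f"
    then show "w \<in> (+) u ` keys f" by (intro image_eqI[of _ _ "w - u"]) simp_all
  qed (elim imageE, simp)
  ultimately show ?thesis by blast
qed

lemma chi_cancel: "chi u * f = chi u * g \<longleftrightarrow> f = g"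
proof
  assume "chi u * f = chi u * g"
  then have "chi (- u) * (chi u * f) = chi (- u) * (chi u * g)" by simp
  then show "f = g" by (simp add: chi_mult flip: mult.assoc)
qed simp

lemma cst_mult: "cst a * cst b = cst (a * b)"
  by (simp add: mult_single)

lemma keys_cst_mult: "keys (cst c * f) \<subseteq> keys f"
  by (auto simp: in_keys_iff lookup_single_mult)

lemma cst_mult_eq_0_iff: "cst c * f = 0 \<longleftrightarrow> c = 0 \<or> f = 0"
  by (auto simp: poly_mapping_eq_iff fun_eq_iff lookup_single_mult)

lemma single_eq_cst_chi: "Poly_Mapping.single u c = cst c * chi u"
  by (simp add: mult_single)

lemma sum_singles: "keys f \<subseteq> U \<Longrightarrow> finite U \<Longrightarrow> f = (\<Sum>u\<in>U. Poly_Mapping.single u (lookup f u))"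
  by (rule poly_mapping_eqI)
     (auto simp: lookup_sum lookup_single when_def in_keys_iff)

lemma keys_add_subset: "keys f \<subseteq> S \<Longrightarrow> keys g \<subseteq> S \<Longrightarrow> keys (f + g) \<subseteq> S"
  using keys_add[of f g] by blast

lemma keys_minus: "keys (- f) = keys f"
  by (simp add: set_eq_iff in_keys_iff del: split_paired_All)

lemma keys_diff_subset: "keys f \<subseteq> S \<Longrightarrow> keys g \<subseteq> S \<Longrightarrow> keys (f - g) \<subseteq> S"
  by (metis add_uminus_conv_diff keys_add_subset keys_minus)

lemma keys_sum_subset: "(\<And>i. i \<in> I \<Longrightarrow> keys (f i) \<subseteq> S) \<Longrightarrow> keys (sum f I) \<subseteq> S"
proof (induction I rule: infinite_finite_induct)
  case (insert x F)
  then show ?case by (simp add: keys_add_subset)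
qed simp_all

lemma laurent_induct [consumes 1, case_names single add]:
  assumes "keys f \<subseteq> S" "\<And>u c. u \<in> S \<Longrightarrow> P (Poly_Mapping.single u c)"
    and add: "\<And>f g. keys f \<subseteq> S \<Longrightarrow> keys g \<subseteq> S \<Longrightarrow> P f \<Longrightarrow> P g \<Longrightarrow> P (f + g)"
    and "P 0"
  shows "P f"
proof -
  have "P (\<Sum>u\<in>U. Poly_Mapping.single u (lookup f u)) \<and>
      keys (\<Sum>u\<in>U. Poly_Mapping.single u (lookup f u)) \<subseteq> S" if "finite U" "U \<subseteq> keys f" for U
    using that
  proof (induction U rule: finite_induct)
    case (insert u U)
    then have "u \<in> S" "keys (Poly_Mapping.single u (lookup f u)) \<subseteq> S" using assms(1) by auto
    with insert show ?case by (simp add: add assms(2) keys_add_subset)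
  qed (simp add: \<open>P 0\<close>)
  from this[OF finite_keys order_refl] show ?thesis using sum_singles[of f "keys f"] by simp
qed

subsection \<open>Operators\<close>

definition linext :: "(lattice \<Rightarrow> laurent) \<Rightarrow> laurent \<Rightarrow> laurent" where
  "linext h f = (\<Sum>u\<in>keys f. cst (lookup f u) * h u)"

lemma linext_superset: "finite U \<Longrightarrow> keys f \<subseteq> U \<Longrightarrow> linext h f = (\<Sum>u\<in>U. cst (lookup f u) * h u)"
  unfolding linext_def by (rule sum.mono_neutral_left) (auto simp: in_keys_iff)

lemma linext_add: "linext h (f + g) = linext h f + linext h g"
proof -
  let ?U = "keys f \<union> keys g"
  have "linext h (f + g) = (\<Sum>u\<in>?U. cst (lookup (f + g) u) * h u)"
    by (rule linext_superset) (use keys_add[of f g] in auto)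
  also have "\<dots> = (\<Sum>u\<in>?U. cst (lookup f u) * h u) + (\<Sum>u\<in>?U. cst (lookup g u) * h u)"
    by (simp add: lookup_add single_add algebra_simps sum.distrib)
  finally show ?thesis by (simp add: linext_superset[of ?U])
qed

lemma linext_0 [simp]: "linext h 0 = 0"
  by (simp add: linext_def)

lemma linext_single [simp]: "linext h (Poly_Mapping.single u c) = cst c * h u"
  by (simp add: linext_def)

lemma keys_linext: "(\<And>u. u \<in> keys f \<Longrightarrow> keys (h u) \<subseteq> S) \<Longrightarrow> keys (linext h f) \<subseteq> S"
  unfolding linext_def by (intro keys_sum_subset) (use keys_cst_mult in blast)

definition euler :: "lattice \<Rightarrow> laurent \<Rightarrow> laurent" where
  "euler p f = Poly_Mapping.mapp (\<lambda>u c. of_int (dot p u) * c) f"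

text \<open>
  The component of degree \<open>s\<close> for the grading by the functional \<open>l\<close>.
\<close>

definition gpart :: "lattice \<Rightarrow> int \<Rightarrow> laurent \<Rightarrow> laurent" where
  "gpart l s f = Poly_Mapping.mapp (\<lambda>u c. if dot l u = s then c else 0) f"

lemma lookup_euler [simp]: "lookup (euler p f) u = of_int (dot p u) * lookup f u"
  by (auto simp: euler_def lookup_mapp when_def in_keys_iff)

lemma lookup_gpart: "lookup (gpart l s f) u = (if dot l u = s then lookup f u else 0)"
  by (auto simp: gpart_def lookup_mapp when_def in_keys_iff)

lemma euler_simps [simp]:
  "euler p (f + g) = euler p f + euler p g" "euler p 0 = 0"
  "euler p (Poly_Mapping.single u c) = cst (of_int (dot p u)) * Poly_Mapping.single u c"
  "euler p (cst c * f) = cst c * euler p f" "euler p (f - g) = euler p f - euler p g"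
  "euler p 1 = 0"
  by (rule poly_mapping_eqI; simp add: lookup_add ring_distribs lookup_single_mult lookup_minus
        lookup_one when_def lookup_single del: single_of_int)+

lemma euler_mult_cst [simp]: "euler p (f * cst c) = cst c * euler p f"
  by (simp add: mult.commute[of f "cst c"])

lemma euler_mult: "euler p (f * g) = f * euler p g + g * euler p f"
proof (rule laurent_induct[OF subset_UNIV, of "\<lambda>f. euler p (f * g) = f * euler p g + g * euler p f" f])
  fix u :: lattice and c :: complex
  have "euler p (Poly_Mapping.single u c) = Poly_Mapping.single u (of_int (dot p u) * c)"
    by (simp add: mult_single del: single_of_int)
  then have *: "lookup (g * euler p (Poly_Mapping.single u c)) w =
      of_int (dot p u) * c * lookup g (w - u)" for w
    by (simp only: mult.commute[of g] lookup_single_mult)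
  show "euler p (Poly_Mapping.single u c * g) =
      Poly_Mapping.single u c * euler p g + g * euler p (Poly_Mapping.single u c)"
    by (rule poly_mapping_eqI)
      (simp only: lookup_add * lookup_single_mult lookup_euler dot_simps of_int_diff, simp add: algebra_simps)
next
  fix f1 f2
  assume "euler p (f1 * g) = f1 * euler p g + g * euler p f1"
    "euler p (f2 * g) = f2 * euler p g + g * euler p f2"
  then show "euler p ((f1 + f2) * g) = (f1 + f2) * euler p g + g * euler p (f1 + f2)"
    by (simp add: distrib_left distrib_right)
qed simp

lemma keys_euler: "keys (euler p f) \<subseteq> keys f"
  by (auto simp: in_keys_iff)

text \<open>
  The vector field \<open>A * E1 + B * E2\<close>, where \<open>E1\<close> and \<open>E2\<close> are the Euler fields of \<open>p1\<close> and \<open>p2\<close>. On a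
  torus these two fields are a basis of the vector fields when \<open>p1\<close> and \<open>p2\<close> are independent.
\<close>

definition vfield :: "lattice \<Rightarrow> lattice \<Rightarrow> laurent \<Rightarrow> laurent \<Rightarrow> laurent \<Rightarrow> laurent" where
  "vfield p1 p2 A B f = A * euler p1 f + B * euler p2 f"

lemma vfield_simps [simp]:
  "vfield p1 p2 A B (f + g) = vfield p1 p2 A B f + vfield p1 p2 A B g"
  "vfield p1 p2 A B 0 = 0" "vfield p1 p2 A B 1 = 0"
  "vfield p1 p2 A B (f - g) = vfield p1 p2 A B f - vfield p1 p2 A B g"
  "vfield p1 p2 A B (cst c * f) = cst c * vfield p1 p2 A B f"
  "vfield p1 p2 A B (cst c) = 0"
  by (simp_all add: vfield_def algebra_simps)

lemma vfield_mult: "vfield p1 p2 A B (f * g) = f * vfield p1 p2 A B g + g * vfield p1 p2 A B f"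
  by (simp add: vfield_def euler_mult algebra_simps)

lemma vfield_chi: "vfield p1 p2 A B (chi u) =
   chi u * (cst (of_int (dot p1 u)) * A + cst (of_int (dot p2 u)) * B)"
  by (simp add: vfield_def algebra_simps)

lemma vfield_power: "vfield p1 p2 A B (f ^ n) = of_nat n * f ^ (n - 1) * vfield p1 p2 A B f"
proof (induction n)
  case (Suc n)
  let ?d = "vfield p1 p2 A B f"
  have *: "f * (of_nat n * f ^ (n - 1) * ?d) = of_nat n * f ^ n * ?d"
    by (cases n) (simp_all only: power_Suc diff_Suc_1 of_nat_0 mult_zero_left mult_zero_right mult_ac)
  have "vfield p1 p2 A B (f ^ Suc n) = of_nat n * f ^ n * ?d + f ^ n * ?d"
    by (simp only: power_Suc vfield_mult Suc.IH *)
  also have "\<dots> = of_nat (Suc n) * f ^ (Suc n - 1) * ?d"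
    by (simp only: of_nat_Suc diff_Suc_1 distrib_right mult_1_left add.commute)
  finally show ?case .
qed simp

subsection \<open>Top parts\<close>

definition below :: "lattice \<Rightarrow> int \<Rightarrow> laurent \<Rightarrow> bool" where
  "below l s f \<longleftrightarrow> (\<forall>u\<in>keys f. dot l u \<le> s)"

lemma below_add: "below l s f \<Longrightarrow> below l s g \<Longrightarrow> below l s (f + g)"
  unfolding below_def using keys_add[of f g] by blast

lemma gpart_simps [simp]:
  "gpart l s (f + g) = gpart l s f + gpart l s g" "gpart l s 0 = 0"
  "gpart l s (Poly_Mapping.single u c) = (if dot l u = s then Poly_Mapping.single u c else 0)"
  "gpart l s (cst c * f) = cst c * gpart l s f"
  "gpart l s (f - g) = gpart l s f - gpart l s g"
  "euler p (gpart l s f) = gpart l s (euler p f)"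
  by (rule poly_mapping_eqI; simp add: lookup_add lookup_gpart lookup_single_mult lookup_single
        when_def lookup_minus; auto)+

lemma gpart_chi_mult: "gpart l s (chi u * f) = chi u * gpart l (s - dot l u) f"
proof (rule poly_mapping_eqI)
  fix w
  show "lookup (gpart l s (chi u * f)) w = lookup (chi u * gpart l (s - dot l u) f) w"
    by (simp only: lookup_gpart lookup_single_mult dot_simps) simp
qed

lemma keys_gpart: "keys (gpart l s f) = {u \<in> keys f. dot l u = s}"
proof (rule Set.set_eqI)
  fix u show "u \<in> keys (gpart l s f) \<longleftrightarrow> u \<in> {u \<in> keys f. dot l u = s}"
    by (simp add: in_keys_iff lookup_gpart)
qed

lemma gpart_eq_0: "below l s f \<Longrightarrow> s < t \<Longrightarrow> gpart l t f = 0"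
proof -
  assume "below l s f" "s < t"
  then have "keys (gpart l t f) = {}" by (force simp: keys_gpart below_def)
  then show ?thesis by simp
qed

lemma below_mult:
  assumes "below l s f" "below l t g" shows "below l (s + t) (f * g)"
  unfolding below_def
proof
  fix u assume "u \<in> keys (f * g)"
  then obtain a b where "u = a + b" "a \<in> keys f" "b \<in> keys g" using keys_mult[of f g] by blast
  with assms show "dot l u \<le> s + t" by (simp add: below_def add_mono)
qed

lemma gpart_mult_top:
  assumes "below l s f" "below l t g"
  shows "gpart l (s + t) (f * g) = gpart l s f * gpart l t g"
proof -
  have "keys f \<subseteq> {u. dot l u \<le> s}" using assms(1) by (auto simp: below_def)
  then show ?thesis
  proof (induction f rule: laurent_induct)
    case (single u c)
    have eq: "gpart l (s + t) (Poly_Mapping.single u c * g)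
        = cst c * (chi u * gpart l (s + t - dot l u) g)"
      by (simp only: single_eq_cst_chi[of u c] mult.assoc gpart_simps(4) gpart_chi_mult)
    show ?case
    proof (cases "dot l u = s")
      case True
      then show ?thesis unfolding eq by (simp only: gpart_simps(3) if_True single_eq_cst_chi[of u c] mult.assoc) simp
    next
      case False
      with single have "gpart l (s + t - dot l u) g = 0"
        by (intro gpart_eq_0[OF assms(2)]) simp
      with False show ?thesis unfolding eq by (simp only: gpart_simps(3) if_False mult_zero_right mult_zero_left)
    qed
  next
    case (add f g)
    then show ?case by (simp only: distrib_right gpart_simps(1))
  qed simp
qed

lemma below_euler: "below l s f \<Longrightarrow> below l s (euler p f)"
  using keys_euler[of p f] unfolding below_def by blast

lemma below_vfield:
  "below l D A \<Longrightarrow> below l D B \<Longrightarrow> below l s f \<Longrightarrow> below l (D + s) (vfield p1 p2 A B f)"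
  unfolding vfield_def by (intro below_add below_mult below_euler)

text \<open>
  Passing to the top part turns a derivation of a graded algebra into a homogeneous one; this is how
  properties of \<open>A * E1 + B * E2\<close> are read off from the boundary of its Newton polygon.
\<close>

lemma gpart_vfield_top:
  "below l D A \<Longrightarrow> below l D B \<Longrightarrow> below l s f \<Longrightarrow>
   gpart l (D + s) (vfield p1 p2 A B f) = vfield p1 p2 (gpart l D A) (gpart l D B) (gpart l s f)"
  unfolding vfield_def by (simp add: gpart_mult_top below_euler)

section \<open>The edge of a Newton polygon\<close>

lemma coeff_mult_top:
  fixes p q :: "complex poly"
  assumes "degree p \<le> m" "degree q \<le> n"
  shows "coeff (p * q) (m + n) = coeff p m * coeff q n"
proof -
  have "coeff p i * coeff q (m + n - i) = 0" if "i \<le> m + n" "i \<noteq> m" for i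
    using that assms by (cases "i < m") (simp_all add: coeff_eq_0)
  then have "(\<Sum>i\<le>m + n. coeff p i * coeff q (m + n - i)) =
      (\<Sum>i\<in>{m}. coeff p i * coeff q (m + n - i))"
    by (intro sum.mono_neutral_right) auto
  then show ?thesis by (simp add: coeff_mult)
qed

lemma linear_mult_pderiv_power:
  fixes g :: "complex poly" and c :: complex
  defines "p \<equiv> [:-c, 1:]"
  shows "p * pderiv (p ^ k * g) = p ^ k * (of_nat k * g + p * pderiv g)"
proof -
  have "pderiv p = 1" by (simp add: p_def pderiv_pCons)
  then have "p * pderiv (p ^ k * g) = p ^ k * p * pderiv g + g * (p * pderiv (p ^ k))"
    by (simp add: pderiv_mult algebra_simps)
  moreover have "p * pderiv (p ^ k) = of_nat k * p ^ k"
  proof (cases k)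
    case (Suc n)
    then show ?thesis using \<open>pderiv p = 1\<close>
      by (simp only: pderiv_power_Suc) (simp add: algebra_simps of_nat_poly)
  qed simp
  ultimately show ?thesis by (simp add: algebra_simps)
qed

text \<open>
  Along an edge of the Newton polygon, a vector field is a monomial times \<open>x(s) * E1 + y(s) * E2\<close>, where
  \<open>s\<close> is the character of the primitive direction of the edge, which has coordinates \<open>(b, -a)\<close> with
  respect to \<open>p1\<close> and \<open>p2\<close>. Its iterates on a character with coordinates \<open>(u1, u2)\<close> are monomials
  times \<open>f j\<close> evaluated at \<open>s\<close>, and \<open>f_Suc\<close> is the resulting recursion. The end points of the
  edge are roots of the two kinds, \<open>I\<close> is its lattice length and \<open>D\<close> its degree for the grading in
  which \<open>s\<close> has degree zero.
\<close>

locale edge =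
  fixes x y :: "complex poly" and a b u1 u2 D :: int and I :: nat and f :: "nat \<Rightarrow> complex poly"
    and \<beta> :: "complex poly"
  assumes ab: "a \<ge> 1" "b \<ge> 1"
    and D: "D = int I * a * b - a - b" "D > 0"
    and x: "degree x \<le> I" "coeff x I = 0" "coeff x 0 \<noteq> 0"
    and y: "degree y \<le> I" "coeff y I \<noteq> 0" "coeff y 0 = 0"
    and beta: "\<beta> = smult (of_int b) x - smult (of_int a) y"
    and f0: "f 0 = 1"
    and f_Suc: "\<And>j. f (Suc j) =
      (smult (of_int (u1 - int j)) x + smult (of_int (u2 + int j * (int I * a - 1))) y) * f j
        + \<beta> * pCons 0 (pderiv (f j))"
    and u: "a * u1 + b * u2 > 0"
begin

lemma beta_nz: "\<beta> \<noteq> 0" "degree \<beta> \<le> I"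
proof -
  have "coeff \<beta> I \<noteq> 0" using x y ab by (simp add: beta)
  then show "\<beta> \<noteq> 0" by auto
  show "degree \<beta> \<le> I" using x y unfolding beta by (auto intro!: degree_diff_le)
qed

text \<open>
  The coordinates with respect to \<open>p1\<close> and \<open>p2\<close> of the monomial in front of the \<open>j\<close>-th iterate.
\<close>

definition U1 where "U1 j = u1 - int j"
definition U2 where "U2 j = u2 + int j * (int I * a - 1)"

lemma weight: "a * U1 j + b * U2 j = a * u1 + b * u2 + int j * D"
  by (simp add: U1_def U2_def D algebra_simps)

lemma weight_pos: "a * U1 j + b * U2 j > 0"
proof -
  have "int j * D \<ge> 0" using D(2) by simp
  then show ?thesis unfolding weight using u by linarith
qed

text \<open>
  Let \<open>c\<close> be a root of multiplicity \<open>e\<close> of the last nonzero iterate \<open>f j\<close>. The equation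
  \<open>\<alpha> * f j + \<beta> * s * (f j)' = 0\<close> forces \<open>\<beta>\<close> to vanish at \<open>c\<close>, to some order \<open>\<nu> + 1\<close>, and then \<open>\<alpha>\<close>
  vanishes to order \<open>\<nu>\<close>, with a known leading coefficient. So every step of the recursion raises the
  order of vanishing at \<open>c\<close> by at least \<open>\<nu>\<close>, and by exactly \<open>\<nu>\<close> unless an explicit integer is zero.
  Since the recursion ends with zero, the integer must vanish at some step, and this is the
  stated inequality.
\<close>

lemma root_multiplicity:
  assumes F: "f j \<noteq> 0" "f (Suc j) = 0" and c: "poly (f j) c = 0" "c \<noteq> 0"
  shows "Polynomial.order c \<beta> \<ge> 1 \<and>
    (int (Polynomial.order c \<beta>) - 1) * (a * U1 j + b * U2 j) > int (Polynomial.order c (f j)) * D"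
proof -
  define p where "p = [:-c, 1:]"
  define e where "e = Polynomial.order c (f j)"
  define L where "L = a * U1 j + b * U2 j"
  define \<alpha> where "\<alpha> = smult (of_int (U1 j)) x + smult (of_int (U2 j)) y"
  have pc: "poly p c = 0" by (simp add: p_def)
  have pnz: "p \<noteq> 0" by (simp add: p_def)
  have L: "L > 0" using weight_pos by (simp add: L_def)
  have rel: "\<alpha> * f j + \<beta> * ([:0, 1:] * pderiv (f j)) = 0"
    using F(2) f_Suc[of j] by (simp add: \<alpha>_def U1_def U2_def)
  obtain K where K: "f j = p ^ e * K" "\<not> p dvd K"
    using order_decomp[OF F(1), of c] by (auto simp: p_def e_def)
  have Kc: "poly K c \<noteq> 0" using K(2) by (simp add: p_def poly_eq_0_iff_dvd)
  have e: "e \<ge> 1" using c(1) F(1) order_root[of "f j" c] by (simp add: e_def)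
  have "p ^ e * (\<alpha> * p * K + \<beta> * [:0, 1:] * (of_nat e * K + p * pderiv K)) =
      p * (\<alpha> * f j + \<beta> * ([:0, 1:] * pderiv (f j)))"
  proof -
    have "p * (\<alpha> * (q * K) + \<beta> * (z * w)) = q * (\<alpha> * p * K) + \<beta> * z * (p * w)" for q z w
      by (simp only: distrib_left mult_ac)
    moreover have "q * (\<alpha> * p * K) + \<beta> * z * (q * w) = q * (\<alpha> * p * K + \<beta> * z * w)" for q z w
      by (simp only: distrib_left mult_ac)
    ultimately show ?thesis
      unfolding K(1) by (simp only: linear_mult_pderiv_power[of c e K, folded p_def])
  qed
  then have rel2: "\<alpha> * p * K + \<beta> * [:0, 1:] * (of_nat e * K + p * pderiv K) = 0"
    using rel pnz by simp
  from arg_cong[OF this, of "\<lambda>q. poly q c"] have "poly \<beta> c = 0"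
    using c(2) e Kc pc by simp
  then have "Polynomial.order c \<beta> \<ge> 1" using beta_nz(1) order_root[of \<beta> c] by simp
  then obtain \<nu> where nu: "Polynomial.order c \<beta> = Suc \<nu>" by (cases "Polynomial.order c \<beta>") auto
  obtain B where B: "\<beta> = p ^ Suc \<nu> * B" "\<not> p dvd B"
    using order_decomp[OF beta_nz(1), of c] nu by (auto simp: p_def)
  have Bc: "poly B c \<noteq> 0" using B(2) by (simp add: p_def poly_eq_0_iff_dvd)
  have "p * (\<alpha> * K + p ^ \<nu> * B * [:0, 1:] * (of_nat e * K + p * pderiv K)) = 0"
    using rel2 unfolding B(1) by (simp only: power_Suc distrib_left mult_ac)
  then have rel3: "\<alpha> * K + p ^ \<nu> * B * [:0, 1:] * (of_nat e * K + p * pderiv K) = 0"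
    using pnz by (simp only: mult_eq_0_iff simp_thms)
  then have "\<alpha> * K = p ^ \<nu> * (- (B * [:0, 1:] * (of_nat e * K + p * pderiv K)))"
    by (simp only: add_eq_0_iff2 mult_minus_right mult.assoc)
  then have dvd: "p ^ \<nu> dvd \<alpha> * K" by (rule dvdI)
  have "p ^ \<nu> dvd \<alpha>"
  proof (cases "\<alpha> = 0")
    case False
    have "K \<noteq> 0" using K(2) by auto
    then have "Polynomial.order c (\<alpha> * K) = Polynomial.order c \<alpha>"
      using False Kc by (simp add: order_mult order_root)
    with dvd \<open>K \<noteq> 0\<close> False show ?thesis
      unfolding p_def by (simp add: order_divides)
  qed simp
  then obtain A where A: "\<alpha> = p ^ \<nu> * A" by (rule dvdE)
  have "p ^ \<nu> * (A * K + B * [:0, 1:] * (of_nat e * K + p * pderiv K)) = 0"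
    using rel3 unfolding A by (simp only: distrib_left mult_ac)
  then have "A * K + B * [:0, 1:] * (of_nat e * K + p * pderiv K) = 0" using pnz by simp
  from arg_cong[OF this, of "\<lambda>q. poly q c"]
  have "(poly A c + poly B c * c * of_nat e) * poly K c = 0"
    using pc by (simp add: algebra_simps)
  then have Ac: "poly A c = - (poly B c * c * of_nat e)" using Kc by (simp add: add_eq_0_iff2)
  have comb: "smult (of_int L) (smult (of_int v1) x + smult (of_int v2) y) =
      p ^ \<nu> * (smult (of_int (a * v1 + b * v2)) A + smult (of_int (v1 * U2 j - v2 * U1 j)) (p * B))" for v1 v2
  proof -
    have "smult (of_int L) (smult (of_int v1) x + smult (of_int v2) y) =
      smult (of_int (a * v1 + b * v2)) \<alpha> + smult (of_int (v1 * U2 j - v2 * U1 j)) \<beta>"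
      by (rule poly_eqI) (simp add: L_def \<alpha>_def beta algebra_simps)
    then show ?thesis unfolding A B(1) by (simp add: algebra_simps)
  qed
  \<comment> \<open>Otherwise \<open>f i\<close> vanishes at \<open>c\<close> to the exact order \<open>i * \<nu>\<close> for all \<open>i\<close>, so it is never zero.\<close>
  have "\<exists>i. int i * int \<nu> * L = int e * (a * u1 + b * u2 + int i * D)"
  proof (rule ccontr)
    assume no: "\<not> ?thesis"
    have "\<exists>g. f i = p ^ (i * \<nu>) * g \<and> poly g c \<noteq> 0" for i
    proof (induction i)
      case 0
      then show ?case using f0 by (intro exI[of _ 1]) simp
    next
      case (Suc i)
      then obtain g where g: "f i = p ^ (i * \<nu>) * g" "poly g c \<noteq> 0" by blast
      let ?al = "smult (of_int (U1 i)) x + smult (of_int (U2 i)) y"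
      let ?q = "p ^ (i * \<nu>)"
      define h where "h = (smult (of_int (a * U1 i + b * U2 i)) A
          + smult (of_int (U1 i * U2 j - U2 i * U1 j)) (p * B)) * g
          + smult (of_int L) ([:0, 1:] * B * (of_nat (i * \<nu>) * g + p * pderiv g))"
      have "smult (of_int L) (f (Suc i)) = smult (of_int L) ?al * f i
          + smult (of_int L) (p ^ \<nu> * [:0, 1:] * B * (p * pderiv (f i)))"
        by (simp add: f_Suc B(1) U1_def U2_def smult_add_right algebra_simps)
      also have "\<dots> = p ^ \<nu> * ?q * h"
        unfolding comb g(1) linear_mult_pderiv_power[of c, folded p_def] h_def
        by (simp add: algebra_simps)
      finally have eq: "smult (of_int L) (f (Suc i)) = p ^ (Suc i * \<nu>) * h"
        by (simp add: power_add)
      have "poly h c = poly B c * c * poly g c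
          * of_int (int i * int \<nu> * L - int e * (a * u1 + b * u2 + int i * D))"
        unfolding h_def weight by (simp add: Ac pc algebra_simps)
      moreover have "int i * int \<nu> * L - int e * (a * u1 + b * u2 + int i * D) \<noteq> 0"
        using no by simp
      ultimately have "poly h c \<noteq> 0"
        using Bc c(2) g(2) by (simp only: mult_eq_0_iff of_int_eq_0_iff) simp
      moreover have "f (Suc i) = p ^ (Suc i * \<nu>) * smult (1 / of_int L) h"
        using arg_cong[OF eq, of "smult (1 / of_int L)"] L by simp
      ultimately show ?case using L by (intro exI[of _ "smult (1 / of_int L) h"]) simp
    qed
    from this[of "Suc j"] F(2) pnz show False by auto
  qed
  then obtain i where i: "int i * int \<nu> * L = int e * (a * u1 + b * u2 + int i * D)" ..
  have "i > 0"
  proof (rule ccontr)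
    assume "\<not> i > 0"
    with i u e show False by simp
  qed
  have "int i * (int e * D) < int e * (a * u1 + b * u2) + int i * (int e * D)"
    using u e by simp
  also have "\<dots> = int i * (int \<nu> * L)" using i by (simp add: algebra_simps)
  finally have "int e * D < int \<nu> * L" using \<open>i > 0\<close> by simp
  then show ?thesis using nu by (simp add: L_def e_def)
qed

text \<open>
  Let \<open>f j\<close> be the last nonzero iterate. Comparing the lowest and the highest coefficients of
  \<open>\<alpha> * f j + \<beta> * s * (f j)' = 0\<close> determines the order \<open>s\<close> of \<open>f j\<close> at \<open>0\<close> and its degree \<open>s + N\<close>. By
  \<open>root_multiplicity\<close>, every other root costs \<open>\<beta>\<close>, whose degree is at most \<open>I\<close>, more zeros than
  its share. Summing over the set \<open>R\<close> of these roots gives \<open>card R * (a * b) < a + b\<close>, which leaves a single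
  root and forces \<open>a = 1\<close> or \<open>b = 1\<close>.
\<close>

theorem edge_collapses:
  assumes "f k = 0"
  shows "\<exists>j c \<kappa> s N. f (Suc j) = 0 \<and> f j = smult \<kappa> ([:0, 1:] ^ s * [:- c, 1:] ^ N) \<and>
    \<kappa> \<noteq> 0 \<and> c \<noteq> 0 \<and> N > 0 \<and> U1 j + int s * b = 0 \<and> U2 j = a * (int s + int N) \<and> (a = 1 \<or> b = 1)"
proof -
  obtain j where j: "f j \<noteq> 0" "f (Suc j) = 0"
  proof -
    have "f (LEAST k. f k = 0) = 0" using assms by (rule LeastI)
    moreover obtain j where "(LEAST k. f k = 0) = Suc j"
      using f0 calculation by (cases "LEAST k. f k = 0") auto
    moreover have "f j \<noteq> 0" using not_less_Least[of j "\<lambda>k. f k = 0"] calculation(2) by simp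
    ultimately show ?thesis using that by simp
  qed
  define L where "L = a * U1 j + b * U2 j"
  have L: "L > 0" using weight_pos by (simp add: L_def)
  define z where "z = [:0, 1 :: complex:]"
  define s where "s = Polynomial.order 0 (f j)"
  obtain G where G: "f j = z ^ s * G" "\<not> z dvd G"
    using order_decomp[OF j(1), of 0] by (auto simp: s_def z_def)
  have Gnz: "G \<noteq> 0" using G by auto
  have G0: "poly G 0 \<noteq> 0" using G(2) poly_eq_0_iff_dvd[of G 0] by (simp add: z_def)
  define N where "N = degree G"
  define \<alpha> where "\<alpha> = smult (of_int (U1 j)) x + smult (of_int (U2 j)) y"
  have "z ^ s * (\<alpha> * G + \<beta> * (of_nat s * G + z * pderiv G)) = \<alpha> * f j + \<beta> * (z * pderiv (f j))"
    unfolding G(1) using linear_mult_pderiv_power[of 0 s G] by (simp add: z_def algebra_simps)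
  also have "\<dots> = f (Suc j)" by (simp add: f_Suc \<alpha>_def U1_def U2_def z_def)
  finally have rel: "\<alpha> * G + \<beta> * (of_nat s * G + z * pderiv G) = 0" using j(2) by (simp add: z_def)
  have "(of_int (U1 j) * coeff x 0 + of_int b * coeff x 0 * of_nat s) * poly G 0 = 0"
  proof -
    have "poly \<alpha> 0 = of_int (U1 j) * coeff x 0" "poly \<beta> 0 = of_int b * coeff x 0"
      using y(3) by (simp_all add: \<alpha>_def beta poly_0_coeff_0)
    then show ?thesis
      using arg_cong[OF rel, of "\<lambda>q. poly q 0"] by (simp add: z_def distrib_right mult.assoc)
  qed
  moreover have "of_int (U1 j) * coeff x 0 + of_int b * coeff x 0 * of_nat s
      = coeff x 0 * of_int (U1 j + int s * b)"
    by (simp add: algebra_simps)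
  ultimately have "coeff x 0 * of_int (U1 j + int s * b) = 0"
    using G0 by (simp only: mult_eq_0_iff simp_thms)
  then have s: "U1 j + int s * b = 0" using x(3) by (simp only: mult_eq_0_iff of_int_eq_0_iff simp_thms)
  have dG: "degree (of_nat s * G + z * pderiv G) \<le> N"
  proof (rule degree_add_le)
    show "degree (of_nat s * G) \<le> N" by (simp add: N_def of_nat_poly)
    show "degree (z * pderiv G) \<le> N"
      by (cases "pderiv G = 0") (auto simp: z_def N_def degree_pderiv pderiv_eq_0_iff)
  qed
  have cG: "coeff (of_nat s * G + z * pderiv G) N = of_nat (s + N) * coeff G N"
    by (cases N) (simp_all add: z_def of_nat_poly coeff_pderiv algebra_simps)
  have "degree \<alpha> \<le> I" unfolding \<alpha>_def using x(1) y(1)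
    by (auto intro!: degree_add_le)
  then have "coeff (\<alpha> * G) (I + N) = coeff \<alpha> I * coeff G N"
    by (rule coeff_mult_top) (simp add: N_def)
  moreover have "coeff (\<beta> * (of_nat s * G + z * pderiv G)) (I + N) =
      coeff \<beta> I * (of_nat (s + N) * coeff G N)"
    by (simp only: coeff_mult_top[OF beta_nz(2) dG] cG)
  moreover have "coeff (\<alpha> * G) (I + N) + coeff (\<beta> * (of_nat s * G + z * pderiv G)) (I + N) = 0"
    using arg_cong[OF rel, of "\<lambda>q. coeff q (I + N)"] by (simp only: coeff_add coeff_0)
  ultimately have "coeff \<alpha> I * coeff G N + coeff \<beta> I * (of_nat (s + N) * coeff G N) = 0"
    by (simp only:)
  moreover have "coeff \<alpha> I * g + coeff \<beta> I * (of_nat (s + N) * g) =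
      coeff y I * g * of_int (U2 j - a * (int s + int N))" for g
    using x(2) by (simp add: \<alpha>_def beta algebra_simps)
  ultimately have "coeff y I * coeff G N * of_int (U2 j - a * (int s + int N)) = 0"
    by simp
  moreover have "coeff G N \<noteq> 0" using Gnz by (simp add: N_def)
  ultimately have U2: "U2 j = a * (int s + int N)" using y(2) by (simp only: mult_eq_0_iff of_int_eq_0_iff simp_thms right_minus_eq)
  have LN: "L = a * b * int N"
  proof -
    have "U1 j = - int s * b" using s by simp
    then show ?thesis unfolding L_def U2 by (simp add: algebra_simps)
  qed
  then have N: "N > 0" using L by (cases N) auto
  define R where "R = {c. poly G c = 0}"
  have finR: "finite R" using Gnz poly_roots_finite by (simp add: R_def)
  have sumR: "(\<Sum>c\<in>R. Polynomial.order c G) = N"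
    using size_proots_complex[of G] Gnz by (simp add: size_multiset_overloaded_eq R_def N_def)
  have "R \<noteq> {}" using sumR N by auto
  have root: "Polynomial.order c \<beta> \<ge> 1" "(int (Polynomial.order c \<beta>) - 1) * L > int (Polynomial.order c G) * D" if "c \<in> R" for c
  proof -
    have "c \<noteq> 0" using that G0 by (auto simp: R_def)
    have "z ^ s \<noteq> 0" by (simp add: z_def)
    have "Polynomial.order c (f j) = Polynomial.order c (z ^ s) + Polynomial.order c G"
      using j(1) unfolding G(1) by (rule order_mult)
    also have "Polynomial.order c (z ^ s) = 0" using \<open>c \<noteq> 0\<close> by (intro order_0I) (simp add: z_def)
    finally have o: "Polynomial.order c (f j) = Polynomial.order c G" by simp
    have "poly (f j) c = 0" using that by (simp add: G(1) R_def)
    from root_multiplicity[OF j this \<open>c \<noteq> 0\<close>]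
    show "Polynomial.order c \<beta> \<ge> 1" "(int (Polynomial.order c \<beta>) - 1) * L > int (Polynomial.order c G) * D"
      by (simp_all add: o L_def)
  qed
  have "(\<Sum>c\<in>R. Polynomial.order c \<beta>) \<le> I"
  proof -
    have sub: "R \<subseteq> set_mset (proots \<beta>)"
      using root(1) beta_nz(1) by (fastforce simp: order_root)
    have "(\<Sum>c\<in>R. Polynomial.order c \<beta>) \<le> (\<Sum>c\<in>set_mset (proots \<beta>). Polynomial.order c \<beta>)"
      by (rule sum_mono2) (use sub in auto)
    also have "\<dots> = size (proots \<beta>)" using beta_nz(1) by (simp add: size_multiset_overloaded_eq)
    also have "\<dots> \<le> I" using size_proots_le[of \<beta>] beta_nz(2) by linarith
    finally show ?thesis .
  qed
  then have sumb: "(\<Sum>c\<in>R. int (Polynomial.order c \<beta>)) \<le> int I" by (metis of_nat_le_iff of_nat_sum)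
  have "int N * D = (\<Sum>c\<in>R. int (Polynomial.order c G) * D)"
    unfolding sumR[symmetric] by (simp add: sum_distrib_right)
  also have "\<dots> < (\<Sum>c\<in>R. (int (Polynomial.order c \<beta>) - 1) * L)"
    by (rule sum_strict_mono) (use finR \<open>R \<noteq> {}\<close> root in auto)
  also have "\<dots> = ((\<Sum>c\<in>R. int (Polynomial.order c \<beta>)) - int (card R)) * L"
    by (simp add: sum_subtractf flip: sum_distrib_right)
  also have "\<dots> \<le> (int I - int (card R)) * L"
    using sumb L by (intro mult_right_mono) auto
  also have "\<dots> = int N * ((int I - int (card R)) * (a * b))" by (simp add: LN)
  finally have "D < (int I - int (card R)) * (a * b)" using N by simp
  then have ineq: "int (card R) * (a * b) < a + b" by (simp add: D algebra_simps)
  have cR: "card R \<ge> 1" using finR \<open>R \<noteq> {}\<close> by (simp add: Suc_le_eq card_gt_0_iff)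
  have ab0: "a * b \<ge> 1" using ab by (metis mult_mono' mult_1 zero_le_one)
  have ab1: "(a - 1) * (b - 1) \<ge> 0" using ab by simp
  then have ab2: "a + b \<le> a * b + 1" by (simp add: algebra_simps)
  have "card R = 1"
  proof (rule ccontr)
    assume "card R \<noteq> 1"
    then have "2 * (a * b) \<le> int (card R) * (a * b)" using cR ab0 by (intro mult_right_mono) auto
    then show False using ineq ab0 ab2 by linarith
  qed
  then obtain c where c: "R = {c}" by (auto simp: card_1_singleton_iff)
  have "a = 1 \<or> b = 1"
  proof (rule ccontr)
    assume "\<not> ?thesis"
    then have "1 \<le> a - 1" "1 \<le> b - 1" using ab by auto
    then have "1 \<le> (a - 1) * (b - 1)" using mult_mono[of 1 "a - 1" 1 "b - 1"] by simp
    then show False using ineq \<open>card R = 1\<close> by (simp add: algebra_simps)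
  qed
  have "c \<noteq> 0" using c G0 by (auto simp: R_def)
  have oc: "Polynomial.order c G = N" using sumR c by simp
  obtain q where q: "G = [:- c, 1:] ^ N * q"
    using order_decomp[OF Gnz, of c] oc by auto
  have "q \<noteq> 0" using q Gnz by auto
  then have "degree G = N + degree q" unfolding q by (simp add: degree_mult_eq degree_power_eq)
  then have "degree q = 0" by (simp add: N_def)
  then obtain \<kappa> where \<kappa>: "q = [:\<kappa>:]" by (rule degree_eq_zeroE)
  have "f j = smult \<kappa> ([:0, 1:] ^ s * [:- c, 1:] ^ N)"
    unfolding G(1) q \<kappa> z_def by simp
  moreover have "\<kappa> \<noteq> 0" using \<kappa> \<open>q \<noteq> 0\<close> by auto
  ultimately show ?thesis
    using j(2) \<open>c \<noteq> 0\<close> N s U2 \<open>a = 1 \<or> b = 1\<close> by blast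
qed

end

lemma below_diff: "below l s f \<Longrightarrow> below l s g \<Longrightarrow> below l s (f - g)"
  using keys_diff_subset[of f "{u. dot l u \<le> s}" g] unfolding below_def by blast

section \<open>Semigroup algebras of plane cones and their derivations\<close>

definition Alg :: "lattice set \<Rightarrow> laurent set" where
  "Alg S = {f. keys f \<subseteq> S}"

definition derivation_on :: "lattice set \<Rightarrow> (laurent \<Rightarrow> laurent) \<Rightarrow> bool" where
  "derivation_on S d \<longleftrightarrow> (\<forall>f\<in>Alg S. d f \<in> Alg S) \<and>
     (\<forall>f\<in>Alg S. \<forall>g\<in>Alg S. d (f + g) = d f + d g \<and> d (f * g) = f * d g + g * d f) \<and>
     (\<forall>c. d (cst c) = 0)"

text \<open>
  The infinitesimal generator of an action of the multiplicative group has this property: \<open>F k\<close> is the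
  component of weight \<open>k\<close> of \<open>f\<close>.
\<close>

definition int_semisimple :: "lattice set \<Rightarrow> (laurent \<Rightarrow> laurent) \<Rightarrow> bool" where
  "int_semisimple S d \<longleftrightarrow> (\<forall>f\<in>Alg S. \<exists>(K::int set) F. finite K \<and> f = (\<Sum>k\<in>K. F k) \<and>
     (\<forall>k\<in>K. F k \<in> Alg S \<and> d (F k) = cst (of_int k) * F k))"

text \<open>
  The flags \<open>b1\<close> and \<open>b2\<close> tell which inequalities are imposed, so that the whole lattice, half planes
  and pointed cones are covered at once. In all cases \<open>p1\<close> and \<open>p2\<close> serve as coordinates.
\<close>

locale plane_cone =
  fixes S :: "lattice set" and p1 p2 :: lattice and b1 b2 :: bool
  assumes S_def: "S = {u. (b1 \<longrightarrow> dot p1 u \<ge> 0) \<and> (b2 \<longrightarrow> dot p2 u \<ge> 0)}"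
    and prim1: "\<exists>e. dot p1 e = 1" and prim2: "\<exists>e. dot p2 e = 1"
    and indep: "fst p1 * snd p2 - snd p1 * fst p2 \<noteq> 0"
begin

text \<open>
  The vectors \<open>v1\<close> and \<open>v2\<close> are \<open>N\<close> times the basis dual to \<open>p1\<close> and \<open>p2\<close>, where \<open>N\<close> is the index of
  the sublattice spanned by \<open>p1\<close> and \<open>p2\<close>.
\<close>

definition N :: int where "N = \<bar>fst p1 * snd p2 - snd p1 * fst p2\<bar>"
definition v1 :: lattice where
  "v1 = smul (sgn (fst p1 * snd p2 - snd p1 * fst p2)) (snd p2, - fst p2)"
definition v2 :: lattice where
  "v2 = smul (sgn (fst p1 * snd p2 - snd p1 * fst p2)) (- snd p1, fst p1)"

lemma N_pos: "N > 0"
  using indep by (simp add: N_def)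

lemma dot_v [simp]: "dot p1 v1 = N" "dot p2 v1 = 0" "dot p1 v2 = 0" "dot p2 v2 = N"
  by (simp_all add: v1_def v2_def N_def dot_def smul_def abs_sgn algebra_simps)

lemma cramer: "smul N u = smul (dot p1 u) v1 + smul (dot p2 u) v2"
  by (simp add: v1_def v2_def N_def dot_def smul_def abs_sgn prod_eq_iff algebra_simps)

lemma dot_inj: "dot p1 u = 0 \<Longrightarrow> dot p2 u = 0 \<Longrightarrow> u = 0"
  using cramer[of u] N_pos by (simp add: smul_eq_0_iff)

lemma dot_inj': "dot p1 u = dot p1 w \<Longrightarrow> dot p2 u = dot p2 w \<Longrightarrow> u = w"
  using dot_inj[of "u - w"] by simp

lemma v_in_S: "v1 \<in> S" "v2 \<in> S" "0 \<in> S"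
  using N_pos by (simp_all add: S_def)

lemma S_add: "u \<in> S \<Longrightarrow> w \<in> S \<Longrightarrow> u + w \<in> S"
  by (auto simp: S_def)

lemma e1: obtains e where "e \<in> S" "dot p1 e = 1"
proof -
  obtain e where e: "dot p1 e = 1" using prim1 by blast
  let ?e = "e + smul \<bar>dot p2 e\<bar> v2"
  have "dot p2 ?e \<ge> 0"
  proof -
    have "\<bar>dot p2 e\<bar> * 1 \<le> \<bar>dot p2 e\<bar> * N" using N_pos by (intro mult_left_mono) auto
    then show ?thesis by simp
  qed
  then have "?e \<in> S" using e by (simp add: S_def)
  then show ?thesis using that[of ?e] e by simp
qed

lemma Alg_simps:
  "f \<in> Alg S \<Longrightarrow> g \<in> Alg S \<Longrightarrow> f + g \<in> Alg S" "f \<in> Alg S \<Longrightarrow> g \<in> Alg S \<Longrightarrow> f - g \<in> Alg S"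
  "cst c \<in> Alg S" "u \<in> S \<Longrightarrow> chi u \<in> Alg S" "u \<in> S \<Longrightarrow> Poly_Mapping.single u c \<in> Alg S"
  "0 \<in> Alg S" "1 \<in> Alg S" "f \<in> Alg S \<Longrightarrow> cst c * f \<in> Alg S"
  using v_in_S(3) keys_add_subset[of f S g] keys_diff_subset[of f S g] keys_cst_mult[of c f]
  by (simp_all add: Alg_def)

lemma Alg_mult: assumes "f \<in> Alg S" "g \<in> Alg S" shows "f * g \<in> Alg S"
proof -
  have "{a + b |a b. a \<in> keys f \<and> b \<in> keys g} \<subseteq> S" using assms S_add by (force simp: Alg_def)
  with keys_mult[of f g] show ?thesis by (simp add: Alg_def)
qed

lemma Alg_sum: "(\<And>i. i \<in> I \<Longrightarrow> h i \<in> Alg S) \<Longrightarrow> sum h I \<in> Alg S"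
  by (simp add: Alg_def keys_sum_subset)

abbreviation vf where "vf \<equiv> vfield p1 p2"

subsection \<open>Derivations are vector fields\<close>

definition repr :: "(laurent \<Rightarrow> laurent) \<Rightarrow> laurent \<Rightarrow> laurent \<Rightarrow> bool" where
  "repr d A B \<longleftrightarrow> (\<forall>f\<in>Alg S. d f = vf A B f)"

text \<open>
  By the Leibniz rule the logarithmic derivative \<open>chi (- u) * d (chi u)\<close> is additive in \<open>u\<close>. So it is
  determined by its values at \<open>v1\<close> and \<open>v2\<close>, which span a sublattice of finite index.
\<close>

lemma derivation_repr:
  assumes d: "derivation_on S d"
  defines "\<delta> \<equiv> \<lambda>u. chi (- u) * d (chi u)"
  shows "repr d (cst (1 / of_int N) * \<delta> v1) (cst (1 / of_int N) * \<delta> v2)"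
proof -
  let ?A = "cst (1 / of_int N) * \<delta> v1" and ?B = "cst (1 / of_int N) * \<delta> v2"
  have d_add: "d (f + g) = d f + d g" and d_mult: "d (f * g) = f * d g + g * d f"
    if "f \<in> Alg S" "g \<in> Alg S" for f g using d that by (simp_all add: derivation_on_def)
  have d_cst: "d (cst c) = 0" for c using d by (simp add: derivation_on_def)
  have d_smult: "d (cst c * f) = cst c * d f" if "f \<in> Alg S" for c f
    using d_mult[OF Alg_simps(3) that] by (simp add: d_cst)
  have del: "d (chi u) = chi u * \<delta> u" for u
    by (simp add: \<delta>_def chi_mult flip: mult.assoc)
  have \<delta>_0: "\<delta> 0 = 0" using d_cst[of 1] by (simp add: \<delta>_def)
  have \<delta>_add: "\<delta> (u + w) = \<delta> u + \<delta> w" if "u \<in> S" "w \<in> S" for u w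
  proof -
    have "chi (u + w) * \<delta> (u + w) = d (chi u * chi w)" by (simp only: chi_mult del)
    also have "\<dots> = chi u * (chi w * \<delta> w) + chi w * (chi u * \<delta> u)"
      using that by (simp only: d_mult Alg_simps del)
    also have "\<dots> = chi (u + w) * (\<delta> u + \<delta> w)"
      by (simp only: chi_mult[symmetric] distrib_left mult_ac add_ac)
    finally show ?thesis by (simp only: chi_cancel)
  qed
  have nat_mult: "smul (int k) u \<in> S \<and> \<delta> (smul (int k) u) = cst (of_nat k) * \<delta> u" if "u \<in> S" for k u
  proof (induction k)
    case (Suc k)
    have "smul (int (Suc k)) u = smul (int k) u + u" by (simp add: smul_add add.commute)
    moreover have "cst (of_nat (Suc k)) * \<delta> u = cst (of_nat k) * \<delta> u + \<delta> u"
      by (simp only: of_nat_Suc single_add distrib_right single_one) simp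
    ultimately show ?case using Suc S_add \<delta>_add[of "smul (int k) u" u] that by simp
  qed (simp add: \<delta>_0 v_in_S)
  have int_mult: "smul k v \<in> S \<and> \<delta> (smul k v) = cst (of_int k) * \<delta> v"
    if "v \<in> S" "k \<ge> 0 \<or> - v \<in> S" for k v
  proof (cases "k \<ge> 0")
    case True
    then show ?thesis using nat_mult[OF that(1), of "nat k"] by simp
  next
    case False
    then have mv: "- v \<in> S" using that by simp
    have neg: "\<delta> (- v) = - \<delta> v" using \<delta>_add[OF that(1) mv] \<delta>_0 by (simp add: eq_neg_iff_add_eq_0 add.commute)
    have "smul (int (nat (- k))) (- v) = smul k v" using False by (simp add: smul_def)
    moreover have "cst (of_nat (nat (- k))) * - \<delta> v = cst (of_int k) * \<delta> v"
    proof -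
      have "(of_nat (nat (- k)) :: complex) = - of_int k" using False by simp
      then show ?thesis by (simp only: single_uminus mult_minus_left mult_minus_right minus_minus)
    qed
    ultimately show ?thesis using nat_mult[OF mv, of "nat (- k)"] neg by simp
  qed
  have \<delta>_eq: "\<delta> u = cst (of_int (dot p1 u)) * ?A + cst (of_int (dot p2 u)) * ?B" if u: "u \<in> S" for u
  proof -
    have m1: "smul (dot p1 u) v1 \<in> S \<and> \<delta> (smul (dot p1 u) v1) = cst (of_int (dot p1 u)) * \<delta> v1"
      using u N_pos by (intro int_mult v_in_S) (auto simp: S_def)
    have m2: "smul (dot p2 u) v2 \<in> S \<and> \<delta> (smul (dot p2 u) v2) = cst (of_int (dot p2 u)) * \<delta> v2"
      using u N_pos by (intro int_mult v_in_S) (auto simp: S_def)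
    have "cst (of_int N) * \<delta> u = \<delta> (smul N u)" using int_mult[OF u, of N] N_pos by simp
    also have "\<dots> = cst (of_int (dot p1 u)) * \<delta> v1 + cst (of_int (dot p2 u)) * \<delta> v2"
      unfolding cramer using m1 m2 \<delta>_add by simp
    finally have "cst (1 / of_int N) * (cst (of_int N) * \<delta> u) =
      cst (1 / of_int N) * (cst (of_int (dot p1 u)) * \<delta> v1 + cst (of_int (dot p2 u)) * \<delta> v2)" by simp
    moreover have "cst (1 / of_int N) * (cst (of_int N) * \<delta> u) = \<delta> u"
      using N_pos by (simp only: mult.assoc[symmetric] cst_mult) simp
    ultimately show ?thesis by (simp only: distrib_left mult_ac)
  qed
  show ?thesis unfolding repr_def
  proof
    fix f assume "f \<in> Alg S"
    then have "keys f \<subseteq> S" by (simp add: Alg_def)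
    then show "d f = vf ?A ?B f"
    proof (induction f rule: laurent_induct)
      case (single u c)
      then have "d (Poly_Mapping.single u c) = cst c * (chi u * \<delta> u)"
        using d_smult[OF Alg_simps(4)[OF single]] del by (simp only: single_eq_cst_chi[of u c])
      then show ?case using \<delta>_eq[OF single]
        by (simp only: single_eq_cst_chi[of u c] vfield_simps vfield_chi)
    next
      case (add f g)
      then show ?case by (simp only: vfield_simps d_add Alg_def mem_Collect_eq)
    qed (use d_cst[of 0] in simp)
  qed
qed

lemma repr_chi: "repr d A B \<Longrightarrow> u \<in> S \<Longrightarrow>
    d (chi u) = chi u * (cst (of_int (dot p1 u)) * A + cst (of_int (dot p2 u)) * B)"
  by (simp add: repr_def Alg_simps vfield_chi)

lemma repr_lookup: assumes "repr d A B" "derivation_on S d" "u \<in> S"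
    "of_int (dot p1 u) * lookup A m + of_int (dot p2 u) * lookup B m \<noteq> 0"
  shows "u + m \<in> S"
proof -
  have "d (chi u) \<in> Alg S" using assms(2,3) by (simp add: derivation_on_def Alg_simps)
  moreover have "lookup (d (chi u)) (u + m) = of_int (dot p1 u) * lookup A m + of_int (dot p2 u) * lookup B m"
    unfolding repr_chi[OF assms(1,3)] by (simp add: lookup_single_mult lookup_add del: single_of_int)
  then have "u + m \<in> keys (d (chi u))" using assms(4) by (simp add: in_keys_iff)
  ultimately show ?thesis by (auto simp: Alg_def)
qed

text \<open>
  The derivation is applied to characters on the boundary of the cone, \<open>chi v2\<close>, and next to it,
  \<open>chi e\<close> with \<open>dot p1 e = 1\<close>; the result has to be supported in \<open>S\<close>.
\<close>

lemma repr_root1: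
  assumes r: "repr d A B" "derivation_on S d" and b1
  shows "dot p1 m < 0 \<Longrightarrow> lookup B m = 0" "dot p1 m < -1 \<Longrightarrow> lookup A m = 0"
proof -
  show B: "lookup B m = 0" if "dot p1 m < 0"
  proof (rule ccontr)
    assume "lookup B m \<noteq> 0"
    then have "v2 + m \<in> S" using repr_lookup[OF r v_in_S(2), of m] N_pos by simp
    then show False using that \<open>b1\<close> by (simp add: S_def)
  qed
  show "lookup A m = 0" if "dot p1 m < -1"
  proof (rule ccontr)
    assume "lookup A m \<noteq> 0"
    obtain e where e: "e \<in> S" "dot p1 e = 1" by (rule e1)
    then have "e + m \<in> S" using repr_lookup[OF r e(1), of m] B that \<open>lookup A m \<noteq> 0\<close> by simp
    then show False using that \<open>b1\<close> e by (simp add: S_def)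
  qed
qed

lemma swap: "plane_cone S p2 p1 b2 b1"
  using prim1 prim2 indep by unfold_locales (auto simp: S_def algebra_simps)

lemma repr_swap: "repr d A B \<Longrightarrow> plane_cone.repr S p2 p1 d B A"
  by (simp add: repr_def plane_cone.repr_def[OF swap] vfield_def add.commute)

lemma repr_root2:
  assumes "repr d A B" "derivation_on S d" b2
  shows "dot p2 m < 0 \<Longrightarrow> lookup A m = 0" "dot p2 m < -1 \<Longrightarrow> lookup B m = 0"
  using plane_cone.repr_root1[OF swap repr_swap assms(2)] assms by blast+

definition spt :: "laurent \<Rightarrow> laurent \<Rightarrow> lattice set" where "spt A B = keys A \<union> keys B"

lemma spt_iff: "m \<in> spt A B \<longleftrightarrow> lookup A m \<noteq> 0 \<or> lookup B m \<noteq> 0"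
  by (simp add: spt_def in_keys_iff)

text \<open>
  An exponent of a derivation outside \<open>S\<close> is a root of the first or of the second kind.
\<close>

lemma spt_cases:
  assumes "repr d A B" "derivation_on S d" "m \<in> spt A B" "m \<notin> S"
  shows "b1 \<and> dot p1 m = -1 \<and> lookup B m = 0 \<and> lookup A m \<noteq> 0 \<and> (b2 \<longrightarrow> dot p2 m \<ge> 0) \<or>
    b2 \<and> dot p2 m = -1 \<and> lookup A m = 0 \<and> lookup B m \<noteq> 0 \<and> (b1 \<longrightarrow> dot p1 m \<ge> 0)"
proof -
  have ne: "lookup A m \<noteq> 0 \<or> lookup B m \<noteq> 0" using assms(3) by (simp add: spt_iff)
  consider "b1" "dot p1 m < 0" | "b2" "dot p2 m < 0" using assms(4) by (auto simp: S_def)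
  then show ?thesis
  proof cases
    case 1
    have "lookup B m = 0" using repr_root1(1)[OF assms(1,2) 1] .
    moreover from this ne have "\<not> dot p1 m < -1" using repr_root1(2)[OF assms(1,2) 1(1), of m] by blast
    moreover have "b2 \<longrightarrow> dot p2 m \<ge> 0"
      using repr_root2(1)[OF assms(1,2), of m] ne calculation(1) by linarith
    ultimately show ?thesis using 1 ne by simp
  next
    case 2
    have "lookup A m = 0" using repr_root2(1)[OF assms(1,2) 2] .
    moreover from this ne have "\<not> dot p2 m < -1" using repr_root2(2)[OF assms(1,2) 2(1), of m] by blast
    moreover have "b1 \<longrightarrow> dot p1 m \<ge> 0"
      using repr_root1(1)[OF assms(1,2), of m] ne calculation(1) by linarith
    ultimately show ?thesis using 2 ne by simp
  qed
qed

subsection \<open>Local finiteness and semisimplicity at the top\<close>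

lemma vf_iterate_top:
  assumes "below l D A" "below l D B" "below l s f"
  shows "below l (s + int j * D) ((vf A B ^^ j) f) \<and>
    gpart l (s + int j * D) ((vf A B ^^ j) f) = (vf (gpart l D A) (gpart l D B) ^^ j) (gpart l s f)"
proof (induction j)
  case (Suc j)
  have eq: "s + int (Suc j) * D = D + (s + int j * D)" by (simp add: algebra_simps)
  from Suc show ?case unfolding eq
    using below_vfield[OF assms(1,2)] gpart_vfield_top[OF assms(1,2)] by simp
qed (use assms in simp)

text \<open>
  The iterates of \<open>d\<close> on \<open>chi u\<close> stay in the span of finitely many eigenvectors, so their degrees are
  bounded. But every application of the top part raises the degree by \<open>D > 0\<close> unless it gives zero.
\<close>

lemma top_nilpotent:
  assumes r: "repr d A B" "derivation_on S d" "int_semisimple S d"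
    and D: "below l D A" "below l D B" "D > 0" and u: "u \<in> S"
  shows "\<exists>j. (vf (gpart l D A) (gpart l D B) ^^ j) (chi u) = 0"
proof -
  obtain K :: "int set" and F where K: "finite K" "chi u = (\<Sum>k\<in>K. F k)"
    "\<And>k. k \<in> K \<Longrightarrow> F k \<in> Alg S" "\<And>k. k \<in> K \<Longrightarrow> d (F k) = cst (of_int k) * F k"
    using r(3) Alg_simps(4)[OF u] unfolding int_semisimple_def by metis
  have it: "(vf A B ^^ j) (chi u) = (\<Sum>k\<in>K. cst (of_int k ^ j) * F k)" for j
  proof (induction j)
    case (Suc j)
    have "vf A B (\<Sum>k\<in>K. h k) = (\<Sum>k\<in>K. vf A B (h k))" for h
      using K(1) by (induction K) simp_all
    then have "(vf A B ^^ Suc j) (chi u) = (\<Sum>k\<in>K. cst (of_int k ^ j) * vf A B (F k))"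
      using Suc by simp
    also have "\<dots> = (\<Sum>k\<in>K. cst (of_int k ^ Suc j) * F k)"
    proof (rule sum.cong)
      fix k assume "k \<in> K"
      then have "vf A B (F k) = cst (of_int k) * F k" using r(1) K by (simp add: repr_def)
      then show "cst (of_int k ^ j) * vf A B (F k) = cst (of_int k ^ Suc j) * F k"
        by (simp only: mult.assoc[symmetric] cst_mult power_Suc2)
    qed simp
    finally show ?case .
  qed (use K in simp)
  define U where "U = (\<Union>k\<in>K. keys (F k))"
  have "finite U" using K(1) by (simp add: U_def)
  have keysU: "keys ((vf A B ^^ j) (chi u)) \<subseteq> U" for j
    unfolding it U_def by (rule keys_sum_subset) (use keys_cst_mult in blast)
  define j where "j = nat (1 + \<bar>dot l u\<bar> + (\<Sum>w\<in>U. \<bar>dot l w\<bar>))"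
  have j: "int j = 1 + \<bar>dot l u\<bar> + (\<Sum>w\<in>U. \<bar>dot l w\<bar>)"
    by (simp add: j_def add_nonneg_nonneg sum_nonneg)
  have "dot l w < dot l u + int j * D" if "w \<in> U" for w
  proof -
    have "\<bar>dot l w\<bar> \<le> (\<Sum>w\<in>U. \<bar>dot l w\<bar>)" using \<open>finite U\<close> that by (intro member_le_sum) auto
    then have "dot l w < dot l u + int j" unfolding j by linarith
    moreover have "int j * 1 \<le> int j * D" using D by (intro mult_left_mono) auto
    ultimately show ?thesis by linarith
  qed
  then have "keys (gpart l (dot l u + int j * D) ((vf A B ^^ j) (chi u))) = {}"
    using keysU[of j] by (fastforce simp: keys_gpart)
  then have "gpart l (dot l u + int j * D) ((vf A B ^^ j) (chi u)) = 0" by simp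
  moreover have "below l (dot l u) (chi u)" by (simp add: below_def)
  ultimately have "(vf (gpart l D A) (gpart l D B) ^^ j) (gpart l (dot l u) (chi u)) = 0"
    using vf_iterate_top[OF D(1,2), of "dot l u" "chi u" j] by simp
  then show ?thesis by auto
qed

text \<open>
  A lexicographic maximum on a finite set is the strict maximum of the single functional \<open>K * l1 + l2\<close>
  for large \<open>K\<close>.
\<close>

lemma lex_max:
  assumes fin: "finite M" and inj: "\<And>u. dot l1 u = 0 \<Longrightarrow> dot l2 u = 0 \<Longrightarrow> u = 0"
    and m0: "m0 \<in> M" "dot l1 m0 > 0 \<or> dot l1 m0 = 0 \<and> dot l2 m0 > 0"
  obtains m l where "m \<in> M" "dot l m > 0" "\<And>m'. m' \<in> M \<Longrightarrow> m' \<noteq> m \<Longrightarrow> dot l m' < dot l m"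
    "dot l1 m > 0 \<or> dot l1 m = 0 \<and> dot l2 m > 0" "\<And>m'. m' \<in> M \<Longrightarrow> dot l1 m' \<le> dot l1 m"
proof -
  define K where "K = 1 + 2 * (\<Sum>m\<in>M. \<bar>dot l2 m\<bar>)"
  define l where "l = smul K l1 + l2"
  have small: "2 * \<bar>dot l2 m\<bar> < K" if "m \<in> M" for m
    using member_le_sum[OF that, of "\<lambda>m. \<bar>dot l2 m\<bar>"] fin by (simp add: K_def)
  have Kpos: "K > 0" using small[OF m0(1)] by linarith
  have lex: "dot l m' < dot l m" if "m \<in> M" "m' \<in> M" "dot l1 m' < dot l1 m" for m m'
  proof -
    have "K * dot l1 m' + K \<le> K * dot l1 m"
      using mult_left_mono[of "dot l1 m' + 1" "dot l1 m" K] that(3) Kpos by (simp add: distrib_left)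
    then show ?thesis using small[OF that(1)] small[OF that(2)] by (simp add: l_def)
  qed
  obtain m where m: "m \<in> M" "\<And>m'. m' \<in> M \<Longrightarrow> dot l m' \<le> dot l m"
  proof -
    have "Max (dot l ` M) \<in> dot l ` M" using fin m0(1) by (intro Max_in) auto
    then obtain m where "m \<in> M" "dot l m = Max (dot l ` M)" by auto
    then show ?thesis using that[of m] fin by auto
  qed
  have le1: "dot l1 m' \<le> dot l1 m" if "m' \<in> M" for m'
    using lex[OF that m(1)] m(2)[OF that] by linarith
  have uniq: "dot l m' < dot l m" if "m' \<in> M" "m' \<noteq> m" for m'
  proof -
    have "dot l m' \<noteq> dot l m"
    proof
      assume eq: "dot l m' = dot l m"
      then have "dot l1 m' = dot l1 m" using le1[OF that(1)] lex[OF m(1) that(1)] by force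
      then have "m' - m = 0" using eq by (intro inj) (simp_all add: l_def)
      then show False using that by simp
    qed
    with m(2)[OF that(1)] show ?thesis by simp
  qed
  have pos: "dot l m > 0"
  proof -
    have "dot l m0 > 0"
    proof (cases "dot l1 m0 > 0")
      case True
      then have "K * 1 \<le> K * dot l1 m0" using Kpos by (intro mult_left_mono) auto
      then show ?thesis using small[OF m0(1)] by (simp add: l_def)
    qed (use m0 in \<open>simp add: l_def\<close>)
    then show ?thesis using m(2)[OF m0(1)] by linarith
  qed
  have "dot l1 m \<ge> 0" using le1[OF m0(1)] m0(2) by linarith
  moreover have "dot l2 m > 0" if "dot l1 m = 0" using pos that by (simp add: l_def)
  ultimately have "dot l1 m > 0 \<or> dot l1 m = 0 \<and> dot l2 m > 0" by linarith
  then show ?thesis using that m(1) pos uniq le1 by blast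
qed

text \<open>
  For a suitable functional the top part of \<open>d\<close> consists of the exponent \<open>m\<close> alone, so it maps \<open>chi w\<close> to
  \<open>p w * chi (w + m)\<close> with an additive \<open>p\<close>. It is nilpotent on \<open>chi u\<close> for \<open>u \<in> S\<close>, which means that
  \<open>p (u + j * m) = 0\<close> for some \<open>j\<close>. If \<open>m\<close> were in \<open>S\<close>, the choice \<open>u = m\<close> would give \<open>p m = 0\<close>, and then the
  choices \<open>u = v1, v2\<close> would give \<open>p = 0\<close>, so that \<open>m\<close> would not occur in \<open>d\<close>.
\<close>

lemma lex_top_is_root:
  assumes r: "repr d A B" "derivation_on S d" "int_semisimple S d"
    and inj: "\<forall>u. dot l1 u = 0 \<and> dot l2 u = 0 \<longrightarrow> u = 0"
    and m0: "m0 \<in> spt A B" "dot l1 m0 > 0 \<or> dot l1 m0 = 0 \<and> dot l2 m0 > 0"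
  obtains m where "m \<in> spt A B" "m \<notin> S" "dot l1 m > 0 \<or> dot l1 m = 0 \<and> dot l2 m > 0"
    "\<And>m'. m' \<in> spt A B \<Longrightarrow> dot l1 m' \<le> dot l1 m"
proof -
  have fin: "finite (spt A B)" by (simp add: spt_def)
  obtain m l where m: "m \<in> spt A B" "dot l m > 0"
    and top: "\<And>m'. m' \<in> spt A B \<Longrightarrow> m' \<noteq> m \<Longrightarrow> dot l m' < dot l m"
    and m': "dot l1 m > 0 \<or> dot l1 m = 0 \<and> dot l2 m > 0"
    "\<And>m'. m' \<in> spt A B \<Longrightarrow> dot l1 m' \<le> dot l1 m"
    using lex_max[OF fin _ m0] inj by blast
  have le: "dot l m' \<le> dot l m" if "m' \<in> spt A B" for m' using top[OF that] by (cases "m' = m") auto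
  have bel: "below l (dot l m) A" "below l (dot l m) B"
    using le by (auto simp: below_def spt_def)
  have parts: "gpart l (dot l m) A = Poly_Mapping.single m (lookup A m)"
    "gpart l (dot l m) B = Poly_Mapping.single m (lookup B m)"
    by (rule poly_mapping_eqI, use top in \<open>force simp: lookup_gpart lookup_single when_def spt_iff\<close>)+
  define p where "p w = of_int (dot p1 w) * lookup A m + of_int (dot p2 w) * lookup B m" for w
  have p_add: "p (u + w) = p u + p w" "p (smul k u) = of_int k * p u" for u w k
    by (simp_all add: p_def algebra_simps)
  have step: "vf (Poly_Mapping.single m (lookup A m)) (Poly_Mapping.single m (lookup B m)) (cst c * chi w) =
      cst (c * p w) * chi (w + m)" for c w
  proof -
    have "vf (Poly_Mapping.single m (lookup A m)) (Poly_Mapping.single m (lookup B m)) (cst c * chi w) =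
      Poly_Mapping.single (w + m) (c * (of_int (dot p1 w) * lookup A m + of_int (dot p2 w) * lookup B m))"
      by (subst vfield_simps(5), subst vfield_chi)
        (simp only: mult_single single_add[symmetric] add_0_left mult_1_left)
    then show ?thesis
      by (simp only: mult_single p_def add_0_left mult_1_right)
  qed
  have chi_nz: "chi w \<noteq> 0" for w
    using lookup_single_eq[of w "1 :: complex"] by (metis lookup_zero zero_neq_one)
  have zero: "\<exists>j. p (u + smul (int j) m) = 0" if u: "u \<in> S" for u
  proof (rule ccontr)
    assume no: "\<not> ?thesis"
    have "\<exists>c. c \<noteq> 0 \<and> (vf (gpart l (dot l m) A) (gpart l (dot l m) B) ^^ j) (chi u) =
        cst c * chi (u + smul (int j) m)" for j
    proof (induction j)
      case 0
      show ?case by (intro exI[of _ 1]) simp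
    next
      case (Suc j)
      then obtain c where "c \<noteq> 0" "(vf (gpart l (dot l m) A) (gpart l (dot l m) B) ^^ j) (chi u) =
        cst c * chi (u + smul (int j) m)" by blast
      moreover have "u + smul (int j) m + m = u + smul (int (Suc j)) m"
        by (simp add: smul_add algebra_simps)
      moreover have "p (u + smul (int j) m) \<noteq> 0" using no by blast
      ultimately show ?case unfolding parts
        by (intro exI[of _ "c * p (u + smul (int j) m)"]) (simp only: funpow.simps comp_apply step, simp)
    qed
    then show False
      using top_nilpotent[OF r bel m(2) u] by (metis cst_mult_eq_0_iff chi_nz)
  qed
  have "m \<notin> S"
  proof
    assume mS: "m \<in> S"
    show False
    proof (cases "p m = 0")
      case True
      have "p v1 = 0" "p v2 = 0" using zero[OF v_in_S(1)] zero[OF v_in_S(2)] True by (auto simp: p_add)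
      then have "lookup A m = 0" "lookup B m = 0" using N_pos by (simp_all add: p_def)
      then show False using m(1) by (simp add: spt_iff)
    next
      case False
      obtain j where "p (m + smul (int j) m) = 0" using zero[OF mS] by blast
      then have "of_nat (Suc j) * p m = 0" by (simp add: p_add algebra_simps)
      then show False using False by (simp only: mult_eq_0_iff of_nat_eq_0_iff) simp
    qed
  qed
  then show ?thesis using that m(1) m' by blast
qed

text \<open>
  Semisimplicity says that \<open>f\<close> is killed by a polynomial in \<open>d\<close> without multiple roots; here the factor
  of \<open>lam\<close> is split off from the others.
\<close>

lemma annihilator:
  assumes r: "repr d A B" "derivation_on S d" "int_semisimple S d" and f: "f \<in> Alg S"
  obtains ks where "lam \<notin> set ks" "foldr (\<lambda>k g. vf A B g - cst k * g) (lam # ks) f = 0"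
proof -
  obtain K :: "int set" and F where K: "finite K" "f = (\<Sum>k\<in>K. F k)"
    "\<And>k. k \<in> K \<Longrightarrow> F k \<in> Alg S" "\<And>k. k \<in> K \<Longrightarrow> d (F k) = cst (of_int k) * F k"
    using r(3) f unfolding int_semisimple_def by metis
  obtain ks where ks: "set ks = of_int ` K - {lam}"
    using finite_list[of "of_int ` K - {lam}"] K(1) by auto
  define op where "op = (\<lambda>k g. vf A B g - cst k * g)"
  have op_add: "op k (g + h) = op k g + op k h" "op k 0 = 0" for k g h
    by (simp_all add: op_def algebra_simps)
  have fold_sum: "foldr op xs (\<Sum>k\<in>K. h k) = (\<Sum>k\<in>K. foldr op xs (h k))" for xs h
    using K(1)
  proof (induction xs)
    case (Cons x xs)
    have "op x (\<Sum>k\<in>K. g k) = (\<Sum>k\<in>K. op x (g k))" for g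
      using K(1) by (induction K) (simp_all add: op_add)
    then show ?case using Cons by simp
  qed simp
  have fold_F: "\<exists>c. foldr op xs (F k) = cst c * F k \<and> (of_int k \<in> set xs \<longrightarrow> c = 0)" if "k \<in> K" for xs k
  proof (induction xs)
    case Nil
    show ?case by (intro exI[of _ 1]) simp
  next
    case (Cons x xs)
    then obtain c where c: "foldr op xs (F k) = cst c * F k" "of_int k \<in> set xs \<longrightarrow> c = 0" by blast
    have "vf A B (F k) = cst (of_int k) * F k" using that r(1) K by (simp add: repr_def)
    then have "op x (cst c * F k) = cst (c * of_int k - x * c) * F k"
      by (simp only: op_def vfield_simps mult.assoc[symmetric] cst_mult single_diff left_diff_distrib)
    then have "op x (cst c * F k) = cst (c * (of_int k - x)) * F k"
      by (simp only: right_diff_distrib mult.commute[of x])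
    then show ?case using c by (intro exI[of _ "c * (of_int k - x)"]) auto
  qed
  have "foldr op (lam # ks) (F k) = 0" if k: "k \<in> K" for k
  proof -
    have "of_int k \<in> set (lam # ks)" using ks k by auto
    then show ?thesis using fold_F[OF k, of "lam # ks"] by (metis mult_zero_left single_zero)
  qed
  then have "foldr op (lam # ks) f = 0" unfolding K(2) fold_sum by simp
  then show ?thesis using that[of ks] ks by (simp add: op_def)
qed

text \<open>
  In the case of equality, the top part of \<open>d\<close> has the same eigenvalue \<open>lam\<close> at \<open>chi v1\<close> and at
  \<open>chi (v1 + m)\<close>, and maps the former to the latter with the nonzero coefficient \<open>\<gamma> * N\<close>. Such a Jordan
  block contradicts \<open>annihilator\<close>.
\<close>

lemma no_jordan_block:
  assumes r: "repr d A B" "derivation_on S d" "int_semisimple S d"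
    and bel: "below l 0 A" "below l 0 B"
    and top: "gpart l 0 A = cst a0 + cst \<gamma> * chi m" "gpart l 0 B = cst b0"
    and m: "dot p1 m = -1" "\<gamma> \<noteq> 0"
  shows "of_int (dot p2 m) * b0 \<noteq> a0"
proof
  assume eq: "of_int (dot p2 m) * b0 = a0"
  define lam where "lam = of_int N * a0"
  obtain ks where ks: "lam \<notin> set ks"
    "foldr (\<lambda>k g. vf A B g - cst k * g) (lam # ks) (chi v1) = 0"
    using annihilator[OF r Alg_simps(4)[OF v_in_S(1)]] by blast
  define T where "T = vf (gpart l 0 A) (gpart l 0 B)"
  define G where "G xs = foldr (\<lambda>k g. T g - cst k * g) xs (chi v1)" for xs
  have red: "below l (dot l v1) (foldr (\<lambda>k g. vf A B g - cst k * g) xs (chi v1)) \<and>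
     gpart l (dot l v1) (foldr (\<lambda>k g. vf A B g - cst k * g) xs (chi v1)) = G xs" for xs
  proof (induction xs)
    case (Cons x xs)
    define h where "h = foldr (\<lambda>k g. vf A B g - cst k * g) xs (chi v1)"
    have h: "below l (dot l v1) h" "gpart l (dot l v1) h = G xs" using Cons by (simp_all add: h_def)
    have "below l (dot l v1) (vf A B h)" "gpart l (dot l v1) (vf A B h) = T (G xs)"
      using below_vfield[OF bel h(1)] gpart_vfield_top[OF bel h(1)] h(2) by (simp_all add: T_def)
    moreover have "below l (dot l v1) (cst x * h)"
      using h(1) keys_cst_mult[of x h] unfolding below_def by blast
    moreover have "foldr (\<lambda>k g. vf A B g - cst k * g) (x # xs) (chi v1) = vf A B h - cst x * h"
      by (simp add: h_def)
    moreover have "G (x # xs) = T (G xs) - cst x * G xs" by (simp add: G_def)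
    ultimately show ?case using h(2) by (simp only: below_diff gpart_simps simp_thms)
  qed (simp add: G_def below_def)
  have lookT: "lookup (T g) w = (a0 * of_int (dot p1 w) + b0 * of_int (dot p2 w)) * lookup g w
      + \<gamma> * of_int (dot p1 w + 1) * lookup g (w - m)" for g w
    unfolding T_def top vfield_def
    by (simp only: distrib_right lookup_add mult.assoc lookup_single_mult lookup_euler dot_simps)
      (simp add: m(1) algebra_simps)
  have inv: "(\<forall>w. dot p1 w > N \<longrightarrow> lookup (G xs) w = 0) \<and> (lam \<notin> set xs \<longrightarrow> lookup (G xs) v1 \<noteq> 0)" for xs
  proof (induction xs)
    case Nil
    have "w \<noteq> v1" if "dot p1 w > N" for w using that dot_v(1) by (metis less_irrefl)
    then show ?case by (simp add: G_def lookup_single when_def del: split_paired_All)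
  next
    case (Cons x xs)
    have G: "G (x # xs) = T (G xs) - cst x * G xs" by (simp add: G_def)
    have "lookup (G (x # xs)) w = 0" if "dot p1 w > N" for w
    proof -
      have "dot p1 (w - m) > N" using that m(1) by simp
      then have "lookup (G xs) w = 0" "lookup (G xs) (w - m) = 0" using Cons that by blast+
      then show ?thesis by (simp add: G lookup_minus lookT lookup_single_mult)
    qed
    moreover have "lookup (G (x # xs)) v1 = (lam - x) * lookup (G xs) v1"
    proof -
      have "dot p1 (v1 - m) > N" using m(1) by simp
      then have "lookup (G xs) (v1 - m) = 0" using Cons by blast
      then show ?thesis 
        by (simp only: G lookup_minus lookT lookup_single_mult lam_def dot_v diff_zero) (simp add: algebra_simps)
    qed
    ultimately show ?case using Cons by auto
  qed
  have "G (lam # ks) = 0" using red[of "lam # ks"] ks(2) by simp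
  moreover have "lookup (G (lam # ks)) (v1 + m) = \<gamma> * of_int N * lookup (G ks) v1"
  proof -
    have "G (lam # ks) = T (G ks) - cst lam * G ks" by (simp add: G_def)
    moreover have "a0 * of_int (dot p1 (v1 + m)) + b0 * of_int (dot p2 (v1 + m)) = lam"
      using eq by (simp add: m(1) lam_def algebra_simps)
    ultimately show ?thesis by (simp only: lookup_minus lookT lookup_single_mult) (simp add: m(1))
  qed
  ultimately show False using inv[of ks] ks(1) m(2) N_pos by simp
qed

end

section \<open>Triangular automorphisms\<close>

definition automorphism_on :: "lattice set \<Rightarrow> (laurent \<Rightarrow> laurent) \<Rightarrow> bool" where
  "automorphism_on S \<phi> \<longleftrightarrow> bij_betw \<phi> (Alg S) (Alg S) \<and>
     (\<forall>f\<in>Alg S. \<forall>g\<in>Alg S. \<phi> (f + g) = \<phi> f + \<phi> g \<and> \<phi> (f * g) = \<phi> f * \<phi> g) \<and> (\<forall>c. \<phi> (cst c) = cst c)"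

definition diagonalizable :: "lattice set \<Rightarrow> (laurent \<Rightarrow> laurent) \<Rightarrow> bool" where
  "diagonalizable S d \<longleftrightarrow>
     (\<exists>\<phi>. automorphism_on S \<phi> \<and> (\<forall>u\<in>S. \<exists>lam. d (\<phi> (chi u)) = cst lam * \<phi> (chi u)))"

lemma automorphism_on_compose:
  "automorphism_on S \<phi> \<Longrightarrow> automorphism_on S \<psi> \<Longrightarrow> automorphism_on S (\<lambda>f. \<phi> (\<psi> f))"
  unfolding automorphism_on_def
  using bij_betw_trans[of \<psi> "Alg S" "Alg S" \<phi> "Alg S"]
  by (auto simp: comp_def bij_betw_apply)

context plane_cone
begin

lemma conjugate:
  assumes d: "derivation_on S d" "int_semisimple S d"
    and \<phi>: "automorphism_on S \<phi>" and \<psi>: "\<And>f. f \<in> Alg S \<Longrightarrow> \<psi> f \<in> Alg S \<and> \<phi> (\<psi> f) = f \<and> \<psi> (\<phi> f) = f"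
  defines "d' \<equiv> \<lambda>f. \<psi> (d (\<phi> f))"
  shows "derivation_on S d'" "int_semisimple S d'" "diagonalizable S d' \<Longrightarrow> diagonalizable S d"
proof -
  have \<phi>A: "\<phi> f \<in> Alg S" if "f \<in> Alg S" for f
    using \<phi> that by (auto simp: automorphism_on_def bij_betw_apply)
  have \<phi>h: "\<phi> (f + g) = \<phi> f + \<phi> g" "\<phi> (f * g) = \<phi> f * \<phi> g" "\<phi> (cst c) = cst c"
    if "f \<in> Alg S" "g \<in> Alg S" for f g c using \<phi> that by (auto simp: automorphism_on_def)
  have \<psi>h: "\<psi> (f + g) = \<psi> f + \<psi> g" "\<psi> (f * g) = \<psi> f * \<psi> g"
    if "f \<in> Alg S" "g \<in> Alg S" for f g
  proof -
    have "\<psi> (\<phi> (\<psi> f) + \<phi> (\<psi> g)) = \<psi> (\<phi> (\<psi> f + \<psi> g))" using \<phi>h \<psi> that by simp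
    then show "\<psi> (f + g) = \<psi> f + \<psi> g" using \<psi> that Alg_simps(1) by simp
    have "\<psi> (\<phi> (\<psi> f) * \<phi> (\<psi> g)) = \<psi> (\<phi> (\<psi> f * \<psi> g))" using \<phi>h \<psi> that by simp
    then show "\<psi> (f * g) = \<psi> f * \<psi> g" using \<psi> that Alg_mult by simp
  qed
  have \<phi>c: "\<phi> (cst c) = cst c" for c using \<phi> by (auto simp: automorphism_on_def)
  have \<psi>c: "\<psi> (cst c) = cst c" for c using \<psi>[OF Alg_simps(3), of c] \<phi>c by simp
  have \<psi>0: "\<psi> 0 = 0" using \<psi>c[of 0] by simp
  have dA: "d f \<in> Alg S" if "f \<in> Alg S" for f using d that by (simp add: derivation_on_def)
  have dh: "d (f + g) = d f + d g" "d (f * g) = f * d g + g * d f"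
    if "f \<in> Alg S" "g \<in> Alg S" for f g using d(1) that by (simp_all add: derivation_on_def)
  show "derivation_on S d'" unfolding derivation_on_def
  proof (intro conjI ballI allI)
    fix f g assume fg: "f \<in> Alg S" "g \<in> Alg S"
    show "d' f \<in> Alg S" using fg by (simp add: d'_def \<psi> dA \<phi>A)
    show "d' (f + g) = d' f + d' g" using fg by (simp add: d'_def \<psi>h dA \<phi>A dh \<phi>h)
    show "d' (f * g) = f * d' g + g * d' f"
      using fg by (simp add: d'_def \<psi>h dA \<phi>A dh \<phi>h Alg_mult \<psi>)
  next
    fix c show "d' (cst c) = 0" using d(1) by (simp add: d'_def \<phi>c derivation_on_def \<psi>0)
  qed
  have \<phi>sum: "\<psi> (\<Sum>k\<in>K. h k) = (\<Sum>k\<in>K. \<psi> (h k))" if "finite K" "\<And>k. k \<in> K \<Longrightarrow> h k \<in> Alg S" for h and K :: "int set"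
    using that by (induction K) (simp_all add: \<psi>0 \<psi>h Alg_sum)
  show "int_semisimple S d'" unfolding int_semisimple_def
  proof
    fix f assume f: "f \<in> Alg S"
    obtain K :: "int set" and F where K: "finite K" "\<phi> f = (\<Sum>k\<in>K. F k)"
      "\<And>k. k \<in> K \<Longrightarrow> F k \<in> Alg S" "\<And>k. k \<in> K \<Longrightarrow> d (F k) = cst (of_int k) * F k"
      using d(2) \<phi>A[OF f] unfolding int_semisimple_def by metis
    have "f = (\<Sum>k\<in>K. \<psi> (F k))" using \<psi>[OF f] K \<phi>sum[of K F] by simp
    moreover have "d' (\<psi> (F k)) = cst (of_int k) * \<psi> (F k)" if "k \<in> K" for k
      using that K(3,4) \<psi> \<psi>h(2)[OF Alg_simps(3), of "F k" "of_int k"] by (simp add: d'_def \<psi>c del: single_of_int)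
    ultimately show "\<exists>(K::int set) F. finite K \<and> f = (\<Sum>k\<in>K. F k) \<and>
        (\<forall>k\<in>K. F k \<in> Alg S \<and> d' (F k) = cst (of_int k) * F k)"
      using K(1,3) \<psi> by (intro exI[of _ K] exI[of _ "\<lambda>k. \<psi> (F k)"]) auto
  qed
  assume "diagonalizable S d'"
  then obtain \<theta> where \<theta>: "automorphism_on S \<theta>"
    "\<And>u. u \<in> S \<Longrightarrow> \<exists>lam. d' (\<theta> (chi u)) = cst lam * \<theta> (chi u)"
    unfolding diagonalizable_def by blast
  have \<theta>A: "\<theta> f \<in> Alg S" if "f \<in> Alg S" for f
    using \<theta>(1) that by (auto simp: automorphism_on_def bij_betw_apply)
  show "diagonalizable S d" unfolding diagonalizable_def
  proof (intro exI[of _ "\<lambda>f. \<phi> (\<theta> f)"] conjI ballI)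
    show "automorphism_on S (\<lambda>f. \<phi> (\<theta> f))" by (rule automorphism_on_compose[OF \<phi> \<theta>(1)])
    fix u assume u: "u \<in> S"
    obtain lam where "d' (\<theta> (chi u)) = cst lam * \<theta> (chi u)" using \<theta>(2)[OF u] by blast
    then have "\<phi> (d' (\<theta> (chi u))) = \<phi> (cst lam * \<theta> (chi u))" by simp
    moreover have "d (\<phi> (\<theta> (chi u))) \<in> Alg S" using u by (simp add: dA \<phi>A \<theta>A Alg_simps)
    ultimately have "d (\<phi> (\<theta> (chi u))) = cst lam * \<phi> (\<theta> (chi u))"
      using u \<phi>h(2)[OF Alg_simps(3) \<theta>A[OF Alg_simps(4)]] by (simp add: d'_def \<psi> \<phi>c)
    then show "\<exists>lam. d (\<phi> (\<theta> (chi u))) = cst lam * \<phi> (\<theta> (chi u))" by blast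
  qed
qed

text \<open>
  For \<open>W = 1 + c * chi m\<close>, where \<open>m\<close> is a root of the first kind, this is the exponential of the locally
  nilpotent derivation \<open>c * chi m * E1\<close>; in \<open>S\<close> the exponents \<open>dot p1 u\<close> are nonnegative.
\<close>

definition tri :: "laurent \<Rightarrow> laurent \<Rightarrow> laurent" where
  "tri W = linext (\<lambda>u. chi u * W ^ nat (dot p1 u))"

lemma tri_simps [simp]:
  "tri W (f + g) = tri W f + tri W g" "tri W 0 = 0"
  "tri W (Poly_Mapping.single u c) = cst c * (chi u * W ^ nat (dot p1 u))"
  by (simp_all add: tri_def linext_add)

lemma tri_cst: "tri W (cst c) = cst c"
  by (simp add: mult_single)

lemma tri_cst_mult [simp]: "tri W (cst c * f) = cst c * tri W f"
proof (induction f rule: laurent_induct[OF subset_UNIV])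
  case (1 u a)
  have "tri W (cst c * Poly_Mapping.single u a) = cst (c * a) * (chi u * W ^ nat (dot p1 u))"
    by (simp only: mult_single tri_simps add_0_left)
  then show ?case by (simp only: tri_simps cst_mult[symmetric] mult.assoc)
qed (simp_all add: distrib_left)

lemma tri_mult:
  assumes "b1" "f \<in> Alg S" "g \<in> Alg S" shows "tri W (f * g) = tri W f * tri W g"
proof -
  have *: "tri W (Poly_Mapping.single u c * g) = tri W (Poly_Mapping.single u c) * tri W g" if "u \<in> S" for u c
  proof -
    have "keys g \<subseteq> S" using assms by (simp add: Alg_def)
    then show ?thesis
    proof (induction g rule: laurent_induct)
      case (single w c')
      have "nat (dot p1 (u + w)) = nat (dot p1 u) + nat (dot p1 w)"
        using \<open>u \<in> S\<close> single \<open>b1\<close> by (simp add: S_def nat_add_distrib)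
      then have "chi (u + w) * W ^ nat (dot p1 (u + w)) =
        (chi u * W ^ nat (dot p1 u)) * (chi w * W ^ nat (dot p1 w))"
        by (simp only: power_add chi_mult[symmetric] mult_ac)
      moreover have "tri W (Poly_Mapping.single u c * Poly_Mapping.single w c') =
          cst (c * c') * (chi (u + w) * W ^ nat (dot p1 (u + w)))"
        by (simp only: mult_single tri_simps)
      ultimately show ?case by (simp only: tri_simps cst_mult[symmetric] mult_ac)
    qed (simp_all add: distrib_left)
  qed
  have "keys f \<subseteq> S" using assms by (simp add: Alg_def)
  then show ?thesis
    by (induction f rule: laurent_induct) (use * in \<open>simp_all add: distrib_right\<close>)
qed

lemma chi_binomial_keys:
  "keys (chi u * (1 + cst c * chi m) ^ k) \<subseteq> (\<lambda>i. u + smul (int i) m) ` {..k}"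
proof (induction k)
  case (Suc k)
  have "chi u * (1 + cst c * chi m) ^ Suc k =
     chi u * (1 + cst c * chi m) ^ k + cst c * (chi m * (chi u * (1 + cst c * chi m) ^ k))"
    by (simp only: power_Suc distrib_right mult_1_left distrib_left mult_ac)
  moreover have "keys (cst c * (chi m * (chi u * (1 + cst c * chi m) ^ k)))
      \<subseteq> (\<lambda>i. u + smul (int i) m) ` {..Suc k}"
  proof -
    have "(+) m ` (\<lambda>i. u + smul (int i) m) ` {..k} \<subseteq> (\<lambda>i. u + smul (int i) m) ` {..Suc k}"
    proof
      fix w assume "w \<in> (+) m ` (\<lambda>i. u + smul (int i) m) ` {..k}"
      then obtain i where i: "i \<le> k" "w = m + (u + smul (int i) m)" by blast
      then have "w = u + smul (int (Suc i)) m" by (simp add: smul_add algebra_simps)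
      then show "w \<in> (\<lambda>i. u + smul (int i) m) ` {..Suc k}"
        using i(1) by (intro image_eqI[of _ _ "Suc i"]) simp_all
    qed
    with Suc show ?thesis
      using keys_cst_mult[of c "chi m * (chi u * (1 + cst c * chi m) ^ k)"]
      unfolding keys_chi_mult[of m] by blast
  qed
  moreover have "keys (chi u * (1 + cst c * chi m) ^ k) \<subseteq> (\<lambda>i. u + smul (int i) m) ` {..Suc k}"
    using Suc by (rule order_trans) (rule image_mono, simp)
  ultimately show ?case by (metis keys_add_subset)
qed simp

end

text \<open>
  A root of the first kind.
\<close>

locale root1 = plane_cone +
  fixes m :: lattice
  assumes b1: "b1" and m1: "dot p1 m = -1" and m2: "b2 \<Longrightarrow> dot p2 m \<ge> 0"
begin

abbreviation W where "W c \<equiv> 1 + cst c * chi m"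

lemma root_shift: "u \<in> S \<Longrightarrow> int i \<le> dot p1 u \<Longrightarrow> u + smul (int i) m \<in> S"
  using m1 m2 by (simp add: S_def)

lemma tri_Alg: assumes "f \<in> Alg S" shows "tri (W c) f \<in> Alg S"
proof -
  have "keys (tri (W c) f) \<subseteq> S" unfolding tri_def
  proof (rule keys_linext)
    fix u assume "u \<in> keys f"
    then have "u \<in> S" using assms by (auto simp: Alg_def)
    then show "keys (chi u * W c ^ nat (dot p1 u)) \<subseteq> S"
      using chi_binomial_keys[of u c m "nat (dot p1 u)"] root_shift[of u] b1
      by (fastforce simp: S_def)
  qed
  then show ?thesis by (simp add: Alg_def)
qed

text \<open>
  With \<open>i\<close> kept apart from \<open>dot p1 u\<close> the statement goes through the induction, which replaces
  \<open>u\<close> by \<open>u + m\<close>; for \<open>i = dot p1 u\<close> it says that the parameters \<open>c\<close> and \<open>c'\<close> are added.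
\<close>

lemma tri_tri_chi: "int i \<le> dot p1 u \<Longrightarrow>
    tri (W c') (chi u * W c ^ i) = chi u * W c' ^ (nat (dot p1 u) - i) * (W c' + cst c * chi m) ^ i"
proof (induction i arbitrary: u)
  case (Suc i)
  define r where "r = nat (dot p1 u) - Suc i"
  have r: "nat (dot p1 u) - i = Suc r" "nat (dot p1 (u + m)) - i = r"
    using Suc.prems m1 by (simp_all add: r_def nat_diff_distrib)
  have "chi u * W c ^ Suc i = chi u * W c ^ i + cst c * (chi (u + m) * W c ^ i)"
    by (simp only: power_Suc chi_mult[symmetric] distrib_right distrib_left mult_1_left mult_ac)
  then have "tri (W c') (chi u * W c ^ Suc i) = tri (W c') (chi u * W c ^ i)
      + tri (W c') (cst c * (chi (u + m) * W c ^ i))" by simp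
  also have "tri (W c') (cst c * g) = cst c * tri (W c') g" for g by simp
  also have "tri (W c') (chi u * W c ^ i) = chi u * W c' ^ Suc r * (W c' + cst c * chi m) ^ i"
    using Suc by (simp add: r(1))
  also have "tri (W c') (chi (u + m) * W c ^ i) = chi (u + m) * W c' ^ r * (W c' + cst c * chi m) ^ i"
    using Suc.IH[of "u + m"] Suc.prems m1 r(2) by simp
  finally show ?case
    unfolding r_def[symmetric]
    by (simp only: power_Suc chi_mult[symmetric] distrib_right distrib_left mult_ac)
qed simp

lemma tri_inverse: assumes "f \<in> Alg S" shows "tri (W (- c)) (tri (W c) f) = f"
proof -
  have "keys f \<subseteq> S" using assms by (simp add: Alg_def)
  then show ?thesis
  proof (induction f rule: laurent_induct)
    case (single u a)
    have "dot p1 u \<ge> 0" using single b1 by (simp add: S_def)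
    then have "tri (W (- c)) (chi u * W c ^ nat (dot p1 u)) = chi u * (W (- c) + cst c * chi m) ^ nat (dot p1 u)"
      by (subst tri_tri_chi) simp_all
    also have "W (- c) + cst c * chi m = 1"
      by (simp add: mult_single flip: single_add add.assoc)
    finally have 1: "tri (W (- c)) (chi u * W c ^ nat (dot p1 u)) = chi u" by simp
    have A: "chi u * W c ^ nat (dot p1 u) \<in> Alg S"
      using tri_Alg[OF Alg_simps(4)[OF single], of c] by simp
    have "tri (W (- c)) (cst a * (chi u * W c ^ nat (dot p1 u))) = cst a * chi u"
      using tri_mult[OF b1 Alg_simps(3) A] by (simp only: 1 tri_cst)
    then show ?case by (simp only: tri_simps single_eq_cst_chi[of u a, symmetric])
  qed simp_all
qed

lemma tri_automorphism: "automorphism_on S (tri (W c))"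
  unfolding automorphism_on_def
proof (intro conjI ballI allI)
  show "bij_betw (tri (W c)) (Alg S) (Alg S)"
    by (rule bij_betw_byWitness[of _ "tri (W (- c))"])
      (use tri_inverse[of _ c] tri_inverse[of _ "- c"] tri_Alg in auto)
qed (use tri_mult[OF b1] tri_cst in auto)

lemma conjugate_tri:
  fixes c :: complex
  assumes "derivation_on S d" "int_semisimple S d"
  defines "d' \<equiv> \<lambda>f. tri (W (- c)) (d (tri (W c) f))"
  shows "derivation_on S d'" "int_semisimple S d'" "diagonalizable S d' \<Longrightarrow> diagonalizable S d"
  unfolding d'_def
  by (rule conjugate[OF assms(1,2) tri_automorphism],
      use tri_inverse[of _ c] tri_inverse[of _ "- c"] tri_Alg in auto)+

text \<open>
  A root of degree zero defines automorphisms that respect the grading, so that conjugation by them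
  acts on top parts.
\<close>

lemma tri_gpart:
  assumes "dot l m = 0"
  shows "gpart l s (tri (W c) f) = tri (W c) (gpart l s f)"
proof (induction f rule: laurent_induct[OF subset_UNIV])
  case (1 u a)
  have k: "keys (cst a * (chi u * W c ^ nat (dot p1 u))) \<subseteq> {w. dot l w = dot l u}"
    using chi_binomial_keys[of u c m "nat (dot p1 u)"] keys_cst_mult[of a "chi u * W c ^ nat (dot p1 u)"] assms
    by fastforce
  have "gpart l s g = (if s = t then g else 0)" if "keys g \<subseteq> {w. dot l w = t}" for g t
  proof (rule poly_mapping_eqI)
    fix w show "lookup (gpart l s g) w = lookup (if s = t then g else 0) w"
      using that by (cases "w \<in> keys g") (auto simp: lookup_gpart in_keys_iff)
  qed
  from this[OF k] show ?case by (simp only: tri_simps gpart_simps) auto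
qed simp_all

lemma tri_below:
  assumes "dot l m = 0" "below l s f"
  shows "below l s (tri (W c) f)"
proof -
  have "keys (tri (W c) f) \<subseteq> {w. dot l w \<le> s}" unfolding tri_def
  proof (rule keys_linext)
    fix u assume "u \<in> keys f"
    then have "dot l u \<le> s" using assms(2) by (simp add: below_def)
    then show "keys (chi u * W c ^ nat (dot p1 u)) \<subseteq> {w. dot l w \<le> s}"
      using chi_binomial_keys[of u c m "nat (dot p1 u)"] assms(1) by fastforce
  qed
  then show ?thesis by (auto simp: below_def)
qed

text \<open>
  After conjugation, \<open>chi v\<close> is an eigenvector of the top part. As \<open>dot p2 v = 0\<close>, the new derivation maps
  \<open>chi v\<close> to \<open>dot p1 v * chi v * A'\<close>, so the top part of \<open>A'\<close> is a constant: all roots of the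
  first kind have disappeared from the edge.
\<close>

lemma reduce_top:
  assumes r: "repr d A B" "derivation_on S d" "int_semisimple S d"
    and l: "dot l m = 0" and bel: "below l D A" "below l D B"
    and v: "dot p1 v > 0" "dot p2 v = 0"
    and eig: "vf (gpart l D A) (gpart l D B) (tri (W c) (chi v)) = cst lam * tri (W c) (chi v)"
  obtains d' A' B' where "repr d' A' B'" "derivation_on S d'" "int_semisimple S d'"
    "diagonalizable S d' \<longrightarrow> diagonalizable S d" "below l D A'" "below l D B'"
    "keys (gpart l D A') \<subseteq> {0}"
proof -
  define d' where "d' = (\<lambda>f. tri (W (- c)) (d (tri (W c) f)))"
  note conj = conjugate_tri[OF r(2,3), of c, folded d'_def]
  define \<delta> where "\<delta> = (\<lambda>u. chi (- u) * d' (chi u))"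
  define A' where "A' = cst (1 / of_int N) * \<delta> v1"
  define B' where "B' = cst (1 / of_int N) * \<delta> v2"
  have r': "repr d' A' B'"
    using derivation_repr[OF conj(1)] by (simp only: A'_def B'_def \<delta>_def)
  have bel_d': "below l (D + dot l u) (d' (chi u))" if "u \<in> S" for u
  proof -
    have "below l (dot l u) (tri (W c) (chi u))" by (rule tri_below[OF l]) (simp add: below_def)
    moreover have "tri (W c) (chi u) \<in> Alg S" by (rule tri_Alg[OF Alg_simps(4)[OF that]])
    ultimately show ?thesis
      using r(1) bel unfolding d'_def repr_def by (simp add: tri_below[OF l] below_vfield)
  qed
  have bel_\<delta>: "below l D (cst a * \<delta> u)" if "u \<in> S" for u a
  proof -
    have "below l D (\<delta> u)"
      using bel_d'[OF that] unfolding below_def \<delta>_def keys_chi_mult by (simp add: algebra_simps)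
    then show ?thesis using keys_cst_mult[of a "\<delta> u"] unfolding below_def by blast
  qed
  have vS: "v \<in> S" using v by (simp add: S_def)
  have "gpart l (D + dot l v) (d' (chi v)) = cst lam * chi v"
  proof -
    have "below l (dot l v) (tri (W c) (chi v))" by (rule tri_below[OF l]) (simp add: below_def)
    moreover have "gpart l (dot l v) (tri (W c) (chi v)) = tri (W c) (chi v)"
      by (simp only: tri_gpart[OF l] gpart_simps refl if_True)
    ultimately have "gpart l (D + dot l v) (vf A B (tri (W c) (chi v))) = cst lam * tri (W c) (chi v)"
      using gpart_vfield_top[OF bel, of "dot l v" "tri (W c) (chi v)"] eig by simp
    moreover have "d (tri (W c) (chi v)) = vf A B (tri (W c) (chi v))"
      using r(1) tri_Alg[OF Alg_simps(4)[OF vS]] by (simp add: repr_def)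
    ultimately have "gpart l (D + dot l v) (d' (chi v)) = tri (W (- c)) (cst lam * tri (W c) (chi v))"
      unfolding d'_def by (simp only: tri_gpart[OF l])
    also have "\<dots> = cst lam * chi v"
      using tri_mult[OF b1 Alg_simps(3) tri_Alg[OF Alg_simps(4)[OF vS]]] tri_inverse[OF Alg_simps(4)[OF vS]]
      by (simp only: tri_cst)
    finally show ?thesis .
  qed
  moreover have "d' (chi v) = chi v * (cst (of_int (dot p1 v)) * A')"
    using repr_chi[OF r' vS] v(2) by simp
  then have "gpart l (D + dot l v) (d' (chi v)) = chi v * (cst (of_int (dot p1 v)) * gpart l D A')"
    by (simp only: gpart_chi_mult gpart_simps) simp
  ultimately have "chi v * (cst (of_int (dot p1 v)) * gpart l D A') = chi v * cst lam"
    by (simp only: mult.commute)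
  then have eq: "cst (of_int (dot p1 v)) * gpart l D A' = cst lam" by (simp only: chi_cancel)
  have "keys (gpart l D A') \<subseteq> {0}"
  proof
    fix w assume w: "w \<in> keys (gpart l D A')"
    have "lookup (cst (of_int (dot p1 v)) * gpart l D A') w = of_int (dot p1 v) * lookup (gpart l D A') w"
      by (simp only: lookup_single_mult diff_zero)
    then have "lookup (cst lam) w \<noteq> 0" using w v(1) unfolding eq by (simp add: in_keys_iff)
    then show "w \<in> {0}" by (simp add: lookup_single when_def split: if_splits)
  qed
  moreover have "below l D A'" "below l D B'" unfolding A'_def B'_def by (rule bel_\<delta>, rule v_in_S)+
  ultimately show ?thesis using that r' conj by blast
qed

text \<open>
  The fields \<open>chi w * E1\<close> for roots \<open>w\<close> of the first kind commute. So conjugation by the exponential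
  of \<open>c * chi m * E1\<close> affects only the constant part \<open>a0 * E1 + b0 * E2\<close>, and changes the coefficient of
  \<open>chi m\<close> by \<open>c\<close> times the eigenvalue of that part.
\<close>

lemma remove_root:
  assumes r: "repr d A B" "derivation_on S d" "int_semisimple S d"
    and A: "A = cst a0 + cst \<gamma> * chi m + A2" "\<And>w. w \<in> keys A2 \<Longrightarrow> dot p1 w = -1 \<and> (b2 \<longrightarrow> dot p2 w \<ge> 0)" and B: "B = cst b0"
    and c: "\<gamma> = c * (a0 - of_int (dot p2 m) * b0)"
  shows "repr (\<lambda>f. tri (W (- c)) (d (tri (W c) f))) (cst a0 + A2) B"
proof -
  have triA2: "tri (W c) (chi u * A2) = chi u * W c ^ (nat (dot p1 u) - 1) * A2" for u
  proof -
    have "keys A2 \<subseteq> {w. dot p1 w = -1}" using A(2) by blast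
    then show ?thesis
    proof (induction A2 rule: laurent_induct)
      case (single w a)
      have "nat (dot p1 (u + w)) = nat (dot p1 u) - 1" using single by (simp add: nat_diff_distrib')
      then have "tri (W c) (chi u * Poly_Mapping.single w a)
          = cst a * (chi (u + w) * W c ^ (nat (dot p1 u) - 1))"
        by (simp only: mult_single mult_1_left tri_simps)
      also have "\<dots> = chi u * W c ^ (nat (dot p1 u) - 1) * (cst a * chi w)"
        by (simp only: chi_mult[symmetric] mult_ac)
      finally show ?case by (simp only: single_eq_cst_chi[of w a])
    qed (simp_all add: distrib_left)
  qed
  have tri_cm: "tri (W c) (cst a * g) = cst a * tri (W c) g" if "g \<in> Alg S" for a g
    using tri_mult[OF b1 Alg_simps(3) that] by (simp only: tri_cst)
  have dW: "vf A B (W c) = cst c * chi m * (cst (of_int (dot p2 m)) * B - A)"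
    by (simp add: vfield_chi m1 single_uminus mult.assoc)
  have key: "vf A B (tri (W c) (chi u)) = tri (W c) (vf (cst a0 + A2) B (chi u))" if u: "u \<in> S" for u
  proof -
    define s where "s = cst (of_int (dot p2 u))"
    have r0: "dot p1 u \<ge> 0" using u b1 by (simp add: S_def)
    have lhs: "vf A B (tri (W c) (chi u)) =
      chi u * (of_nat (nat (dot p1 u)) * W c ^ (nat (dot p1 u) - 1) * vf A B (W c))
        + W c ^ nat (dot p1 u) * (chi u * (of_nat (nat (dot p1 u)) * A + s * B))"
    proof -
      have "vf A B (chi u) = chi u * (of_nat (nat (dot p1 u)) * A + s * B)"
        using r0 by (simp only: vfield_chi s_def) simp
      moreover have "tri (W c) (chi u) = chi u * W c ^ nat (dot p1 u)" by simp
      ultimately show ?thesis by (simp only: vfield_mult vfield_power)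
    qed
    have rhs: "tri (W c) (vf (cst a0 + A2) B (chi u)) =
       (of_nat (nat (dot p1 u)) * cst a0 + s * B) * (chi u * W c ^ nat (dot p1 u))
       + of_nat (nat (dot p1 u)) * (chi u * W c ^ (nat (dot p1 u) - 1) * A2)"
    proof -
      let ?r = "of_nat (nat (dot p1 u)) :: complex"
      have "vf (cst a0 + A2) B (chi u) = cst (?r * a0 + of_int (dot p2 u) * b0) * chi u + cst ?r * (chi u * A2)"
        using r0 unfolding vfield_chi B
        by (simp only: single_add cst_mult[symmetric] distrib_left distrib_right mult_ac) simp
      then have "tri (W c) (vf (cst a0 + A2) B (chi u)) =
          tri (W c) (cst (?r * a0 + of_int (dot p2 u) * b0) * chi u) + tri (W c) (cst ?r * (chi u * A2))" by simp
      also have "tri (W c) (cst ?r * g) = cst ?r * tri (W c) g" for g by (rule tri_cst_mult)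
      also have "tri (W c) (cst (?r * a0 + of_int (dot p2 u) * b0) * chi u) =
          cst (?r * a0 + of_int (dot p2 u) * b0) * (chi u * W c ^ nat (dot p1 u))"
        using tri_cm[OF Alg_simps(4)[OF u]] by simp
      finally show ?thesis unfolding triA2 B s_def
        by (simp only: single_add cst_mult[symmetric] single_of_nat)
    qed
    show ?thesis
    proof (cases "nat (dot p1 u)")
      case 0
      then show ?thesis unfolding lhs rhs by (simp add: mult_ac)
    next
      case (Suc k)
      define P where "P = W c ^ k"
      define R where "R = (of_nat (Suc k) :: laurent)"
      have g: "cst \<gamma> * chi m = cst c * chi m * (cst a0 - cst (of_int (dot p2 m)) * B)"
        unfolding c B by (simp only: cst_mult[symmetric] single_diff mult_ac)
      have "R * vf A B (W c) + W c * (R * A + s * B) = (R * cst a0 + s * B) * W c + R * A2"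
        unfolding dW unfolding A(1) unfolding g by (simp add: algebra_simps)
      then have "chi u * P * (R * vf A B (W c) + W c * (R * A + s * B)) =
          chi u * P * ((R * cst a0 + s * B) * W c + R * A2)" by simp
      then show ?thesis unfolding lhs rhs Suc diff_Suc_1 power_Suc P_def[symmetric] R_def[symmetric]
        by (simp only: distrib_left distrib_right mult_ac add_ac)
    qed
  qed
  show ?thesis unfolding repr_def
  proof
    fix f assume f: "f \<in> Alg S"
    then have f': "keys f \<subseteq> S" by (simp add: Alg_def)
    then have "vf A B (tri (W c) f) = tri (W c) (vf (cst a0 + A2) B f) \<and> vf (cst a0 + A2) B f \<in> Alg S"
    proof (induction f rule: laurent_induct)
      case (single u a)
      have "cst (of_int (dot p1 u)) * (chi u * A2) \<in> Alg S"
      proof (cases "dot p1 u = 0")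
        case False
        then have "dot p1 u \<ge> 1" using single b1 by (simp add: S_def)
        then have "keys (chi u * A2) \<subseteq> S"
          unfolding keys_chi_mult using single A(2) by (force simp: S_def)
        then have "chi u * A2 \<in> Alg S" by (simp add: Alg_def)
        then show ?thesis by (rule Alg_simps(8))
      qed (simp add: Alg_simps)
      moreover have "vf (cst a0 + A2) B (chi u) = cst (of_int (dot p1 u) * a0 + of_int (dot p2 u) * b0) * chi u
          + cst (of_int (dot p1 u)) * (chi u * A2)"
        unfolding vfield_chi B
        by (simp only: single_add cst_mult[symmetric] distrib_left distrib_right mult_ac add_ac)
      ultimately have A': "vf (cst a0 + A2) B (chi u) \<in> Alg S"
        by (simp only: Alg_simps(1,4,8) single)
      have "vf A B (tri (W c) (cst a * chi u)) = cst a * vf A B (tri (W c) (chi u))"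
        by (simp only: tri_cm[OF Alg_simps(4)[OF single]] vfield_simps)
      also have "\<dots> = tri (W c) (cst a * vf (cst a0 + A2) B (chi u))"
        by (simp only: key[OF single] tri_cm[OF A'])
      finally show ?case using A'
        by (simp only: single_eq_cst_chi[of u a] vfield_simps Alg_simps simp_thms)
    qed (simp_all add: Alg_simps)
    moreover have "d (tri (W c) f) = vf A B (tri (W c) f)" using r(1) tri_Alg[OF f] by (simp add: repr_def)
    ultimately show "tri (W (- c)) (d (tri (W c) f)) = vf (cst a0 + A2) B f"
      using tri_inverse by simp
  qed
qed

end

section \<open>Diagonalization\<close>

context plane_cone
begin

text \<open>
  If only roots of the first kind occur, a nonzero exponent in \<open>S\<close> is impossible: with signs chosen so that
  it is positive for \<open>p1\<close>, the lexicographic maximum would be a root with \<open>dot p1\<close> nonnegative. So \<open>d\<close> is a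
  diagonal field plus root terms. The root with the largest \<open>dot p2\<close> belongs to a top part of degree
  zero, hence \<open>no_jordan_block\<close> allows to remove it; induct on the number of terms.
\<close>

lemma one_sided:
  assumes "repr d A B" "derivation_on S d" "int_semisimple S d"
    and "\<And>m. m \<in> spt A B \<Longrightarrow> b2 \<Longrightarrow> dot p2 m \<ge> 0"
  shows "diagonalizable S d"
  using assms
proof (induction "card (keys A)" arbitrary: d A B rule: less_induct)
  case less
  note r = less.prems(1-3) and side = less.prems(4)
  have root: "b1 \<and> dot p1 m = -1 \<and> lookup B m = 0 \<and> lookup A m \<noteq> 0 \<and> (b2 \<longrightarrow> dot p2 m \<ge> 0)"
    if "m \<in> spt A B" "m \<notin> S" for m
    using spt_cases[OF r(1,2) that] side[OF that(1)] by fastforce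
  have supp: "m \<notin> S" if m: "m \<in> spt A B" "m \<noteq> 0" for m
  proof
    assume mS: "m \<in> S"
    define l1 where "l1 = smul (if dot p1 m < 0 then -1 else 1) p1"
    define l2 where "l2 = smul (if dot p2 m < 0 then -1 else 1) p2"
    have "u = 0" if "dot l1 u = 0" "dot l2 u = 0" for u
      using that by (intro dot_inj) (auto simp: l1_def l2_def split: if_splits)
    then have inj: "\<forall>u. dot l1 u = 0 \<and> dot l2 u = 0 \<longrightarrow> u = 0" by blast
    have "\<not> (dot p1 m = 0 \<and> dot p2 m = 0)" using dot_inj m(2) by blast
    then have "dot l1 m > 0 \<or> dot l1 m = 0 \<and> dot l2 m > 0" by (auto simp: l1_def l2_def)
    from lex_top_is_root[OF r inj m(1) this]
    obtain m' where m': "m' \<in> spt A B" "m' \<notin> S" "dot l1 m' > 0 \<or> dot l1 m' = 0 \<and> dot l2 m' > 0"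
      by blast
    then have "dot l1 m' \<ge> 0" by linarith
    have "b1" "dot p1 m' = -1" using root[OF m'(1,2)] by auto
    moreover have "dot p1 m \<ge> 0" using mS \<open>b1\<close> by (simp add: S_def)
    ultimately show False using \<open>dot l1 m' \<ge> 0\<close> by (simp add: l1_def)
  qed
  define a0 where "a0 = lookup A 0"
  define b0 where "b0 = lookup B 0"
  have B: "B = cst b0"
  proof (rule poly_mapping_eqI)
    fix w show "lookup B w = lookup (cst b0) w"
      using root[of w] supp[of w] by (cases "w = 0") (auto simp: b0_def lookup_single when_def spt_iff)
  qed
  show ?case
  proof (cases "keys A \<subseteq> {0}")
    case True
    have A: "A = cst a0"
    proof (rule poly_mapping_eqI)
      fix w show "lookup A w = lookup (cst a0) w"
        using True by (cases "w = 0") (auto simp: a0_def lookup_single when_def in_keys_iff)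
    qed
    have "automorphism_on S (\<lambda>f. f)" by (simp add: automorphism_on_def bij_betw_def)
    moreover have "d (chi u) = cst (of_int (dot p1 u) * a0 + of_int (dot p2 u) * b0) * chi u" if "u \<in> S" for u
      unfolding repr_chi[OF r(1) that] A B
      by (simp only: single_add cst_mult mult.commute)
    ultimately show ?thesis unfolding diagonalizable_def by blast
  next
    case False
    define X where "X = keys A - {0}"
    have X: "finite X" "X \<noteq> {}" using False by (auto simp: X_def)
    have "Max (dot p2 ` X) \<in> dot p2 ` X" using X by (intro Max_in) auto
    then obtain m where m: "m \<in> X" "dot p2 m = Max (dot p2 ` X)" by (metis imageE)
    have mmax: "dot p2 w \<le> dot p2 m" if "w \<in> X" for w using that X(1) by (simp add: m(2))
    have Xr: "b1 \<and> dot p1 w = -1 \<and> (b2 \<longrightarrow> dot p2 w \<ge> 0)" if "w \<in> X" for w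
    proof -
      have "w \<in> spt A B" "w \<noteq> 0" using that by (simp_all add: X_def spt_def)
      then show ?thesis using root[of w] supp[of w] by blast
    qed
    interpret root1 S p1 p2 b1 b2 m
      by unfold_locales (use Xr[OF m(1)] in auto)
    have m0: "m \<noteq> 0" using m(1) by (simp add: X_def)
    define \<gamma> where "\<gamma> = lookup A m"
    have \<gamma>: "\<gamma> \<noteq> 0" using m(1) by (simp add: X_def \<gamma>_def in_keys_iff)
    define A2 where "A2 = A - cst a0 - cst \<gamma> * chi m"
    have lA2: "lookup A2 w = (if w = 0 \<or> w = m then 0 else lookup A w)" for w
      using m0 by (auto simp: A2_def lookup_minus mult_single lookup_single when_def a0_def \<gamma>_def)
    have kA2: "w \<in> X" if "w \<in> keys A2" for w
      using that by (auto simp: in_keys_iff lA2 X_def split: if_splits)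
    define l where "l = smul (dot p2 m) p1 + p2"
    have lX: "dot l w = dot p2 w - dot p2 m" if "w \<in> X" for w
      using Xr[OF that] by (simp add: l_def)
    have belA: "below l 0 A" unfolding below_def
    proof
      fix w assume "w \<in> keys A"
      then show "dot l w \<le> 0" using lX[of w] mmax[of w] by (cases "w = 0") (simp_all add: X_def)
    qed
    have belB: "below l 0 B" by (simp add: B below_def)
    have gA: "gpart l 0 A = cst a0 + cst \<gamma> * chi m"
    proof (rule poly_mapping_eqI)
      fix w
      have "lookup A w = 0" if "dot l w = 0" "w \<noteq> 0" "w \<noteq> m"
      proof (rule ccontr)
        assume "lookup A w \<noteq> 0"
        then have "w \<in> X" using that by (simp add: X_def in_keys_iff)
        then have "dot p1 w = dot p1 m" "dot p2 w = dot p2 m"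
          using Xr lX[of w] that(1) m1 by auto
        then show False using dot_inj' that(3) by blast
      qed
      moreover have "dot l m = 0" using m1 by (simp add: l_def)
      ultimately show "lookup (gpart l 0 A) w = lookup (cst a0 + cst \<gamma> * chi m) w"
        using m0 by (auto simp: lookup_gpart lookup_add mult_single lookup_single when_def a0_def \<gamma>_def)
    qed
    have gB: "gpart l 0 B = cst b0" by (simp add: B)
    have nj: "of_int (dot p2 m) * b0 \<noteq> a0"
      by (rule no_jordan_block[OF r belA belB gA gB m1 \<gamma>])
    define c where "c = \<gamma> / (a0 - of_int (dot p2 m) * b0)"
    have c: "\<gamma> = c * (a0 - of_int (dot p2 m) * b0)" using nj by (simp add: c_def)
    have A: "A = cst a0 + cst \<gamma> * chi m + A2" by (simp add: A2_def)
    have r': "repr (\<lambda>f. tri (W (- c)) (d (tri (W c) f))) (cst a0 + A2) B"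
      by (rule remove_root[OF r A _ B c]) (use kA2 Xr in blast)
    have keys': "keys (cst a0 + A2) \<subseteq> keys A - {m}"
    proof
      fix w assume "w \<in> keys (cst a0 + A2)"
      then show "w \<in> keys A - {m}" using m0
        by (auto simp: in_keys_iff lookup_add lA2 lookup_single when_def a0_def split: if_splits)
    qed
    have "card (keys (cst a0 + A2)) < card (keys A)"
      using keys' m(1) by (intro psubset_card_mono) (auto simp: X_def)
    moreover have "dot p2 w \<ge> 0" if "w \<in> spt (cst a0 + A2) B" "b2" for w
      using that keys' side[of w] by (auto simp: spt_def)
    ultimately have "diagonalizable S (\<lambda>f. tri (W (- c)) (d (tri (W c) f)))"
      using less.hyps[OF _ r' conjugate_tri(1,2)[OF r(2,3)]] by blast
    then show ?thesis by (rule conjugate_tri(3)[OF r(2,3)])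
  qed
qed

end

subsection \<open>Polynomials along a line\<close>

text \<open>
  The polynomial \<open>f\<close> evaluated at \<open>chi z\<close>.
\<close>

definition emb :: "lattice \<Rightarrow> complex poly \<Rightarrow> laurent" where
  "emb z f = fold_coeffs (\<lambda>c r. cst c + chi z * r) f 0"

lemma emb_0 [simp]: "emb z 0 = 0" by (simp add: emb_def)

lemma emb_pCons [simp]: "emb z (pCons c f) = cst c + chi z * emb z f"
  by (cases "c = 0 \<and> f = 0") (auto simp: emb_def)

lemma emb_add: "emb z (f + g) = emb z f + emb z g"
  by (induction f g rule: poly_induct2) (simp_all add: single_add algebra_simps)

lemma emb_smult: "emb z (smult c f) = cst c * emb z f"
  by (induction f) (simp_all add: cst_mult[symmetric] algebra_simps del: mult_single)

lemma emb_mult: "emb z (f * g) = emb z f * emb z g"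
  by (induction f) (simp_all add: emb_add emb_smult algebra_simps)

lemma emb_1 [simp]: "emb z 1 = 1" by (simp add: one_pCons)

lemma emb_power: "emb z (f ^ n) = emb z f ^ n"
  by (induction n) (simp_all add: emb_mult)

lemma emb_monom: "emb z (monom c n) = cst c * chi (smul (int n) z)"
proof (induction n)
  case (Suc n)
  have "emb z (monom c (Suc n)) = cst c * (chi z * chi (smul (int n) z))"
    by (simp only: monom_Suc emb_pCons Suc.IH single_zero add_0_left mult_ac)
  then show ?case by (simp only: chi_mult) (simp add: smul_add)
qed (simp add: monom_0)

lemma emb_sum: "emb z (sum h I) = (\<Sum>i\<in>I. emb z (h i))"
  by (induction I rule: infinite_finite_induct) (simp_all add: emb_add)

lemma lookup_emb:
  assumes "z \<noteq> 0"
  shows "lookup (emb z f) (smul k z) = (if k \<ge> 0 then coeff f (nat k) else 0)"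
proof (induction f arbitrary: k)
  case (pCons c f)
  have "smul k z - z = smul (k - 1) z" by (simp add: smul_add)
  then have "lookup (emb z (pCons c f)) (smul k z) =
      (if k = 0 then c else 0) + lookup (emb z f) (smul (k - 1) z)"
    using assms by (simp add: lookup_add lookup_single_mult lookup_single when_def smul_eq_0_iff
        eq_commute[of 0])
  then show ?case unfolding pCons.IH
    by (auto simp: coeff_pCons nat_diff_distrib split: nat.splits)
qed simp

lemma emb_eq_0: "z \<noteq> 0 \<Longrightarrow> emb z f = 0 \<Longrightarrow> f = 0"
  using lookup_emb[of z f "int _"] by (intro poly_eqI) simp

lemma euler_emb: "euler p (emb z f) = cst (of_int (dot p z)) * emb z (pCons 0 (pderiv f))"
proof (induction f)
  case (pCons c f)
  have "euler p (emb z (pCons c f)) =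
      chi z * (cst (of_int (dot p z)) * emb z (pCons 0 (pderiv f)))
       + emb z f * (cst (of_int (dot p z)) * chi z)"
    by (simp only: emb_pCons euler_simps euler_mult pCons.IH dot_simps of_int_0 single_zero mult_zero_left add_0_left)
  then show ?case
    by (simp only: pderiv_pCons emb_pCons emb_add single_zero add_0_left distrib_left mult_ac add_ac)
qed simp

lemma emb_exists:
  assumes "z \<noteq> 0" "keys g \<subseteq> (\<lambda>i. m0 + smul (int i) z) ` {..I}"
  obtains f where "g = chi m0 * emb z f" "degree f \<le> I"
    "\<And>i. i \<le> I \<Longrightarrow> coeff f i = lookup g (m0 + smul (int i) z)"
proof -
  define f where "f = (\<Sum>i\<le>I. monom (lookup g (m0 + smul (int i) z)) i)"
  have inj: "inj_on (\<lambda>i. m0 + smul (int i) z) {..I}"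
    using smul_inj[OF assms(1)] by (intro inj_onI) simp
  have "g = (\<Sum>u\<in>(\<lambda>i. m0 + smul (int i) z) ` {..I}. Poly_Mapping.single u (lookup g u))"
    by (rule sum_singles[OF assms(2)]) simp
  also have "\<dots> = (\<Sum>i\<le>I. Poly_Mapping.single (m0 + smul (int i) z) (lookup g (m0 + smul (int i) z)))"
    by (rule sum.reindex_cong[OF inj]) simp_all
  also have "\<dots> = chi m0 * emb z f"
    by (simp add: f_def emb_sum emb_monom sum_distrib_left mult_single)
  finally have "g = chi m0 * emb z f" .
  moreover have "degree f \<le> I" unfolding f_def
    by (rule degree_sum_le) (auto intro: order_trans[OF degree_monom_le])
  moreover have "coeff f i = lookup g (m0 + smul (int i) z)" if "i \<le> I" for i
    using that by (simp add: f_def coeff_sum)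
  ultimately show ?thesis using that by blast
qed

context plane_cone
begin

lemma vf_emb:
  "vf (chi m0 * emb z x) (chi m0 * emb z y) (chi u * emb z f) =
    chi (u + m0) * emb z ((smult (of_int (dot p1 u)) x + smult (of_int (dot p2 u)) y) * f
      + (smult (of_int (dot p1 z)) x + smult (of_int (dot p2 z)) y) * pCons 0 (pderiv f))"
proof -
  have *: "euler p (chi u * emb z f) = chi u * (cst (of_int (dot p u)) * emb z f
      + cst (of_int (dot p z)) * emb z (pCons 0 (pderiv f)))" for p
    by (simp only: euler_mult euler_emb euler_simps distrib_left mult_ac add_ac)
  show ?thesis unfolding vfield_def *
    by (simp only: chi_mult[symmetric] emb_add emb_mult emb_smult distrib_left distrib_right mult_ac add_ac)
qed

text \<open>
  Let \<open>m0\<close> and \<open>m1\<close> be the farthest roots of the two kinds. The line through them bounds the support of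
  \<open>d\<close>, since a lexicographic maximum beyond it would be a root farther away. As \<open>n * k > 1\<close>, the degree \<open>D\<close>
  of this edge is positive and its part of \<open>d\<close> is nilpotent on \<open>chi v1\<close>. Then \<open>edge_collapses\<close> applies;
  as \<open>n \<ge> k\<close>, it yields \<open>b = 1\<close>, so that \<open>- z\<close> is a root of the first kind, of degree zero. The last nonzero
  iterate is the image of a character \<open>chi v\<close> under the corresponding triangular automorphism, up to a
  constant, and \<open>reduce_top\<close> moves the roots of the first kind off the edge.
\<close>

lemma reduce_edge:
  assumes r: "repr d A B" "derivation_on S d" "int_semisimple S d" and b: b1 b2
    and m0: "m0 \<in> spt A B" "dot p1 m0 = -1" "dot p2 m0 = n"
    and m1: "m1 \<in> spt A B" "dot p2 m1 = -1" "dot p1 m1 = k"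
    and max1: "\<And>m. m \<in> spt A B \<Longrightarrow> dot p1 m = -1 \<Longrightarrow> dot p2 m \<le> n"
    and max2: "\<And>m. m \<in> spt A B \<Longrightarrow> dot p2 m = -1 \<Longrightarrow> dot p1 m \<le> k"
    and nk: "k \<ge> 1" "n \<ge> k" "n * k > 1"
  shows "\<exists>d' A' B'. repr d' A' B' \<and> derivation_on S d' \<and> int_semisimple S d' \<and>
    (diagonalizable S d' \<longrightarrow> diagonalizable S d) \<and>
    (\<forall>m\<in>spt A' B'. dot p1 m = -1 \<longrightarrow> dot p2 m \<le> n - 1) \<and>
    (\<forall>m\<in>spt A' B'. dot p2 m = -1 \<longrightarrow> dot p1 m \<le> k)"
proof -
  \<comment> \<open>\<open>z\<close> is the primitive direction of the edge and \<open>g\<close> its lattice length.\<close>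
  define g where "g = gcd (fst (m1 - m0)) (snd (m1 - m0))"
  define z where "z = (fst (m1 - m0) div g, snd (m1 - m0) div g)"
  have "m1 \<noteq> m0" using m0 m1 nk by auto
  then have ne: "fst (m1 - m0) \<noteq> 0 \<or> snd (m1 - m0) \<noteq> 0" by (auto simp: prod_eq_iff)
  then have g: "g > 0" by (simp add: g_def gcd_pos_int)
  have gz: "m1 - m0 = smul g z" by (simp add: z_def smul_def g_def prod_eq_iff)
  have cop: "coprime (fst z) (snd z)"
    using ne unfolding z_def g_def by (simp add: div_gcd_coprime)
  have z0: "z \<noteq> 0" using gz \<open>m1 \<noteq> m0\<close> by auto
  define I where "I = nat g"
  have I: "int I = g" using g by (simp add: I_def)
  define a where "a = - dot p2 z"
  define b where "b = dot p1 z"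
  have gb: "g * b = k + 1" using arg_cong[OF gz, of "dot p1"] m0 m1 by (simp add: b_def)
  have ga: "g * a = n + 1" using arg_cong[OF gz, of "dot p2"] m0 m1 by (simp add: a_def)
  have b1': "b \<ge> 1"
  proof (rule ccontr)
    assume "\<not> b \<ge> 1"
    then have "g * b \<le> 0" using g by (intro mult_nonneg_nonpos) auto
    then show False using gb nk by simp
  qed
  have ab: "b \<le> a"
  proof -
    have "g * b \<le> g * a" using ga gb nk by simp
    then show ?thesis using g by simp
  qed
  define D where "D = int I * a * b - a - b"
  have "g * D = n * k - 1"
  proof -
    have "g * D = (g * a) * (g * b) - g * a - g * b" by (simp add: D_def I algebra_simps)
    then show ?thesis unfolding ga gb by (simp add: algebra_simps)
  qed
  then have "g * D > 0" using nk by simp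
  then have D: "D > 0" using g by (simp add: zero_less_mult_iff)
  define l where "l = smul a p1 + smul b p2"
  have lw: "dot l w = a * dot p1 w + b * dot p2 w" for w by (simp add: l_def)
  have lz: "dot l z = 0" by (simp add: lw a_def b_def)
  have n: "n = g * a - 1" and k: "k = g * b - 1" using ga gb by simp_all
  have lm0: "dot l m0 = D" by (simp add: lw m0 D_def I n algebra_simps)
  have lm1: "dot l m1 = D" by (simp add: lw m1 D_def I k algebra_simps)
  have le: "dot l m \<le> D" if m: "m \<in> spt A B" for m
  proof (rule ccontr)
    assume gt: "\<not> dot l m \<le> D"
    have "u = 0" if "dot l u = 0" "dot p1 u = 0" for u
      using that b1' by (intro dot_inj) (simp_all add: lw)
    then have inj: "\<forall>u. dot l u = 0 \<and> dot p1 u = 0 \<longrightarrow> u = 0" by blast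
    have "dot l m > 0 \<or> dot l m = 0 \<and> dot p1 m > 0" using gt D by linarith
    from lex_top_is_root[OF r inj m this]
    obtain m' where m': "m' \<in> spt A B" "m' \<notin> S" "dot l m \<le> dot l m'" using m by blast
    from spt_cases[OF r(1,2) m'(1,2)] show False
    proof (elim disjE conjE)
      assume 1: "dot p1 m' = -1"
      then have "b * dot p2 m' \<le> b * n" using max1[OF m'(1)] b1' by (intro mult_left_mono) auto
      then have "dot l m' \<le> dot l m0" using 1 by (simp add: lw m0)
      then show False using gt m'(3) lm0 by simp
    next
      assume 1: "dot p2 m' = -1"
      then have "a * dot p1 m' \<le> a * k" using max2[OF m'(1)] b1' ab by (intro mult_left_mono) auto
      then have "dot l m' \<le> dot l m1" using 1 by (simp add: lw m1)
      then show False using gt m'(3) lm1 by simp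
    qed
  qed
  have bel: "below l D A" "below l D B" using le by (auto simp: below_def spt_def)
  have line: "m \<in> (\<lambda>i. m0 + smul (int i) z) ` {..I}" if m: "m \<in> spt A B" "dot l m = D" for m
  proof -
    obtain s t where st: "s * fst z + t * snd z = 1"
      using cop by (metis bezout_int coprime_imp_gcd_eq_1)
    define w where "w = m - m0"
    have lw0: "dot l w = 0" using m lm0 by (simp add: w_def)
    have "l \<noteq> 0"
    proof
      assume "l = 0"
      then have "dot l m0 = 0" by (simp add: dot_def)
      then show False using lm0 D by simp
    qed
    have par: "fst w * snd z = snd w * fst z"
    proof -
      have 1: "fst l * fst w = - (snd l * snd w)" "fst l * fst z = - (snd l * snd z)"
        using lw0 lz by (simp_all add: dot_def)
      have "fst l * (fst w * snd z - snd w * fst z) = (fst l * fst w) * snd z - snd w * (fst l * fst z)"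
        by (simp add: algebra_simps)
      also have "\<dots> = 0" unfolding 1 by (simp add: algebra_simps)
      finally have A1: "fst l * (fst w * snd z - snd w * fst z) = 0" .
      have "snd l * (fst w * snd z - snd w * fst z) = - (- (snd l * snd z)) * fst w + (- (snd l * snd w)) * fst z"
        by (simp add: algebra_simps)
      also have "\<dots> = 0" unfolding 1[symmetric] by (simp add: algebra_simps)
      finally have A2: "snd l * (fst w * snd z - snd w * fst z) = 0" .
      from A1 A2 \<open>l \<noteq> 0\<close> show ?thesis by (auto simp: prod_eq_iff)
    qed
    define q where "q = s * fst w + t * snd w"
    have "q * fst z = fst w" "q * snd z = snd w"
    proof -
      have "q * fst z = s * fst z * fst w + t * (snd w * fst z)" by (simp add: q_def algebra_simps)
      also have "\<dots> = fst w * (s * fst z + t * snd z)" unfolding par[symmetric] by (simp add: algebra_simps)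
      finally show "q * fst z = fst w" by (simp add: st)
      have "q * snd z = s * (fst w * snd z) + t * snd z * snd w" by (simp add: q_def algebra_simps)
      also have "\<dots> = snd w * (s * fst z + t * snd z)" unfolding par by (simp add: algebra_simps)
      finally show "q * snd z = snd w" by (simp add: st)
    qed
    then have "w = smul q z" by (simp add: smul_def prod_eq_iff)
    then have mq: "m = m0 + smul q z" by (simp add: w_def algebra_simps)
    have "dot p1 m \<ge> -1"
      using repr_root1[OF r(1,2) b(1), of m] m(1) by (force simp: spt_iff)
    then have "q * b \<ge> 0" using m0 by (simp add: mq b_def)
    then have q0: "q \<ge> 0" using b1' by (simp add: zero_le_mult_iff)
    have "dot p2 m \<ge> -1"
      using repr_root2[OF r(1,2) b(2), of m] m(1) by (force simp: spt_iff)
    then have "(g - q) * a \<ge> 0" using m0 ga by (simp add: mq a_def algebra_simps)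
    then have "q \<le> g" using b1' ab by (simp add: zero_le_mult_iff)
    then show ?thesis using mq q0 I by (intro image_eqI[of _ _ "nat q"]) auto
  qed
  have "keys (gpart l D A) \<subseteq> (\<lambda>i. m0 + smul (int i) z) ` {..I}"
       "keys (gpart l D B) \<subseteq> (\<lambda>i. m0 + smul (int i) z) ` {..I}"
    using line unfolding keys_gpart spt_def by blast+
  then obtain x y where x: "gpart l D A = chi m0 * emb z x" "degree x \<le> I"
      "\<And>i. i \<le> I \<Longrightarrow> coeff x i = lookup (gpart l D A) (m0 + smul (int i) z)"
    and y: "gpart l D B = chi m0 * emb z y" "degree y \<le> I"
      "\<And>i. i \<le> I \<Longrightarrow> coeff y i = lookup (gpart l D B) (m0 + smul (int i) z)"
    using emb_exists[OF z0] by metis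
  have m1z: "m0 + smul (int I) z = m1" using gz I by (simp add: algebra_simps)
  have B0: "lookup B m0 = 0" "lookup A m0 \<noteq> 0" "lookup A m1 = 0" "lookup B m1 \<noteq> 0"
    using repr_root1(1)[OF r(1,2) b(1), of m0] repr_root2(1)[OF r(1,2) b(2), of m1] m0 m1
    by (auto simp: spt_iff)
  define \<beta> where "\<beta> = smult (of_int b) x - smult (of_int a) y"
  define f where "f = rec_nat (1 :: complex poly) (\<lambda>j g.
      (smult (of_int (N - int j)) x + smult (of_int (0 + int j * (int I * a - 1))) y) * g
        + \<beta> * pCons 0 (pderiv g))"
  have f_Suc: "f (Suc j) = (smult (of_int (N - int j)) x + smult (of_int (0 + int j * (int I * a - 1))) y) * f j
        + \<beta> * pCons 0 (pderiv (f j))" for j by (simp add: f_def)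
  interpret E: edge x y a b N 0 D I f \<beta>
  proof
    show "a \<ge> 1" "b \<ge> 1" using ab b1' by auto
    show "D = int I * a * b - a - b" by (rule D_def)
    show "D > 0" by (rule D)
    show "degree x \<le> I" "degree y \<le> I" by (fact x(2), fact y(2))
    show "coeff x I = 0" "coeff y I \<noteq> 0" "coeff x 0 \<noteq> 0" "coeff y 0 = 0"
      using x(3)[of I] y(3)[of I] x(3)[of 0] y(3)[of 0] m1z B0 lm0 lm1 by (simp_all add: lookup_gpart)
    show "\<beta> = smult (of_int b) x - smult (of_int a) y" by (rule \<beta>_def)
    show "f 0 = 1" by (simp add: f_def)
    show "a * N + b * 0 > 0" using N_pos ab b1' by simp
  qed (rule f_Suc)
  define T where "T = vf (gpart l D A) (gpart l D B)"
  define U where "U j = v1 + smul (int j) m0" for j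
  have U: "dot p1 (U j) = E.U1 j" "dot p2 (U j) = E.U2 j" for j
    by (simp_all add: U_def E.U1_def E.U2_def m0 n I)
  have T_step: "T (chi (U j) * emb z (f j)) = chi (U (Suc j)) * emb z (f (Suc j))" for j
  proof -
    have "U j + m0 = U (Suc j)" by (simp add: U_def smul_add algebra_simps)
    moreover have "smult (of_int (dot p1 z)) x + smult (of_int (dot p2 z)) y = \<beta>"
      by (simp add: \<beta>_def a_def b_def)
    ultimately show ?thesis
      unfolding T_def x(1) y(1) vf_emb U by (simp add: f_Suc E.U1_def E.U2_def)
  qed
  have iter: "(T ^^ j) (chi v1) = chi (U j) * emb z (f j)" for j
    by (induction j) (simp_all add: T_step, simp add: U_def f_def)
  obtain j0 where "(T ^^ j0) (chi v1) = 0"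
    using top_nilpotent[OF r bel D v_in_S(1)] unfolding T_def by blast
  then have "chi (U j0) * emb z (f j0) = chi (U j0) * 0" by (simp add: iter)
  then have "f j0 = 0" using emb_eq_0[OF z0] by (simp only: chi_cancel)
  from E.edge_collapses[OF this] obtain j c \<kappa> s N' where
    fj: "f (Suc j) = 0" "f j = smult \<kappa> ([:0, 1:] ^ s * [:- c, 1:] ^ N')" "\<kappa> \<noteq> 0" "N' > 0"
    and U1: "E.U1 j + int s * b = 0" and U2: "E.U2 j = a * (int s + int N')" and ab1: "a = 1 \<or> b = 1"
    by metis
  note edge_end = m1(2,3)
  have b_1: "b = 1" using ab1 ab b1' by linarith
  interpret root1 S p1 p2 b1 b2 "- z"
    by unfold_locales (use b b_1 ab in \<open>simp_all add: b_def a_def\<close>)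
  \<comment> \<open>The exponent of the highest term of the last nonzero iterate; the equations for \<open>U1\<close> and \<open>U2\<close> place
    it on the ray \<open>dot p2 v = 0\<close>.\<close>
  define v where "v = U j + smul (int s) z + smul (int N') z"
  have v: "dot p1 v = int N'" "dot p2 v = 0"
    using U1 U2 by (simp_all add: v_def U b_1 b_def[symmetric] a_def algebra_simps)
  have tri_v: "cst \<kappa> * tri (W (- c)) (chi v) = chi (U j) * emb z (f j)"
  proof -
    have e: "chi z * W (- c) = emb z [:- c, 1:]"
    proof -
      have "chi z * W (- c) = chi z + cst (- c) * (chi z * chi (- z))"
        by (simp only: distrib_left mult_1_right mult_1_left mult_ac)
      then show ?thesis by (simp only: chi_mult) (simp add: add.commute)
    qed
    have t: "tri (W (- c)) (chi v) = chi v * W (- c) ^ N'" by (simp add: v)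
    have "chi v = chi (U j) * chi (smul (int s) z) * chi z ^ N'"
      by (simp only: v_def chi_mult chi_power)
    then have "chi v * W (- c) ^ N' = chi (U j) * chi (smul (int s) z) * (chi z * W (- c)) ^ N'"
      by (simp only: power_mult_distrib mult_ac)
    also have "\<dots> = chi (U j) * (emb z ([:0, 1:] ^ s) * emb z ([:- c, 1:] ^ N'))"
      by (simp only: e emb_power chi_power[symmetric] mult.assoc) simp
    finally show ?thesis unfolding t fj(2) emb_smult emb_mult by (simp only: mult.left_commute)
  qed
  have "cst \<kappa> * T (tri (W (- c)) (chi v)) = T (chi (U j) * emb z (f j))"
    unfolding tri_v[symmetric] T_def by simp
  also have "\<dots> = 0" unfolding T_step fj(1) by simp
  finally have "T (tri (W (- c)) (chi v)) = cst 0 * tri (W (- c)) (chi v)"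
    using fj(3) by (simp add: cst_mult_eq_0_iff)
  then obtain d' A' B' where d': "repr d' A' B'" "derivation_on S d'" "int_semisimple S d'"
    "diagonalizable S d' \<longrightarrow> diagonalizable S d" "below l D A'" "below l D B'"
    "keys (gpart l D A') \<subseteq> {0}"
    using reduce_top[OF r, of l D v "- c" 0] lz bel v fj(4) unfolding T_def by auto
  have "dot p2 m \<le> n - 1" if m: "m \<in> spt A' B'" "dot p1 m = -1" for m
  proof -
    have "lookup A' m \<noteq> 0"
      using repr_root1(1)[OF d'(1,2) b(1), of m] m by (auto simp: spt_iff)
    then have mA: "m \<in> keys A'" by (simp add: in_keys_iff)
    then have "dot l m \<le> D" using d'(5) by (simp add: below_def)
    moreover have "dot l m \<noteq> D"
    proof
      assume "dot l m = D"
      then have "m \<in> {0}" using mA d'(7) by (auto simp: keys_gpart)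
      then show False using m by simp
    qed
    ultimately have "dot l m < dot l m0" using lm0 by simp
    then show ?thesis using m by (simp add: lw m0 b_1)
  qed
  moreover have "dot p1 m \<le> k" if m: "m \<in> spt A' B'" "dot p2 m = -1" for m
  proof -
    have "lookup B' m \<noteq> 0"
      using repr_root2(1)[OF d'(1,2) b(2), of m] m by (auto simp: spt_iff)
    then have "dot l m \<le> D" using d'(6) by (simp add: below_def in_keys_iff)
    then have "dot l m \<le> dot l m1" unfolding lm1 .
    then have "a * dot p1 m \<le> a * k" unfolding lw by (simp add: m edge_end)
    then show ?thesis using ab b1' by simp
  qed
  ultimately show ?thesis using d'(1-4) by blast
qed

text \<open>
  The fields \<open>chi m * E1\<close> and \<open>chi (- m) * E2\<close> and the Euler fields act like linear vector fields in two
  variables. Powers of a linear form that is an eigenvector are eigenvectors as well, and the condition on \<open>c\<close>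
  is the quadratic equation for the eigenlines.
\<close>

lemma eigen_linear:
  assumes m: "dot p1 m = -1" and v: "dot p1 v = int n" "n > 0" "dot p2 v = 0"
    and c: "\<gamma> + c * (of_int (dot p2 m) * b0 - a0) = c\<^sup>2 * \<epsilon> * of_int (dot p2 m)"
  shows "vf (cst a0 + cst \<gamma> * chi m) (cst b0 + cst \<epsilon> * chi (- m)) (chi v * (1 + cst c * chi m) ^ n) =
    cst (of_nat n * (a0 + c * \<epsilon> * of_int (dot p2 m))) * (chi v * (1 + cst c * chi m) ^ n)"
proof -
  let ?V = "vf (cst a0 + cst \<gamma> * chi m) (cst b0 + cst \<epsilon> * chi (- m))" and ?W = "1 + cst c * chi m"
  define e where "e = (of_int (dot p2 m) :: complex)"
  obtain k where k: "n = Suc k" using v(2) by (cases n) auto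
  have V1: "?V (chi v) = chi v * (of_nat n * (cst a0 + cst \<gamma> * chi m))"
    unfolding vfield_chi v by simp
  have inv: "chi m * chi (- m) = 1" by (simp only: chi_mult) simp
  have "?V ?W = cst c * (chi m * (cst e * (cst b0 + cst \<epsilon> * chi (- m)) - (cst a0 + cst \<gamma> * chi m)))"
    by (simp only: vfield_simps vfield_chi m e_def add_0_left)
      (simp add: single_uminus, simp only: diff_conv_add_uminus minus_add_distrib add_ac)
  also have "\<dots> = cst (c * (e * b0 - a0)) * chi m - cst (c * \<gamma>) * (chi m * chi m)
      + cst (c * (e * \<epsilon>)) * (chi m * chi (- m))"
    by (simp only: cst_mult[symmetric] single_diff distrib_left right_diff_distrib left_diff_distrib mult_ac)
      (simp add: algebra_simps)
  finally have VW: "?V ?W = cst (c * (e * b0 - a0)) * chi m - cst (c * \<gamma>) * (chi m * chi m) + cst (c * (e * \<epsilon>))"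
    by (simp only: inv mult_1_right)
  have c': "c * (e * b0 - a0) = c\<^sup>2 * \<epsilon> * e - \<gamma>" using c by (simp add: e_def algebra_simps)
  have "(cst a0 + cst \<gamma> * chi m) * ?W + ?V ?W = cst (a0 + c * \<epsilon> * e) * ?W"
    unfolding VW c'
    by (simp only: single_add single_diff power2_eq_square cst_mult[symmetric] distrib_left distrib_right
          left_diff_distrib mult_1_left mult_1_right mult_ac) (simp add: algebra_simps)
  then have key: "?W ^ k * (chi v * (of_nat n * ((cst a0 + cst \<gamma> * chi m) * ?W + ?V ?W))) =
      ?W ^ k * (chi v * (of_nat n * (cst (a0 + c * \<epsilon> * e) * ?W)))" by simp
  have gen: "chi v * (of_nat (Suc k) * w ^ k * q) + w * w ^ k * (chi v * (of_nat (Suc k) * p)) =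
      w ^ k * (chi v * (of_nat (Suc k) * (p * w + q)))" for w p q :: laurent
    by (simp only: distrib_left mult_ac add_ac)
  have P: "?V (?W ^ Suc k) = of_nat (Suc k) * ?W ^ k * ?V ?W"
    using vfield_power[of p1 p2 _ _ ?W "Suc k"] by (simp only: diff_Suc_1)
  have "?V (chi v * ?W ^ n) = chi v * ?V (?W ^ Suc k) + ?W ^ Suc k * ?V (chi v)"
    unfolding k by (rule vfield_mult)
  also have "\<dots> = chi v * (of_nat (Suc k) * ?W ^ k * ?V ?W)
      + ?W * ?W ^ k * (chi v * (of_nat (Suc k) * (cst a0 + cst \<gamma> * chi m)))"
    unfolding P V1[unfolded k] by (simp only: power_Suc)
  also have "\<dots> = ?W ^ k * (chi v * (of_nat n * ((cst a0 + cst \<gamma> * chi m) * ?W + ?V ?W)))"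
    unfolding k by (rule gen)
  also note key
  also have "?W ^ k * (chi v * (of_nat n * (cst (a0 + c * \<epsilon> * e) * ?W))) =
      (of_nat n * cst (a0 + c * \<epsilon> * e)) * (chi v * ?W ^ n)"
    unfolding k power_Suc by (simp only: mult_ac)
  also have "of_nat n * cst (a0 + c * \<epsilon> * e) = cst (of_nat n * (a0 + c * \<epsilon> * e))"
    by (simp only: cst_mult[symmetric] single_of_nat)
  finally show ?thesis by (simp only: e_def)
qed

text \<open>
  For \<open>n = k = 1\<close> the two farthest roots are opposite and the edge has degree zero. The coefficient \<open>\<epsilon>\<close> is
  not zero, so the quadratic equation of \<open>eigen_linear\<close> has a solution, which provides the eigenvector
  for \<open>reduce_top\<close>.
\<close>

lemma reduce_square:
  assumes r: "repr d A B" "derivation_on S d" "int_semisimple S d" and b: b1 b2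
    and m0: "m0 \<in> spt A B" "dot p1 m0 = -1" "dot p2 m0 = 1"
    and m1: "m1 \<in> spt A B" "dot p2 m1 = -1" "dot p1 m1 = 1"
    and max1: "\<And>m. m \<in> spt A B \<Longrightarrow> dot p1 m = -1 \<Longrightarrow> dot p2 m \<le> 1"
    and max2: "\<And>m. m \<in> spt A B \<Longrightarrow> dot p2 m = -1 \<Longrightarrow> dot p1 m \<le> 1"
  shows "\<exists>d' A' B'. repr d' A' B' \<and> derivation_on S d' \<and> int_semisimple S d' \<and>
    (diagonalizable S d' \<longrightarrow> diagonalizable S d) \<and>
    (\<forall>m\<in>spt A' B'. dot p1 m = -1 \<longrightarrow> dot p2 m \<le> 0) \<and>
    (\<forall>m\<in>spt A' B'. dot p2 m = -1 \<longrightarrow> dot p1 m \<le> 1)"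
proof -
  define l where "l = p1 + p2"
  have lw: "dot l w = dot p1 w + dot p2 w" for w by (simp add: l_def)
  have m1_eq: "m1 = - m0" using m0 m1 by (intro dot_inj') simp_all
  have m0_nz: "m0 \<noteq> 0" using m0 by auto
  have le: "dot l m \<le> 0" if m: "m \<in> spt A B" for m
  proof (rule ccontr)
    assume gt: "\<not> dot l m \<le> 0"
    have "u = 0" if "dot l u = 0" "dot p1 u = 0" for u
      using that by (intro dot_inj) (simp_all add: lw)
    then have inj: "\<forall>u. dot l u = 0 \<and> dot p1 u = 0 \<longrightarrow> u = 0" by blast
    have "dot l m > 0 \<or> dot l m = 0 \<and> dot p1 m > 0" using gt by linarith
    from lex_top_is_root[OF r inj m this]
    obtain m' where m': "m' \<in> spt A B" "m' \<notin> S" "dot l m \<le> dot l m'" using m by blast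
    from spt_cases[OF r(1,2) m'(1,2)] show False
      using max1[OF m'(1)] max2[OF m'(1)] gt m'(3) by (auto simp: lw)
  qed
  have bel: "below l 0 A" "below l 0 B" using le by (auto simp: below_def spt_def)
  have cases: "w = 0 \<or> w = m0 \<or> w = - m0" if w: "w \<in> spt A B" "dot l w = 0" for w
  proof -
    have "dot p1 w \<ge> -1" using repr_root1[OF r(1,2) b(1), of w] w(1) by (force simp: spt_iff)
    moreover have "dot p2 w \<ge> -1" using repr_root2[OF r(1,2) b(2), of w] w(1) by (force simp: spt_iff)
    ultimately consider "dot p1 w = -1" "dot p2 w = 1" | "dot p1 w = 0" "dot p2 w = 0"
      | "dot p1 w = 1" "dot p2 w = -1" using w(2) unfolding lw by linarith
    then show ?thesis
    proof cases
      case 1 then have "w = m0" using m0 by (intro dot_inj') simp_all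
      then show ?thesis by simp
    next
      case 2 then show ?thesis using dot_inj by blast
    next
      case 3 then have "w = - m0" using m0 by (intro dot_inj') simp_all
      then show ?thesis by simp
    qed
  qed
  define a0 where "a0 = lookup A 0"
  define b0 where "b0 = lookup B 0"
  define \<gamma> where "\<gamma> = lookup A m0"
  define \<epsilon> where "\<epsilon> = lookup B (- m0)"
  have B0: "lookup B m0 = 0" "lookup A (- m0) = 0" "\<epsilon> \<noteq> 0"
    using repr_root1(1)[OF r(1,2) b(1), of m0] repr_root2(1)[OF r(1,2) b(2), of m1] m0 m1
    by (auto simp: spt_iff m1_eq \<epsilon>_def)
  have neq: "m0 \<noteq> - m0" using m0(2) by (metis dot_simps(3) equal_neg_zero one_neq_zero neg_equal_0_iff_equal)
  have gA: "gpart l 0 A = cst a0 + cst \<gamma> * chi m0"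
  proof (rule poly_mapping_eqI)
    fix w
    have "lookup A w = 0" if "dot l w = 0" "w \<noteq> 0" "w \<noteq> m0"
      using cases[of w] that B0(2) by (auto simp: spt_iff)
    moreover have "dot l m0 = 0" using m0 by (simp add: lw)
    ultimately show "lookup (gpart l 0 A) w = lookup (cst a0 + cst \<gamma> * chi m0) w"
      using m0_nz by (auto simp: lookup_gpart lookup_add mult_single lookup_single when_def a0_def \<gamma>_def)
  qed
  have gB: "gpart l 0 B = cst b0 + cst \<epsilon> * chi (- m0)"
  proof (rule poly_mapping_eqI)
    fix w
    have "lookup B w = 0" if "dot l w = 0" "w \<noteq> 0" "w \<noteq> - m0"
      using cases[of w] that B0(1) by (auto simp: spt_iff)
    moreover have "dot l (- m0) = 0" using m0 by (simp add: lw)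
    ultimately show "lookup (gpart l 0 B) w = lookup (cst b0 + cst \<epsilon> * chi (- m0)) w"
      using m0_nz by (auto simp: lookup_gpart lookup_add mult_single lookup_single when_def b0_def \<epsilon>_def)
  qed
  obtain c where c: "\<gamma> + c * (of_int (dot p2 m0) * b0 - a0) = c\<^sup>2 * \<epsilon> * of_int (dot p2 m0)"
  proof -
    have "\<not> constant (poly [:- \<gamma>, a0 - b0, \<epsilon>:])"
      using B0(3) by (simp add: constant_degree)
    then obtain c where "poly [:- \<gamma>, a0 - b0, \<epsilon>:] c = 0"
      using fundamental_theorem_of_algebra by blast
    then show ?thesis using that[of c] m0(3) by (simp add: algebra_simps power2_eq_square)
  qed
  interpret root1 S p1 p2 b1 b2 m0
    by unfold_locales (use b m0 in simp_all)
  have v: "dot p1 v1 = int (nat N)" "nat N > 0" "dot p2 v1 = 0" using N_pos by simp_all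
  have tri_v: "tri (W c) (chi v1) = chi v1 * W c ^ nat N" by simp
  have eig: "vf (gpart l 0 A) (gpart l 0 B) (tri (W c) (chi v1)) =
      cst (of_nat (nat N) * (a0 + c * \<epsilon> * of_int (dot p2 m0))) * tri (W c) (chi v1)"
    unfolding gA gB tri_v by (rule eigen_linear[OF m0(2) v c])
  have dlm: "dot l m0 = 0" using m0 by (simp add: lw)
  have v1_pos: "dot p1 v1 > 0" using N_pos by simp
  obtain d' A' B' where d': "repr d' A' B'" "derivation_on S d'" "int_semisimple S d'"
    "diagonalizable S d' \<longrightarrow> diagonalizable S d" "below l 0 A'" "below l 0 B'"
    "keys (gpart l 0 A') \<subseteq> {0}"
    by (rule reduce_top[OF r dlm bel v1_pos dot_v(2) eig])
  have "dot p2 m \<le> 0" if m: "m \<in> spt A' B'" "dot p1 m = -1" for m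
  proof -
    have "lookup A' m \<noteq> 0"
      using repr_root1(1)[OF d'(1,2) b(1), of m] m by (auto simp: spt_iff)
    then have mA: "m \<in> keys A'" by (simp add: in_keys_iff)
    then have "dot l m \<le> 0" using d'(5) by (simp add: below_def)
    moreover have "dot l m \<noteq> 0"
    proof
      assume "dot l m = 0"
      then have "m \<in> {0}" using mA d'(7) by (auto simp: keys_gpart)
      then show False using m by simp
    qed
    ultimately show ?thesis using m by (simp add: lw)
  qed
  moreover have "dot p1 m \<le> 1" if m: "m \<in> spt A' B'" "dot p2 m = -1" for m
  proof -
    have "lookup B' m \<noteq> 0"
      using repr_root2(1)[OF d'(1,2) b(2), of m] m by (auto simp: spt_iff)
    then have "dot l m \<le> 0" using d'(6) by (simp add: below_def in_keys_iff)
    then show ?thesis using m by (simp add: lw)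
  qed
  ultimately show ?thesis using d'(1-4) by blast
qed

text \<open>
  For \<open>n = 0\<close> the only root of the first kind is \<open>m0\<close>, and no exponent has positive \<open>dot p2\<close>. The top part with
  respect to \<open>p2\<close> has degree zero, and \<open>no_jordan_block\<close> shows that its diagonal part acts on \<open>chi m0\<close> with
  the nonzero eigenvalue \<open>- a0\<close>. So \<open>m0\<close> can be removed, after which only roots of the second kind are left.
\<close>

lemma reduce_flat:
  assumes r: "repr d A B" "derivation_on S d" "int_semisimple S d" and b: b1 b2
    and m0: "m0 \<in> spt A B" "dot p1 m0 = -1" "dot p2 m0 = 0"
    and max1: "\<And>m. m \<in> spt A B \<Longrightarrow> dot p1 m = -1 \<Longrightarrow> dot p2 m \<le> 0"
  shows "diagonalizable S d"
proof -
  have inj: "\<forall>u. dot p2 u = 0 \<and> dot p1 u = 0 \<longrightarrow> u = 0" using dot_inj by blast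
  have lex: "\<not> (dot p2 m > 0 \<or> dot p2 m = 0 \<and> dot p1 m > 0)" if m: "m \<in> spt A B" for m
  proof
    assume "dot p2 m > 0 \<or> dot p2 m = 0 \<and> dot p1 m > 0"
    from lex_top_is_root[OF r inj m this]
    obtain m' where m': "m' \<in> spt A B" "m' \<notin> S" "dot p2 m' > 0 \<or> dot p2 m' = 0 \<and> dot p1 m' > 0"
      by blast
    from spt_cases[OF r(1,2) m'(1,2)] show False
      using max1[OF m'(1)] m'(3) by auto
  qed
  have bel: "below p2 0 A" "below p2 0 B" using lex unfolding below_def spt_def by force+
  have m0_nz: "m0 \<noteq> 0" using m0 by auto
  have cases: "w = 0 \<or> w = m0" if w: "w \<in> spt A B" "dot p2 w = 0" for w
  proof -
    have "dot p1 w \<ge> -1" using repr_root1[OF r(1,2) b(1), of w] w(1) by (force simp: spt_iff)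
    moreover have "dot p1 w \<le> 0" using lex[OF w(1)] w(2) by force
    ultimately have "dot p1 w = 0 \<or> dot p1 w = -1" by linarith
    then show ?thesis using w(2) m0 dot_inj[of w] dot_inj'[of w m0] by linarith
  qed
  define a0 where "a0 = lookup A 0"
  define b0 where "b0 = lookup B 0"
  define \<gamma> where "\<gamma> = lookup A m0"
  have B0: "lookup B m0 = 0" "\<gamma> \<noteq> 0"
    using repr_root1(1)[OF r(1,2) b(1), of m0] m0 by (auto simp: spt_iff \<gamma>_def)
  have gA: "gpart p2 0 A = cst a0 + cst \<gamma> * chi m0"
  proof (rule poly_mapping_eqI)
    fix w
    have "lookup A w = 0" if "dot p2 w = 0" "w \<noteq> 0" "w \<noteq> m0"
      using cases[of w] that by (auto simp: spt_iff)
    then show "lookup (gpart p2 0 A) w = lookup (cst a0 + cst \<gamma> * chi m0) w"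
      using m0_nz m0(3) by (auto simp: lookup_gpart lookup_add mult_single lookup_single when_def a0_def \<gamma>_def)
  qed
  have gB: "gpart p2 0 B = cst b0"
  proof (rule poly_mapping_eqI)
    fix w
    have "lookup B w = 0" if "dot p2 w = 0" "w \<noteq> 0"
      using cases[of w] that B0(1) by (auto simp: spt_iff)
    then show "lookup (gpart p2 0 B) w = lookup (cst b0) w"
      by (auto simp: lookup_gpart lookup_single when_def b0_def)
  qed
  have "of_int (dot p2 m0) * b0 \<noteq> a0"
    by (rule no_jordan_block[OF r bel gA gB m0(2) B0(2)])
  then have a0: "a0 \<noteq> 0" using m0(3) by simp
  define c where "c = \<gamma> / a0"
  have c: "\<gamma> + c * (of_int (dot p2 m0) * b0 - a0) = c\<^sup>2 * 0 * of_int (dot p2 m0)"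
    using a0 by (simp add: c_def m0(3))
  interpret root1 S p1 p2 b1 b2 m0
    by unfold_locales (use b m0 in simp_all)
  have v: "dot p1 v1 = int (nat N)" "nat N > 0" "dot p2 v1 = 0" using N_pos by simp_all
  have tri_v: "tri (W c) (chi v1) = chi v1 * W c ^ nat N" by simp
  have eig: "vf (gpart p2 0 A) (gpart p2 0 B) (tri (W c) (chi v1)) =
      cst (of_nat (nat N) * (a0 + c * 0 * of_int (dot p2 m0))) * tri (W c) (chi v1)"
    using eigen_linear[OF m0(2) v c] unfolding gA gB tri_v by (simp only: single_zero mult_zero_left add_0_right)
  have dlm: "dot p2 m0 = 0" by (rule m0(3))
  have v1_pos: "dot p1 v1 > 0" using N_pos by simp
  obtain d' A' B' where d': "repr d' A' B'" "derivation_on S d'" "int_semisimple S d'"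
    "diagonalizable S d' \<longrightarrow> diagonalizable S d" "below p2 0 A'" "below p2 0 B'"
    "keys (gpart p2 0 A') \<subseteq> {0}"
    by (rule reduce_top[OF r dlm bel v1_pos dot_v(2) eig])
  have "dot p1 m \<ge> 0" if m: "m \<in> spt A' B'" for m
  proof (rule ccontr)
    assume neg: "\<not> dot p1 m \<ge> 0"
    then have "dot p1 m = -1"
      using repr_root1[OF d'(1,2) b(1), of m] m by (force simp: spt_iff)
    have "lookup A' m \<noteq> 0"
      using repr_root1(1)[OF d'(1,2) b(1), of m] m neg by (auto simp: spt_iff)
    then have mA: "m \<in> keys A'" by (simp add: in_keys_iff)
    then have "dot p2 m \<le> 0" using d'(5) by (simp add: below_def)
    moreover have "dot p2 m \<ge> 0"
      using repr_root2(1)[OF d'(1,2) b(2), of m] \<open>lookup A' m \<noteq> 0\<close> by linarith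
    ultimately have "m \<in> {0}" using mA d'(7) by (auto simp: keys_gpart)
    then show False using neg by simp
  qed
  then have "diagonalizable S d'"
    using plane_cone.one_sided[OF swap repr_swap[OF d'(1)] d'(2,3)]
    by (simp add: spt_def Un_commute)
  then show ?thesis using d'(4) by blast
qed

text \<open>
  Induction on the bounds \<open>n\<close> and \<open>k\<close> for the distances of the roots of the two kinds. If the bounds are
  attained, one of the reductions lowers a bound while preserving the other one, or finishes the proof;
  the roles of \<open>p1\<close> and \<open>p2\<close> are exchanged when the second kind reaches farther.
\<close>

lemma two_sided:
  assumes "repr d A B" "derivation_on S d" "int_semisimple S d" and b: b1 b2
    and "\<And>m. m \<in> spt A B \<Longrightarrow> dot p1 m = -1 \<Longrightarrow> dot p2 m < int n"
    and "\<And>m. m \<in> spt A B \<Longrightarrow> dot p2 m = -1 \<Longrightarrow> dot p1 m < int k"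
  shows "diagonalizable S d"
  using assms(1-3,6-)
proof (induction "n + k" arbitrary: d A B n k rule: less_induct)
  case less
  note r = less.prems(1-3) and n = less.prems(4) and k = less.prems(5)
  have swp: "m \<in> spt B A \<longleftrightarrow> m \<in> spt A B" for m A B by (auto simp: spt_def)
  interpret sw: plane_cone S p2 p1 b2 b1 by (rule swap)
  have rs: "sw.repr d B A" if "repr d A B" for d A B by (rule repr_swap[OF that])
  show ?case
  proof (cases "(\<forall>m\<in>spt A B. dot p1 m \<noteq> -1) \<or> (\<forall>m\<in>spt A B. dot p2 m \<noteq> -1)")
    case True
    then show ?thesis
    proof
      assume no: "\<forall>m\<in>spt A B. dot p1 m \<noteq> -1"
      have "dot p1 m \<ge> 0" if m: "m \<in> spt A B" for m
        using repr_root1[OF r(1,2) b(1), of m] m no by (force simp: spt_iff)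
      then show ?thesis using sw.one_sided[OF rs[OF r(1)] r(2,3)] swp by blast
    next
      assume no: "\<forall>m\<in>spt A B. dot p2 m \<noteq> -1"
      have "dot p2 m \<ge> 0" if m: "m \<in> spt A B" for m
        using repr_root2[OF r(1,2) b(2), of m] m no by (force simp: spt_iff)
      then show ?thesis using one_sided[OF r] by blast
    qed
  next
    case False
    then obtain w1 w2 where w: "w1 \<in> spt A B" "dot p1 w1 = -1" "w2 \<in> spt A B" "dot p2 w2 = -1" by blast
    have w1: "dot p2 w1 \<ge> 0"
      using repr_root2(1)[OF r(1,2) b(2), of w1] repr_root1(1)[OF r(1,2) b(1), of w1] w
      by (force simp: spt_iff)
    have w2: "dot p1 w2 \<ge> 0"
      using repr_root2(1)[OF r(1,2) b(2), of w2] repr_root1(1)[OF r(1,2) b(1), of w2] w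
      by (force simp: spt_iff)
    have "n > 0" "k > 0" using n[OF w(1,2)] k[OF w(3,4)] w1 w2 by auto
    show ?thesis
    proof (cases "(\<forall>m\<in>spt A B. dot p1 m = -1 \<longrightarrow> dot p2 m < int (n - 1))
        \<or> (\<forall>m\<in>spt A B. dot p2 m = -1 \<longrightarrow> dot p1 m < int (k - 1))")
      case True
      then show ?thesis
      proof
        assume "\<forall>m\<in>spt A B. dot p1 m = -1 \<longrightarrow> dot p2 m < int (n - 1)"
        then show ?thesis using less.hyps[of "n - 1" k, OF _ r] \<open>n > 0\<close> k by simp
      next
        assume "\<forall>m\<in>spt A B. dot p2 m = -1 \<longrightarrow> dot p1 m < int (k - 1)"
        then show ?thesis using less.hyps[of n "k - 1", OF _ r] \<open>k > 0\<close> n by simp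
      qed
    next
      case False
      define n' where "n' = int n - 1"
      define k' where "k' = int k - 1"
      have max1: "dot p2 m \<le> n'" if "m \<in> spt A B" "dot p1 m = -1" for m
        using n[OF that] by (simp add: n'_def)
      have max2: "dot p1 m \<le> k'" if "m \<in> spt A B" "dot p2 m = -1" for m
        using k[OF that] by (simp add: k'_def)
      have "int (n - 1) = n'" "int (k - 1) = k'" using \<open>n > 0\<close> \<open>k > 0\<close> by (simp_all add: n'_def k'_def)
      with False max1 max2 obtain m0 m1 where m0: "m0 \<in> spt A B" "dot p1 m0 = -1" "dot p2 m0 = n'"
        and m1: "m1 \<in> spt A B" "dot p2 m1 = -1" "dot p1 m1 = k'" by force
      have nk0: "n' \<ge> 0" "k' \<ge> 0" using \<open>n > 0\<close> \<open>k > 0\<close> by (simp_all add: n'_def k'_def)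
      consider "n' = 0" | "k' = 0" | "n' = 1" "k' = 1" | "k' \<ge> 1" "n' \<ge> k'" "n' * k' > 1"
        | "n' \<ge> 1" "k' \<ge> n'" "k' * n' > 1"
      proof -
        have "n' * k' > 1" if "n' \<ge> 1" "k' \<ge> 1" "\<not> (n' = 1 \<and> k' = 1)"
        proof (cases "n' = 1")
          case False
          then have "2 * 1 \<le> n' * k'" using that by (intro mult_mono) auto
          then show ?thesis by simp
        qed (use that in auto)
        then show ?thesis using that nk0 by (metis int_one_le_iff_zero_less le_less linear mult.commute)
      qed
      then show ?thesis
      proof cases
        case 1
        then show ?thesis using reduce_flat[OF r b m0(1,2)] m0(3) max1 by simp
      next
        case 2
        then show ?thesis
          using sw.reduce_flat[OF rs[OF r(1)] r(2,3) b(2,1), of m1] m1 max2 by (simp add: swp)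
      next
        case 3
        have "\<exists>d' A' B'. repr d' A' B' \<and> derivation_on S d' \<and> int_semisimple S d' \<and>
            (diagonalizable S d' \<longrightarrow> diagonalizable S d) \<and>
            (\<forall>m\<in>spt A' B'. dot p1 m = -1 \<longrightarrow> dot p2 m \<le> 0) \<and>
            (\<forall>m\<in>spt A' B'. dot p2 m = -1 \<longrightarrow> dot p1 m \<le> 1)"
          by (rule reduce_square[OF r b m0[unfolded 3] m1[unfolded 3] max1[unfolded 3] max2[unfolded 3]])
        then obtain d' A' B' where d': "repr d' A' B'" "derivation_on S d'" "int_semisimple S d'"
          "diagonalizable S d' \<longrightarrow> diagonalizable S d"
          "\<forall>m\<in>spt A' B'. dot p1 m = -1 \<longrightarrow> dot p2 m \<le> 0"
          "\<forall>m\<in>spt A' B'. dot p2 m = -1 \<longrightarrow> dot p1 m \<le> 1"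
          by blast
        have "int n = 2" "int k = 2" using 3 by (simp_all add: n'_def k'_def)
        then have "diagonalizable S d'"
          using less.hyps[of "n - 1" k, OF _ d'(1-3)] d'(5,6) by force
        then show ?thesis using d'(4) by blast
      next
        case 4
        have "\<exists>d' A' B'. repr d' A' B' \<and> derivation_on S d' \<and> int_semisimple S d' \<and>
            (diagonalizable S d' \<longrightarrow> diagonalizable S d) \<and>
            (\<forall>m\<in>spt A' B'. dot p1 m = -1 \<longrightarrow> dot p2 m \<le> n' - 1) \<and>
            (\<forall>m\<in>spt A' B'. dot p2 m = -1 \<longrightarrow> dot p1 m \<le> k')"
          by (rule reduce_edge[OF r b m0 m1 max1 max2 4])
        then obtain d' A' B' where d': "repr d' A' B'" "derivation_on S d'" "int_semisimple S d'"
          "diagonalizable S d' \<longrightarrow> diagonalizable S d"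
          "\<forall>m\<in>spt A' B'. dot p1 m = -1 \<longrightarrow> dot p2 m \<le> n' - 1"
          "\<forall>m\<in>spt A' B'. dot p2 m = -1 \<longrightarrow> dot p1 m \<le> k'"
          by blast
        have "int (n - 1) = n'" "int k = k' + 1" using \<open>n > 0\<close> by (simp_all add: n'_def k'_def)
        then have "diagonalizable S d'"
          using less.hyps[of "n - 1" k, OF _ d'(1-3)] d'(5,6) \<open>n > 0\<close> by force
        then show ?thesis using d'(4) by blast
      next
        case 5
        have s0: "m0 \<in> spt B A" and s1: "m1 \<in> spt B A" using m0(1) m1(1) by (simp_all only: swp)
        have s2: "dot p1 m \<le> k'" if "m \<in> spt B A" "dot p2 m = -1" for m
          using max2 that unfolding swp[of m B A] by blast
        have s3: "dot p2 m \<le> n'" if "m \<in> spt B A" "dot p1 m = -1" for m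
          using max1 that unfolding swp[of m B A] by blast
        have "\<exists>d' A' B'. sw.repr d' A' B' \<and> derivation_on S d' \<and> int_semisimple S d' \<and>
            (diagonalizable S d' \<longrightarrow> diagonalizable S d) \<and>
            (\<forall>m\<in>spt A' B'. dot p2 m = -1 \<longrightarrow> dot p1 m \<le> k' - 1) \<and>
            (\<forall>m\<in>spt A' B'. dot p1 m = -1 \<longrightarrow> dot p2 m \<le> n')"
          by (rule sw.reduce_edge[OF rs[OF r(1)] r(2,3) b(2,1) s1 m1(2,3) s0 m0(2,3) s2 s3 5])
        then obtain d' A' B' where d': "sw.repr d' A' B'" "derivation_on S d'" "int_semisimple S d'"
          "diagonalizable S d' \<longrightarrow> diagonalizable S d"
          "\<forall>m\<in>spt A' B'. dot p2 m = -1 \<longrightarrow> dot p1 m \<le> k' - 1"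
          "\<forall>m\<in>spt A' B'. dot p1 m = -1 \<longrightarrow> dot p2 m \<le> n'"
          by blast
        have r': "repr d' B' A'" using sw.repr_swap[OF d'(1)] .
        have "int n = n' + 1" "int (k - 1) = k'" using \<open>k > 0\<close> by (simp_all add: n'_def k'_def)
        then have "diagonalizable S d'"
          using less.hyps[of n "k - 1", OF _ r' d'(2,3)] d'(5,6) \<open>k > 0\<close> swp[of _ A' B'] by force
        then show ?thesis using d'(4) by blast
      qed
    qed
  qed
qed

theorem semisimple_diagonalizable:
  assumes d: "derivation_on S d" "int_semisimple S d"
  shows "diagonalizable S d"
proof -
  obtain A B where r: "repr d A B" using derivation_repr[OF d(1)] by blast
  show ?thesis
  proof (cases "b1 \<and> b2")
    case True
    define n where "n = nat (1 + (\<Sum>m\<in>spt A B. \<bar>dot p1 m\<bar> + \<bar>dot p2 m\<bar>))"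
    have fin: "finite (spt A B)" by (simp add: spt_def)
    have "\<bar>dot p1 m\<bar> + \<bar>dot p2 m\<bar> < int n" if "m \<in> spt A B" for m
    proof -
      have "\<bar>dot p1 m\<bar> + \<bar>dot p2 m\<bar> \<le> (\<Sum>m\<in>spt A B. \<bar>dot p1 m\<bar> + \<bar>dot p2 m\<bar>)"
        by (rule member_le_sum[OF that]) (use fin in auto)
      then show ?thesis by (simp add: n_def)
    qed
    then show ?thesis using True by (intro two_sided[OF r d, of n n]) force+
  next
    case False
    then show ?thesis
    proof (cases b2)
      case True
      then have "\<not> b1" using False by simp
      then show ?thesis using plane_cone.one_sided[OF swap repr_swap[OF r] d] by blast
    next
      case False
      then show ?thesis using one_sided[OF r d] by blast
    qed
  qed
qed

end

section \<open>Saturated plane semigroups are cones\<close>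

definition det2 :: "lattice \<Rightarrow> lattice \<Rightarrow> int" where
  "det2 a b = fst a * snd b - snd a * fst b"

definition perp :: "lattice \<Rightarrow> lattice" where
  "perp a = (- snd a, fst a)"

lemma det2_perp: "dot (perp a) b = det2 a b"
  by (simp add: perp_def det2_def dot_def)

text \<open>
  Cramer's rule for \<open>u\<close> in terms of \<open>h\<close> and \<open>g\<close>, without denominators.
\<close>

lemma plane_identity: "smul (det2 h g) u = smul (det2 u g) h + smul (det2 h u) g"
  by (simp add: smul_def det2_def prod_eq_iff algebra_simps)

lemma det2_anti: "det2 a b = - det2 b a"
  by (simp add: det2_def)

lemma primitive_multiple:
  assumes "p \<noteq> 0"
  obtains k p' where "k > 0" "p = smul k p'" "\<exists>e. dot p' e = 1"
proof -
  define k where "k = gcd (fst p) (snd p)"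
  define p' where "p' = (fst p div k, snd p div k)"
  have ne: "fst p \<noteq> 0 \<or> snd p \<noteq> 0" using assms by (auto simp: prod_eq_iff)
  then have "k > 0" by (simp add: k_def gcd_pos_int)
  moreover have "p = smul k p'" by (simp add: p'_def smul_def k_def prod_eq_iff)
  moreover have "coprime (fst p') (snd p')"
    using ne unfolding p'_def k_def by (simp add: div_gcd_coprime)
  then obtain s t where "s * fst p' + t * snd p' = 1"
    by (metis bezout_int coprime_imp_gcd_eq_1)
  then have "dot p' (s, t) = 1" by (simp add: dot_def mult.commute)
  ultimately show ?thesis using that by blast
qed

text \<open>
  The vectors in an open half plane are linearly preordered by their angle.
\<close>

lemma extreme_vector:
  assumes "finite G" "G \<noteq> {}" "\<And>g. g \<in> G \<Longrightarrow> det2 u g > 0"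
  shows "\<exists>g0\<in>G. \<forall>g\<in>G. det2 g0 g \<ge> 0"
  using assms
proof (induction G rule: finite_ne_induct)
  case (singleton x)
  then show ?case by (simp add: det2_def)
next
  case (insert x F)
  then obtain g0 where g0: "g0 \<in> F" "\<And>g. g \<in> F \<Longrightarrow> det2 g0 g \<ge> 0" by blast
  have pos: "det2 u x > 0" "det2 u g0 > 0" using insert.prems g0(1) by auto
  show ?case
  proof (cases "det2 g0 x \<ge> 0")
    case True
    then show ?thesis using g0 by auto
  next
    case False
    have "det2 x g \<ge> 0" if g: "g \<in> F" for g
    proof -
      have "det2 u g > 0" using insert.prems g by auto
      have "det2 u g0 * det2 x g = det2 u g * det2 x g0 + det2 u x * det2 g0 g"
        by (simp add: det2_def algebra_simps)
      also have "det2 x g0 \<ge> 0" using False det2_anti[of x g0] by simp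
      then have "det2 u g * det2 x g0 + det2 u x * det2 g0 g \<ge> 0"
        using g0(2)[OF g] pos \<open>det2 u g > 0\<close> by (intro add_nonneg_nonneg mult_nonneg_nonneg) auto
      finally show ?thesis using pos(2) by (simp add: zero_le_mult_iff)
    qed
    then show ?thesis by (intro bexI[of _ x]) (auto simp: det2_def)
  qed
qed

lemma dot_eq_0_if_generating:
  assumes group: "\<And>w. \<exists>t\<in>S. w + t \<in> S" and z: "\<And>u. u \<in> S \<Longrightarrow> dot p u = 0"
  shows "p = 0"
proof -
  have "dot p w = 0" for w
  proof -
    obtain t where "t \<in> S" "w + t \<in> S" using group by blast
    then show ?thesis using z[of t] z[of "w + t"] by simp
  qed
  from this[of "(1, 0)"] this[of "(0, 1)"] show ?thesis by (simp add: dot_def prod_eq_iff)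
qed

text \<open>
  The finite set \<open>G\<close> replaces generators of \<open>S\<close>: it is enough that \<open>G\<close> and \<open>S\<close> have the same dual
  cone.
\<close>

locale saturated_semigroup =
  fixes S G :: "lattice set"
  assumes zero: "0 \<in> S" and add: "\<And>u w. u \<in> S \<Longrightarrow> w \<in> S \<Longrightarrow> u + w \<in> S"
    and sat: "\<And>k u. k > 0 \<Longrightarrow> smul k u \<in> S \<Longrightarrow> u \<in> S"
    and group: "\<And>w. \<exists>t\<in>S. w + t \<in> S"
    and G: "finite G" "G \<subseteq> S" "\<And>p. \<forall>g\<in>G. dot p g \<ge> 0 \<Longrightarrow> \<forall>u\<in>S. dot p u \<ge> 0"
begin

lemma smul_S: assumes "u \<in> S" "k \<ge> 0" shows "smul k u \<in> S"
  using assms(2)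
proof (induction k rule: int_ge_induct)
  case (step i)
  then show ?case using add[of "smul i u" u] assms(1) by (simp add: smul_add)
qed (use zero in simp)

lemma dot_S_eq_0: "(\<And>u. u \<in> S \<Longrightarrow> dot p u = 0) \<Longrightarrow> p = 0"
  by (rule dot_eq_0_if_generating[OF group])

text \<open>
  Choose \<open>u \<notin> S\<close>. If \<open>G\<close> has elements to the left of \<open>u\<close>, the one closest to the direction of \<open>u\<close> spans a
  supporting line: an element \<open>h\<close> of \<open>G\<close> on its other side would make a positive multiple of \<open>u\<close> a
  nonnegative combination of elements of \<open>G\<close>, and \<open>u\<close> would be in \<open>S\<close> by saturation.
\<close>

lemma supporting_functional:
  assumes "S \<noteq> UNIV"
  obtains p where "p \<noteq> 0" "\<forall>g\<in>G. dot p g \<ge> 0"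
proof -
  obtain u where u: "u \<notin> S" using assms by blast
  then have u0: "u \<noteq> 0" using zero by auto
  have uu: "dot u u > 0"
    using u0 by (auto simp: dot_def prod_eq_iff sum_power2_gt_zero_iff simp flip: power2_eq_square)
  define G1 where "G1 = {g \<in> G. det2 u g > 0}"
  show ?thesis
  proof (cases "G1 = {}")
    case True
    then have "\<forall>g\<in>G. dot (- perp u) g \<ge> 0" by (auto simp: G1_def det2_perp not_less)
    moreover have "- perp u \<noteq> 0" using u0 by (auto simp: perp_def prod_eq_iff)
    ultimately show ?thesis using that by blast
  next
    case False
    have "finite G1" "\<And>g. g \<in> G1 \<Longrightarrow> det2 u g > 0" using G(1) by (simp_all add: G1_def)
    then obtain g0 where g0: "g0 \<in> G1" "\<And>g. g \<in> G1 \<Longrightarrow> det2 g0 g \<ge> 0"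
      using extreme_vector[OF _ False] by blast
    have g0': "g0 \<in> G" "det2 u g0 > 0" using g0(1) by (auto simp: G1_def)
    have "det2 g0 h \<ge> 0" if h: "h \<in> G" for h
    proof (cases "det2 u h" "0 :: int" rule: linorder_cases)
      case greater
      then show ?thesis using g0(2) h by (simp add: G1_def)
    next
      case less
      show ?thesis
      proof (rule ccontr)
        assume "\<not> det2 g0 h \<ge> 0"
        then have pos: "det2 h g0 > 0" using det2_anti[of h g0] by simp
        have "smul (det2 u g0) h + smul (det2 h u) g0 \<in> S"
          using less g0' h G(2) det2_anti[of h u] by (intro add smul_S) auto
        then show False using sat[OF pos] u plane_identity[of h g0 u] by simp
      qed
    next
      case equal
      have par: "smul (dot u u) h = smul (dot u h) u"
        using equal by (simp add: smul_def dot_def det2_def prod_eq_iff algebra_simps)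
      have "dot u h \<le> 0"
      proof (rule ccontr)
        assume pos: "\<not> dot u h \<le> 0"
        have "smul (dot u u) h \<in> S" using h G(2) uu by (intro smul_S) auto
        then show False using sat[of "dot u h" u] pos u par by simp
      qed
      moreover have "det2 g0 u < 0" using g0' det2_anti[of g0 u] by simp
      moreover have "dot u u * det2 g0 h = dot u h * det2 g0 u"
        using arg_cong[OF par, of "dot (perp g0)"] by (simp add: det2_perp)
      ultimately have "dot u u * det2 g0 h \<ge> 0" by (simp add: mult_nonpos_nonpos)
      then show ?thesis using uu by (simp add: zero_le_mult_iff)
    qed
    then have "\<forall>h\<in>G. dot (perp g0) h \<ge> 0" by (simp add: det2_perp)
    moreover have "perp g0 \<noteq> 0" using g0'(2) by (auto simp: perp_def prod_eq_iff det2_def)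
    ultimately show ?thesis using that by blast
  qed
qed

lemma kernel_multiple:
  assumes "dot w e = 1" "dot w u = 0" shows "u = smul (det2 e u) (perp w)"
proof -
  have a: "fst w * fst u = - (snd w * snd u)" using assms(2) by (simp add: dot_def)
  have "fst u * (fst w * fst e + snd w * snd e) = (fst w * fst u) * fst e + fst u * snd w * snd e"
    by (simp add: algebra_simps)
  then have "fst u * (fst w * fst e + snd w * snd e) = - ((fst e * snd u - snd e * fst u) * snd w)"
    unfolding a by (simp add: algebra_simps)
  moreover have "(fst e * snd u - snd e * fst u) * fst w = fst e * snd u * fst w - snd e * (fst w * fst u)"
    by (simp add: algebra_simps)
  then have "snd u * (fst w * fst e + snd w * snd e) = (fst e * snd u - snd e * fst u) * fst w"
    unfolding a by (simp add: algebra_simps)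
  ultimately show ?thesis using assms(1) by (simp add: dot_def smul_def perp_def det2_def prod_eq_iff)
qed

text \<open>
  On the line \<open>dot w u = 0\<close> the semigroup meets only the ray of \<open>v0\<close>, so a small tilt of \<open>w\<close> gives a
  functional \<open>q\<close> that is positive on the nonzero elements of \<open>G\<close>. In this half plane \<open>G\<close> has a first and a last
  element \<open>g1\<close> and \<open>g2\<close> with respect to the angle. By Cramer's rule and saturation, \<open>S\<close> is the whole
  cone between them.
\<close>

lemma pointed_case:
  assumes w: "dot w e = 1" "\<And>u. u \<in> S \<Longrightarrow> dot w u \<ge> 0" and v0: "v0 = perp w \<or> v0 = - perp w" "- v0 \<notin> S"
  shows "\<exists>p1 p2. plane_cone S p1 p2 True True"
proof -
  have v0': "v0 \<noteq> 0" "dot w v0 = 0" using v0(1) w(1) by (auto simp: perp_def dot_def prod_eq_iff)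
  have vv: "dot v0 v0 > 0"
    using v0'(1) by (auto simp: dot_def prod_eq_iff sum_power2_gt_zero_iff simp flip: power2_eq_square)
  have ker: "\<exists>t > 0. u = smul t v0" if u: "u \<in> S" "u \<noteq> 0" "dot w u = 0" for u
  proof -
    obtain t where t: "u = smul t v0"
    proof (cases "v0 = perp w")
      case True
      then show ?thesis using kernel_multiple[OF w(1) u(3)] that by blast
    next
      case False
      then have "v0 = - perp w" using v0(1) by blast
      then have "u = smul (- det2 e u) v0"
        using kernel_multiple[OF w(1) u(3)] by (simp add: smul_def prod_eq_iff)
      then show ?thesis using that by blast
    qed
    have "t > 0"
    proof (rule ccontr)
      assume "\<not> t > 0"
      moreover have "t \<noteq> 0" using t u(2) by auto
      ultimately have "- t > 0" by simp
      moreover have "smul (- t) (- v0) \<in> S" using u(1) t by (simp add: smul_def)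
      ultimately show False using sat v0(2) by blast
    qed
    then show ?thesis using t by blast
  qed
  define K where "K = 1 + (\<Sum>g\<in>G. \<bar>dot v0 g\<bar>)"
  define q where "q = smul K w + v0"
  define c where "c = (snd q, - fst q)"
  define G' where "G' = G - {0}"
  have qc: "dot q g = det2 c g" for g by (simp add: c_def det2_def dot_def)
  have qpos: "det2 c g > 0" if g: "g \<in> G'" for g
  proof -
    have gS: "g \<in> S" "g \<in> G" "g \<noteq> 0" using g G(2) by (auto simp: G'_def)
    have "dot q g > 0"
    proof (cases "dot w g = 0")
      case True
      then obtain t where "t > 0" "g = smul t v0" using ker gS by blast
      then show ?thesis using vv v0' by (simp add: q_def)
    next
      case False
      then have "dot w g \<ge> 1" using w(2)[OF gS(1)] by simp
      moreover have Kg: "\<bar>dot v0 g\<bar> < K"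
        using member_le_sum[OF gS(2), of "\<lambda>g. \<bar>dot v0 g\<bar>"] G(1) by (simp add: K_def)
      ultimately have "K * 1 \<le> K * dot w g" by (intro mult_left_mono) auto
      then show ?thesis using Kg by (simp add: q_def)
    qed
    then show ?thesis by (simp add: qc)
  qed
  have G'fin: "finite G'" using G(1) by (simp add: G'_def)
  have G'ne: "G' \<noteq> {}"
  proof
    assume "G' = {}"
    then have "\<forall>g\<in>G. dot p g = 0" for p by (auto simp: G'_def)
    then have "\<forall>g\<in>G. dot p g \<ge> 0" for p by simp
    then have pos: "\<forall>u\<in>S. dot p u \<ge> 0" for p using G(3) by blast
    have "dot w u = 0" if "u \<in> S" for u using pos[of w] pos[of "- w"] that by fastforce
    then have "w = 0" by (rule dot_S_eq_0)
    then show False using w(1) by (simp add: dot_def)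
  qed
  obtain g1 where g1: "g1 \<in> G'" "\<And>g. g \<in> G' \<Longrightarrow> det2 g1 g \<ge> 0"
    using extreme_vector[OF G'fin G'ne qpos] by blast
  \<comment> \<open>A reflection, which reverses the order by angle.\<close>
  define m where "m = (\<lambda>u :: lattice. (snd u, fst u))"
  have m: "det2 (m a) (m b) = det2 b a" for a b by (simp add: m_def det2_def algebra_simps)
  have "det2 (m (- c)) h > 0" if "h \<in> m ` G'" for h
  proof -
    obtain g where g: "g \<in> G'" "h = m g" using \<open>h \<in> m ` G'\<close> by blast
    have "det2 g (- c) = det2 c g" by (simp add: det2_def)
    then show ?thesis using qpos[OF g(1)] by (simp add: g(2) m)
  qed
  then have "\<exists>h\<in>m ` G'. \<forall>h'\<in>m ` G'. det2 h h' \<ge> 0"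
    by (intro extreme_vector[of "m ` G'" "m (- c)"]) (use G'fin G'ne in simp_all)
  then obtain h where h: "h \<in> m ` G'" "\<And>h'. h' \<in> m ` G' \<Longrightarrow> det2 h h' \<ge> 0" by blast
  then obtain g2 where "g2 \<in> G'" "h = m g2" by blast
  with h(2) have g2: "g2 \<in> G'" "\<And>g. g \<in> G' \<Longrightarrow> det2 g g2 \<ge> 0"
    by (simp, metis imageI m)
  have gS: "g1 \<in> S" "g2 \<in> S" using g1(1) g2(1) G(2) by (auto simp: G'_def)
  have S1: "det2 g1 u \<ge> 0" and S2: "det2 u g2 \<ge> 0" if u: "u \<in> S" for u
  proof -
    have "\<forall>g\<in>G. dot (perp g1) g \<ge> 0"
      using g1(2) by (metis DiffI G'_def det2_perp dot_simps(4) order_refl singletonD)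
    then have "\<forall>u\<in>S. dot (perp g1) u \<ge> 0" by (rule G(3))
    then show "det2 g1 u \<ge> 0" using u by (simp add: det2_perp)
    have "\<forall>g\<in>G. dot (- perp g2) g \<ge> 0"
    proof
      fix g assume "g \<in> G"
      then show "dot (- perp g2) g \<ge> 0"
        using g2(2)[of g] det2_anti[of g g2] by (cases "g = 0") (auto simp: G'_def det2_perp)
    qed
    then have "dot (- perp g2) u \<ge> 0" using G(3) u by blast
    then show "det2 u g2 \<ge> 0" using det2_anti[of u g2] by (simp add: det2_perp)
  qed
  have pos12: "det2 g1 g2 > 0"
  proof (rule ccontr)
    assume "\<not> det2 g1 g2 > 0"
    then have z: "det2 g1 g2 = 0" using S1[OF gS(2)] by simp
    have "det2 g1 u = 0" if u: "u \<in> S" for u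
    proof -
      have "det2 c g2 * det2 u g1 = det2 c g1 * det2 u g2 + det2 g1 g2 * det2 u c"
        by (simp add: det2_def algebra_simps)
      also have "\<dots> \<ge> 0" using z S2[OF u] qpos[OF g1(1)] by simp
      finally have "det2 u g1 \<ge> 0" using qpos[OF g2(1)] by (simp add: zero_le_mult_iff)
      then show ?thesis using S1[OF u] det2_anti[of u g1] by simp
    qed
    then have "perp g1 = 0" by (intro dot_S_eq_0) (simp add: det2_perp)
    then have "g1 = 0" by (simp add: perp_def prod_eq_iff)
    then show False using g1(1) by (simp add: G'_def)
  qed
  have S_eq: "u \<in> S \<longleftrightarrow> det2 g1 u \<ge> 0 \<and> det2 u g2 \<ge> 0" for u
  proof
    assume "det2 g1 u \<ge> 0 \<and> det2 u g2 \<ge> 0"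
    then have "smul (det2 u g2) g1 + smul (det2 g1 u) g2 \<in> S" using gS by (intro add smul_S) auto
    then show "u \<in> S" using sat[OF pos12] by (simp add: plane_identity[of g1 g2 u])
  qed (use S1 S2 in blast)
  have "perp g1 \<noteq> 0" "- perp g2 \<noteq> 0"
    using g1(1) g2(1) by (auto simp: G'_def perp_def prod_eq_iff)
  then obtain k1 q1 k2 q2 where q1: "k1 > 0" "perp g1 = smul k1 q1" "\<exists>e. dot q1 e = 1"
    and q2: "k2 > 0" "- perp g2 = smul k2 q2" "\<exists>e. dot q2 e = 1"
    using primitive_multiple by metis
  have d1: "det2 g1 u = k1 * dot q1 u" for u using q1(2) det2_perp[of g1 u] by simp
  have d2: "det2 u g2 = k2 * dot q2 u" for u
  proof -
    have "det2 u g2 = dot (- perp g2) u" using det2_anti[of u g2] by (simp add: det2_perp)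
    then show ?thesis unfolding q2(2) by simp
  qed
  have "plane_cone S q1 q2 True True"
  proof
    show "S = {u. (True \<longrightarrow> dot q1 u \<ge> 0) \<and> (True \<longrightarrow> dot q2 u \<ge> 0)}"
      using S_eq q1(1) q2(1) by (auto simp: d1 d2 zero_le_mult_iff)
    show "fst q1 * snd q2 - snd q1 * fst q2 \<noteq> 0"
    proof
      assume z: "fst q1 * snd q2 - snd q1 * fst q2 = 0"
      have "det2 g1 g2 = - (fst (perp g1) * snd (- perp g2) - snd (perp g1) * fst (- perp g2))"
        by (simp add: det2_def perp_def algebra_simps)
      also have "\<dots> = - (k1 * k2 * (fst q1 * snd q2 - snd q1 * fst q2))"
        unfolding q1(2) q2(2) by (simp add: smul_def algebra_simps)
      finally show False using z pos12 by simp
    qed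
  qed (use q1 q2 in auto)
  then show ?thesis by blast
qed

text \<open>
  If \<open>S\<close> is not the whole lattice, it lies in a half plane \<open>dot w u \<ge> 0\<close>. Either \<open>S\<close> contains the bounding
  line, and then it is the half plane by saturation, or it omits one direction of this line and is
  pointed.
\<close>

theorem is_plane_cone: "\<exists>p1 p2 b1 b2. plane_cone S p1 p2 b1 b2"
proof (cases "S = UNIV")
  case True
  have "plane_cone S (1, 0) (0, 1) False False"
    by unfold_locales (auto simp: True dot_def intro: exI[of _ 1])
  then show ?thesis by blast
next
  case False
  then obtain p where p: "p \<noteq> 0" "\<forall>g\<in>G. dot p g \<ge> 0" by (rule supporting_functional)
  obtain k w where w: "k > 0" "p = smul k w" "\<exists>e. dot w e = 1" by (rule primitive_multiple[OF p(1)])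
  obtain e where e: "dot w e = 1" using w(3) by blast
  have wS: "dot w u \<ge> 0" if "u \<in> S" for u
    using G(3)[OF p(2)] that w(1,2) by (auto simp: zero_le_mult_iff)
  show ?thesis
  proof (cases "perp w \<in> S \<and> - perp w \<in> S")
    case True
    obtain s where s: "s \<in> S" "dot w s > 0"
    proof -
      obtain t where "t \<in> S" "e + t \<in> S" using group by blast
      then show ?thesis using that[of "e + t"] wS[of t] e by simp
    qed
    have "u \<in> S" if u: "dot w u \<ge> 0" for u
    proof -
      define r where "r = smul (dot w s) u - smul (dot w u) s"
      have "r = smul (det2 e r) (perp w)" by (rule kernel_multiple[OF e]) (simp add: r_def)
      moreover have "smul t (perp w) \<in> S" for t
      proof (cases "t \<ge> 0")
        case False
        then have "smul (- t) (- perp w) \<in> S" using True by (intro smul_S) auto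
        then show ?thesis by (simp add: smul_def)
      qed (use True smul_S in auto)
      ultimately have "r \<in> S" by metis
      then have "smul (dot w u) s + r \<in> S" using s u by (intro add smul_S) auto
      then show ?thesis using sat[OF s(2)] by (simp add: r_def)
    qed
    then have S_eq: "S = {u. dot w u \<ge> 0}" using wS by blast
    have "w \<noteq> 0" using e by (auto simp: dot_def)
    then have ww: "fst w * fst w + snd w * snd w > 0"
      by (auto simp: prod_eq_iff sum_power2_gt_zero_iff simp flip: power2_eq_square)
    have "plane_cone S w (perp w) True False"
    proof
      show "S = {u. (True \<longrightarrow> dot w u \<ge> 0) \<and> (False \<longrightarrow> dot (perp w) u \<ge> 0)}" using S_eq by simp
      show "\<exists>e. dot w e = 1" by (rule w(3))
      show "\<exists>e. dot (perp w) e = 1"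
        using e by (intro exI[of _ "perp e"]) (simp add: perp_def dot_def)
      have "fst w * snd (perp w) - snd w * fst (perp w) = fst w * fst w + snd w * snd w"
        by (simp add: perp_def)
      then show "fst w * snd (perp w) - snd w * fst (perp w) \<noteq> 0" using ww by linarith
    qed
    then show ?thesis by blast
  next
    case False
    then consider "- perp w \<notin> S" | "- (- perp w) \<notin> S" by auto
    then show ?thesis
    proof cases
      case 1
      show ?thesis using pointed_case[OF e wS _ 1] by blast
    next
      case 2
      show ?thesis using pointed_case[OF e wS _ 2] by blast
    qed
  qed
qed

end

section \<open>Laurent polynomials as functions on the torus\<close>

abbreviation torus :: "(complex \<times> complex) set" where
  "torus \<equiv> (UNIV - {0}) \<times> (UNIV - {0})"

text \<open>
  The character \<open>chi u\<close> as a function on the torus.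
\<close>

definition cpow :: "lattice \<Rightarrow> complex \<times> complex \<Rightarrow> complex" where
  "cpow u z = fst z powi fst u * snd z powi snd u"

lemma cpow_add: "z \<in> torus \<Longrightarrow> cpow (u + v) z = cpow u z * cpow v z"
  by (simp add: cpow_def power_int_add mem_Times_iff mult_ac)

lemma cpow_mult: "cpow u (fst z * fst w, snd z * snd w) = cpow u z * cpow u w"
  by (simp add: cpow_def power_int_mult_distrib)

lemma cpow_0 [simp]: "cpow 0 z = 1" and cpow_one [simp]: "cpow u (1, 1) = 1"
  by (simp_all add: cpow_def)

lemma cpow_nz: "z \<in> torus \<Longrightarrow> cpow u z \<noteq> 0"
  by (simp add: cpow_def mem_Times_iff)

lemma powi_conv_power:
  assumes "(t :: complex) \<noteq> 0" "k + int M \<ge> 0" shows "t ^ M * t powi k = t ^ nat (k + int M)"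
proof -
  have "t ^ nat (k + int M) = t powi (int M + k)" using assms(2) by (simp add: power_int_def add.commute)
  then show ?thesis using assms(1) by (simp add: power_int_add)
qed

lemma powi_sum_conv_poly:
  assumes "finite I"
  shows "\<exists>p M. (\<forall>t :: complex. t \<noteq> 0 \<longrightarrow> poly p t = t ^ M * (\<Sum>i\<in>I. c i * t powi h i)) \<and>
    (\<forall>j. coeff p j = (\<Sum>i\<in>I. if h i + int M = int j then c i else 0)) \<and> (\<forall>i\<in>I. h i + int M \<ge> 0)"
proof -
  define M where "M = nat (\<Sum>i\<in>I. \<bar>h i\<bar>)"
  have M: "h i + int M \<ge> 0" if "i \<in> I" for i
    using member_le_sum[OF that, of "\<lambda>i. \<bar>h i\<bar>"] assms by (simp add: M_def)
  define p where "p = (\<Sum>i\<in>I. monom (c i) (nat (h i + int M)))"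
  have "poly p t = t ^ M * (\<Sum>i\<in>I. c i * t powi h i)" if "t \<noteq> 0" for t
    using M that by (simp add: p_def poly_sum poly_monom sum_distrib_left powi_conv_power[symmetric] mult_ac)
  moreover have "coeff p j = (\<Sum>i\<in>I. if h i + int M = int j then c i else 0)" for j
    unfolding p_def coeff_sum by (rule sum.cong) (use M in \<open>force simp: nat_eq_iff\<close>)+
  ultimately show ?thesis using M by blast
qed

lemma powi_independent:
  assumes "finite I" "\<And>t :: complex. t \<noteq> 0 \<Longrightarrow> (\<Sum>i\<in>I. c i * t powi h i) = 0"
  shows "(\<Sum>i\<in>{i\<in>I. h i = k}. c i) = 0"
proof (cases "k \<in> h ` I")
  case True
  obtain p M where p: "\<And>t :: complex. t \<noteq> 0 \<Longrightarrow> poly p t = t ^ M * (\<Sum>i\<in>I. c i * t powi h i)"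
    "\<And>j. coeff p j = (\<Sum>i\<in>I. if h i + int M = int j then c i else 0)" "\<And>i. i \<in> I \<Longrightarrow> h i + int M \<ge> 0"
    using powi_sum_conv_poly[OF assms(1), of c h] by blast
  have "UNIV - {0 :: complex} \<subseteq> {t. poly p t = 0}" using p(1) assms(2) by auto
  moreover have "infinite (UNIV - {0 :: complex})" by (simp add: infinite_UNIV_char_0)
  ultimately have "p = 0" using poly_roots_finite[of p] finite_subset by blast
  moreover have "coeff p (nat (k + int M)) = (\<Sum>i\<in>{i\<in>I. h i = k}. c i)"
  proof -
    have "k + int M \<ge> 0" using True p(3) by auto
    then have "coeff p (nat (k + int M)) = (\<Sum>i\<in>I. if h i = k then c i else 0)"
      unfolding p(2) by (intro sum.cong) auto
    then show ?thesis using assms(1) by (simp add: sum.If_cases Int_def)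
  qed
  ultimately show ?thesis by simp
next
  case False
  then have "{i\<in>I. h i = k} = {}" by auto
  then show ?thesis by (simp only: sum.empty)
qed

text \<open>
  Independence of characters. The exponents are given by a function on an index set, which may repeat
  values; the two variables are treated one after the other.
\<close>

lemma cpow_independent:
  assumes "finite I" "\<And>z. z \<in> torus \<Longrightarrow> (\<Sum>i\<in>I. c i * cpow (w i) z) = 0"
  shows "(\<Sum>i\<in>{i\<in>I. w i = v}. c i) = 0"
proof -
  have 1: "(\<Sum>i\<in>{i\<in>I. fst (w i) = k}. c i * b powi snd (w i)) = 0" if "b \<noteq> 0" for b k
  proof (rule powi_independent[OF assms(1)])
    fix t :: complex assume "t \<noteq> 0"
    then show "(\<Sum>i\<in>I. c i * b powi snd (w i) * t powi fst (w i)) = 0"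
      using assms(2)[of "(t, b)"] that by (simp add: cpow_def mult_ac)
  qed
  have "(\<Sum>i\<in>{i\<in>{i\<in>I. fst (w i) = fst v}. snd (w i) = snd v}. c i) = 0"
    by (rule powi_independent) (use assms(1) 1 in auto)
  moreover have "{i\<in>{i\<in>I. fst (w i) = fst v}. snd (w i) = snd v} = {i\<in>I. w i = v}"
    by (auto simp: prod_eq_iff)
  ultimately show ?thesis by simp
qed

lemma cpow_independent_single:
  assumes "finite U" "\<And>z. z \<in> torus \<Longrightarrow> (\<Sum>u\<in>U. c u * cpow u z) = 0" "u \<in> U"
  shows "c u = 0"
proof -
  have "{i \<in> U. i = u} = {u}" using assms(3) by auto
  then show ?thesis using cpow_independent[OF assms(1,2), of u] by simp
qed

lemma regular_Gm_I:
  assumes "finite I"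
  shows "(\<lambda>t\<in>UNIV - {0}. \<Sum>i\<in>I. c i * t powi h i) \<in> regular Gm_variety"
proof -
  obtain p M where p: "\<And>t :: complex. t \<noteq> 0 \<Longrightarrow> poly p t = t ^ M * (\<Sum>i\<in>I. c i * t powi h i)"
    using powi_sum_conv_poly[OF assms, of c h] by blast
  have "(\<lambda>t\<in>UNIV - {0}. \<Sum>i\<in>I. c i * t powi h i) = (\<lambda>z\<in>UNIV - {0}. poly p z / z ^ M)"
    by (rule restrict_ext) (simp add: p)
  then show ?thesis by (auto simp: Gm_variety_def)
qed

lemma regular_Gm_E:
  assumes "F \<in> regular Gm_variety"
  shows "\<exists>(I :: nat set) c h. finite I \<and> (\<forall>t. t \<noteq> 0 \<longrightarrow> F t = (\<Sum>i\<in>I. c i * t powi h i))"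
proof -
  obtain p k where F: "F = (\<lambda>z\<in>UNIV - {0}. poly p z / z ^ k)"
    using assms by (auto simp: Gm_variety_def)
  have "F t = (\<Sum>i\<le>degree p. coeff p i * t powi (int i - int k))" if "t \<noteq> 0" for t
    using that by (simp add: F poly_altdef power_int_diff sum_divide_distrib)
  then show ?thesis by (intro exI[of _ "{..degree p}"] exI) auto
qed

lemma regular_Gm2_I:
  assumes "finite I"
  shows "(\<lambda>z\<in>torus. \<Sum>i\<in>I. c i * cpow (w i) z) \<in> regular (variety_prod Gm_variety Gm_variety)"
proof -
  obtain \<beta> where \<beta>: "bij_betw \<beta> {0..<card I} I" using ex_bij_betw_nat_finite[OF assms] by blast
  define f where "f j = (\<lambda>t\<in>UNIV - {0 :: complex}. c (\<beta> j) * t powi fst (w (\<beta> j)))" for j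
  define g where "g j = (\<lambda>t\<in>UNIV - {0 :: complex}. t powi snd (w (\<beta> j)))" for j
  have "f j \<in> regular Gm_variety" "g j \<in> regular Gm_variety" for j
    using regular_Gm_I[of "{()}" "\<lambda>_. c (\<beta> j)" "\<lambda>_. fst (w (\<beta> j))"]
      regular_Gm_I[of "{()}" "\<lambda>_. 1" "\<lambda>_. snd (w (\<beta> j))"] by (simp_all add: f_def g_def)
  moreover have "(\<Sum>i\<in>I. c i * cpow (w i) z) = (\<Sum>j<card I. f j (fst z) * g j (snd z))" if "z \<in> torus" for z
  proof -
    have "(\<Sum>i\<in>I. c i * cpow (w i) z) = (\<Sum>j\<in>{0..<card I}. c (\<beta> j) * cpow (w (\<beta> j)) z)"
      by (rule sum.reindex_bij_betw[OF \<beta>, symmetric])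
    then show ?thesis using that
      by (simp add: f_def g_def cpow_def mem_Times_iff mult_ac lessThan_atLeast0)
  qed
  then have "(\<lambda>z\<in>torus. \<Sum>i\<in>I. c i * cpow (w i) z) =
      (\<lambda>z\<in>torus. \<Sum>j<card I. f j (fst z) * g j (snd z))" by (intro restrict_ext) simp
  moreover have pts: "points Gm_variety = UNIV - {0}" by (simp add: Gm_variety_def)
  ultimately show ?thesis
    by (simp only: variety_prod_def pts variety.select_convs mem_Collect_eq) blast
qed

text \<open>
  The index set consists of a term of the tensor and a term of each of its two Laurent polynomials.
\<close>

lemma regular_Gm2_E:
  assumes "F \<in> regular (variety_prod Gm_variety Gm_variety)"
  shows "\<exists>(I :: (nat \<times> nat \<times> nat) set) c w. finite I \<and>
    (\<forall>z\<in>torus. F z = (\<Sum>i\<in>I. c i * cpow (w i) z))"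
proof -
  have pts: "points Gm_variety = UNIV - {0}" by (simp add: Gm_variety_def)
  obtain n f g where F: "F = (\<lambda>z\<in>torus. \<Sum>i<(n::nat). f i (fst z) * g i (snd z))"
    and fg: "\<And>i. i < n \<Longrightarrow> f i \<in> regular Gm_variety" "\<And>i. i < n \<Longrightarrow> g i \<in> regular Gm_variety"
    using assms unfolding variety_prod_def pts by auto
  define Q where "Q F y \<longleftrightarrow> finite (fst y :: nat set) \<and>
    (\<forall>t. t \<noteq> 0 \<longrightarrow> F t = (\<Sum>j\<in>fst y. fst (snd y) j * t powi snd (snd y) j))"
    for F :: "complex \<Rightarrow> complex" and y
  have Q: "\<exists>y. Q F y" if F: "F \<in> regular Gm_variety" for F
  proof -
    obtain I :: "nat set" and c h where "finite I" "\<And>t. t \<noteq> 0 \<Longrightarrow> F t = (\<Sum>i\<in>I. c i * t powi h i)"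
      using regular_Gm_E[OF F] by blast
    then have "Q F (I, c, h)" by (simp add: Q_def)
    then show ?thesis by blast
  qed
  have ex: "\<forall>i\<in>{..<n}. \<exists>y. Q (f i) y" "\<forall>i\<in>{..<n}. \<exists>y. Q (g i) y" using fg Q by blast+
  from bchoice[OF ex(1)] obtain Y where Y: "\<forall>i\<in>{..<n}. Q (f i) (Y i)" ..
  from bchoice[OF ex(2)] obtain Y' where Y': "\<forall>i\<in>{..<n}. Q (g i) (Y' i)" ..
  define I c h where "I i = fst (Y i)" and "c i = fst (snd (Y i))" and "h i = snd (snd (Y i))" for i
  define I' c' h' where "I' i = fst (Y' i)" and "c' i = fst (snd (Y' i))" and "h' i = snd (snd (Y' i))" for i
  have f: "finite (I i)" "t \<noteq> 0 \<Longrightarrow> f i t = (\<Sum>j\<in>I i. c i j * t powi h i j)" if "i < n" for i t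
    using Y that by (simp_all add: Q_def I_def c_def h_def)
  have g: "finite (I' i)" "t \<noteq> 0 \<Longrightarrow> g i t = (\<Sum>j\<in>I' i. c' i j * t powi h' i j)" if "i < n" for i t
    using Y' that by (simp_all add: Q_def I'_def c'_def h'_def)
  define J where "J = Sigma {..<n} (\<lambda>i. I i \<times> I' i)"
  have "F z = (\<Sum>(i, j, j')\<in>J. c i j * c' i j' * cpow (h i j, h' i j') z)" if z: "z \<in> torus" for z
  proof -
    have "F z = (\<Sum>i<n. (\<Sum>j\<in>I i. c i j * fst z powi h i j) * (\<Sum>j\<in>I' i. c' i j * snd z powi h' i j))"
      using z f g by (simp add: F mem_Times_iff)
    also have "\<dots> = (\<Sum>i<n. \<Sum>(j, j')\<in>I i \<times> I' i. c i j * c' i j' * cpow (h i j, h' i j') z)"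
    proof (rule sum.cong[OF refl])
      fix i
      have "(\<Sum>j\<in>I i. c i j * fst z powi h i j) * (\<Sum>j\<in>I' i. c' i j * snd z powi h' i j) =
          (\<Sum>j\<in>I i. \<Sum>j'\<in>I' i. c i j * c' i j' * cpow (h i j, h' i j') z)"
        unfolding sum_product by (intro sum.cong refl) (simp add: cpow_def)
      then show "(\<Sum>j\<in>I i. c i j * fst z powi h i j) * (\<Sum>j\<in>I' i. c' i j * snd z powi h' i j) =
          (\<Sum>(j, j')\<in>I i \<times> I' i. c i j * c' i j' * cpow (h i j, h' i j') z)"
        by (simp only: sum.cartesian_product)
    qed
    also have "\<dots> = (\<Sum>(i, j, j')\<in>J. c i j * c' i j' * cpow (h i j, h' i j') z)"
      unfolding J_def by (subst sum.Sigma) (use f(1) g(1) in auto)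
    finally show ?thesis .
  qed
  note F_eq = this
  define cc where "cc x = (case x of (i, j, j') \<Rightarrow> c i j * c' i j')" for x
  define ww where "ww x = (case x of (i, j, j') \<Rightarrow> (h i j, h' i j'))" for x
  have "\<forall>z\<in>torus. F z = (\<Sum>x\<in>J. cc x * cpow (ww x) z)"
    using F_eq by (simp add: cc_def ww_def split_def)
  moreover have "finite J" using f(1) g(1) by (auto simp: J_def)
  ultimately have "finite J \<and> (\<forall>z\<in>torus. F z = (\<Sum>x\<in>J. cc x * cpow (ww x) z))" by blast
  then show ?thesis by (rule_tac exI[of _ J], rule_tac exI[of _ cc], rule_tac exI[of _ ww])
qed

section \<open>Affine varieties\<close>

lemma mpoly_const: "Poly_Mapping.single 0 c \<in> mpolys n" "mpoly_eval (Poly_Mapping.single 0 c) a = c"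
  by (auto simp: mpolys_def mpoly_eval_def)

lemma mpoly_var: "i < n \<Longrightarrow> Poly_Mapping.single (Poly_Mapping.single i 1) 1 \<in> mpolys n"
  "mpoly_eval (Poly_Mapping.single (Poly_Mapping.single i 1) 1) a = a i"
  by (auto simp: mpolys_def mpoly_eval_def)

lemma restrict_plus: "(\<lambda>x\<in>X. (\<lambda>x\<in>X. f x) x + (\<lambda>x\<in>X. g x) x) = (\<lambda>x\<in>X. f x + g x)"
  and restrict_times: "(\<lambda>x\<in>X. (\<lambda>x\<in>X. f x) x * (\<lambda>x\<in>X. g x) x) = (\<lambda>x\<in>X. f x * g x)"
  and restrict_times_right: "(\<lambda>x\<in>X. h x * (\<lambda>x\<in>X. g x) x) = (\<lambda>x\<in>X. h x * g x)"
  and restrict_times_left: "(\<lambda>x\<in>X. (\<lambda>x\<in>X. g x) x * h x) = (\<lambda>x\<in>X. g x * h x)"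
  by (rule restrict_ext, simp)+

lemma coordinate_in:
  assumes "i < n"
  shows "(\<lambda>x\<in>X. f i x) \<in> {\<lambda>x\<in>X. mpoly_eval p (\<lambda>i. f i x) | p. p \<in> mpolys n}"
proof -
  have "(\<lambda>x\<in>X. f i x) =
      (\<lambda>x\<in>X. mpoly_eval (Poly_Mapping.single (Poly_Mapping.single i 1) 1) (\<lambda>i. f i x))"
    by (simp only: mpoly_var(2))
  then show ?thesis using mpoly_var(1)[OF assms] by blast
qed

locale variety_algebra =
  fixes V :: "'a variety"
  assumes aff: "affine_variety V" and dom: "domain (coordinate_ring V)"
begin

abbreviation X where "X \<equiv> points V"
abbreviation reg where "reg \<equiv> regular V"

lemma cr [simp]:
  "carrier (coordinate_ring V) = reg" "f \<otimes>\<^bsub>coordinate_ring V\<^esub> g = (\<lambda>x\<in>X. f x * g x)"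
  "f \<oplus>\<^bsub>coordinate_ring V\<^esub> g = (\<lambda>x\<in>X. f x + g x)" "\<one>\<^bsub>coordinate_ring V\<^esub> = (\<lambda>x\<in>X. 1)"
  "\<zero>\<^bsub>coordinate_ring V\<^esub> = (\<lambda>x\<in>X. 0)"
  by (simp_all add: coordinate_ring_def)

lemma reg_mult: "f \<in> reg \<Longrightarrow> g \<in> reg \<Longrightarrow> (\<lambda>x\<in>X. f x * g x) \<in> reg"
  and reg_add: "f \<in> reg \<Longrightarrow> g \<in> reg \<Longrightarrow> (\<lambda>x\<in>X. f x + g x) \<in> reg"
proof -
  interpret domain "coordinate_ring V" by (rule dom)
  show "f \<in> reg \<Longrightarrow> g \<in> reg \<Longrightarrow> (\<lambda>x\<in>X. f x * g x) \<in> reg" using m_closed by simp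
  show "f \<in> reg \<Longrightarrow> g \<in> reg \<Longrightarrow> (\<lambda>x\<in>X. f x + g x) \<in> reg" using a_closed by simp
qed

lemma presentation:
  "\<exists>(n::nat) (f :: nat \<Rightarrow> 'a \<Rightarrow> complex) I. I \<subseteq> mpolys n \<and>
     bij_betw (\<lambda>x. \<lambda>i\<in>{..<n}. f i x) X {a \<in> {..<n} \<rightarrow>\<^sub>E UNIV. \<forall>p\<in>I. mpoly_eval p a = 0} \<and>
     reg = {\<lambda>x\<in>X. mpoly_eval p (\<lambda>i. f i x) | p. p \<in> mpolys n}"
  using aff by (simp only: affine_variety_def)

lemma reg_ext: "f \<in> reg \<Longrightarrow> f \<in> extensional X"
  using aff by (auto simp: affine_variety_def)

lemma reg_const: "(\<lambda>x\<in>X. c) \<in> reg"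
proof -
  obtain n f where "reg = {\<lambda>x\<in>X. mpoly_eval p (\<lambda>i. f i x) | p. p \<in> mpolys (n::nat)}"
    using aff by (auto simp: affine_variety_def)
  then show ?thesis using mpoly_const(1)[of c n] by (force simp: mpoly_const(2))
qed

lemma reg_scale: "f \<in> reg \<Longrightarrow> (\<lambda>x\<in>X. c * f x) \<in> reg"
  using reg_mult[OF reg_const[of c], of f] unfolding restrict_times_left .

lemma reg_sum: "finite I \<Longrightarrow> (\<And>i. i \<in> I \<Longrightarrow> f i \<in> reg) \<Longrightarrow> (\<lambda>x\<in>X. \<Sum>i\<in>I. f i x) \<in> reg"
proof (induction I rule: finite_induct)
  case (insert i I)
  then have "(\<lambda>x\<in>X. (\<lambda>x\<in>X. f i x) x + (\<lambda>x\<in>X. \<Sum>i\<in>I. f i x) x) \<in> reg"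
    by (intro reg_add) (auto simp: extensional_restrict reg_ext)
  then show ?case unfolding restrict_plus sum.insert[OF insert.hyps(1,2)] .
qed (use reg_const[of 0] in simp)

lemma reg_domain:
  assumes "f \<in> reg" "g \<in> reg" "\<And>x. x \<in> X \<Longrightarrow> f x * g x = 0"
  shows "(\<forall>x\<in>X. f x = 0) \<or> (\<forall>x\<in>X. g x = 0)"
proof -
  interpret domain "coordinate_ring V" by (rule dom)
  have "(\<lambda>x\<in>X. f x * g x) = (\<lambda>x\<in>X. 0)" using assms(3) by (rule restrict_ext)
  then have "f = (\<lambda>x\<in>X. 0) \<or> g = (\<lambda>x\<in>X. 0)"
    using integral[of f g] assms(1,2) by simp
  then show ?thesis by auto
qed

lemma X_nonempty: "X \<noteq> {}"
proof
  interpret domain "coordinate_ring V" by (rule dom)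
  assume "X = {}"
  then have "(\<lambda>x\<in>X. 1 :: complex) = (\<lambda>x\<in>X. 0)" by (intro restrict_ext) simp
  then show False using one_not_zero by simp
qed

lemma reg_domain_prod:
  assumes "finite I" "\<And>i. i \<in> I \<Longrightarrow> f i \<in> reg" "\<And>i. i \<in> I \<Longrightarrow> \<exists>x\<in>X. f i x \<noteq> 0"
  shows "(\<lambda>x\<in>X. \<Prod>i\<in>I. f i x) \<in> reg \<and> (\<exists>x\<in>X. (\<Prod>i\<in>I. f i x) \<noteq> 0)"
  using assms
proof (induction I rule: finite_induct)
  case empty
  show ?case using reg_const[of 1] one_neq_zero[where 'a = complex] X_nonempty unfolding prod.empty by blast
next
  case (insert i I)
  let ?p = "\<lambda>x\<in>X. \<Prod>i\<in>I. f i x"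
  have p: "?p \<in> reg" "\<exists>x\<in>X. ?p x \<noteq> 0" using insert.IH insert.prems by fastforce+
  have fi: "f i \<in> reg" "\<exists>x\<in>X. f i x \<noteq> 0" using insert.prems by simp_all
  have ptw: "(\<Prod>i\<in>insert i I. f i x) = f i x * ?p x" if "x \<in> X" for x
    using insert.hyps that by simp
  have eq: "(\<lambda>x\<in>X. \<Prod>i\<in>insert i I. f i x) = (\<lambda>x\<in>X. f i x * ?p x)"
    by (rule restrict_ext) (rule ptw)
  obtain x where x: "x \<in> X" "f i x * ?p x \<noteq> 0" using reg_domain[OF fi(1) p(1)] fi(2) p(2) by blast
  have 1: "(\<lambda>x\<in>X. \<Prod>i\<in>insert i I. f i x) \<in> reg" unfolding eq by (rule reg_mult[OF fi(1) p(1)])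
  have "(\<Prod>i\<in>insert i I. f i x) \<noteq> 0" unfolding ptw[OF x(1)] by (rule x(2))
  then have 2: "\<exists>x\<in>X. (\<Prod>i\<in>insert i I. f i x) \<noteq> 0" using x(1) by (rule_tac bexI)
  show ?case by (rule conjI[OF 1 2])
qed

lemma separating: "x \<in> X \<Longrightarrow> y \<in> X \<Longrightarrow> (\<And>f. f \<in> reg \<Longrightarrow> f x = f y) \<Longrightarrow> x = y"
proof -
  assume xy: "x \<in> X" "y \<in> X" and eq: "\<And>f. f \<in> reg \<Longrightarrow> f x = f y"
  from presentation obtain n f I where
    bij: "bij_betw (\<lambda>x. \<lambda>i\<in>{..<n::nat}. f i x) X {a \<in> {..<n} \<rightarrow>\<^sub>E UNIV. \<forall>p\<in>I. mpoly_eval p a = 0}"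
    and reg: "reg = {\<lambda>x\<in>X. mpoly_eval p (\<lambda>i. f i x) | p. p \<in> mpolys n}"
    by (elim exE conjE) (rule that)
  have "f i x = f i y" if "i < n" for i
  proof -
    have "(\<lambda>x\<in>X. f i x) \<in> reg" unfolding reg by (rule coordinate_in[OF that])
    from eq[OF this] show ?thesis using xy by simp
  qed
  then have "(\<lambda>i\<in>{..<n}. f i x) = (\<lambda>i\<in>{..<n}. f i y)" by (intro restrict_ext) simp
  then show "x = y" using bij xy by (auto simp: bij_betw_def inj_on_def)
qed

text \<open>
  The coordinate ring is finitely generated as an algebra, expressed by closure conditions.
\<close>

lemma reg_generators:
  shows "\<exists>(n :: nat) F. (\<forall>i<n. F i \<in> reg) \<and>
    (\<forall>C. (\<forall>c. (\<lambda>x\<in>X. c) \<in> C) \<longrightarrow> (\<forall>i<n. F i \<in> C) \<longrightarrow>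
      (\<forall>f\<in>C. \<forall>g\<in>C. (\<lambda>x\<in>X. f x + g x) \<in> C \<and> (\<lambda>x\<in>X. f x * g x) \<in> C) \<longrightarrow> reg \<subseteq> C)"
proof -
  from presentation obtain n f where
    reg: "reg = {\<lambda>x\<in>X. mpoly_eval p (\<lambda>i. f i x) | p. p \<in> mpolys (n::nat)}"
    by (elim exE conjE) (rule that)
  define F where "F i = (\<lambda>x\<in>X. f i x)" for i
  have "F i \<in> reg" if "i < n" for i
    unfolding reg F_def by (rule coordinate_in[OF that])
  moreover have "reg \<subseteq> C" if const: "\<And>c. (\<lambda>x\<in>X. c) \<in> C" and F: "\<And>i. i < n \<Longrightarrow> F i \<in> C"
    and add: "\<And>f g. f \<in> C \<Longrightarrow> g \<in> C \<Longrightarrow> (\<lambda>x\<in>X. f x + g x) \<in> C"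
    and mult: "\<And>f g. f \<in> C \<Longrightarrow> g \<in> C \<Longrightarrow> (\<lambda>x\<in>X. f x * g x) \<in> C" for C
  proof
    fix h assume "h \<in> reg"
    then obtain p where p: "p \<in> mpolys n" "h = (\<lambda>x\<in>X. mpoly_eval p (\<lambda>i. f i x))" unfolding reg by blast
    have sumC: "(\<lambda>x\<in>X. \<Sum>i\<in>I. g i x) \<in> C" if "finite I" "\<And>i. i \<in> I \<Longrightarrow> (\<lambda>x\<in>X. g i x) \<in> C" for I :: "(nat \<Rightarrow>\<^sub>0 nat) set" and g
      using that
    proof (induction I rule: finite_induct)
      case (insert i I)
      then show ?case using add[of "\<lambda>x\<in>X. g i x" "\<lambda>x\<in>X. \<Sum>i\<in>I. g i x"]
        unfolding restrict_plus sum.insert[OF insert.hyps(1,2)] by blast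
    next
      case empty
      show ?case unfolding sum.empty by (rule const)
    qed
    have prodC: "(\<lambda>x\<in>X. \<Prod>i\<in>I. g i x) \<in> C" if "finite I" "\<And>i. i \<in> I \<Longrightarrow> (\<lambda>x\<in>X. g i x) \<in> C" for I :: "nat set" and g
      using that
    proof (induction I rule: finite_induct)
      case (insert i I)
      then show ?case using mult[of "\<lambda>x\<in>X. g i x" "\<lambda>x\<in>X. \<Prod>i\<in>I. g i x"]
        unfolding restrict_times prod.insert[OF insert.hyps(1,2)] by blast
    next
      case empty
      show ?case unfolding prod.empty by (rule const)
    qed
    have powC: "(\<lambda>x\<in>X. f i x ^ k) \<in> C" if "i < n" for i k
    proof (induction k)
      case (Suc k)
      show ?case using mult[OF F[OF that] Suc] unfolding F_def restrict_times power_Suc .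
    next
      case 0
      show ?case unfolding power_0 by (rule const)
    qed
    show "h \<in> C" unfolding p(2) mpoly_eval_def
    proof (rule sumC)
      fix m assume m: "m \<in> Poly_Mapping.keys p"
      have "(\<lambda>x\<in>X. \<Prod>i\<in>Poly_Mapping.keys m. f i x ^ Poly_Mapping.lookup m i) \<in> C"
        by (rule prodC) (use m p(1) powC in \<open>auto simp: mpolys_def\<close>)
      from mult[OF const[of "Poly_Mapping.lookup p m"] this]
      show "(\<lambda>x\<in>X. Poly_Mapping.lookup p m * (\<Prod>i\<in>Poly_Mapping.keys m. f i x ^ Poly_Mapping.lookup m i)) \<in> C"
        unfolding restrict_times .
    qed simp
  qed
  ultimately show ?thesis by (intro exI[of _ n] exI[of _ F]) blast
qed

text \<open>
  A character of the coordinate ring is evaluation at a point: its values on the coordinate functions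
  satisfy the equations that define the variety.
\<close>

lemma point_of_character:
  assumes add: "\<And>f g. f \<in> reg \<Longrightarrow> g \<in> reg \<Longrightarrow> e (\<lambda>x\<in>X. f x + g x) = e f + e g"
    and mult: "\<And>f g. f \<in> reg \<Longrightarrow> g \<in> reg \<Longrightarrow> e (\<lambda>x\<in>X. f x * g x) = e f * e g"
    and const: "\<And>c. e (\<lambda>x\<in>X. c) = (c :: complex)"
  shows "\<exists>y\<in>X. \<forall>f\<in>reg. e f = f y"
proof -
  from presentation obtain n f I where I: "I \<subseteq> mpolys n" and bij: "bij_betw (\<lambda>x. \<lambda>i\<in>{..<n::nat}. f i x) X
      {a \<in> {..<n} \<rightarrow>\<^sub>E UNIV. \<forall>p\<in>I. mpoly_eval p a = 0}"
    and reg: "reg = {\<lambda>x\<in>X. mpoly_eval p (\<lambda>i. f i x) | p. p \<in> mpolys n}"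
    by (elim exE conjE) (rule that)
  define F where "F i = (\<lambda>x\<in>X. f i x)" for i
  have F: "F i \<in> reg" if "i < n" for i
    unfolding reg F_def by (rule coordinate_in[OF that])
  define a where "a = (\<lambda>i\<in>{..<n}. e (F i))"
  have e_sum: "(\<lambda>x\<in>X. \<Sum>i\<in>J. g i x) \<in> reg \<and> e (\<lambda>x\<in>X. \<Sum>i\<in>J. g i x) = (\<Sum>i\<in>J. e (\<lambda>x\<in>X. g i x))"
    if "finite J" "\<And>i. i \<in> J \<Longrightarrow> (\<lambda>x\<in>X. g i x) \<in> reg" for J :: "(nat \<Rightarrow>\<^sub>0 nat) set" and g
    using that
  proof (induction J rule: finite_induct)
    case (insert i J)
    have gi: "(\<lambda>x\<in>X. g i x) \<in> reg" by (rule insert.prems) simp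
    have IH: "(\<lambda>x\<in>X. \<Sum>i\<in>J. g i x) \<in> reg"
      "e (\<lambda>x\<in>X. \<Sum>i\<in>J. g i x) = (\<Sum>i\<in>J. e (\<lambda>x\<in>X. g i x))" using insert by blast+
    have r: "(\<lambda>x\<in>X. g i x + (\<Sum>i\<in>J. g i x)) \<in> reg"
      using reg_add[OF gi IH(1)] unfolding restrict_plus .
    have e: "e (\<lambda>x\<in>X. g i x + (\<Sum>i\<in>J. g i x)) = e (\<lambda>x\<in>X. g i x) + (\<Sum>i\<in>J. e (\<lambda>x\<in>X. g i x))"
      using add[OF gi IH(1)] unfolding restrict_plus IH(2) .
    show ?case unfolding sum.insert[OF insert.hyps(1,2)] by (rule conjI[OF r e])
  next
    case empty
    show ?case unfolding sum.empty by (rule conjI[OF reg_const const])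
  qed
  have e_prod: "(\<lambda>x\<in>X. \<Prod>i\<in>J. g i x) \<in> reg \<and> e (\<lambda>x\<in>X. \<Prod>i\<in>J. g i x) = (\<Prod>i\<in>J. e (\<lambda>x\<in>X. g i x))"
    if "finite J" "\<And>i. i \<in> J \<Longrightarrow> (\<lambda>x\<in>X. g i x) \<in> reg" for J :: "nat set" and g
    using that
  proof (induction J rule: finite_induct)
    case (insert i J)
    have gi: "(\<lambda>x\<in>X. g i x) \<in> reg" by (rule insert.prems) simp
    have IH: "(\<lambda>x\<in>X. \<Prod>i\<in>J. g i x) \<in> reg"
      "e (\<lambda>x\<in>X. \<Prod>i\<in>J. g i x) = (\<Prod>i\<in>J. e (\<lambda>x\<in>X. g i x))" using insert by blast+
    have r: "(\<lambda>x\<in>X. g i x * (\<Prod>i\<in>J. g i x)) \<in> reg"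
      using reg_mult[OF gi IH(1)] unfolding restrict_times .
    have e: "e (\<lambda>x\<in>X. g i x * (\<Prod>i\<in>J. g i x)) = e (\<lambda>x\<in>X. g i x) * (\<Prod>i\<in>J. e (\<lambda>x\<in>X. g i x))"
      using mult[OF gi IH(1)] unfolding restrict_times IH(2) .
    show ?case unfolding prod.insert[OF insert.hyps(1,2)] by (rule conjI[OF r e])
  next
    case empty
    show ?case unfolding prod.empty by (rule conjI[OF reg_const const])
  qed
  have e_pow: "(\<lambda>x\<in>X. f i x ^ k) \<in> reg \<and> e (\<lambda>x\<in>X. f i x ^ k) = a i ^ k" if "i < n" for i k
  proof (induction k)
    case (Suc k)
    have ai: "a i = e (F i)" using that by (simp add: a_def)
    note IH = conjunct1[OF Suc] conjunct2[OF Suc]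
    have r: "(\<lambda>x\<in>X. f i x * f i x ^ k) \<in> reg"
      using reg_mult[OF F[OF that] IH(1)] unfolding F_def restrict_times .
    have e: "e (\<lambda>x\<in>X. f i x * f i x ^ k) = a i * a i ^ k"
      using mult[OF F[OF that] IH(1)] unfolding IH(2) ai[symmetric] unfolding F_def restrict_times .
    show ?case unfolding power_Suc by (rule conjI[OF r e])
  next
    case 0
    show ?case unfolding power_0 by (rule conjI[OF reg_const const])
  qed
  have e_eval: "e (\<lambda>x\<in>X. mpoly_eval p (\<lambda>i. f i x)) = mpoly_eval p a" if p: "p \<in> mpolys n" for p
  proof -
    have *: "(\<lambda>x\<in>X. Poly_Mapping.lookup p m * (\<Prod>i\<in>Poly_Mapping.keys m. f i x ^ Poly_Mapping.lookup m i)) \<in> reg \<and>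
       e (\<lambda>x\<in>X. Poly_Mapping.lookup p m * (\<Prod>i\<in>Poly_Mapping.keys m. f i x ^ Poly_Mapping.lookup m i))
        = Poly_Mapping.lookup p m * (\<Prod>i\<in>Poly_Mapping.keys m. a i ^ Poly_Mapping.lookup m i)"
      if m: "m \<in> Poly_Mapping.keys p" for m
    proof -
      have mn: "i < n" if "i \<in> Poly_Mapping.keys m" for i using p m that by (auto simp: mpolys_def)
      have "(\<lambda>x\<in>X. \<Prod>i\<in>Poly_Mapping.keys m. f i x ^ Poly_Mapping.lookup m i) \<in> reg \<and>
          e (\<lambda>x\<in>X. \<Prod>i\<in>Poly_Mapping.keys m. f i x ^ Poly_Mapping.lookup m i) =
          (\<Prod>i\<in>Poly_Mapping.keys m. e (\<lambda>x\<in>X. f i x ^ Poly_Mapping.lookup m i))"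
        by (rule e_prod) (use e_pow mn in auto)
      also have "(\<Prod>i\<in>Poly_Mapping.keys m. e (\<lambda>x\<in>X. f i x ^ Poly_Mapping.lookup m i)) =
          (\<Prod>i\<in>Poly_Mapping.keys m. a i ^ Poly_Mapping.lookup m i)"
        by (rule prod.cong) (use e_pow mn in auto)
      finally have E: "(\<lambda>x\<in>X. \<Prod>i\<in>Poly_Mapping.keys m. f i x ^ Poly_Mapping.lookup m i) \<in> reg"
        "e (\<lambda>x\<in>X. \<Prod>i\<in>Poly_Mapping.keys m. f i x ^ Poly_Mapping.lookup m i) =
          (\<Prod>i\<in>Poly_Mapping.keys m. a i ^ Poly_Mapping.lookup m i)" by blast+
      note r = reg_mult[OF reg_const[of "Poly_Mapping.lookup p m"] E(1), unfolded restrict_times]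
      note e = mult[OF reg_const[of "Poly_Mapping.lookup p m"] E(1), unfolded restrict_times const E(2)]
      show ?thesis by (rule conjI[OF r e])
    qed
    let ?t = "\<lambda>m x. Poly_Mapping.lookup p m * (\<Prod>i\<in>Poly_Mapping.keys m. f i x ^ Poly_Mapping.lookup m i)"
    have "e (\<lambda>x\<in>X. \<Sum>m\<in>Poly_Mapping.keys p. ?t m x) = (\<Sum>m\<in>Poly_Mapping.keys p. e (\<lambda>x\<in>X. ?t m x))"
      by (rule e_sum[THEN conjunct2]) (rule finite_keys, rule *[THEN conjunct1])
    also have "\<dots> = (\<Sum>m\<in>Poly_Mapping.keys p. Poly_Mapping.lookup p m *
        (\<Prod>i\<in>Poly_Mapping.keys m. a i ^ Poly_Mapping.lookup m i))"
      by (rule sum.cong[OF refl]) (rule *[THEN conjunct2])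
    finally show ?thesis unfolding mpoly_eval_def .
  qed
  have eval_cong: "mpoly_eval p b = mpoly_eval p b'" if "p \<in> mpolys n" "\<And>i. i < n \<Longrightarrow> b i = b' i" for p b b'
  proof -
    have "b i = b' i" if "m \<in> Poly_Mapping.keys p" "i \<in> Poly_Mapping.keys m" for m i
      using \<open>p \<in> mpolys n\<close> that by (intro \<open>\<And>i. i < n \<Longrightarrow> b i = b' i\<close>) (auto simp: mpolys_def)
    then show ?thesis unfolding mpoly_eval_def by simp
  qed
  have "a \<in> {a \<in> {..<n} \<rightarrow>\<^sub>E UNIV. \<forall>p\<in>I. mpoly_eval p a = 0}"
  proof (intro CollectI conjI ballI)
    show "a \<in> {..<n} \<rightarrow>\<^sub>E UNIV" by (simp add: a_def)
    fix p assume p: "p \<in> I"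
    have "mpoly_eval p (\<lambda>i. f i x) = 0" if "x \<in> X" for x
    proof -
      have "mpoly_eval p (\<lambda>i\<in>{..<n}. f i x) = 0" using bij_betw_apply[OF bij that] p by blast
      then show ?thesis using eval_cong[of p "\<lambda>i\<in>{..<n}. f i x" "\<lambda>i. f i x"] I p by auto
    qed
    then have "(\<lambda>x\<in>X. mpoly_eval p (\<lambda>i. f i x)) = (\<lambda>x\<in>X. 0)" by (intro restrict_ext) simp
    then show "mpoly_eval p a = 0" using e_eval[of p] I p const[of 0] by auto
  qed
  then have "a \<in> (\<lambda>x. \<lambda>i\<in>{..<n}. f i x) ` X" using bij by (simp add: bij_betw_def)
  then obtain y where y: "y \<in> X" "a = (\<lambda>i\<in>{..<n}. f i y)" by blast
  have "e g = g y" if g: "g \<in> reg" for g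
  proof -
    obtain p where p: "p \<in> mpolys n" "g = (\<lambda>x\<in>X. mpoly_eval p (\<lambda>i. f i x))" using g unfolding reg by blast
    then show ?thesis using e_eval[OF p(1)] y eval_cong[OF p(1), of a "\<lambda>i. f i y"] by simp
  qed
  then show ?thesis using y(1) by blast
qed

end

section \<open>Weight decompositions\<close>

text \<open>
  The last assumption is the coaction on the coordinate ring, which expresses that the action is
  algebraic.
\<close>

locale torus_rep = variety_algebra V for V :: "'a variety" +
  fixes \<tau> :: "complex \<times> complex \<Rightarrow> 'a \<Rightarrow> 'a"
  assumes act_closed: "z \<in> torus \<Longrightarrow> x \<in> points V \<Longrightarrow> \<tau> z x \<in> points V"
    and act_mult: "z \<in> torus \<Longrightarrow> w \<in> torus \<Longrightarrow> x \<in> points V \<Longrightarrow>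
      \<tau> (fst z * fst w, snd z * snd w) x = \<tau> z (\<tau> w x)"
    and act_one: "x \<in> points V \<Longrightarrow> \<tau> (1, 1) x = x"
    and rational: "f \<in> regular V \<Longrightarrow> \<exists>(I :: (nat \<times> nat \<times> nat \<times> nat) set) w h. finite I \<and> (\<forall>i\<in>I. h i \<in> regular V) \<and>
      (\<forall>z\<in>torus. \<forall>x\<in>points V. f (\<tau> z x) = (\<Sum>i\<in>I. cpow (w i) z * h i x))"
begin

definition wt :: "lattice \<Rightarrow> ('a \<Rightarrow> complex) \<Rightarrow> bool" where
  "wt u f \<longleftrightarrow> f \<in> reg \<and> (\<forall>z\<in>torus. \<forall>x\<in>X. f (\<tau> z x) = cpow u z * f x)"

text \<open>
  Collect the terms of \<open>f (\<tau> z x)\<close> with the same exponent. Comparing \<open>f (\<tau> z (\<tau> y x))\<close> with the expansion of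
  \<open>f\<close> at the product of \<open>z\<close> and \<open>y\<close>, the independence of characters shows that the coefficients are
  weight vectors.
\<close>

lemma weight_decomposition:
  assumes f: "f \<in> reg"
  shows "\<exists>U h. finite U \<and> (\<forall>u\<in>U. wt u (h u)) \<and> (\<forall>x\<in>X. f x = (\<Sum>u\<in>U. h u x))"
proof -
  from rational[OF f] obtain I :: "(nat \<times> nat \<times> nat \<times> nat) set" and w k where I0: "finite I"
    "\<forall>i\<in>I. k i \<in> reg" "\<forall>z\<in>torus. \<forall>x\<in>X. f (\<tau> z x) = (\<Sum>i\<in>I. cpow (w i) z * k i x)"
    by (elim exE conjE) (rule that)
  note I = I0(1) bspec[OF I0(2)] bspec[OF bspec[OF I0(3)]]
  define U where "U = w ` I"
  define h where "h u = (\<lambda>x\<in>X. \<Sum>i\<in>{i\<in>I. w i = u}. k i x)" for u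
  have finU: "finite U" using I(1) by (simp add: U_def)
  have hreg: "h u \<in> reg" for u unfolding h_def by (rule reg_sum) (use I in auto)
  have f_eq: "f (\<tau> z x) = (\<Sum>u\<in>U. h u x * cpow u z)" if "z \<in> torus" "x \<in> X" for z x
  proof -
    have "f (\<tau> z x) = (\<Sum>u\<in>w ` I. \<Sum>i\<in>{i\<in>I. w i = u}. cpow (w i) z * k i x)"
      unfolding I(3)[OF that] by (rule sum.image_gen[OF I(1)])
    also have "\<dots> = (\<Sum>u\<in>U. h u x * cpow u z)" unfolding U_def
    proof (rule sum.cong)
      fix u show "(\<Sum>i\<in>{i\<in>I. w i = u}. cpow (w i) z * k i x) = h u x * cpow u z"
      proof -
        have "(\<Sum>i\<in>{i\<in>I. w i = u}. cpow (w i) z * k i x) = (\<Sum>i\<in>{i\<in>I. w i = u}. cpow u z * k i x)"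
          by (rule sum.cong) auto
        then show ?thesis using that(2) by (simp add: h_def sum_distrib_left mult.commute)
      qed
    qed simp
    finally show ?thesis .
  qed
  have "wt u (h u)" if u: "u \<in> U" for u
    unfolding wt_def
  proof (intro conjI ballI hreg)
    fix y x assume y: "y \<in> torus" and x: "x \<in> X"
    have yx: "\<tau> y x \<in> X" by (rule act_closed[OF y x])
    have "(\<Sum>u\<in>U. (h u (\<tau> y x) - cpow u y * h u x) * cpow u z) = 0" if z: "z \<in> torus" for z
    proof -
      have zy: "(fst z * fst y, snd z * snd y) \<in> torus" using y z by auto
      have "f (\<tau> z (\<tau> y x)) = f (\<tau> (fst z * fst y, snd z * snd y) x)"
        by (simp only: act_mult[OF z y x])
      then show ?thesis unfolding f_eq[OF z yx] f_eq[OF zy x]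
        by (simp add: cpow_mult right_diff_distrib sum_subtractf mult_ac)
    qed
    from cpow_independent_single[OF finU this u] show "h u (\<tau> y x) = cpow u y * h u x" by simp
  qed
  moreover have "f x = (\<Sum>u\<in>U. h u x)" if "x \<in> X" for x
    using f_eq[of "(1, 1)" x] that by (simp add: act_one)
  ultimately show ?thesis using finU by blast
qed

lemma wt_reg: "wt u f \<Longrightarrow> f \<in> reg" by (simp add: wt_def)

lemma wtD: "wt u f \<Longrightarrow> z \<in> torus \<Longrightarrow> x \<in> X \<Longrightarrow> f (\<tau> z x) = cpow u z * f x"
  unfolding wt_def by blast

lemma wtI: "f \<in> reg \<Longrightarrow> (\<And>z x. z \<in> torus \<Longrightarrow> x \<in> X \<Longrightarrow> f (\<tau> z x) = cpow u z * f x) \<Longrightarrow> wt u f"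
  unfolding wt_def by blast

lemma wt_mult: "wt u f \<Longrightarrow> wt v g \<Longrightarrow> wt (u + v) (\<lambda>x\<in>X. f x * g x)"
  by (rule wtI) (simp_all add: reg_mult wt_reg act_closed cpow_add wtD del: mem_Sigma_iff)

lemma wt_const: "wt 0 (\<lambda>x\<in>X. c)"
  by (rule wtI) (simp_all add: reg_const act_closed del: mem_Sigma_iff)

lemma wt_scale: "wt u f \<Longrightarrow> wt u (\<lambda>x\<in>X. c * f x)"
  by (rule wtI) (simp_all add: reg_scale wt_reg act_closed wtD del: mem_Sigma_iff)

end

section \<open>The semigroup of weights\<close>

lemma cpow_smul_nat: "cpow (smul (int k) u) z = cpow u z ^ k"
  by (simp add: cpow_def smul_def power_mult_distrib power_int_power' mult.commute)

lemma int_subgroup: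
  assumes "0 \<in> H" "\<And>a b. a \<in> H \<Longrightarrow> b \<in> H \<Longrightarrow> a - b \<in> (H :: int set)"
  shows "\<exists>g\<ge>0. \<forall>k. k \<in> H \<longleftrightarrow> g dvd k"
proof (cases "H = {0}")
  case True
  then show ?thesis by (intro exI[of _ 0]) auto
next
  case False
  then obtain a where a: "a \<in> H" "a \<noteq> 0" using assms(1) by blast
  have neg: "- b \<in> H" if "b \<in> H" for b using assms(2)[OF assms(1) that] by simp
  have plus: "b + c \<in> H" if "b \<in> H" "c \<in> H" for b c using assms(2)[OF that(1) neg[OF that(2)]] by simp
  define P where "P n \<longleftrightarrow> n > 0 \<and> int n \<in> H" for n
  have "P (nat \<bar>a\<bar>)" using a neg[OF a(1)] by (auto simp: P_def abs_if)
  then have L: "P (LEAST n. P n)" by (rule LeastI)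
  define g where "g = int (LEAST n. P n)"
  have g: "g > 0" "g \<in> H" using L by (auto simp: P_def g_def)
  have mult: "g * int n \<in> H" for n
    by (induction n) (use assms(1) g plus in \<open>auto simp: distrib_left\<close>)
  have mult': "g * k \<in> H" for k
    using mult[of "nat k"] neg[OF mult[of "nat (- k)"]] by (cases "k \<ge> 0") auto
  have "g dvd k" if k: "k \<in> H" for k
  proof (rule ccontr)
    assume "\<not> g dvd k"
    then have "k mod g \<noteq> 0" by (simp add: dvd_eq_mod_eq_0)
    then have m: "0 < k mod g" "k mod g < g" using g by (simp_all add: le_neq_trans)
    have "k mod g = k - g * (k div g)" by (simp add: minus_mult_div_eq_mod)
    then have "k mod g \<in> H" using assms(2)[OF k mult'] by simp
    then have "P (nat (k mod g))" using m by (simp add: P_def)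
    then have "(LEAST n. P n) \<le> nat (k mod g)" by (rule Least_le)
    then show False using m by (simp add: g_def)
  qed
  then show ?thesis using g mult' by (intro exI[of _ g]) (auto elim!: dvdE)
qed

lemma nontrivial_root:
  assumes "g \<ge> 0" "g \<noteq> 1"
  shows "\<exists>t :: complex. t \<noteq> 0 \<and> t \<noteq> 1 \<and> (\<forall>k. g dvd k \<longrightarrow> t powi k = 1)"
proof (cases "g = 0")
  case True
  then show ?thesis by (intro exI[of _ 2]) auto
next
  case False
  define n where "n = nat g"
  have n: "n \<ge> 2" "g = int n" using assms False by (auto simp: n_def)
  have "card {z :: complex. z ^ n = 1} = n" using n by (intro card_roots_unity_eq) auto
  then have "\<not> {z :: complex. z ^ n = 1} \<subseteq> {1}"
    using n card_mono[of "{1 :: complex}" "{z. z ^ n = 1}"] by auto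
  then obtain t :: complex where t: "t ^ n = 1" "t \<noteq> 1" by auto
  moreover have "t \<noteq> 0" using t n by (auto simp: power_0_left)
  moreover have "t powi k = 1" if dv: "g dvd k" for k
  proof -
    obtain j where "k = g * j" using dv by (rule dvdE)
    then show ?thesis using t n by (simp add: power_int_mult)
  qed
  ultimately show ?thesis by blast
qed

text \<open>
  A proper subgroup of the lattice takes the value one at some nontrivial point of the torus. The subgroup
  is replaced by its projection to the second coordinate and the kernel of this projection, for which
  suitable points come from \<open>nontrivial_root\<close>.
\<close>

lemma lattice_subgroup_full:
  assumes H: "0 \<in> H" "\<And>a b. a \<in> H \<Longrightarrow> b \<in> H \<Longrightarrow> a - b \<in> H"
    and sep: "\<And>z. z \<in> torus \<Longrightarrow> z \<noteq> (1, 1) \<Longrightarrow> \<exists>u\<in>H. cpow u z \<noteq> 1"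
  shows "w \<in> H"
proof -
  have neg: "- b \<in> H" if "b \<in> H" for b using H(2)[OF H(1) that] by simp
  have plus: "b + c \<in> H" if "b \<in> H" "c \<in> H" for b c using H(2)[OF that(1) neg[OF that(2)]] by simp
  have mult: "smul (int n) u \<in> H" if "u \<in> H" for n u
    by (induction n) (use H(1) plus that in \<open>auto simp: smul_add\<close>)
  have mult': "smul k u \<in> H" if "u \<in> H" for k u
    using mult[OF that, of "nat k"] mult[OF neg[OF that], of "nat (- k)"]
    by (cases "k \<ge> 0") (auto simp: smul_def)
  have "0 \<in> snd ` H" using image_eqI[OF _ H(1), of 0 snd] by simp
  moreover have "a - b \<in> snd ` H" if "a \<in> snd ` H" "b \<in> snd ` H" for a b
    using that by (auto simp: image_iff) (metis H(2) diff_Pair snd_conv)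
  ultimately obtain g where g: "g \<ge> 0" "\<And>k. k \<in> snd ` H \<longleftrightarrow> g dvd k"
    using int_subgroup[of "snd ` H"] by blast
  have "g = 1"
  proof (rule ccontr)
    assume "g \<noteq> 1"
    then obtain t :: complex where t: "t \<noteq> 0" "t \<noteq> 1" "\<And>k. g dvd k \<Longrightarrow> t powi k = 1"
      using nontrivial_root[OF g(1)] by blast
    obtain u where u: "u \<in> H" "cpow u (1, t) \<noteq> 1" using sep[of "(1, t)"] t by auto
    have "g dvd snd u" using u(1) g(2) by blast
    then show False using u(2) t(3) by (simp add: cpow_def)
  qed
  then obtain p where p: "(p, 1) \<in> H" using g(2)[of 1] by (auto simp: image_iff)
  define H1 where "H1 = {i. (i, 0) \<in> H}"
  have "0 \<in> H1" using H(1) by (simp add: H1_def zero_prod_def)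
  moreover have "a - b \<in> H1" if "a \<in> H1" "b \<in> H1" for a b
    using H(2)[of "(a, 0)" "(b, 0)"] that by (simp add: H1_def)
  ultimately obtain e where e: "e \<ge> 0" "\<And>k. k \<in> H1 \<longleftrightarrow> e dvd k"
    using int_subgroup[of H1] by blast
  have red: "fst u - snd u * p \<in> H1" if "u \<in> H" for u
    using H(2)[OF that mult'[OF p, of "snd u"]] by (simp add: H1_def smul_def minus_prod_def)
  have "e = 1"
  proof (rule ccontr)
    assume "e \<noteq> 1"
    then obtain t :: complex where t: "t \<noteq> 0" "t \<noteq> 1" "\<And>k. e dvd k \<Longrightarrow> t powi k = 1"
      using nontrivial_root[OF e(1)] by blast
    obtain u where u: "u \<in> H" "cpow u (t, t powi (- p)) \<noteq> 1"
      using sep[of "(t, t powi (- p))"] t by auto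
    have "cpow u (t, t powi (- p)) = t powi (fst u - snd u * p)"
      using t(1) by (simp add: cpow_def power_int_mult[symmetric] flip: power_int_add) (simp add: algebra_simps)
    moreover have "e dvd fst u - snd u * p" using red[OF u(1)] e(2) by blast
    ultimately show False using u(2) t(3) by simp
  qed
  then have "(fst w - snd w * p, 0) \<in> H" using e(2)[of "fst w - snd w * p"] by (simp add: H1_def)
  from plus[OF this mult'[OF p, of "snd w"]] show ?thesis by (simp add: smul_def)
qed

text \<open>
  Monomials in a set \<open>GG\<close> of functions that are labelled by their weights, together with their weights.
\<close>

inductive_set wmonos :: "'a set \<Rightarrow> (lattice \<times> ('a \<Rightarrow> complex)) set \<Rightarrow> (lattice \<times> ('a \<Rightarrow> complex)) set"
  for X GG where
  one: "(0, \<lambda>x\<in>X. 1) \<in> wmonos X GG"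
| mult: "(u, g) \<in> GG \<Longrightarrow> (w, M) \<in> wmonos X GG \<Longrightarrow> (u + w, \<lambda>x\<in>X. g x * M x) \<in> wmonos X GG"

lemma wmonos_mult:
  "(w, M) \<in> wmonos X GG \<Longrightarrow> (w', M') \<in> wmonos X GG \<Longrightarrow> (w + w', \<lambda>x\<in>X. M x * M' x) \<in> wmonos X GG"
proof (induction rule: wmonos.induct)
  case one
  have "M' \<in> extensional X" using one by cases auto
  then have "(\<lambda>x\<in>X. (\<lambda>x\<in>X. 1) x * M' x) = M'" by (intro extensionalityI[of _ X]) auto
  then show ?case using one by simp
next
  case (mult u g w M)
  have "(\<lambda>x\<in>X. (\<lambda>x\<in>X. g x * M x) x * M' x) = (\<lambda>x\<in>X. g x * (\<lambda>x\<in>X. M x * M' x) x)"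
    by (rule restrict_ext) simp
  then show ?case using wmonos.mult[OF mult.hyps(1) mult.IH[OF mult.prems]] by (simp only: add.assoc)
qed

inductive_set mono_span :: "'a set \<Rightarrow> (lattice \<times> ('a \<Rightarrow> complex)) set \<Rightarrow> ('a \<Rightarrow> complex) set"
  for X GG where
  zero: "(\<lambda>x\<in>X. 0) \<in> mono_span X GG"
| step: "f \<in> mono_span X GG \<Longrightarrow> (w, M) \<in> wmonos X GG \<Longrightarrow> (\<lambda>x\<in>X. f x + c * M x) \<in> mono_span X GG"

lemma mono_span_ext: "f \<in> mono_span X GG \<Longrightarrow> f \<in> extensional X"
  by (induction rule: mono_span.induct) (rule restrict_extensional)+

lemma mono_span_wmonos: "(w, M) \<in> wmonos X GG \<Longrightarrow> (\<lambda>x\<in>X. c * M x) \<in> mono_span X GG"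
proof -
  assume M: "(w, M) \<in> wmonos X GG"
  have "(\<lambda>x\<in>X. (\<lambda>x\<in>X. 0) x + c * M x) = (\<lambda>x\<in>X. c * M x)" by (rule restrict_ext) simp
  with mono_span.step[OF mono_span.zero M, of c] show ?thesis by (simp only:)
qed

lemma mono_span_add:
  assumes "g \<in> mono_span X GG" "f \<in> mono_span X GG" shows "(\<lambda>x\<in>X. f x + g x) \<in> mono_span X GG"
  using assms(1)
proof (induction rule: mono_span.induct)
  case zero
  have "(\<lambda>x\<in>X. f x + (\<lambda>x\<in>X. 0) x) = f"
    by (rule extensionalityI[of _ X]) (use mono_span_ext[OF assms(2)] in auto)
  then show ?case using assms(2) by (simp only:)
next
  case (step g w M c)
  have "(\<lambda>x\<in>X. f x + (\<lambda>x\<in>X. g x + c * M x) x) = (\<lambda>x\<in>X. (\<lambda>x\<in>X. f x + g x) x + c * M x)"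
    by (rule restrict_ext) simp
  then show ?case using mono_span.step[OF step.IH step.hyps(2), of c] by (simp only:)
qed

lemma mono_span_mult:
  assumes "g \<in> mono_span X GG" "f \<in> mono_span X GG" shows "(\<lambda>x\<in>X. f x * g x) \<in> mono_span X GG"
proof -
  have m: "(\<lambda>x\<in>X. c * (f x * M x)) \<in> mono_span X GG" if M: "(w, M) \<in> wmonos X GG" for c w M
    using assms(2)
  proof (induction rule: mono_span.induct)
    case zero
    have "(\<lambda>x\<in>X. c * ((\<lambda>x\<in>X. 0) x * M x)) = (\<lambda>x\<in>X. 0)" by (rule restrict_ext) simp
    then show ?case using mono_span.zero by (simp only:)
  next
    case (step f w' M' c')
    have "(\<lambda>x\<in>X. c * ((\<lambda>x\<in>X. f x + c' * M' x) x * M x)) =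
        (\<lambda>x\<in>X. (\<lambda>x\<in>X. c * (f x * M x)) x + (c * c') * (\<lambda>x\<in>X. M' x * M x) x)"
      by (rule restrict_ext) (simp add: algebra_simps)
    then show ?case using mono_span.step[OF step.IH wmonos_mult[OF step.hyps(2) M], of "c * c'"] by (simp only:)
  qed
  show ?thesis using assms(1)
  proof (induction rule: mono_span.induct)
    case zero
    have "(\<lambda>x\<in>X. f x * (\<lambda>x\<in>X. 0) x) = (\<lambda>x\<in>X. 0)" by (rule restrict_ext) simp
    then show ?case using mono_span.zero by (simp only:)
  next
    case (step g w M c)
    have "(\<lambda>x\<in>X. f x * (\<lambda>x\<in>X. g x + c * M x) x) =
        (\<lambda>x\<in>X. (\<lambda>x\<in>X. f x * g x) x + (\<lambda>x\<in>X. c * (f x * M x)) x)"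
      by (rule restrict_ext) (simp add: algebra_simps)
    then show ?case using mono_span_add[OF m[OF step.hyps(2), of c] step.IH] by (simp only:)
  qed
qed

text \<open>
  The algebraic side of a toric surface: a normal variety with an effective action of the torus that has
  no three algebraically independent functions.
\<close>

locale toric_algebra = torus_rep V \<tau> for V :: "'a variety" and \<tau> +
  assumes effective: "z \<in> torus \<Longrightarrow> z \<noteq> (1, 1) \<Longrightarrow> \<exists>x\<in>points V. \<tau> z x \<noteq> x"
    and dim2: "\<nexists>F. alg_independent V 3 F"
    and normal: "integrally_closed (coordinate_ring V)"
begin

definition S :: "lattice set" where "S = {u. \<exists>f. wt u f \<and> (\<exists>x\<in>X. f x \<noteq> 0)}"

lemma S_I: "wt u f \<Longrightarrow> x \<in> X \<Longrightarrow> f x \<noteq> 0 \<Longrightarrow> u \<in> S" by (auto simp: S_def)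

lemma nz_mult:
  assumes "f \<in> reg" "g \<in> reg" "\<exists>x\<in>X. f x \<noteq> 0" "\<exists>x\<in>X. g x \<noteq> 0"
  shows "\<exists>x\<in>X. (\<lambda>x\<in>X. f x * g x) x \<noteq> 0"
  using reg_domain[OF assms(1,2)] assms(3,4) by fastforce

lemma S_zero: "0 \<in> S"
  using wt_const[of 1] X_nonempty by (auto simp: S_def intro!: exI[of _ "\<lambda>x\<in>X. 1"])

lemma S_add: assumes "u \<in> S" "v \<in> S" shows "u + v \<in> S"
proof -
  obtain f g where f: "wt u f" "\<exists>x\<in>X. f x \<noteq> 0" and g: "wt v g" "\<exists>x\<in>X. g x \<noteq> 0"
    using assms unfolding S_def by blast
  show ?thesis using wt_mult[OF f(1) g(1)] nz_mult[OF wt_reg[OF f(1)] wt_reg[OF g(1)] f(2) g(2)] S_I by blast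
qed

text \<open>
  A regular function that separates \<open>x\<close> from \<open>\<tau> z x\<close> has a component whose weight is not trivial at \<open>z\<close>.
\<close>

lemma weights_separate:
  assumes z: "z \<in> torus" "z \<noteq> (1, 1)" shows "\<exists>u\<in>S. cpow u z \<noteq> 1"
proof -
  obtain x where x: "x \<in> X" "\<tau> z x \<noteq> x" using effective[OF z] by blast
  obtain f where f: "f \<in> reg" "f (\<tau> z x) \<noteq> f x"
    using separating[OF act_closed[OF z(1) x(1)] x(1)] x(2) by blast
  from weight_decomposition[OF f(1)] obtain U h where U: "finite U" "\<forall>u\<in>U. wt u (h u)"
    "\<forall>x\<in>X. f x = (\<Sum>u\<in>U. h u x)" by (elim exE conjE) (rule that)
  have "f (\<tau> z x) = (\<Sum>u\<in>U. cpow u z * h u x)"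
    using U act_closed[OF z(1) x(1)] wtD[OF _ z(1) x(1)] by simp
  then have "(\<Sum>u\<in>U. cpow u z * h u x) \<noteq> (\<Sum>u\<in>U. h u x)" using f(2) U(3) x(1) by simp
  then obtain u where u: "u \<in> U" "cpow u z * h u x \<noteq> h u x" by (meson sum.cong)
  then have "h u x \<noteq> 0" "cpow u z \<noteq> 1" by auto
  then show ?thesis using S_I[of u "h u" x] U(2) u(1) x(1) by blast
qed

lemma S_group: "\<exists>t\<in>S. w + t \<in> S"
proof -
  define H where "H = {a - b | a b. a \<in> S \<and> b \<in> S}"
  have "w \<in> H"
  proof (rule lattice_subgroup_full)
    have "0 = (0 :: lattice) - 0" by simp
    then show "0 \<in> H" unfolding H_def using S_zero by blast
    show "a - b \<in> H" if ab: "a \<in> H" "b \<in> H" for a b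
    proof -
      obtain a1 a2 b1 b2 where e: "a = a1 - a2" "b = b1 - b2" "a1 \<in> S" "a2 \<in> S" "b1 \<in> S" "b2 \<in> S"
        using ab unfolding H_def by blast
      have "a - b = (a1 + b2) - (a2 + b1)" by (simp add: e)
      moreover have "a1 + b2 \<in> S" "a2 + b1 \<in> S" using e S_add by blast+
      ultimately show ?thesis unfolding H_def by blast
    qed
    show "\<exists>u\<in>H. cpow u z \<noteq> 1" if z: "z \<in> torus" "z \<noteq> (1, 1)" for z
    proof -
      obtain u where "u \<in> S" "cpow u z \<noteq> 1" using weights_separate[OF z] by blast
      moreover from this have "u - 0 \<in> H" unfolding H_def using S_zero by blast
      ultimately show ?thesis by auto
    qed
  qed
  then obtain a b where "w = a - b" "a \<in> S" "b \<in> S" unfolding H_def by blast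
  then show ?thesis by (intro bexI[of _ b]) simp_all
qed

lemma dot_S_eq_0: "(\<And>u. u \<in> S \<Longrightarrow> dot p u = 0) \<Longrightarrow> p = 0"
  by (rule dot_eq_0_if_generating[OF S_group])

text \<open>
  If \<open>f\<close> and \<open>g\<close>, of the same weight, are not proportional, then \<open>f\<close>, \<open>g\<close> and \<open>h\<close> are algebraically independent:
  the torus action isolates the terms of a single weight in a relation, and since the weights of \<open>g\<close>
  and \<open>h\<close> are linearly independent, these terms are a power of \<open>h\<close> times a homogeneous polynomial in \<open>f\<close>
  and \<open>g\<close>. It is a product of linear forms \<open>f - r * g\<close> up to a power of \<open>g\<close>, none of which is zero, in a
  domain.
\<close>

lemma not_three_independent:
  assumes f: "wt u f" and g: "wt u g" "\<exists>x\<in>X. g x \<noteq> 0" and h: "wt w h" "\<exists>x\<in>X. h x \<noteq> 0"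
    and ind: "det2 u w \<noteq> 0"
  shows "\<exists>r. \<forall>x\<in>X. f x = r * g x"
proof (rule ccontr)
  assume nprop: "\<not> ?thesis"
  note fr = wt_reg[OF f] and gr = wt_reg[OF g(1)] and hr = wt_reg[OF h(1)]
  define F :: "nat \<Rightarrow> 'a \<Rightarrow> complex" where "F i = (if i = 0 then f else if i = 1 then g else h)" for i
  define L where "L = (\<lambda>(m :: nat \<Rightarrow>\<^sub>0 nat) i. Poly_Mapping.lookup m i)"
  define M where "M m x = f x ^ L m 0 * g x ^ L m 1 * h x ^ L m 2" for m x
  have "alg_independent V 3 F"
    unfolding alg_independent_def
  proof (intro conjI ballI allI impI)
    fix i :: nat show "F i \<in> reg" using fr gr hr by (simp add: F_def)
  next
    fix p assume p: "p \<in> mpolys 3" and ev: "\<forall>x\<in>X. mpoly_eval p (\<lambda>i. F i x) = 0"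
    show "p = 0"
    proof (rule ccontr)
      assume "p \<noteq> 0"
      then obtain ms where ms: "ms \<in> Poly_Mapping.keys p" by (metis all_not_in_conv keys_eq_empty)
      have km: "Poly_Mapping.keys m \<subseteq> {..<3}" if "m \<in> Poly_Mapping.keys p" for m
        using p that by (simp add: mpolys_def)
      have Mev: "(\<Prod>i\<in>Poly_Mapping.keys m. F i x ^ Poly_Mapping.lookup m i) = M m x"
        if "m \<in> Poly_Mapping.keys p" for m x
      proof -
        have "(\<Prod>i\<in>Poly_Mapping.keys m. F i x ^ Poly_Mapping.lookup m i) =
            (\<Prod>i\<in>{..<3}. F i x ^ Poly_Mapping.lookup m i)"
          by (rule prod.mono_neutral_left) (use km[OF that] in \<open>auto simp: in_keys_iff\<close>)
        also have "\<dots> = M m x" by (simp add: numeral_3_eq_3 lessThan_Suc F_def M_def L_def numeral_2_eq_2 mult_ac)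
        finally show ?thesis .
      qed
      have rel: "(\<Sum>m\<in>Poly_Mapping.keys p. Poly_Mapping.lookup p m * M m x) = 0" if "x \<in> X" for x
        using ev that Mev by (simp add: mpoly_eval_def cong: sum.cong)
      define \<omega> where "\<omega> m = smul (int (L m 0)) u + smul (int (L m 1)) u + smul (int (L m 2)) w" for m
      define K where "K = {m \<in> Poly_Mapping.keys p. \<omega> m = \<omega> ms}"
      have rel': "(\<Sum>m\<in>K. Poly_Mapping.lookup p m * M m x) = 0" if x: "x \<in> X" for x
        unfolding K_def
      proof (rule cpow_independent[OF finite_keys])
        fix z assume z: "z \<in> torus"
        have "M m (\<tau> z x) = M m x * cpow (\<omega> m) z" for m
          using wtD[OF f z x] wtD[OF g(1) z x] wtD[OF h(1) z x]
          by (simp add: M_def \<omega>_def cpow_add[OF z] cpow_smul_nat power_mult_distrib mult_ac)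
        then show "(\<Sum>m\<in>Poly_Mapping.keys p. Poly_Mapping.lookup p m * M m x * cpow (\<omega> m) z) = 0"
          using rel[OF act_closed[OF z x]] by (simp add: mult.assoc)
      qed
      define n where "n = L ms 0 + L ms 1"
      have K: "m \<in> Poly_Mapping.keys p" "L m 2 = L ms 2" "L m 0 + L m 1 = n" if m: "m \<in> K" for m
      proof -
        show "m \<in> Poly_Mapping.keys p" using m by (simp add: K_def)
        have eq: "\<omega> m = \<omega> ms" using m by (simp add: K_def)
        have d1: "det2 u (\<omega> m) = int (L m 2) * det2 u w" for m
          by (simp add: \<omega>_def det2_def smul_def algebra_simps)
        have d2: "det2 (\<omega> m) w = int (L m 0 + L m 1) * det2 u w" for m
          by (simp add: \<omega>_def det2_def smul_def algebra_simps)
        show "L m 2 = L ms 2" using d1[of m] d1[of ms] eq ind by simp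
        show "L m 0 + L m 1 = n" using d2[of m] d2[of ms] eq ind by (simp add: n_def flip: of_nat_add)
      qed
      have msK: "ms \<in> K" using ms by (simp add: K_def)
      have Kfin: "finite K" by (simp add: K_def)
      \<comment> \<open>The homogeneous polynomial of the relation, dehomogenized with respect to \<open>g\<close>.\<close>
      define Q where "Q = (\<Sum>m\<in>K. monom (Poly_Mapping.lookup p m) (L m 0))"
      have "coeff Q (L ms 0) = (\<Sum>m\<in>{ms}. Poly_Mapping.lookup p m)"
      proof -
        have "coeff Q (L ms 0) = (\<Sum>m\<in>K. if L m 0 = L ms 0 then Poly_Mapping.lookup p m else 0)"
          by (simp add: Q_def coeff_sum cong: if_cong)
        also have "\<dots> = (\<Sum>m\<in>{ms}. Poly_Mapping.lookup p m)"
        proof (rule sum.mono_neutral_cong_right)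
          show "\<forall>m\<in>K - {ms}. (if L m 0 = L ms 0 then Poly_Mapping.lookup p m else 0) = 0"
          proof
            fix m assume m: "m \<in> K - {ms}"
            have "L m 0 \<noteq> L ms 0"
            proof
              assume e0: "L m 0 = L ms 0"
              have e: "L m 1 = L ms 1" "L m 2 = L ms 2" using K(2,3)[of m] K(3)[OF msK] m e0 by auto
              have "Poly_Mapping.lookup m i = Poly_Mapping.lookup ms i" for i
              proof (cases "i < 3")
                case True
                then have "i = 0 \<or> i = 1 \<or> i = 2" by linarith
                then show ?thesis using e e0 by (auto simp: L_def)
              next
                case False
                then show ?thesis using km[OF ms] km[OF K(1)[of m]] m
                  by (metis DiffD1 in_keys_iff lessThan_iff subsetD)
              qed
              then have "m = ms" by (rule poly_mapping_eqI)
              then show False using m by simp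
            qed
            then show "(if L m 0 = L ms 0 then Poly_Mapping.lookup p m else 0) = 0" by simp
          qed
        qed (use Kfin msK in auto)
        finally show ?thesis .
      qed
      then have "coeff Q (L ms 0) \<noteq> 0" using ms by (simp add: in_keys_iff)
      then have "Q \<noteq> 0" by auto
      define R where "R = {r. poly Q r = 0}"
      have finR: "finite R" using \<open>Q \<noteq> 0\<close> poly_roots_finite by (simp add: R_def)
      have fac: "(\<lambda>x\<in>X. f x + (- r) * g x) \<in> reg" for r
        using reg_add[OF fr reg_scale[OF gr, of "- r"]] unfolding restrict_def
        by (rule back_subst[of "\<lambda>f. f \<in> reg"]) auto
      have nzf: "\<exists>x\<in>X. (\<lambda>x\<in>X. f x + (- r) * g x) x \<noteq> 0" for r
      proof (rule ccontr)
        assume "\<not> ?thesis"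
        then have "\<forall>x\<in>X. f x = r * g x" by simp
        then show False using nprop by blast
      qed
      have P: "(\<lambda>x\<in>X. \<Prod>r\<in>R. (\<lambda>x\<in>X. f x + (- r) * g x) x) \<in> reg"
        "\<exists>x\<in>X. (\<Prod>r\<in>R. (\<lambda>x\<in>X. f x + (- r) * g x) x) \<noteq> 0"
        using reg_domain_prod[OF finR, of "\<lambda>r. \<lambda>x\<in>X. f x + (- r) * g x", OF fac nzf] by blast+
      have hg: "(\<lambda>x\<in>X. h x * g x) \<in> reg" "\<exists>x\<in>X. (\<lambda>x\<in>X. h x * g x) x \<noteq> 0"
        using reg_mult[OF hr gr] nz_mult[OF hr gr h(2) g(2)] by blast+
      have "(\<lambda>x\<in>X. h x * g x) x * (\<lambda>x\<in>X. \<Prod>r\<in>R. (\<lambda>x\<in>X. f x + (- r) * g x) x) x = 0" if x: "x \<in> X" for x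
      proof (cases "h x = 0 \<or> g x = 0")
        case True
        then show ?thesis using x by auto
      next
        case False
        have "(\<Sum>m\<in>K. Poly_Mapping.lookup p m * M m x) = g x ^ n * h x ^ L ms 2 * poly Q (f x / g x)"
          unfolding Q_def poly_sum sum_distrib_left
        proof (rule sum.cong)
          fix m assume m: "m \<in> K"
          have "g x ^ n = g x ^ L m 0 * g x ^ L m 1" using K(3)[OF m] by (metis power_add)
          then show "Poly_Mapping.lookup p m * M m x =
              g x ^ n * h x ^ L ms 2 * poly (monom (Poly_Mapping.lookup p m) (L m 0)) (f x / g x)"
            using False K(2)[OF m] by (simp add: M_def poly_monom power_divide)
        qed simp
        then have "poly Q (f x / g x) = 0" using rel'[OF x] False by simp
        then have r: "f x / g x \<in> R" by (simp add: R_def)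
        have "(\<lambda>x\<in>X. f x + (- (f x / g x)) * g x) x = 0" using False x by simp
        then have "(\<Prod>r\<in>R. (\<lambda>x\<in>X. f x + (- r) * g x) x) = 0"
          using x False by (intro prod_zero[OF finR] bexI[OF _ r]) simp
        then show ?thesis using x by simp
      qed
      from reg_domain[OF hg(1) P(1) this] show False using hg(2) P(2) by fastforce
    qed
  qed
  then show False using dim2 by blast
qed

text \<open>
  For a nonzero weight this is \<open>not_three_independent\<close>. Functions of weight zero are multiplied by a
  vector of nonzero weight first.
\<close>

lemma weight_space_one_dim:
  assumes f: "wt u f" "\<exists>x\<in>X. f x \<noteq> 0" and g: "wt u g"
  shows "\<exists>c. \<forall>x\<in>X. g x = c * f x"
proof -
  have main: "\<exists>c. \<forall>x\<in>X. g x = c * f x" if "u \<noteq> 0" "wt u f" "\<exists>x\<in>X. f x \<noteq> 0" "wt u g" for u f g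
  proof -
    have "perp u \<noteq> 0" using that(1) by (auto simp: perp_def prod_eq_iff)
    then obtain w where w: "w \<in> S" "det2 u w \<noteq> 0" using dot_S_eq_0[of "perp u"] by (auto simp: det2_perp)
    then obtain h where "wt w h" "\<exists>x\<in>X. h x \<noteq> 0" unfolding S_def by blast
    then show ?thesis using not_three_independent[OF that(4,2,3)] w(2) by blast
  qed
  show ?thesis
  proof (cases "u = 0")
    case False
    then show ?thesis using main f g by blast
  next
    case True
    obtain v where v: "v \<in> S" "v \<noteq> 0"
    proof -
      obtain t where "t \<in> S" "(1, 0) + t \<in> S" using S_group by blast
      moreover have "(1, 0) + t \<noteq> t" by (simp add: prod_eq_iff)
      ultimately show ?thesis using that by metis
    qed
    obtain h where h: "wt v h" "\<exists>x\<in>X. h x \<noteq> 0" using v(1) unfolding S_def by blast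
    have "\<exists>c. \<forall>x\<in>X. (\<lambda>x\<in>X. g x * h x) x = c * (\<lambda>x\<in>X. f x * h x) x"
    proof (rule main)
      show "u + v \<noteq> 0" using True v by simp
      show "wt (u + v) (\<lambda>x\<in>X. f x * h x)" "wt (u + v) (\<lambda>x\<in>X. g x * h x)"
        using wt_mult f(1) g h(1) by blast+
      show "\<exists>x\<in>X. (\<lambda>x\<in>X. f x * h x) x \<noteq> 0" by (rule nz_mult[OF wt_reg[OF f(1)] wt_reg[OF h(1)] f(2) h(2)])
    qed
    then obtain c where c: "\<And>x. x \<in> X \<Longrightarrow> g x * h x = c * (f x * h x)" by auto
    have k: "(\<lambda>x\<in>X. g x + (\<lambda>x\<in>X. (- c) * f x) x) \<in> reg"
      by (rule reg_add[OF wt_reg[OF g] reg_scale[OF wt_reg[OF f(1)]]])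
    have "(\<lambda>x\<in>X. g x + (\<lambda>x\<in>X. (- c) * f x) x) x * h x = 0" if "x \<in> X" for x
      using c[OF that] that by (simp add: algebra_simps)
    from reg_domain[OF k wt_reg[OF h(1)] this] h(2) show ?thesis by (auto intro!: exI[of _ c])
  qed
qed

end

lemma wmonos_ind_props:
  assumes "(w, M) \<in> wmonos X GG" "\<And>u g. (u, g) \<in> GG \<Longrightarrow> P u g" "P 0 (\<lambda>x\<in>X. 1)"
    "\<And>u g w M. P u g \<Longrightarrow> P w M \<Longrightarrow> P (u + w) (\<lambda>x\<in>X. g x * M x)"
  shows "P w M"
  using assms(1) by (induction rule: wmonos.induct) (use assms in blast)+

context toric_algebra
begin

lemma mono_span_weights:
  assumes GG: "\<And>u g. (u, g) \<in> GG \<Longrightarrow> wt u g" and f: "f \<in> mono_span X GG"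
  shows "\<exists>U h. finite U \<and> U \<subseteq> fst ` wmonos X GG \<and> (\<forall>u\<in>U. wt u (h u)) \<and> (\<forall>x\<in>X. f x = (\<Sum>u\<in>U. h u x))"
  using f
proof (induction rule: mono_span.induct)
  case zero
  show ?case by (rule exI[of _ "{}"]) simp
next
  case (step f w M c)
  from step.IH obtain U h where U: "finite U" "U \<subseteq> fst ` wmonos X GG" "\<forall>u\<in>U. wt u (h u)"
    "\<forall>x\<in>X. f x = (\<Sum>u\<in>U. h u x)" by (elim exE conjE) (rule that)
  have M: "wt w M" by (rule wmonos_ind_props[OF step.hyps(2), of wt]) (use GG wt_const wt_mult in auto)
  have cM: "wt w (\<lambda>x\<in>X. c * M x)" by (rule wt_scale[OF M])
  have w: "w \<in> fst ` wmonos X GG" using step.hyps(2) by (rule image_eqI[rotated]) simp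
  define h' where "h' u = (if u = w then (if w \<in> U then (\<lambda>x\<in>X. h w x + (\<lambda>x\<in>X. c * M x) x) else (\<lambda>x\<in>X. c * M x)) else h u)" for u
  have "wt u (h' u)" if "u \<in> insert w U" for u
  proof -
    have "wt w (\<lambda>x\<in>X. h w x + (\<lambda>x\<in>X. c * M x) x)" if "w \<in> U"
    proof (rule wtI)
      have hw: "wt w (h w)" using U(3) that by blast
      show "(\<lambda>x\<in>X. h w x + (\<lambda>x\<in>X. c * M x) x) \<in> reg" by (rule reg_add[OF wt_reg[OF hw] wt_reg[OF cM]])
      fix z x assume z: "z \<in> torus" and x: "x \<in> X"
      show "(\<lambda>x\<in>X. h w x + (\<lambda>x\<in>X. c * M x) x) (\<tau> z x) = cpow w z * (\<lambda>x\<in>X. h w x + (\<lambda>x\<in>X. c * M x) x) x"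
        using wtD[OF hw z x] wtD[OF cM z x] act_closed[OF z x] x by (simp add: distrib_left)
    qed
    then show ?thesis using that U(3) cM by (auto simp: h'_def)
  qed
  moreover have "(\<lambda>x\<in>X. f x + c * M x) x = (\<Sum>u\<in>insert w U. h' u x)" if x: "x \<in> X" for x
  proof -
    have "(\<Sum>u\<in>insert w U. h' u x) = h' w x + (\<Sum>u\<in>U - {w}. h' u x)"
      using U(1) by (simp add: sum.insert_remove)
    also have "(\<Sum>u\<in>U - {w}. h' u x) = (\<Sum>u\<in>U - {w}. h u x)" by (rule sum.cong) (auto simp: h'_def)
    also have "h' w x = (if w \<in> U then h w x else 0) + c * M x" using x by (simp add: h'_def)
    also have "(if w \<in> U then h w x else 0) + c * M x + (\<Sum>u\<in>U - {w}. h u x) = f x + c * M x"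
      using U(1,4) x by (auto simp: sum.remove[of U w])
    finally show ?thesis using x by simp
  qed
  ultimately show ?case using U(1,2) w
    by (intro exI[of _ "insert w U"] exI[of _ h']) simp
qed

text \<open>
  The weight components of a finite system of generators form a finite set \<open>GG\<close>. Its monomials span the
  coordinate ring, so every weight is the weight of a monomial, and every weight vector is a multiple of
  one. As \<open>V\<close> is irreducible, there is a point \<open>x0\<close> where no element of \<open>GG\<close> vanishes; it lies in the open
  orbit.
\<close>

lemma generating_weights:
  obtains G x0 where "finite G" "G \<subseteq> S" "x0 \<in> X"
    "\<And>u f. wt u f \<Longrightarrow> (\<exists>x\<in>X. f x \<noteq> 0) \<Longrightarrow> f x0 \<noteq> 0"
    "\<And>p. \<forall>g\<in>G. dot p g \<ge> 0 \<Longrightarrow> \<forall>u\<in>S. dot p u \<ge> 0"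
proof -
  from reg_generators obtain n :: nat and F where F: "\<forall>i<n. F i \<in> reg"
    "\<forall>C. (\<forall>c. (\<lambda>x\<in>X. c) \<in> C) \<longrightarrow> (\<forall>i<n. F i \<in> C) \<longrightarrow>
      (\<forall>f\<in>C. \<forall>g\<in>C. (\<lambda>x\<in>X. f x + g x) \<in> C \<and> (\<lambda>x\<in>X. f x * g x) \<in> C) \<longrightarrow> reg \<subseteq> C"
    by (elim exE conjE) (rule that)
  define Q where "Q f y \<longleftrightarrow> finite (fst y) \<and> (\<forall>u\<in>fst y. wt u (snd y u)) \<and> (\<forall>x\<in>X. f x = (\<Sum>u\<in>fst y. snd y u x))"
    for f :: "'a \<Rightarrow> complex" and y :: "lattice set \<times> (lattice \<Rightarrow> 'a \<Rightarrow> complex)"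
  have "\<exists>y. Q f y" if f: "f \<in> reg" for f
  proof -
    from weight_decomposition[OF f] obtain U h where "finite U" "\<forall>u\<in>U. wt u (h u)" "\<forall>x\<in>X. f x = (\<Sum>u\<in>U. h u x)"
      by (elim exE conjE) (rule that)
    then have "Q f (U, h)" by (simp add: Q_def)
    then show ?thesis by blast
  qed
  then have "\<forall>i\<in>{..<n}. \<exists>y. Q (F i) y" using F(1) by blast
  from bchoice[OF this] obtain Y where Y: "\<forall>i\<in>{..<n}. Q (F i) (Y i)" ..
  define GG where "GG = {(u, g). \<exists>i<n. u \<in> fst (Y i) \<and> g = snd (Y i) u \<and> (\<exists>x\<in>X. g x \<noteq> 0)}"
  have "GG \<subseteq> (\<Union>i<n. (\<lambda>u. (u, snd (Y i) u)) ` fst (Y i))" by (auto simp: GG_def)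
  moreover have "finite (\<Union>i<n. (\<lambda>u. (u, snd (Y i) u)) ` fst (Y i))" using Y by (auto simp: Q_def)
  ultimately have GGfin: "finite GG" by (rule finite_subset)
  have GGwt: "wt u g" "\<exists>x\<in>X. g x \<noteq> 0" if ug: "(u, g) \<in> GG" for u g
  proof -
    obtain i where i: "i < n" "u \<in> fst (Y i)" "g = snd (Y i) u" "\<exists>x\<in>X. g x \<noteq> 0" using ug unfolding GG_def by blast
    show "\<exists>x\<in>X. g x \<noteq> 0" by (rule i(4))
    show "wt u g" using Y i by (simp add: Q_def)
  qed
  have "(\<lambda>x\<in>X. \<Prod>i\<in>GG. snd i x) \<in> reg \<and> (\<exists>x\<in>X. (\<Prod>i\<in>GG. snd i x) \<noteq> 0)"
    by (rule reg_domain_prod[OF GGfin]) (use GGwt wt_reg in \<open>metis prod.collapse\<close>)+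
  then obtain x0 where x0: "x0 \<in> X" "(\<Prod>i\<in>GG. snd i x0) \<noteq> 0" by blast
  have GGx0: "g x0 \<noteq> 0" if "(u, g) \<in> GG" for u g using x0(2) GGfin that by force
  have reg_span: "reg \<subseteq> mono_span X GG"
  proof (rule F(2)[rule_format])
    show "(\<lambda>x\<in>X. c) \<in> mono_span X GG" for c
    proof -
      have "(\<lambda>x\<in>X. c * (\<lambda>x\<in>X. 1) x) = (\<lambda>x\<in>X. c)" by (rule restrict_ext) simp
      then show ?thesis using mono_span_wmonos[OF wmonos.one, of c X GG] by (simp only:)
    qed
    show "(\<lambda>x\<in>X. f x + g x) \<in> mono_span X GG \<and> (\<lambda>x\<in>X. f x * g x) \<in> mono_span X GG"
      if "f \<in> mono_span X GG" "g \<in> mono_span X GG" for f g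
      by (rule conjI[OF mono_span_add[OF that(2,1)] mono_span_mult[OF that(2,1)]])
    show "F i \<in> mono_span X GG" if i: "i < n" for i
    proof -
      have Yi: "finite (fst (Y i))" "\<forall>u\<in>fst (Y i). wt u (snd (Y i) u)"
        "\<forall>x\<in>X. F i x = (\<Sum>u\<in>fst (Y i). snd (Y i) u x)" using Y i by (simp_all add: Q_def)
      have h: "snd (Y i) u \<in> mono_span X GG" if u: "u \<in> fst (Y i)" for u
      proof -
       have "wt u (snd (Y i) u)" using Yi(2) u by (rule bspec)
       then have ext: "snd (Y i) u \<in> extensional X" by (rule reg_ext[OF wt_reg])
       show ?thesis
       proof (cases "\<exists>x\<in>X. snd (Y i) u x \<noteq> 0")
        case True
        then have "(u, snd (Y i) u) \<in> GG" using i u by (auto simp: GG_def)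
        from mono_span_wmonos[OF wmonos.mult[OF this wmonos.one], of 1]
        have "(\<lambda>x\<in>X. 1 * (\<lambda>x\<in>X. snd (Y i) u x * (\<lambda>x\<in>X. 1) x) x) \<in> mono_span X GG" .
        moreover have "(\<lambda>x\<in>X. 1 * (\<lambda>x\<in>X. snd (Y i) u x * (\<lambda>x\<in>X. 1) x) x) = snd (Y i) u"
          by (rule extensionalityI[OF restrict_extensional ext]) simp
        ultimately show ?thesis by (simp only:)
      next
        case False
        have "snd (Y i) u = (\<lambda>x\<in>X. 0)"
          by (rule extensionalityI[OF ext restrict_extensional]) (use False in simp)
        then show ?thesis using mono_span.zero by (simp only:)
       qed
      qed
      have "(\<lambda>x\<in>X. \<Sum>u\<in>U. snd (Y i) u x) \<in> mono_span X GG" if "finite U" "U \<subseteq> fst (Y i)" for U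
        using that
      proof (induction U rule: finite_induct)
        case empty
        show ?case unfolding sum.empty by (rule mono_span.zero)
      next
        case (insert u U)
        have "(\<lambda>x\<in>X. snd (Y i) u x + (\<lambda>x\<in>X. \<Sum>u\<in>U. snd (Y i) u x) x) =
            (\<lambda>x\<in>X. \<Sum>u\<in>insert u U. snd (Y i) u x)"
          by (rule restrict_ext) (use insert.hyps in simp)
        moreover have "(\<lambda>x\<in>X. snd (Y i) u x + (\<lambda>x\<in>X. \<Sum>u\<in>U. snd (Y i) u x) x) \<in> mono_span X GG"
          by (rule mono_span_add) (use insert h in blast)+
        ultimately show ?case by (simp only:)
      qed
      from this[OF Yi(1) order_refl] have "(\<lambda>x\<in>X. \<Sum>u\<in>fst (Y i). snd (Y i) u x) \<in> mono_span X GG" .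
      moreover have "F i = (\<lambda>x\<in>X. \<Sum>u\<in>fst (Y i). snd (Y i) u x)"
        by (rule extensionalityI[of _ X]) (use F(1) i reg_ext Yi(3) in auto)
      ultimately show ?thesis by (simp only:)
    qed
  qed
  have mono_ex: "\<exists>M. (w, M) \<in> wmonos X GG" if w: "wt w f" "\<exists>x\<in>X. f x \<noteq> 0" for w f
  proof -
    have "f \<in> mono_span X GG" using reg_span wt_reg[OF w(1)] by blast
    have "\<exists>U h. finite U \<and> U \<subseteq> fst ` wmonos X GG \<and> (\<forall>u\<in>U. wt u (h u)) \<and> (\<forall>x\<in>X. f x = (\<Sum>u\<in>U. h u x))"
      by (rule mono_span_weights[OF _ \<open>f \<in> mono_span X GG\<close>]) (rule GGwt(1))
    then obtain U h where U: "finite U" "U \<subseteq> fst ` wmonos X GG"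
      "\<forall>u\<in>U. wt u (h u)" "\<forall>x\<in>X. f x = (\<Sum>u\<in>U. h u x)" by (elim exE conjE) (rule that)
    have "w \<in> U"
    proof (rule ccontr)
      assume nw: "w \<notin> U"
      obtain x where x: "x \<in> X" "f x \<noteq> 0" using w(2) by blast
      define c where "c u = (if u = w then - f x else h u x)" for u
      have "(\<Sum>u\<in>insert w U. c u * cpow u z) = 0" if z: "z \<in> torus" for z
      proof -
        have "(\<Sum>u\<in>insert w U. c u * cpow u z) = - (f x * cpow w z) + (\<Sum>u\<in>U. c u * cpow u z)"
          using U(1) nw by (simp add: c_def)
        also have "(\<Sum>u\<in>U. c u * cpow u z) = (\<Sum>u\<in>U. h u (\<tau> z x))"
        proof (rule sum.cong[OF refl])
          fix u assume u: "u \<in> U"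
          then have "u \<noteq> w" using nw by blast
          then show "c u * cpow u z = h u (\<tau> z x)"
            using wtD[OF bspec[OF U(3) u] z x(1)] by (simp add: c_def mult.commute)
        qed
        also have "\<dots> = f (\<tau> z x)" using U(4) act_closed[OF z x(1)] by simp
        also have "\<dots> = cpow w z * f x" by (rule wtD[OF w(1) z x(1)])
        finally show ?thesis by simp
      qed
      from cpow_independent_single[OF _ this, of w] have "c w = 0" using U(1) by simp
      then show False using x by (simp add: c_def)
    qed
    then show ?thesis using U(2) by force
  qed
  have monoP: "wt w M \<and> M x0 \<noteq> 0" if M: "(w, M) \<in> wmonos X GG" for w M
    by (rule wmonos_ind_props[OF M, of "\<lambda>w M. wt w M \<and> M x0 \<noteq> 0"])
      (use GGwt GGx0 wt_const wt_mult x0 in auto)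
  have nz0: "f x0 \<noteq> 0" if f: "wt u f" "\<exists>x\<in>X. f x \<noteq> 0" for u f
  proof -
    obtain M where M: "(u, M) \<in> wmonos X GG" using mono_ex[OF f] by blast
    have Mw: "wt u M" "M x0 \<noteq> 0" using monoP[OF M] by auto
    then have "\<exists>x\<in>X. M x \<noteq> 0" using x0(1) by blast
    from weight_space_one_dim[OF Mw(1) this f(1)] obtain c where c: "\<forall>x\<in>X. f x = c * M x" by blast
    then have "c \<noteq> 0" using f(2) by auto
    then show ?thesis using c x0(1) Mw(2) by simp
  qed
  have pos: "\<forall>u\<in>S. dot p u \<ge> 0" if p: "\<forall>g\<in>fst ` GG. dot p g \<ge> 0" for p
  proof
    fix u assume "u \<in> S"
    then obtain M where M: "(u, M) \<in> wmonos X GG" using mono_ex unfolding S_def by blast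
    show "dot p u \<ge> 0"
    proof (rule wmonos_ind_props[OF M, of "\<lambda>u _. dot p u \<ge> 0"])
      show "dot p u \<ge> 0" if "(u, g) \<in> GG" for u g
      proof -
        have "u \<in> fst ` GG" using that by (rule image_eqI[rotated]) simp
        with p show ?thesis by (rule bspec)
      qed
    qed simp_all
  qed
  show ?thesis
  proof (rule that)
    show "finite (fst ` GG)" using GGfin by simp
    show "fst ` GG \<subseteq> S" using GGwt S_I by force
  qed (use x0(1) nz0 pos in blast)+
qed

lemma ring_pow: "f \<in> reg \<Longrightarrow> f [^]\<^bsub>coordinate_ring V\<^esub> (k :: nat) = (\<lambda>x\<in>X. f x ^ k)"
proof (induction k)
  case 0
  interpret domain "coordinate_ring V" by (rule dom)
  show ?case unfolding nat_pow_0 by (simp only: cr power_0)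
next
  case (Suc k)
  interpret domain "coordinate_ring V" by (rule dom)
  show ?case unfolding nat_pow_Suc Suc.IH[OF Suc.prems] by (simp only: cr) (rule restrict_ext, simp)
qed

lemma reg_pow: "f \<in> reg \<Longrightarrow> (\<lambda>x\<in>X. f x ^ k) \<in> reg"
proof (induction k)
  case 0
  show ?case unfolding power_0 by (rule reg_const)
next
  case (Suc k)
  have "(\<lambda>x\<in>X. f x * (\<lambda>x\<in>X. f x ^ k) x) \<in> reg" by (rule reg_mult) (use Suc in blast)+
  then show ?case unfolding restrict_times_right power_Suc .
qed

text \<open>
  Write \<open>u = (u + b) - b\<close> with weights \<open>u + b\<close> and \<open>b\<close>, and take weight vectors \<open>fa\<close>, \<open>fb\<close> and \<open>fk\<close> of weights \<open>u + b\<close>,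
  \<open>b\<close> and \<open>k * u\<close>. Since weight spaces are one-dimensional, the \<open>k\<close>-th power of the fraction \<open>fa / fb\<close> is a
  multiple of \<open>fk\<close>. So the fraction is integral over the coordinate ring, hence regular, and it
  has weight \<open>u\<close>.
\<close>

lemma S_saturated:
  assumes k: "k > 0" "smul k u \<in> S" shows "u \<in> S"
proof -
  obtain n where n: "k = int n" "n > 0" using k(1) by (metis pos_int_cases)
  obtain b where b: "b \<in> S" "u + b \<in> S" using S_group by blast
  obtain fa fb fk where fa: "wt (u + b) fa" "\<exists>x\<in>X. fa x \<noteq> 0" and fb: "wt b fb" "\<exists>x\<in>X. fb x \<noteq> 0"
    and fk: "wt (smul k u) fk" "\<exists>x\<in>X. fk x \<noteq> 0" using b k(2) unfolding S_def by blast
  note ra = wt_reg[OF fa(1)] and rb = wt_reg[OF fb(1)] and rk = wt_reg[OF fk(1)]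
  have wpow: "wt (smul (int n) v) (\<lambda>x\<in>X. f x ^ n)" if f: "wt v f" for v f n
  proof (rule wtI[OF reg_pow[OF wt_reg[OF f]]])
    fix z x assume "z \<in> torus" "x \<in> X"
    then show "(\<lambda>x\<in>X. f x ^ n) (\<tau> z x) = cpow (smul (int n) v) z * (\<lambda>x\<in>X. f x ^ n) x"
      using wtD[OF f] act_closed by (simp add: cpow_smul_nat power_mult_distrib del: mem_Sigma_iff)
  qed
  have nzpow: "\<exists>x\<in>X. (\<lambda>x\<in>X. f x ^ n) x \<noteq> 0" if nz: "\<exists>x\<in>X. f x \<noteq> 0" for f :: "'a \<Rightarrow> complex" and n
  proof -
    obtain x where "x \<in> X" "f x \<noteq> 0" using nz by blast
    then have "(\<lambda>x\<in>X. f x ^ n) x \<noteq> 0" by simp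
    then show ?thesis using \<open>x \<in> X\<close> by (rule bexI)
  qed
  have w1: "wt (smul k u + smul (int n) b) (\<lambda>x\<in>X. fk x * (\<lambda>x\<in>X. fb x ^ n) x)"
    by (rule wt_mult[OF fk(1) wpow[OF fb(1)]])
  have w1nz: "\<exists>x\<in>X. (\<lambda>x\<in>X. fk x * (\<lambda>x\<in>X. fb x ^ n) x) x \<noteq> 0"
    by (rule nz_mult[OF rk wt_reg[OF wpow[OF fb(1)]] fk(2) nzpow[OF fb(2)]])
  have w2: "wt (smul k u + smul (int n) b) (\<lambda>x\<in>X. fa x ^ n)"
    using wpow[OF fa(1), of n] by (simp only: n(1) smul_add(3))
  obtain c where c: "\<And>x. x \<in> X \<Longrightarrow> fa x ^ n = c * (fk x * fb x ^ n)"
    using weight_space_one_dim[OF w1 w1nz w2] by auto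
  define c0 where "c0 = (\<lambda>x\<in>X. (- c) * fk x)"
  have c0: "c0 \<in> reg" unfolding c0_def by (rule reg_scale[OF rk])
  define R where "R = coordinate_ring V"
  interpret domain R unfolding R_def by (rule dom)
  have crR: "carrier R = reg" "\<And>f g. f \<otimes>\<^bsub>R\<^esub> g = (\<lambda>x\<in>X. f x * g x)" "\<And>f g. f \<oplus>\<^bsub>R\<^esub> g = (\<lambda>x\<in>X. f x + g x)"
    "\<zero>\<^bsub>R\<^esub> = (\<lambda>x\<in>X. 0)" by (simp_all only: R_def cr)
  have powR: "f [^]\<^bsub>R\<^esub> (j :: nat) = (\<lambda>x\<in>X. f x ^ j)" if "f \<in> reg" for f j
    unfolding R_def by (rule ring_pow[OF that])
  \<comment> \<open>The coefficients of the monic equation \<open>X^n - c * fk = 0\<close> of the fraction \<open>fa / fb\<close>.\<close>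
  define cc where "cc i = (if i = (0::nat) then c0 else \<zero>\<^bsub>R\<^esub>)" for i
  define t where "t i = cc i \<otimes>\<^bsub>R\<^esub> (fa [^]\<^bsub>R\<^esub> i \<otimes>\<^bsub>R\<^esub> fb [^]\<^bsub>R\<^esub> (n - i))" for i
  have inR: "fa \<in> carrier R" "fb \<in> carrier R" "c0 \<in> carrier R" using ra rb c0 by (simp_all only: crR)
  have ccR: "cc i \<in> carrier R" for i using inR by (simp add: cc_def)
  have tR: "t i \<in> carrier R" for i using ccR inR by (simp add: t_def)
  have "(\<Oplus>\<^bsub>R\<^esub>i\<in>{..<n}. t i) = (\<Oplus>\<^bsub>R\<^esub>i\<in>{..<n}. if 0 = i then t i else \<zero>\<^bsub>R\<^esub>)"
    by (rule add.finprod_cong') (use tR inR in \<open>auto simp: t_def cc_def\<close>)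
  also have "\<dots> = t 0" by (rule finsum_singleton) (use n tR in auto)
  finally have fs: "(\<Oplus>\<^bsub>R\<^esub>i\<in>{..<n}. cc i \<otimes>\<^bsub>R\<^esub> (fa [^]\<^bsub>R\<^esub> i \<otimes>\<^bsub>R\<^esub> fb [^]\<^bsub>R\<^esub> (n - i))) = t 0" by (simp only: t_def)
  have "fa [^]\<^bsub>R\<^esub> n \<oplus>\<^bsub>R\<^esub> t 0 = \<zero>\<^bsub>R\<^esub>"
  proof -
    have t0: "t 0 = (\<lambda>x\<in>X. c0 x * (\<lambda>x\<in>X. (\<lambda>x\<in>X. fa x ^ 0) x * (\<lambda>x\<in>X. fb x ^ n) x) x)"
      unfolding t_def cc_def by (simp only: if_True refl powR[OF ra] powR[OF rb] crR diff_zero)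
    show ?thesis unfolding t0 powR[OF ra] crR
      by (rule restrict_ext) (simp add: c c0_def)
  qed
  then have eqn: "\<exists>(n::nat) c. c \<in> {..<n} \<rightarrow> carrier R \<and> fa [^]\<^bsub>R\<^esub> n \<oplus>\<^bsub>R\<^esub>
      (\<Oplus>\<^bsub>R\<^esub>i\<in>{..<n}. c i \<otimes>\<^bsub>R\<^esub> (fa [^]\<^bsub>R\<^esub> i \<otimes>\<^bsub>R\<^esub> fb [^]\<^bsub>R\<^esub> (n - i))) = \<zero>\<^bsub>R\<^esub>"
    using fs ccR by (intro exI[of _ n] exI[of _ cc]) (simp only: Pi_I simp_thms)
  have "fb \<noteq> \<zero>\<^bsub>R\<^esub>" unfolding crR using fb(2) by auto
  then have "fb \<in> carrier R - {\<zero>\<^bsub>R\<^esub>}" using inR by blast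
  with normal[folded R_def] eqn inR(1) have "fb divides\<^bsub>R\<^esub> fa"
    unfolding integrally_closed_def by blast
  then obtain q where q: "q \<in> reg" "fa = (\<lambda>x\<in>X. fb x * q x)" unfolding factor_def crR by blast
  from weight_decomposition[OF q(1)] obtain U h where U: "finite U" "\<forall>v\<in>U. wt v (h v)"
    "\<forall>x\<in>X. q x = (\<Sum>v\<in>U. h v x)" by (elim exE conjE) (rule that)
  obtain x where x: "x \<in> X" "fa x \<noteq> 0" using fa(2) by blast
  \<comment> \<open>The component of weight \<open>u\<close> of the quotient \<open>q\<close> is not zero: compare the characters in \<open>fa = fb * q\<close>, with
    the index \<open>None\<close> for the left hand side.\<close>
  define w where "w i = (case i of None \<Rightarrow> u + b | Some v \<Rightarrow> b + v)" for i
  define d where "d i = (case i of None \<Rightarrow> - fa x | Some v \<Rightarrow> fb x * h v x)" for i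
  have "(\<Sum>i\<in>insert None (Some ` U). d i * cpow (w i) z) = 0" if z: "z \<in> torus" for z
  proof -
    have zx: "\<tau> z x \<in> X" by (rule act_closed[OF z x(1)])
    have "(\<Sum>i\<in>insert None (Some ` U). d i * cpow (w i) z) =
        - (cpow (u + b) z * fa x) + (\<Sum>v\<in>U. fb x * h v x * cpow (b + v) z)"
      using U(1) by (subst sum.insert) (auto simp: d_def w_def sum.reindex)
    also have "(\<Sum>v\<in>U. fb x * h v x * cpow (b + v) z) = (\<Sum>v\<in>U. fb (\<tau> z x) * h v (\<tau> z x))"
    proof (rule sum.cong[OF refl])
      fix v assume v: "v \<in> U"
      have hv: "h v (\<tau> z x) = cpow v z * h v x" by (rule wtD[OF bspec[OF U(2) v] z x(1)])
      show "fb x * h v x * cpow (b + v) z = fb (\<tau> z x) * h v (\<tau> z x)"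
        unfolding hv wtD[OF fb(1) z x(1)] cpow_add[OF z] by (simp only: mult_ac)
    qed
    also have "\<dots> = fa (\<tau> z x)" using zx U(3) q(2) by (simp add: sum_distrib_left)
    also have "\<dots> = cpow (u + b) z * fa x" by (rule wtD[OF fa(1) z x(1)])
    finally show ?thesis by simp
  qed
  from cpow_independent[OF _ this, of "u + b"] have
    z0: "(\<Sum>i\<in>{i \<in> insert None (Some ` U). w i = u + b}. d i) = 0" using U(1) by simp
  have "u \<in> U \<and> h u x \<noteq> 0"
  proof (rule ccontr)
    assume no: "\<not> ?thesis"
    have "(\<Sum>i\<in>{i \<in> insert None (Some ` U). w i = u + b}. d i) = (\<Sum>i\<in>{None}. d i)"
    proof (rule sum.mono_neutral_right)
      show "\<forall>i\<in>{i \<in> insert None (Some ` U). w i = u + b} - {None}. d i = 0"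
      proof
        fix i assume "i \<in> {i \<in> insert None (Some ` U). w i = u + b} - {None}"
        then obtain v where v: "i = Some v" "v \<in> U" "b + v = u + b" by (auto simp: w_def)
        then have "v = u" by (simp add: add.commute)
        then show "d i = 0" using no v by (simp add: d_def)
      qed
    qed (use U(1) in \<open>auto simp: w_def\<close>)
    then show False using z0 x(2) by (simp add: d_def)
  qed
  then show "u \<in> S" using S_I[of u "h u" x] U(2) x(1) by blast
qed

lemma S_is_cone: "\<exists>p1 p2 b1 b2. plane_cone S p1 p2 b1 b2"
proof -
  obtain G x0 where G: "finite G" "G \<subseteq> S" "\<And>p. \<forall>g\<in>G. dot p g \<ge> 0 \<Longrightarrow> \<forall>u\<in>S. dot p u \<ge> 0"
    using generating_weights by metis
  interpret saturated_semigroup S G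
    by unfold_locales (use S_zero S_add S_saturated S_group G in blast)+
  show ?thesis by (rule is_plane_cone)
qed

end

section \<open>Additive functions on semigroups and endomorphisms of coordinate rings\<close>

text \<open>
  An additive function on \<open>S\<close> extends to the group generated by \<open>S\<close>, which is the whole lattice. Positive and
  negative parts of the coordinates of \<open>u\<close> keep the computation inside \<open>S\<close>.
\<close>

lemma additive_is_dot:
  fixes kk :: "lattice \<Rightarrow> int"
  assumes zero: "0 \<in> S" and S_add: "\<And>u v. u \<in> S \<Longrightarrow> v \<in> S \<Longrightarrow> u + v \<in> S"
    and gen: "\<And>w. \<exists>t\<in>S. w + t \<in> S"
    and add: "\<And>u v. u \<in> S \<Longrightarrow> v \<in> S \<Longrightarrow> kk (u + v) = kk u + kk v"
  shows "\<exists>q. \<forall>u\<in>S. kk u = dot q u"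
proof -
  obtain a b where a: "a \<in> S" "(1, 0) + a \<in> S" and b: "b \<in> S" "(0, 1) + b \<in> S" using gen by metis
  have kk0: "kk 0 = 0" using add[OF zero zero] by simp
  have mult: "smul (int n) u \<in> S \<and> kk (smul (int n) u) = int n * kk u" if u: "u \<in> S" for n u
  proof (induction n)
    case 0
    show ?case using zero kk0 by simp
  next
    case (Suc n)
    have "smul (int (Suc n)) u = smul (int n) u + u" by (simp add: smul_add add.commute)
    then show ?case using Suc S_add u add by (simp add: algebra_simps)
  qed
  define q where "q = (kk ((1, 0) + a) - kk a, kk ((0, 1) + b) - kk b)"
  have "kk u = dot q u" if u: "u \<in> S" for u
  proof -
    let ?p1 = "int (nat (fst u))" and ?m1 = "int (nat (- fst u))"
      and ?p2 = "int (nat (snd u))" and ?m2 = "int (nat (- snd u))"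
    have e: "?p1 = ?m1 + fst u" "?p2 = ?m2 + snd u" by simp_all
    have eq: "u + (smul ?p1 a + (smul ?m1 ((1, 0) + a) + (smul ?p2 b + smul ?m2 ((0, 1) + b)))) =
        smul ?p1 ((1, 0) + a) + (smul ?m1 a + (smul ?p2 ((0, 1) + b) + smul ?m2 b))"
      unfolding e by (simp add: prod_eq_iff smul_def algebra_simps)
    note m = mult[OF a(1), THEN conjunct1] mult[OF a(2), THEN conjunct1]
      mult[OF b(1), THEN conjunct1] mult[OF b(2), THEN conjunct1]
    note k = mult[OF a(1), THEN conjunct2] mult[OF a(2), THEN conjunct2]
      mult[OF b(1), THEN conjunct2] mult[OF b(2), THEN conjunct2]
    have "kk (u + (smul ?p1 a + (smul ?m1 ((1, 0) + a) + (smul ?p2 b + smul ?m2 ((0, 1) + b))))) =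
        kk u + (?p1 * kk a + (?m1 * kk ((1, 0) + a) + (?p2 * kk b + ?m2 * kk ((0, 1) + b))))"
      by (simp only: add u m S_add k)
    moreover have "kk (smul ?p1 ((1, 0) + a) + (smul ?m1 a + (smul ?p2 ((0, 1) + b) + smul ?m2 b))) =
        ?p1 * kk ((1, 0) + a) + (?m1 * kk a + (?p2 * kk ((0, 1) + b) + ?m2 * kk b))"
      by (simp only: add m S_add k)
    ultimately have "kk u = (?p1 - ?m1) * (kk ((1, 0) + a) - kk a) + (?p2 - ?m2) * (kk ((0, 1) + b) - kk b)"
      unfolding eq by (simp add: algebra_simps)
    also have "\<dots> = dot q u" unfolding e by (simp add: q_def dot_def mult.commute)
    finally show ?thesis .
  qed
  then show ?thesis by blast
qed

context variety_algebra
begin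

lemma endomorphism_is_pullback:
  assumes add: "\<And>f g x. f \<in> reg \<Longrightarrow> g \<in> reg \<Longrightarrow> x \<in> X \<Longrightarrow> \<theta> (\<lambda>x\<in>X. f x + g x) x = \<theta> f x + \<theta> g x"
    and mult: "\<And>f g x. f \<in> reg \<Longrightarrow> g \<in> reg \<Longrightarrow> x \<in> X \<Longrightarrow> \<theta> (\<lambda>x\<in>X. f x * g x) x = \<theta> f x * \<theta> g x"
    and const: "\<And>c x. x \<in> X \<Longrightarrow> \<theta> (\<lambda>x\<in>X. c) x = (c :: complex)"
  shows "\<exists>\<alpha>. \<forall>x\<in>X. \<alpha> x \<in> X \<and> (\<forall>f\<in>reg. f (\<alpha> x) = \<theta> f x)"
proof -
  have "\<exists>y. y \<in> X \<and> (\<forall>f\<in>reg. f y = \<theta> f x)" if x: "x \<in> X" for x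
  proof -
    have "\<exists>y\<in>X. \<forall>f\<in>reg. \<theta> f x = f y"
      by (rule point_of_character) (use add mult const x in blast)+
    then obtain y where "y \<in> X" "\<forall>f\<in>reg. \<theta> f x = f y" by (elim bexE)
    then show ?thesis by (intro exI[of _ y]) simp
  qed
  then have "\<forall>x\<in>X. \<exists>y. y \<in> X \<and> (\<forall>f\<in>reg. f y = \<theta> f x)" by (intro ballI)
  from bchoice[OF this] show ?thesis .
qed

end

section \<open>The algebra of a toric surface as a semigroup algebra\<close>

text \<open>
  One weight vector for every weight, normalized at a base point of the open orbit. By this normalization
  they multiply like characters.
\<close>

locale toric_coordinates = toric_algebra V \<tau> for V :: "'a variety" and \<tau> +
  fixes x0 :: 'a and \<chi> :: "lattice \<Rightarrow> 'a \<Rightarrow> complex"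
  assumes x0: "x0 \<in> points V"
    and \<chi>_wt: "u \<in> S \<Longrightarrow> wt u (\<chi> u)" and \<chi>_x0: "u \<in> S \<Longrightarrow> \<chi> u x0 = 1"
begin

lemma \<chi>_reg: "u \<in> S \<Longrightarrow> \<chi> u \<in> reg" by (rule wt_reg[OF \<chi>_wt])

lemma \<chi>_nz: "u \<in> S \<Longrightarrow> \<exists>x\<in>X. \<chi> u x \<noteq> 0" 
proof (rule bexI[OF _ x0])
  show "u \<in> S \<Longrightarrow> \<chi> u x0 \<noteq> 0" by (simp add: \<chi>_x0)
qed

lemma wt_conv_\<chi>:
  assumes "u \<in> S" "wt u f" "x \<in> X" shows "f x = f x0 * \<chi> u x"
proof -
  from weight_space_one_dim[OF \<chi>_wt[OF assms(1)] \<chi>_nz[OF assms(1)] assms(2)]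
  obtain c where c: "\<forall>x\<in>X. f x = c * \<chi> u x" ..
  then show ?thesis using x0 \<chi>_x0[OF assms(1)] assms(3) by simp
qed

lemma \<chi>_add: assumes "u \<in> S" "v \<in> S" "x \<in> X" shows "\<chi> (u + v) x = \<chi> u x * \<chi> v x"
  using wt_conv_\<chi>[OF S_add[OF assms(1,2)] wt_mult[OF \<chi>_wt[OF assms(1)] \<chi>_wt[OF assms(2)]] assms(3)]
    x0 \<chi>_x0 assms by simp

lemma \<chi>_zero: assumes "x \<in> X" shows "\<chi> 0 x = 1"
  using wt_conv_\<chi>[OF S_zero wt_const[of 1] assms] x0 assms by simp

text \<open>
  The isomorphism from \<open>Alg S\<close> to the coordinate ring.
\<close>

definition \<Phi> :: "laurent \<Rightarrow> 'a \<Rightarrow> complex" where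
  "\<Phi> F = (\<lambda>x\<in>X. \<Sum>u\<in>keys F. lookup F u * \<chi> u x)"

lemma \<Phi>_superset:
  assumes "finite U" "keys F \<subseteq> U" "x \<in> X" shows "\<Phi> F x = (\<Sum>u\<in>U. lookup F u * \<chi> u x)"
proof -
  have "(\<Sum>u\<in>keys F. lookup F u * \<chi> u x) = (\<Sum>u\<in>U. lookup F u * \<chi> u x)"
    by (rule sum.mono_neutral_left) (use assms in \<open>auto simp: in_keys_iff\<close>)
  then show ?thesis using assms(3) by (simp add: \<Phi>_def)
qed

lemma \<Phi>_add: assumes "x \<in> X" shows "\<Phi> (F + G) x = \<Phi> F x + \<Phi> G x"
proof -
  let ?U = "keys F \<union> keys G"
  have "\<Phi> (F + G) x = (\<Sum>u\<in>?U. lookup (F + G) u * \<chi> u x)"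
    by (rule \<Phi>_superset[OF _ keys_add assms]) simp
  moreover have "\<Phi> F x = (\<Sum>u\<in>?U. lookup F u * \<chi> u x)" "\<Phi> G x = (\<Sum>u\<in>?U. lookup G u * \<chi> u x)"
    by (rule \<Phi>_superset; use assms in simp)+
  ultimately show ?thesis by (simp add: lookup_add distrib_right sum.distrib)
qed

lemma \<Phi>_single: assumes "x \<in> X" shows "\<Phi> (Poly_Mapping.single u c) x = c * \<chi> u x"
  using \<Phi>_superset[of "{u}" "Poly_Mapping.single u c" x] assms by simp

lemma \<Phi>_0: assumes "x \<in> X" shows "\<Phi> 0 x = 0" using assms by (simp add: \<Phi>_def)

lemma \<Phi>_sum: assumes "finite I" "x \<in> X" shows "\<Phi> (sum H I) x = (\<Sum>i\<in>I. \<Phi> (H i) x)"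
  using assms(1) by (induction I rule: finite_induct) (simp_all add: \<Phi>_0 \<Phi>_add assms(2))

lemma \<Phi>_ext: "\<Phi> F \<in> extensional X" unfolding \<Phi>_def by (rule restrict_extensional)

lemma \<Phi>_reg: assumes "F \<in> Alg S" shows "\<Phi> F \<in> reg"
proof -
  have "(\<lambda>x\<in>X. \<Sum>u\<in>keys F. (\<lambda>x\<in>X. lookup F u * \<chi> u x) x) \<in> reg"
    by (rule reg_sum) (use assms reg_scale \<chi>_reg in \<open>unfold Alg_def, blast intro: finite_keys\<close>)+
  moreover have "(\<lambda>x\<in>X. \<Sum>u\<in>keys F. (\<lambda>x\<in>X. lookup F u * \<chi> u x) x) = \<Phi> F"
    unfolding \<Phi>_def by (rule restrict_ext) simp
  ultimately show ?thesis by (simp only:)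
qed

lemma \<Phi>_cst: "x \<in> X \<Longrightarrow> \<Phi> (cst c) x = c" by (simp add: \<Phi>_single \<chi>_zero)

lemma \<Phi>_mult:
  assumes "F \<in> Alg S" "G \<in> Alg S" "x \<in> X" shows "\<Phi> (F * G) x = \<Phi> F x * \<Phi> G x"
proof -
  have "keys F \<subseteq> S" using assms(1) by (simp add: Alg_def)
  then show ?thesis
  proof (induction F rule: laurent_induct)
    case (single u c)
    have "keys G \<subseteq> S" using assms(2) by (simp add: Alg_def)
    then show ?case
    proof (induction G rule: laurent_induct)
      case (single v d)
      then show ?case using \<chi>_add[OF \<open>u \<in> S\<close> single assms(3)]
        by (simp add: mult_single \<Phi>_single assms(3))
    next
      case (add f g)
      then show ?case by (simp add: \<Phi>_add assms(3) distrib_left)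
    qed (simp add: \<Phi>_0 assms(3))
  next
    case (add f g)
    then show ?case by (simp add: \<Phi>_add assms(3) distrib_right)
  qed (simp add: \<Phi>_0 assms(3))
qed

text \<open>
  On the orbit of the base point, \<open>\<Phi> F\<close> is the Laurent polynomial \<open>F\<close>.
\<close>

lemma \<Phi>_eq_0D: assumes F: "F \<in> Alg S" and 0: "\<And>x. x \<in> X \<Longrightarrow> \<Phi> F x = 0" shows "F = 0"
proof (rule poly_mapping_eqI)
  fix v
  have "(\<Sum>u\<in>keys F. lookup F u * cpow u z) = 0" if z: "z \<in> torus" for z
  proof -
    have "\<Phi> F (\<tau> z x0) = (\<Sum>u\<in>keys F. lookup F u * \<chi> u (\<tau> z x0))"
      by (rule \<Phi>_superset) (use act_closed[OF z x0] in auto)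
    also have "\<dots> = (\<Sum>u\<in>keys F. lookup F u * cpow u z)"
    proof (rule sum.cong[OF refl])
      fix u assume "u \<in> keys F"
      then have u: "u \<in> S" using F unfolding Alg_def by blast
      show "lookup F u * \<chi> u (\<tau> z x0) = lookup F u * cpow u z"
        using wtD[OF \<chi>_wt[OF u] z x0] \<chi>_x0[OF u] by simp
    qed
    finally show ?thesis using 0[OF act_closed[OF z x0]] by simp
  qed
  from cpow_independent_single[OF finite_keys this, of v] show "lookup F v = lookup 0 v"
    by (cases "v \<in> keys F") (auto simp: in_keys_iff)
qed

lemma Alg_diff: "F \<in> Alg S \<Longrightarrow> G \<in> Alg S \<Longrightarrow> F - G \<in> Alg S"
  by (simp add: Alg_def keys_diff_subset)

lemma \<Phi>_inject: assumes "F \<in> Alg S" "G \<in> Alg S" "\<And>x. x \<in> X \<Longrightarrow> \<Phi> F x = \<Phi> G x" shows "F = G"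
proof -
  have "\<Phi> (F - G) x = 0" if "x \<in> X" for x using \<Phi>_add[OF that, of "F - G" G] assms(3)[OF that] by simp
  then have "F - G = 0" by (rule \<Phi>_eq_0D[OF Alg_diff[OF assms(1,2)]])
  then show ?thesis by simp
qed

lemma \<Phi>_surj: assumes f: "f \<in> reg" shows "\<exists>F\<in>Alg S. \<Phi> F = f"
proof -
  from weight_decomposition[OF f] obtain U h where U: "finite U" "\<forall>u\<in>U. wt u (h u)"
    "\<forall>x\<in>X. f x = (\<Sum>u\<in>U. h u x)" by (elim exE conjE) (rule that)
  define F where "F = (\<Sum>u\<in>U \<inter> S. Poly_Mapping.single u (h u x0))"
  have "keys F \<subseteq> S" unfolding F_def by (rule keys_sum_subset) simp
  moreover have "\<Phi> F x = f x" if x: "x \<in> X" for x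
  proof -
    have "\<Phi> F x = (\<Sum>u\<in>U \<inter> S. h u x0 * \<chi> u x)"
      unfolding F_def using U(1) x by (simp add: \<Phi>_sum \<Phi>_single)
    also have "\<dots> = (\<Sum>u\<in>U \<inter> S. h u x)"
    proof (rule sum.cong[OF refl])
      fix u assume "u \<in> U \<inter> S"
      then have u: "u \<in> S" "wt u (h u)" using U(2) by blast+
      show "h u x0 * \<chi> u x = h u x" by (rule wt_conv_\<chi>[OF u x, symmetric])
    qed
    also have "\<dots> = (\<Sum>u\<in>U. h u x)"
    proof (rule sum.mono_neutral_left[OF U(1)])
      show "\<forall>u\<in>U - U \<inter> S. h u x = 0"
      proof
        fix u assume u: "u \<in> U - U \<inter> S"
        show "h u x = 0"
        proof (rule ccontr)
          assume "h u x \<noteq> 0"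
          then have "u \<in> S" using S_I[of u "h u" x] U(2) u x by blast
          then show False using u by blast
        qed
      qed
    qed simp
    finally show ?thesis using U(3) x by simp
  qed
  then have "\<Phi> F = f" using extensionalityI[OF \<Phi>_ext reg_ext[OF f]] by blast
  ultimately show ?thesis unfolding Alg_def by blast
qed

text \<open>
  The inverse of \<open>\<Phi>\<close>.
\<close>

definition \<Psi> :: "('a \<Rightarrow> complex) \<Rightarrow> laurent" where "\<Psi> f = (SOME F. F \<in> Alg S \<and> \<Phi> F = f)"

lemma \<Psi>: assumes "f \<in> reg" shows "\<Psi> f \<in> Alg S" "\<Phi> (\<Psi> f) = f"
proof -
  have "\<exists>F. F \<in> Alg S \<and> \<Phi> F = f" using \<Phi>_surj[OF assms] by blast
  from someI_ex[OF this] show "\<Psi> f \<in> Alg S" "\<Phi> (\<Psi> f) = f" unfolding \<Psi>_def by blast+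
qed

lemma \<Psi>_\<Phi>: assumes "F \<in> Alg S" shows "\<Psi> (\<Phi> F) = F"
  by (rule \<Phi>_inject) (simp_all add: \<Psi> \<Phi>_reg assms)

lemma Alg_S:
  "F \<in> Alg S \<Longrightarrow> G \<in> Alg S \<Longrightarrow> F + G \<in> Alg S" "F \<in> Alg S \<Longrightarrow> G \<in> Alg S \<Longrightarrow> F * G \<in> Alg S"
  "cst c \<in> Alg S" "u \<in> S \<Longrightarrow> chi u \<in> Alg S" "u \<in> S \<Longrightarrow> Poly_Mapping.single u c \<in> Alg S"
proof -
  from S_is_cone obtain p1 p2 b1 b2 where "plane_cone S p1 p2 b1 b2" by (elim exE)
  then interpret plane_cone S p1 p2 b1 b2 .
  show "F \<in> Alg S \<Longrightarrow> G \<in> Alg S \<Longrightarrow> F + G \<in> Alg S" "F \<in> Alg S \<Longrightarrow> G \<in> Alg S \<Longrightarrow> F * G \<in> Alg S"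
    "cst c \<in> Alg S" "u \<in> S \<Longrightarrow> chi u \<in> Alg S" "u \<in> S \<Longrightarrow> Poly_Mapping.single u c \<in> Alg S"
    by (rule Alg_simps Alg_mult; assumption)+
qed

lemma \<Phi>_chi: "u \<in> S \<Longrightarrow> \<Phi> (chi u) = \<chi> u"
  by (rule extensionalityI[OF \<Phi>_ext reg_ext[OF \<chi>_reg]]) (simp_all add: \<Phi>_single)

lemma \<Phi>_pt: "F \<in> Alg S \<Longrightarrow> G \<in> Alg S \<Longrightarrow> \<Phi> (F * G) = (\<lambda>x\<in>X. \<Phi> F x * \<Phi> G x)"
  "\<Phi> (F + G) = (\<lambda>x\<in>X. \<Phi> F x + \<Phi> G x)" "\<Phi> (cst c) = (\<lambda>x\<in>X. c)"
  by (rule extensionalityI[OF \<Phi>_ext restrict_extensional]; simp add: \<Phi>_mult \<Phi>_add \<Phi>_cst)+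

lemma \<Psi>_hom: assumes "f \<in> reg" "g \<in> reg"
  shows "\<Psi> (\<lambda>x\<in>X. f x + g x) = \<Psi> f + \<Psi> g" "\<Psi> (\<lambda>x\<in>X. f x * g x) = \<Psi> f * \<Psi> g"
  using \<Psi>_\<Phi>[OF Alg_S(1)[OF \<Psi>(1)[OF assms(1)] \<Psi>(1)[OF assms(2)]]]
    \<Psi>_\<Phi>[OF Alg_S(2)[OF \<Psi>(1)[OF assms(1)] \<Psi>(1)[OF assms(2)]]]
  unfolding \<Phi>_pt(2) \<Phi>_pt(1)[OF \<Psi>(1)[OF assms(1)] \<Psi>(1)[OF assms(2)]] \<Psi>(2)[OF assms(1)] \<Psi>(2)[OF assms(2)]
  by blast+

lemma \<Psi>_const: "\<Psi> (\<lambda>x\<in>X. c) = cst c"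
  using \<Psi>_\<Phi>[OF Alg_S(3), of c] unfolding \<Phi>_pt(3) .

lemma automorphism_of_points:
  assumes \<phi>: "automorphism_on S \<phi>"
  shows "\<exists>\<alpha>. \<alpha> \<in> Bij X \<and> variety_iso V V \<alpha> \<and> (\<forall>u\<in>S. \<forall>x\<in>X. \<chi> u (\<alpha> x) = \<Phi> (\<phi> (chi u)) x)"
proof -
  define \<phi>' where "\<phi>' = inv_into (Alg S) \<phi>"
  have bij: "bij_betw \<phi> (Alg S) (Alg S)" using \<phi> by (simp add: automorphism_on_def)
  have \<phi>A: "\<phi> F \<in> Alg S" "\<phi>' F \<in> Alg S" "\<phi> (\<phi>' F) = F" "\<phi>' (\<phi> F) = F" if "F \<in> Alg S" for F
    using bij_betw_apply[OF bij that] bij_betw_apply[OF bij_betw_inv_into[OF bij] that]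
      bij_betw_inv_into_right[OF bij that] bij_betw_inv_into_left[OF bij that] by (simp_all add: \<phi>'_def)
  have \<phi>h: "\<phi> (F + G) = \<phi> F + \<phi> G" "\<phi> (F * G) = \<phi> F * \<phi> G" if "F \<in> Alg S" "G \<in> Alg S" for F G
    using \<phi> that by (simp_all add: automorphism_on_def)
  have \<phi>c: "\<phi> (cst c) = cst c" for c using \<phi> by (simp add: automorphism_on_def)
  have inj: "\<phi>' F = G" if "G \<in> Alg S" "\<phi> G = F" for F G using \<phi>A(4) that by blast
  have \<phi>'h: "\<phi>' (F + G) = \<phi>' F + \<phi>' G" "\<phi>' (F * G) = \<phi>' F * \<phi>' G" if "F \<in> Alg S" "G \<in> Alg S" for F G
    by (rule inj; use that in \<open>simp add: \<phi>h \<phi>A Alg_S\<close>)+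
  have \<phi>'c: "\<phi>' (cst c) = cst c" for c by (rule inj[OF Alg_S(3) \<phi>c])
  have pullback: "\<exists>\<alpha>. \<forall>x\<in>X. \<alpha> x \<in> X \<and> (\<forall>f\<in>reg. f (\<alpha> x) = \<Phi> (\<eta> (\<Psi> f)) x)"
    if "\<And>F G. F \<in> Alg S \<Longrightarrow> G \<in> Alg S \<Longrightarrow> \<eta> (F + G) = \<eta> F + \<eta> G"
      "\<And>F G. F \<in> Alg S \<Longrightarrow> G \<in> Alg S \<Longrightarrow> \<eta> (F * G) = \<eta> F * \<eta> G" "\<And>c. \<eta> (cst c) = cst c"
      "\<And>F. F \<in> Alg S \<Longrightarrow> \<eta> F \<in> Alg S" for \<eta>
  proof (rule endomorphism_is_pullback)
    fix f g x assume f: "f \<in> reg" and g: "g \<in> reg" and x: "x \<in> X"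
    show "\<Phi> (\<eta> (\<Psi> (\<lambda>x\<in>X. f x + g x))) x = \<Phi> (\<eta> (\<Psi> f)) x + \<Phi> (\<eta> (\<Psi> g)) x"
      unfolding \<Psi>_hom(1)[OF f g] that(1)[OF \<Psi>(1)[OF f] \<Psi>(1)[OF g]] by (rule \<Phi>_add[OF x])
    show "\<Phi> (\<eta> (\<Psi> (\<lambda>x\<in>X. f x * g x))) x = \<Phi> (\<eta> (\<Psi> f)) x * \<Phi> (\<eta> (\<Psi> g)) x"
      unfolding \<Psi>_hom(2)[OF f g] that(2)[OF \<Psi>(1)[OF f] \<Psi>(1)[OF g]]
      by (rule \<Phi>_mult[OF that(4)[OF \<Psi>(1)[OF f]] that(4)[OF \<Psi>(1)[OF g]] x])
  next
    fix c x assume x: "x \<in> X"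
    show "\<Phi> (\<eta> (\<Psi> (\<lambda>x\<in>X. c))) x = c" unfolding \<Psi>_const that(3) by (rule \<Phi>_cst[OF x])
  qed
  from pullback[of \<phi>, OF \<phi>h \<phi>c \<phi>A(1)] obtain a where
    a: "\<forall>x\<in>X. a x \<in> X \<and> (\<forall>f\<in>reg. f (a x) = \<Phi> (\<phi> (\<Psi> f)) x)" by blast
  from pullback[of \<phi>', OF \<phi>'h \<phi>'c \<phi>A(2)] obtain b where
    b: "\<forall>x\<in>X. b x \<in> X \<and> (\<forall>f\<in>reg. f (b x) = \<Phi> (\<phi>' (\<Psi> f)) x)" by blast
  have aX: "a x \<in> X" and bX: "b x \<in> X" if "x \<in> X" for x using a b that by blast+
  have fa: "f (a x) = \<Phi> (\<phi> (\<Psi> f)) x" and fb: "f (b x) = \<Phi> (\<phi>' (\<Psi> f)) x"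
    if "f \<in> reg" "x \<in> X" for f x using a b that by blast+
  have ra: "\<Phi> (\<phi> (\<Psi> f)) \<in> reg" and rb: "\<Phi> (\<phi>' (\<Psi> f)) \<in> reg" if "f \<in> reg" for f
    using \<Phi>_reg \<phi>A(1,2) \<Psi>(1)[OF that] by blast+
  have ba: "b (a x) = x" if x: "x \<in> X" for x
  proof (rule separating[OF bX[OF aX[OF x]] x])
    fix f assume f: "f \<in> reg"
    show "f (b (a x)) = f x"
      unfolding fb[OF f aX[OF x]] fa[OF rb[OF f] x] \<Psi>_\<Phi>[OF \<phi>A(2)[OF \<Psi>(1)[OF f]]] \<phi>A(3)[OF \<Psi>(1)[OF f]] \<Psi>(2)[OF f] ..
  qed
  have ab: "a (b x) = x" if x: "x \<in> X" for x
  proof (rule separating[OF aX[OF bX[OF x]] x])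
    fix f assume f: "f \<in> reg"
    show "f (a (b x)) = f x"
      unfolding fa[OF f bX[OF x]] fb[OF ra[OF f] x] \<Psi>_\<Phi>[OF \<phi>A(1)[OF \<Psi>(1)[OF f]]] \<phi>A(4)[OF \<Psi>(1)[OF f]] \<Psi>(2)[OF f] ..
  qed
  define \<alpha> where "\<alpha> = restrict a X"
  have \<alpha>x: "\<alpha> x = a x" if "x \<in> X" for x using that by (simp add: \<alpha>_def)
  have bij\<alpha>: "bij_betw \<alpha> X X"
    by (rule bij_betw_byWitness[of X b]) (use \<alpha>x ab ba aX bX in auto)
  have inv\<alpha>: "inv_into X \<alpha> x = b x" if x: "x \<in> X" for x
    by (rule inv_into_f_eq[OF bij_betw_imp_inj_on[OF bij\<alpha>] bX[OF x]]) (use \<alpha>x[OF bX[OF x]] ab[OF x] in simp)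
  have "variety_iso V V \<alpha>" unfolding variety_iso_def morphism_def
  proof (intro conjI ballI bij\<alpha>)
    show "\<alpha> \<in> X \<rightarrow> X" "inv_into X \<alpha> \<in> X \<rightarrow> X" using \<alpha>x aX inv\<alpha> bX by auto
    fix f assume f: "f \<in> reg"
    have "compose X f \<alpha> = \<Phi> (\<phi> (\<Psi> f))"
      by (rule extensionalityI[OF _ \<Phi>_ext]) (simp_all add: compose_def \<alpha>x fa[OF f])
    then show "compose X f \<alpha> \<in> reg" using ra[OF f] by (simp only:)
    have "compose X f (inv_into X \<alpha>) = \<Phi> (\<phi>' (\<Psi> f))"
      by (rule extensionalityI[OF _ \<Phi>_ext]) (simp_all add: compose_def inv\<alpha> fb[OF f])
    then show "compose X f (inv_into X \<alpha>) \<in> reg" using rb[OF f] by (simp only:)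
  qed
  moreover have "\<alpha> \<in> Bij X" using bij\<alpha> by (simp add: Bij_def \<alpha>_def)
  moreover have "\<chi> u (\<alpha> x) = \<Phi> (\<phi> (chi u)) x" if u: "u \<in> S" and x: "x \<in> X" for u x
    using fa[OF \<chi>_reg[OF u] x] \<Psi>_\<Phi>[OF Alg_S(4)[OF u]] unfolding \<alpha>x[OF x] \<Phi>_chi[OF u] by simp
  ultimately show ?thesis by blast
qed

end

lemma (in toric_algebra) coordinates_exist: "\<exists>x0 \<chi>. toric_coordinates V \<tau> x0 \<chi>"
proof -
  obtain x0 where x0: "x0 \<in> X" "\<And>u f. wt u f \<Longrightarrow> (\<exists>x\<in>X. f x \<noteq> 0) \<Longrightarrow> f x0 \<noteq> 0"
    using generating_weights by metis
  have "\<exists>f. wt u f \<and> f x0 = 1" if u: "u \<in> S" for u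
  proof -
    obtain f where f: "wt u f" "\<exists>x\<in>X. f x \<noteq> 0" using u unfolding S_def by blast
    have "wt u (\<lambda>x\<in>X. inverse (f x0) * f x)" "(\<lambda>x\<in>X. inverse (f x0) * f x) x0 = 1"
      using wt_scale[OF f(1)] x0(1) x0(2)[OF f] by simp_all
    then show ?thesis by blast
  qed
  then have "\<forall>u\<in>S. \<exists>f. wt u f \<and> f x0 = 1" by (rule ballI)
  from bchoice[OF this] obtain \<chi> where \<chi>: "\<forall>u\<in>S. wt u (\<chi> u) \<and> \<chi> u x0 = 1" ..
  have "toric_coordinates V \<tau> x0 \<chi>" by unfold_locales (use x0(1) \<chi> in blast)+
  then show ?thesis by blast
qed

section \<open>Actions of the multiplicative group on a toric surface\<close>

text \<open>
  The action of the multiplicative group is regarded as an action of the two-dimensional torus through its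
  first factor, so that the weight decomposition applies to it.
\<close>

locale Gm_toric = toric_coordinates V \<tau> x0 \<chi> + R: torus_rep V "\<lambda>z. \<rho> (fst z)"
  for V :: "'a variety" and \<tau> x0 \<chi> and \<rho> :: "complex \<Rightarrow> 'a \<Rightarrow> 'a" +
  assumes faithful: "t \<noteq> 0 \<Longrightarrow> t \<noteq> 1 \<Longrightarrow> \<exists>x\<in>points V. \<rho> t x \<noteq> x"
begin

lemma \<rho>_closed: "t \<noteq> 0 \<Longrightarrow> x \<in> X \<Longrightarrow> \<rho> t x \<in> X"
  using R.act_closed[of "(t, 1)" x] by simp

lemma \<rho>_one: "x \<in> X \<Longrightarrow> \<rho> 1 x = x"
  using R.act_one[of x] by simp

definition eig :: "int \<Rightarrow> ('a \<Rightarrow> complex) \<Rightarrow> bool" where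
  "eig k f \<longleftrightarrow> f \<in> reg \<and> (\<forall>t x. t \<noteq> 0 \<longrightarrow> x \<in> X \<longrightarrow> f (\<rho> t x) = t powi k * f x)"

lemma eigD: "eig k f \<Longrightarrow> t \<noteq> 0 \<Longrightarrow> x \<in> X \<Longrightarrow> f (\<rho> t x) = t powi k * f x"
  and eig_reg: "eig k f \<Longrightarrow> f \<in> reg"
  and eigI: "f \<in> reg \<Longrightarrow> (\<And>t x. t \<noteq> 0 \<Longrightarrow> x \<in> X \<Longrightarrow> f (\<rho> t x) = t powi k * f x) \<Longrightarrow> eig k f"
  by (simp_all add: eig_def)

lemma eig_mult: assumes "eig k f" "eig l g" shows "eig (k + l) (\<lambda>x\<in>X. f x * g x)"
proof (rule eigI[OF reg_mult[OF eig_reg[OF assms(1)] eig_reg[OF assms(2)]]])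
  fix t x assume t: "t \<noteq> (0 :: complex)" and x: "x \<in> X"
  show "(\<lambda>x\<in>X. f x * g x) (\<rho> t x) = t powi (k + l) * (\<lambda>x\<in>X. f x * g x) x"
    using \<rho>_closed[OF t x] x t by (simp add: eigD[OF assms(1) t x] eigD[OF assms(2) t x] power_int_add)
qed

lemma eig_decomposition:
  assumes f: "f \<in> reg"
  shows "\<exists>K h. finite K \<and> (\<forall>k\<in>K. eig k (h k)) \<and> (\<forall>x\<in>X. f x = (\<Sum>k\<in>K. h k x))"
proof -
  from R.weight_decomposition[OF f] obtain U h where U: "finite U" "\<forall>u\<in>U. R.wt u (h u)"
    "\<forall>x\<in>X. f x = (\<Sum>u\<in>U. h u x)" by (elim exE conjE) (rule that)
  define h' where "h' k = (\<lambda>x\<in>X. \<Sum>u\<in>{u\<in>U. fst u = k}. h u x)" for k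
  have eh: "h u (\<rho> t x) = t powi fst u * h u x" if "u \<in> U" "t \<noteq> 0" "x \<in> X" for u t x
    using R.wtD[OF bspec[OF U(2) that(1)], of "(t, 1)" x] that by (simp add: cpow_def)
  have "eig k (h' k)" for k
  proof (rule eigI)
    show "h' k \<in> reg" unfolding h'_def by (rule reg_sum) (use U(1) in simp, rule R.wt_reg, use U(2) in blast)
    fix t x assume t: "t \<noteq> (0 :: complex)" and x: "x \<in> X"
    have "h' k (\<rho> t x) = (\<Sum>u\<in>{u\<in>U. fst u = k}. h u (\<rho> t x))"
      using \<rho>_closed[OF t x] by (simp add: h'_def)
    also have "\<dots> = (\<Sum>u\<in>{u\<in>U. fst u = k}. t powi k * h u x)"
    proof (rule sum.cong[OF refl])
      fix u assume "u \<in> {u\<in>U. fst u = k}"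
      then have "u \<in> U" "fst u = k" by blast+
      then show "h u (\<rho> t x) = t powi k * h u x" using eh[OF _ t x] by simp
    qed
    finally show "h' k (\<rho> t x) = t powi k * h' k x" using x by (simp add: h'_def sum_distrib_left)
  qed
  moreover have "f x = (\<Sum>k\<in>fst ` U. h' k x)" if x: "x \<in> X" for x
  proof -
    have "f x = (\<Sum>u\<in>U. h u x)" using U(3) x by (rule bspec)
    also have "\<dots> = (\<Sum>k\<in>fst ` U. \<Sum>u\<in>{u\<in>U. fst u = k}. h u x)" by (rule sum.image_gen[OF U(1)])
    finally show ?thesis using x by (simp add: h'_def)
  qed
  ultimately show ?thesis using U(1) by (intro exI[of _ "fst ` U"] exI[of _ h']) simp
qed

text \<open>
  The infinitesimal generator of the action: the derivative at \<open>t = 1\<close>, which exists because regular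
  functions are finite sums of eigenfunctions.
\<close>

definition der :: "('a \<Rightarrow> complex) \<Rightarrow> 'a \<Rightarrow> complex" where
  "der f = (\<lambda>x\<in>X. THE D. ((\<lambda>t. f (\<rho> t x)) has_field_derivative D) (at 1))"

lemma der_eqI: "x \<in> X \<Longrightarrow> ((\<lambda>t. f (\<rho> t x)) has_field_derivative D) (at 1) \<Longrightarrow> der f x = D"
  unfolding der_def by (simp, rule the_equality) (auto intro: DERIV_unique)

lemma near_one: "(\<And>t. t \<noteq> 0 \<Longrightarrow> g t = f t) \<Longrightarrow> (f has_field_derivative D) (at (1 :: complex)) \<Longrightarrow>
    (g has_field_derivative D) (at 1)"
  by (rule has_field_derivative_transform_within_open[of f D 1 "- {0}"]) auto

lemma derivative_sum:
  assumes "finite K" "\<forall>k\<in>K. eig k (h k)" "\<forall>x\<in>X. f x = (\<Sum>k\<in>K. h k x)" "x \<in> X"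
  shows "((\<lambda>t. f (\<rho> t x)) has_field_derivative (\<Sum>k\<in>K. of_int k * h k x)) (at 1)"
proof (rule near_one)
  show "f (\<rho> t x) = (\<Sum>k\<in>K. t powi k * h k x)" if t: "t \<noteq> 0" for t
    using assms(2,3) \<rho>_closed[OF t assms(4)] eigD[OF _ t assms(4)] by simp
  show "((\<lambda>t. \<Sum>k\<in>K. t powi k * h k x) has_field_derivative (\<Sum>k\<in>K. of_int k * h k x)) (at 1)"
    by (rule derivative_eq_intros refl | simp)+
qed

lemma der_sum:
  assumes "finite K" "\<forall>k\<in>K. eig k (h k)" "\<forall>x\<in>X. f x = (\<Sum>k\<in>K. h k x)" "x \<in> X"
  shows "der f x = (\<Sum>k\<in>K. of_int k * h k x)"
  by (rule der_eqI[OF assms(4) derivative_sum[OF assms]])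

lemma der_eig: "eig k f \<Longrightarrow> x \<in> X \<Longrightarrow> der f x = of_int k * f x"
  using der_sum[of "{k}" "\<lambda>_. f" f x] by simp

lemma der_has:
  assumes f: "f \<in> reg" and x: "x \<in> X" shows "((\<lambda>t. f (\<rho> t x)) has_field_derivative der f x) (at 1)"
proof -
  from eig_decomposition[OF f] obtain K h where "finite K" "\<forall>k\<in>K. eig k (h k)"
    "\<forall>x\<in>X. f x = (\<Sum>k\<in>K. h k x)" by (elim exE conjE) (rule that)
  from derivative_sum[OF this x] der_sum[OF this x] show ?thesis by simp
qed

lemma der_reg: assumes f: "f \<in> reg" shows "der f \<in> reg"
proof -
  from eig_decomposition[OF f] obtain K h where K: "finite K" "\<forall>k\<in>K. eig k (h k)"
    "\<forall>x\<in>X. f x = (\<Sum>k\<in>K. h k x)" by (elim exE conjE) (rule that)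
  have "(\<lambda>x\<in>X. \<Sum>k\<in>K. (\<lambda>x\<in>X. of_int k * h k x) x) \<in> reg"
    by (rule reg_sum[OF K(1)]) (rule reg_scale[OF eig_reg[OF bspec[OF K(2)]]])
  moreover have "der f = (\<lambda>x\<in>X. \<Sum>k\<in>K. (\<lambda>x\<in>X. of_int k * h k x) x)"
  proof (rule extensionalityI[of _ X])
    show "der f \<in> extensional X" unfolding der_def by (rule restrict_extensional)
  qed (use der_sum[OF K] in simp_all)
  ultimately show ?thesis by (simp only:)
qed

lemma der_add:
  assumes "f \<in> reg" "g \<in> reg" "x \<in> X" shows "der (\<lambda>x\<in>X. f x + g x) x = der f x + der g x"
proof (rule der_eqI[OF assms(3)], rule near_one)
  show "(\<lambda>x\<in>X. f x + g x) (\<rho> t x) = f (\<rho> t x) + g (\<rho> t x)" if "t \<noteq> 0" for t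
    using \<rho>_closed[OF that assms(3)] by simp
  show "((\<lambda>t. f (\<rho> t x) + g (\<rho> t x)) has_field_derivative der f x + der g x) (at 1)"
    by (rule DERIV_add[OF der_has[OF assms(1,3)] der_has[OF assms(2,3)]])
qed

lemma der_mult:
  assumes "f \<in> reg" "g \<in> reg" "x \<in> X"
  shows "der (\<lambda>x\<in>X. f x * g x) x = f x * der g x + g x * der f x"
proof (rule der_eqI[OF assms(3)], rule near_one)
  show "(\<lambda>x\<in>X. f x * g x) (\<rho> t x) = f (\<rho> t x) * g (\<rho> t x)" if "t \<noteq> 0" for t
    using \<rho>_closed[OF that assms(3)] by simp
  show "((\<lambda>t. f (\<rho> t x) * g (\<rho> t x)) has_field_derivative f x * der g x + g x * der f x) (at 1)"
    using DERIV_mult[OF der_has[OF assms(1,3)] der_has[OF assms(2,3)]]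
    by (simp add: \<rho>_one[OF assms(3)] algebra_simps)
qed

lemma der_const: assumes "x \<in> X" shows "der (\<lambda>x\<in>X. c) x = 0"
proof (rule der_eqI[OF assms], rule near_one)
  show "(\<lambda>x\<in>X. c) (\<rho> t x) = c" if "t \<noteq> 0" for t using \<rho>_closed[OF that assms] by simp
qed simp

text \<open>
  The eigenvalue equation holds for every component of \<open>f\<close>, and so only one of them is nonzero.
\<close>

lemma eig_of_der:
  assumes f: "f \<in> reg" "\<exists>x\<in>X. f x \<noteq> 0" and lam: "\<forall>x\<in>X. der f x = lam * f x"
  shows "\<exists>k. eig k f"
proof -
  from eig_decomposition[OF f(1)] obtain K h where K: "finite K" "\<forall>k\<in>K. eig k (h k)"
    "\<forall>x\<in>X. f x = (\<Sum>k\<in>K. h k x)" by (elim exE conjE) (rule that)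
  have z: "(of_int k - lam) * h k x = 0" if k: "k \<in> K" and x: "x \<in> X" for k x
  proof -
    have "(\<Sum>k\<in>K. (of_int k - lam) * h k x * t powi k) = 0" if t: "t \<noteq> 0" for t
    proof -
      have tx: "\<rho> t x \<in> X" by (rule \<rho>_closed[OF t x])
      have "(\<Sum>k\<in>K. (of_int k - lam) * h k x * t powi k) =
          (\<Sum>k\<in>K. of_int k * h k (\<rho> t x)) - lam * (\<Sum>k\<in>K. h k (\<rho> t x))"
        unfolding sum_distrib_left sum_subtractf[symmetric]
        by (rule sum.cong[OF refl]) (use eigD[OF bspec[OF K(2)] t x] in \<open>simp add: algebra_simps\<close>)
      also have "\<dots> = der f (\<rho> t x) - lam * f (\<rho> t x)" using der_sum[OF K tx] K(3) tx by simp
      finally show ?thesis using lam tx by simp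
    qed
    from powi_independent[OF K(1) this, of k] have "(\<Sum>j\<in>{j\<in>K. j = k}. (of_int j - lam) * h j x) = 0" .
    moreover have "{j\<in>K. j = k} = {k}" using k by blast
    ultimately show ?thesis by simp
  qed
  obtain x1 where x1: "x1 \<in> X" "f x1 \<noteq> 0" using f(2) by blast
  then have "(\<Sum>k\<in>K. h k x1) \<noteq> 0" using K(3) by simp
  then obtain k where k: "k \<in> K" "h k x1 \<noteq> 0" by (meson sum.neutral)
  then have lk: "lam = of_int k" using z[OF k(1) x1(1)] by simp
  have fh: "f x = h k x" if x: "x \<in> X" for x
  proof -
    have "(\<Sum>j\<in>K. h j x) = (\<Sum>j\<in>{k}. h j x)"
      by (rule sum.mono_neutral_right[OF K(1)]) (use k z[OF _ x] in \<open>auto simp: lk\<close>)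
    then show ?thesis using K(3) x by simp
  qed
  have "eig k f"
  proof (rule eigI[OF f(1)])
    fix t x assume t: "t \<noteq> (0 :: complex)" and x: "x \<in> X"
    show "f (\<rho> t x) = t powi k * f x"
      unfolding fh[OF x] fh[OF \<rho>_closed[OF t x]] by (rule eigD[OF bspec[OF K(2) k(1)] t x])
  qed
  then show ?thesis ..
qed

text \<open>
  The generator of the action, transported to \<open>Alg S\<close>.
\<close>

definition d :: "laurent \<Rightarrow> laurent" where "d F = \<Psi> (der (\<Phi> F))"

lemma d_Alg: assumes "F \<in> Alg S" shows "d F \<in> Alg S" and \<Phi>_d: "\<Phi> (d F) = der (\<Phi> F)"
  using \<Psi>[OF der_reg[OF \<Phi>_reg[OF assms]]] by (simp_all add: d_def)

lemma derivation_d: "derivation_on S d"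
  unfolding derivation_on_def
proof (intro conjI ballI allI)
  fix f assume f: "f \<in> Alg S"
  show "d f \<in> Alg S" by (rule d_Alg[OF f])
  fix g assume g: "g \<in> Alg S"
  note rf = \<Phi>_reg[OF f] and rg = \<Phi>_reg[OF g] and df = d_Alg[OF f] and dg = d_Alg[OF g]
  show "d (f + g) = d f + d g"
  proof (rule \<Phi>_inject[OF d_Alg(1)[OF Alg_S(1)[OF f g]] Alg_S(1)[OF df(1) dg(1)]])
    fix x assume x: "x \<in> X"
    show "\<Phi> (d (f + g)) x = \<Phi> (d f + d g) x"
      unfolding \<Phi>_add[OF x, of "d f" "d g"] d_Alg(2)[OF Alg_S(1)[OF f g]] df(2) dg(2)
      unfolding \<Phi>_pt(2) by (rule der_add[OF rf rg x])
  qed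
  show "d (f * g) = f * d g + g * d f"
  proof (rule \<Phi>_inject[OF d_Alg(1)[OF Alg_S(2)[OF f g]] Alg_S(1)[OF Alg_S(2)[OF f dg(1)] Alg_S(2)[OF g df(1)]]])
    fix x assume x: "x \<in> X"
    show "\<Phi> (d (f * g)) x = \<Phi> (f * d g + g * d f) x"
      unfolding \<Phi>_add[OF x] \<Phi>_mult[OF f dg(1) x] \<Phi>_mult[OF g df(1) x]
        d_Alg(2)[OF Alg_S(2)[OF f g]] df(2) dg(2) \<Phi>_pt(1)[OF f g]
      by (rule der_mult[OF rf rg x])
  qed
next
  fix c
  show "d (cst c) = 0"
  proof (rule \<Phi>_eq_0D[OF d_Alg(1)[OF Alg_S(3)]])
    fix x assume x: "x \<in> X"
    show "\<Phi> (d (cst c)) x = 0" unfolding d_Alg(2)[OF Alg_S(3)] \<Phi>_pt(3) by (rule der_const[OF x])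
  qed
qed

lemma semisimple_d: "int_semisimple S d"
  unfolding int_semisimple_def
proof
  fix F assume F: "F \<in> Alg S"
  from eig_decomposition[OF \<Phi>_reg[OF F]] obtain K h where K: "finite K" "\<forall>k\<in>K. eig k (h k)"
    "\<forall>x\<in>X. \<Phi> F x = (\<Sum>k\<in>K. h k x)" by (elim exE conjE) (rule that)
  have h: "\<Psi> (h k) \<in> Alg S" "\<Phi> (\<Psi> (h k)) = h k" if "k \<in> K" for k
    using \<Psi>[OF eig_reg[OF bspec[OF K(2) that]]] by blast+
  have "F = (\<Sum>k\<in>K. \<Psi> (h k))"
  proof (rule \<Phi>_inject[OF F])
    show "(\<Sum>k\<in>K. \<Psi> (h k)) \<in> Alg S" unfolding Alg_def
      using keys_sum_subset[of K "\<lambda>k. \<Psi> (h k)" S] h(1) by (simp add: Alg_def)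
    show "\<Phi> F x = \<Phi> (\<Sum>k\<in>K. \<Psi> (h k)) x" if "x \<in> X" for x
      using that h(2) K(3) by (simp add: \<Phi>_sum[OF K(1) that])
  qed
  moreover have "d (\<Psi> (h k)) = cst (of_int k) * \<Psi> (h k)" if k: "k \<in> K" for k
  proof (rule \<Phi>_inject[OF d_Alg(1)[OF h(1)[OF k]] Alg_S(2)[OF Alg_S(3) h(1)[OF k]]])
    fix x assume x: "x \<in> X"
    show "\<Phi> (d (\<Psi> (h k))) x = \<Phi> (cst (of_int k) * \<Psi> (h k)) x"
      unfolding d_Alg(2)[OF h(1)[OF k]] \<Phi>_mult[OF Alg_S(3) h(1)[OF k] x] \<Phi>_cst[OF x] h(2)[OF k]
      by (rule der_eig[OF bspec[OF K(2) k] x])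
  qed
  ultimately show "\<exists>(K::int set) Fk. finite K \<and> F = (\<Sum>k\<in>K. Fk k) \<and>
      (\<forall>k\<in>K. Fk k \<in> Alg S \<and> d (Fk k) = cst (of_int k) * Fk k)"
    using K(1) h(1) by (intro exI[of _ K] exI[of _ "\<lambda>k. \<Psi> (h k)"]) simp
qed

text \<open>
  The derivation \<open>d\<close> is diagonalized by an automorphism \<open>\<phi>\<close>, and the eigenvalue of \<open>\<phi> (chi u)\<close> is an integer
  that is additive in \<open>u\<close>, hence \<open>dot q u\<close>. If the coordinates of \<open>q\<close> had a greatest common divisor other
  than one, the element given by \<open>nontrivial_root\<close> would act trivially on all functions.
\<close>

theorem linearizing_automorphism:
  "\<exists>\<phi> q. automorphism_on S \<phi> \<and> gcd (fst q) (snd q) = 1 \<and> (\<forall>u\<in>S. eig (dot q u) (\<Phi> (\<phi> (chi u))))"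
proof -
  from S_is_cone obtain p1 p2 b1 b2 where "plane_cone S p1 p2 b1 b2" by (elim exE)
  then interpret C: plane_cone S p1 p2 b1 b2 .
  from C.semisimple_diagonalizable[OF derivation_d semisimple_d] obtain \<phi> where
    \<phi>: "automorphism_on S \<phi>" "\<forall>u\<in>S. \<exists>lam. d (\<phi> (chi u)) = cst lam * \<phi> (chi u)"
    unfolding diagonalizable_def by (elim exE conjE) (rule that)
  have bij: "bij_betw \<phi> (Alg S) (Alg S)" using \<phi>(1) by (simp add: automorphism_on_def)
  have \<phi>A: "\<phi> F \<in> Alg S" if "F \<in> Alg S" for F using bij_betw_apply[OF bij that] .
  have \<phi>h: "\<phi> (F + G) = \<phi> F + \<phi> G" "\<phi> (F * G) = \<phi> F * \<phi> G" if "F \<in> Alg S" "G \<in> Alg S" for F G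
    using \<phi>(1) that by (simp_all add: automorphism_on_def)
  have \<phi>c: "\<phi> (cst c) = cst c" for c using \<phi>(1) by (simp add: automorphism_on_def)
  define g where "g u = \<Phi> (\<phi> (chi u))" for u
  have A: "\<phi> (chi u) \<in> Alg S" if "u \<in> S" for u by (rule \<phi>A[OF Alg_S(4)[OF that]])
  have g: "g u \<in> reg" if "u \<in> S" for u unfolding g_def by (rule \<Phi>_reg[OF A[OF that]])
  have gnz: "\<exists>x\<in>X. g u x \<noteq> 0" if u: "u \<in> S" for u
  proof (rule ccontr)
    assume "\<not> ?thesis"
    then have "\<phi> (chi u) = 0" using \<Phi>_eq_0D[OF A[OF u]] unfolding g_def by blast
    also have "\<dots> = \<phi> 0" using \<phi>c[of 0] by simp
    finally have "chi u = 0"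
      by (rule inj_onD[OF bij_betw_imp_inj_on[OF bij]]) (use Alg_S(4)[OF u] Alg_S(3)[of 0] in simp_all)
    then have "lookup (chi u) u = lookup 0 u" by (rule arg_cong)
    then show False by simp
  qed
  have "\<forall>u\<in>S. \<exists>k. eig k (g u)"
  proof
    fix u assume u: "u \<in> S"
    obtain lam where lam: "d (\<phi> (chi u)) = cst lam * \<phi> (chi u)" using \<phi>(2) u by blast
    have "der (g u) x = lam * g u x" if x: "x \<in> X" for x
      unfolding g_def d_Alg(2)[OF A[OF u], symmetric] lam \<Phi>_mult[OF Alg_S(3) A[OF u] x] \<Phi>_cst[OF x] ..
    then show "\<exists>k. eig k (g u)" by (intro eig_of_der[OF g[OF u] gnz[OF u], of lam] ballI)
  qed
  from bchoice[OF this] obtain kk where kk: "\<forall>u\<in>S. eig (kk u) (g u)" ..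
  have "\<exists>q. \<forall>u\<in>S. kk u = dot q u"
  proof (rule additive_is_dot[OF S_zero S_add S_group])
    fix u v assume u: "u \<in> S" and v: "v \<in> S"
    have uv: "u + v \<in> S" by (rule S_add[OF u v])
    have gm: "g (u + v) = (\<lambda>x\<in>X. g u x * g v x)"
      unfolding g_def chi_mult[symmetric] \<phi>h(2)[OF Alg_S(4)[OF u] Alg_S(4)[OF v]] by (rule \<Phi>_pt(1)[OF A[OF u] A[OF v]])
    obtain x where x: "x \<in> X" "g (u + v) x \<noteq> 0" using gnz[OF uv] by blast
    have 1: "der (g (u + v)) x = of_int (kk (u + v)) * g (u + v) x" by (rule der_eig[OF bspec[OF kk uv] x(1)])
    have 2: "der (g (u + v)) x = of_int (kk u + kk v) * g (u + v) x"
      unfolding gm by (rule der_eig[OF eig_mult[OF bspec[OF kk u] bspec[OF kk v]] x(1)])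
    have "of_int (kk (u + v)) * g (u + v) x = of_int (kk u + kk v) * g (u + v) x"
      by (rule trans[OF 1[symmetric] 2])
    then have "(of_int (kk (u + v)) :: complex) = of_int (kk u + kk v)" using x(2) by simp
    then show "kk (u + v) = kk u + kk v" by (simp only: of_int_eq_iff)
  qed
  then obtain q where q: "\<forall>u\<in>S. kk u = dot q u" ..
  have eig: "eig (dot q u) (g u)" if "u \<in> S" for u using kk q that by (simp add: g_def)
  have "gcd (fst q) (snd q) = 1"
  proof (rule ccontr)
    assume "gcd (fst q) (snd q) \<noteq> 1"
    from nontrivial_root[OF gcd_ge_0_int this] obtain t :: complex where t: "t \<noteq> 0" "t \<noteq> 1"
      and t1: "\<forall>k. gcd (fst q) (snd q) dvd k \<longrightarrow> t powi k = 1" by (elim exE conjE) (rule that)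
    have tq: "t powi dot q u = 1" for u
      using t1 by (simp add: dot_def)
    obtain x where x: "x \<in> X" "\<rho> t x \<noteq> x" using faithful[OF t] by blast
    have "\<rho> t x = x"
    proof (rule separating[OF \<rho>_closed[OF t(1) x(1)] x(1)])
      fix f assume f: "f \<in> reg"
      have "\<Psi> f \<in> \<phi> ` Alg S" using bij \<Psi>(1)[OF f] by (simp add: bij_betw_def)
      then obtain F where F: "F \<in> Alg S" "\<Psi> f = \<phi> F" by blast
      have keysF: "keys F \<subseteq> S" using F(1) by (simp add: Alg_def)
      then have "\<Phi> (\<phi> F) (\<rho> t x) = \<Phi> (\<phi> F) x"
      proof (induction F rule: laurent_induct)
        case (single u c)
        have eq: "\<phi> (Poly_Mapping.single u c) = cst c * \<phi> (chi u)"
          unfolding single_eq_cst_chi[of u c] \<phi>h(2)[OF Alg_S(3) Alg_S(4)[OF single]] \<phi>c ..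
        have "g u (\<rho> t x) = g u x" using eigD[OF eig[OF single] t(1) x(1)] tq by simp
        then show ?case unfolding eq \<Phi>_mult[OF Alg_S(3) A[OF single] x(1)]
            \<Phi>_mult[OF Alg_S(3) A[OF single] \<rho>_closed[OF t(1) x(1)]] g_def
            \<Phi>_cst[OF x(1)] \<Phi>_cst[OF \<rho>_closed[OF t(1) x(1)]] by (simp only:)
      next
        case (add F G)
        then have "F \<in> Alg S" "G \<in> Alg S" by (simp_all add: Alg_def)
        then show ?case using add by (simp only: \<phi>h \<Phi>_add[OF x(1)] \<Phi>_add[OF \<rho>_closed[OF t(1) x(1)]])
      next
        have "\<phi> 0 = 0" using \<phi>c[of 0] by simp
        then show "\<Phi> (\<phi> 0) (\<rho> t x) = \<Phi> (\<phi> 0) x" by (simp only: \<Phi>_0[OF x(1)] \<Phi>_0[OF \<rho>_closed[OF t(1) x(1)]])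
      qed
      then show "f (\<rho> t x) = f x" using \<Psi>(2)[OF f] F(2) by simp
    qed
    then show False using x(2) by simp
  qed
  moreover have "\<forall>u\<in>S. eig (dot q u) (\<Phi> (\<phi> (chi u)))"
    unfolding g_def[symmetric] by (rule ballI) (rule eig)
  ultimately show ?thesis using \<phi>(1) by (intro exI[of _ \<phi>] exI[of _ q] conjI)
qed

theorem conjugating_automorphism:
  "\<exists>\<alpha> q. \<alpha> \<in> Bij X \<and> variety_iso V V \<alpha> \<and> gcd (fst q) (snd q) = 1 \<and>
     (\<forall>t x. t \<noteq> 0 \<longrightarrow> x \<in> X \<longrightarrow> \<alpha> (\<rho> t x) = \<tau> (t powi fst q, t powi snd q) (\<alpha> x))"
proof -
  from linearizing_automorphism obtain \<phi> q where \<phi>: "automorphism_on S \<phi>"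
    and q: "gcd (fst q) (snd q) = 1" and eig: "\<forall>u\<in>S. eig (dot q u) (\<Phi> (\<phi> (chi u)))"
    by (elim exE conjE) (rule that)
  from automorphism_of_points[OF \<phi>] obtain \<alpha> where \<alpha>: "\<alpha> \<in> Bij X" "variety_iso V V \<alpha>"
    "\<forall>u\<in>S. \<forall>x\<in>X. \<chi> u (\<alpha> x) = \<Phi> (\<phi> (chi u)) x" by (elim exE conjE) (rule that)
  have \<alpha>X: "\<alpha> x \<in> X" if "x \<in> X" for x using \<alpha>(1) that by (auto simp: Bij_def bij_betw_def)
  have "\<alpha> (\<rho> t x) = \<tau> (t powi fst q, t powi snd q) (\<alpha> x)" if t: "t \<noteq> 0" and x: "x \<in> X" for t x
  proof -
    define z where "z = (t powi fst q, t powi snd q)"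
    have z: "z \<in> torus" using t by (simp add: z_def)
    have X1: "\<alpha> (\<rho> t x) \<in> X" and X2: "\<tau> z (\<alpha> x) \<in> X"
      by (rule \<alpha>X[OF \<rho>_closed[OF t x]], rule act_closed[OF z \<alpha>X[OF x]])
    have "\<alpha> (\<rho> t x) = \<tau> z (\<alpha> x)"
    proof (rule separating[OF X1 X2])
      fix f assume f: "f \<in> reg"
      have eq: "\<chi> u (\<alpha> (\<rho> t x)) = \<chi> u (\<tau> z (\<alpha> x))" if u: "u \<in> S" for u
      proof -
        have "\<chi> u (\<alpha> (\<rho> t x)) = \<Phi> (\<phi> (chi u)) (\<rho> t x)" using \<alpha>(3) u \<rho>_closed[OF t x] by blast
        also have "\<dots> = t powi dot q u * \<Phi> (\<phi> (chi u)) x" by (rule eigD[OF bspec[OF eig u] t x])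
        also have "\<Phi> (\<phi> (chi u)) x = \<chi> u (\<alpha> x)" using \<alpha>(3) u x by simp
        also have "t powi dot q u = cpow u z"
          using t by (simp add: cpow_def z_def dot_def power_int_add power_int_mult)
        also have "cpow u z * \<chi> u (\<alpha> x) = \<chi> u (\<tau> z (\<alpha> x))"
          by (rule wtD[OF \<chi>_wt[OF u] z \<alpha>X[OF x], symmetric])
        finally show ?thesis .
      qed
      have "\<Phi> (\<Psi> f) (\<alpha> (\<rho> t x)) = \<Phi> (\<Psi> f) (\<tau> z (\<alpha> x))"
        unfolding \<Phi>_superset[OF finite_keys order_refl X1] \<Phi>_superset[OF finite_keys order_refl X2]
      proof (rule sum.cong[OF refl])
        fix u assume "u \<in> keys (\<Psi> f)"
        then have "u \<in> S" using \<Psi>(1)[OF f] unfolding Alg_def by blast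
        from eq[OF this] show "lookup (\<Psi> f) u * \<chi> u (\<alpha> (\<rho> t x)) = lookup (\<Psi> f) u * \<chi> u (\<tau> z (\<alpha> x))"
          by (simp only:)
      qed
      then show "f (\<alpha> (\<rho> t x)) = f (\<tau> z (\<alpha> x))" unfolding \<Psi>(2)[OF f] .
    qed
    then show ?thesis unfolding z_def .
  qed
  then have "\<forall>t x. t \<noteq> 0 \<longrightarrow> x \<in> X \<longrightarrow> \<alpha> (\<rho> t x) = \<tau> (t powi fst q, t powi snd q) (\<alpha> x)" by simp
  then show ?thesis using \<alpha>(1,2) q by (intro exI[of _ \<alpha>] exI[of _ q] conjI)
qed

end

section \<open>Subtori and automorphisms\<close>

lemma cpow_one_parameter:
  "t \<noteq> 0 \<Longrightarrow> cpow u (t powi fst q, t powi snd q) = t powi dot q u"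
  by (simp add: cpow_def dot_def power_int_add power_int_mult)

lemma cpow_powi: "cpow u z powi k = cpow (smul k u) z"
  by (simp add: cpow_def smul_def power_int_mult_distrib power_int_mult[symmetric] mult.commute)

text \<open>
  The monomial \<open>cpow (x, y)\<close>, given by the coefficients of Bezout's identity, is inverse to the
  one-parameter subgroup of \<open>q\<close> on the kernel of the character \<open>(snd q, - fst q)\<close>.
\<close>

lemma one_parameter_image:
  assumes bz: "x * fst q + y * snd q = 1" and w: "w \<in> torus" "cpow (snd q, - fst q) w = 1"
  shows "(cpow (x, y) w powi fst q, cpow (x, y) w powi snd q) = w"
proof -
  have 1: "smul (fst q) (x, y) = (1, 0) + smul (- y) (snd q, - fst q)"
    using bz by (simp add: smul_def algebra_simps)
  have 2: "smul (snd q) (x, y) = (0, 1) + smul x (snd q, - fst q)"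
    using bz by (simp add: smul_def algebra_simps)
  have 3: "cpow (smul k (snd q, - fst q)) w = 1" for k
    unfolding cpow_powi[symmetric] w(2) by simp
  have "cpow (x, y) w powi fst q = fst w"
    unfolding cpow_powi 1 cpow_add[OF w(1)] 3 by (simp add: cpow_def)
  moreover have "cpow (x, y) w powi snd q = snd w"
    unfolding cpow_powi 2 cpow_add[OF w(1)] 3 by (simp add: cpow_def)
  ultimately show ?thesis by simp
qed

lemma points_Gm: "points Gm_variety = UNIV - {0}"
  by (simp add: Gm_variety_def)

lemma points_Gm2: "points (variety_prod Gm_variety Gm_variety) = torus"
  by (simp add: variety_prod_def points_Gm)

lemma carrier_Gm: "carrier Gm_group = UNIV - {0}"
  by (simp add: Gm_group_def)

lemma carrier_Gm2: "carrier (Gm_group \<times>\<times> Gm_group) = torus"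
  by (simp add: DirProd_def carrier_Gm)

lemma group_Gm: "group Gm_group"
  by (rule groupI) (auto simp: Gm_group_def intro!: bexI[of _ "inverse _"])

locale coordinatized_torus =
  fixes T :: "('t, 'm) monoid_scheme" and TV :: "'t variety" and \<psi>0 :: "complex \<times> complex \<Rightarrow> 't"
  assumes alg: "algebraic_group T TV"
    and iso0: "algebraic_group_iso (Gm_group \<times>\<times> Gm_group) (variety_prod Gm_variety Gm_variety) T TV \<psi>0"
begin

lemma group_T: "group T" and points_TV: "points TV = carrier T"
  using alg by (simp_all add: algebraic_group_def)

lemma bij0: "bij_betw \<psi>0 torus (carrier T)"
  using iso0 by (simp add: algebraic_group_iso_def variety_iso_def points_Gm2 points_TV)

lemma \<psi>0_closed: "z \<in> torus \<Longrightarrow> \<psi>0 z \<in> carrier T"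
  by (rule bij_betw_apply[OF bij0])

lemma \<psi>0_mult:
  assumes "z \<in> torus" "w \<in> torus" shows "\<psi>0 (fst z * fst w, snd z * snd w) = \<psi>0 z \<otimes>\<^bsub>T\<^esub> \<psi>0 w"
proof -
  have "\<psi>0 \<in> hom (Gm_group \<times>\<times> Gm_group) T" using iso0 by (simp add: algebraic_group_iso_def iso_def)
  then have "\<psi>0 (z \<otimes>\<^bsub>Gm_group \<times>\<times> Gm_group\<^esub> w) = \<psi>0 z \<otimes>\<^bsub>T\<^esub> \<psi>0 w"
    by (rule hom_mult) (use assms in \<open>simp_all only: carrier_Gm2\<close>)
  moreover have "z \<otimes>\<^bsub>Gm_group \<times>\<times> Gm_group\<^esub> w = (fst z * fst w, snd z * snd w)"
    by (simp add: DirProd_def Gm_group_def case_prod_beta)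
  ultimately show ?thesis by simp
qed

lemma \<psi>0_one: "\<psi>0 (1, 1) = \<one>\<^bsub>T\<^esub>"
proof -
  interpret group T by (rule group_T)
  have "\<psi>0 (1, 1) \<in> carrier T" by (rule \<psi>0_closed) simp
  moreover have "\<psi>0 (1, 1) = \<psi>0 (1, 1) \<otimes>\<^bsub>T\<^esub> \<psi>0 (1, 1)" using \<psi>0_mult[of "(1, 1)" "(1, 1)"] by simp
  ultimately show ?thesis using r_cancel_one' by metis
qed

lemma regular_forward:
  assumes f: "f \<in> regular TV"
  shows "\<exists>(I :: (nat \<times> nat \<times> nat) set) c w. finite I \<and> (\<forall>z\<in>torus. f (\<psi>0 z) = (\<Sum>i\<in>I. c i * cpow (w i) z))"
proof -
  have "compose torus f \<psi>0 \<in> regular (variety_prod Gm_variety Gm_variety)"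
    using iso0 f by (simp add: algebraic_group_iso_def variety_iso_def morphism_def points_Gm2)
  from regular_Gm2_E[OF this] obtain I :: "(nat \<times> nat \<times> nat) set" and c w where
    "finite I" "\<forall>z\<in>torus. compose torus f \<psi>0 z = (\<Sum>i\<in>I. c i * cpow (w i) z)"
    by (elim exE conjE) (rule that)
  then show ?thesis by (intro exI[of _ I] exI[of _ c] exI[of _ w]) (simp add: compose_def del: mem_Sigma_iff)
qed

lemma regular_backward:
  assumes "finite I"
  shows "\<exists>f\<in>regular TV. \<forall>z\<in>torus. f (\<psi>0 z) = (\<Sum>i\<in>I. c i * cpow (w i) z)"
proof -
  define G where "G = (\<lambda>z\<in>torus. \<Sum>i\<in>I. c i * cpow (w i) z)"
  have "G \<in> regular (variety_prod Gm_variety Gm_variety)" unfolding G_def by (rule regular_Gm2_I[OF assms])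
  then have "compose (points TV) G (inv_into torus \<psi>0) \<in> regular TV"
    using iso0 by (simp add: algebraic_group_iso_def variety_iso_def morphism_def points_Gm2)
  moreover have "compose (points TV) G (inv_into torus \<psi>0) (\<psi>0 z) = (\<Sum>i\<in>I. c i * cpow (w i) z)"
    if z: "z \<in> torus" for z
    using \<psi>0_closed[OF z] z bij_betw_inv_into_left[OF bij0 z]
    by (simp add: compose_def points_TV G_def del: mem_Sigma_iff)
  ultimately show ?thesis by blast
qed

text \<open>
  The image is closed, as it is the kernel of the character \<open>(snd q, - fst q)\<close>. The inverse map is the
  restriction of the monomial \<open>cpow (x, y)\<close> of Bezout's identity, hence a morphism.
\<close>

lemma one_parameter_subtorus:
  assumes q: "gcd (fst q) (snd q) = 1"
  defines "\<psi> \<equiv> \<lambda>t. \<psi>0 (t powi fst q, t powi snd q)"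
  shows "parametrized_subtorus T TV (\<psi> ` (UNIV - {0})) \<psi>"
proof -
  interpret T: group T by (rule group_T)
  obtain x y where bz: "x * fst q + y * snd q = 1" using bezout_int[of "fst q" "snd q"] q by auto
  define z where "z t = (t powi fst q, t powi snd q)" for t :: complex
  have \<psi>z: "\<psi> t = \<psi>0 (z t)" for t by (simp add: \<psi>_def z_def)
  have zt: "z t \<in> torus" if "t \<noteq> 0" for t using that by (simp add: z_def)
  have cz: "cpow u (z t) = t powi dot q u" if "t \<noteq> 0" for u t
    unfolding z_def by (rule cpow_one_parameter[OF that])
  have kz: "cpow (x, y) (z t) = t" if "t \<noteq> 0" for t
    unfolding cz[OF that] using bz by (simp add: dot_def mult.commute)
  define S' where "S' = \<psi> ` (UNIV - {0})"
  have \<psi>T: "\<psi> t \<in> carrier T" if "t \<noteq> 0" for t unfolding \<psi>z by (rule \<psi>0_closed[OF zt[OF that]])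
  have inj: "inj_on \<psi> (UNIV - {0})"
  proof (rule inj_onI)
    fix s t assume s: "s \<in> UNIV - {0}" and t: "t \<in> UNIV - {0 :: complex}" and eq: "\<psi> s = \<psi> t"
    have "z s = z t" by (rule inj_onD[OF bij_betw_imp_inj_on[OF bij0] eq[unfolded \<psi>z] zt zt]) (use s t in auto)
    then have "cpow (x, y) (z s) = cpow (x, y) (z t)" by simp
    then show "s = t" using kz s t by simp
  qed
  have hom: "\<psi> \<in> hom Gm_group T"
  proof (rule homI)
    fix s assume s: "s \<in> carrier Gm_group"
    show "\<psi> s \<in> carrier T" using \<psi>T s by (simp add: carrier_Gm)
    fix t assume t: "t \<in> carrier Gm_group"
    have "\<psi>0 (fst (z s) * fst (z t), snd (z s) * snd (z t)) = \<psi>0 (z s) \<otimes>\<^bsub>T\<^esub> \<psi>0 (z t)"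
      by (rule \<psi>0_mult) (use s t zt in \<open>simp_all add: carrier_Gm del: mem_Sigma_iff\<close>)
    then show "\<psi> (s \<otimes>\<^bsub>Gm_group\<^esub> t) = \<psi> s \<otimes>\<^bsub>T\<^esub> \<psi> t"
      by (simp add: \<psi>z z_def Gm_group_def power_int_mult_distrib)
  qed
  interpret gh: group_hom Gm_group T \<psi>
    by (intro group_hom.intro group_hom_axioms.intro group_Gm group_T hom)
  have sub: "subgroup S' T" using gh.img_is_subgroup unfolding carrier_Gm S'_def .
  have bijS: "bij_betw \<psi> (UNIV - {0}) S'" using inj by (simp add: bij_betw_def S'_def)
  have isoS: "\<psi> \<in> iso Gm_group (T\<lparr>carrier := S'\<rparr>)"
  proof (rule isoI)
    show "\<psi> \<in> hom Gm_group (T\<lparr>carrier := S'\<rparr>)"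
      using hom by (auto simp: hom_def carrier_Gm S'_def)
  qed (simp add: bijS carrier_Gm)
  have closed: "zariski_closed TV S'"
  proof -
    have "finite {0 :: nat, 1}" by simp
    from regular_backward[OF this, of "\<lambda>i. if i = 0 then 1 else - 1"
        "\<lambda>i. if i = 0 then (snd q, - fst q) else 0"]
    obtain f where f0: "f \<in> regular TV" "\<forall>w\<in>torus. f (\<psi>0 w) =
        (\<Sum>i\<in>{0 :: nat, 1}. (if i = 0 then 1 else - 1) * cpow (if i = 0 then (snd q, - fst q) else 0) w)" ..
    have f: "f \<in> regular TV" "\<forall>w\<in>torus. f (\<psi>0 w) = cpow (snd q, - fst q) w - 1"
    proof (rule f0(1), rule ballI)
      fix w assume "w \<in> torus"
      from bspec[OF f0(2) this] show "f (\<psi>0 w) = cpow (snd q, - fst q) w - 1" by simp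
    qed
    have "S' = {g \<in> points TV. \<forall>f\<in>{f}. f g = 0}"
    proof (intro Set.set_eqI iffI)
      fix g assume "g \<in> S'"
      then obtain t where t: "t \<noteq> 0" "g = \<psi>0 (z t)" unfolding S'_def \<psi>z by blast
      have "f g = 0" unfolding t(2) bspec[OF f(2) zt[OF t(1)]] cz[OF t(1)] by (simp add: dot_def)
      moreover have "g \<in> points TV" unfolding t(2) points_TV by (rule \<psi>0_closed[OF zt[OF t(1)]])
      ultimately show "g \<in> {g \<in> points TV. \<forall>f\<in>{f}. f g = 0}" by simp
    next
      fix g assume "g \<in> {g \<in> points TV. \<forall>f\<in>{f}. f g = 0}"
      then have g: "g \<in> carrier T" "f g = 0" by (simp_all add: points_TV)
      then obtain w where w: "w \<in> torus" "g = \<psi>0 w" using bij0 unfolding bij_betw_def by blast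
      have "cpow (snd q, - fst q) w = 1" using g(2) bspec[OF f(2) w(1)] w(2) by simp
      from one_parameter_image[OF bz w(1) this] have "z (cpow (x, y) w) = w" by (simp only: z_def)
      then have "g = \<psi> (cpow (x, y) w)" by (simp only: \<psi>z w(2))
      then show "g \<in> S'" unfolding S'_def using cpow_nz[OF w(1)] by blast
    qed
    then show ?thesis unfolding zariski_closed_def using f(1) by (intro exI[of _ "{f}"]) simp
  qed
  have ST: "S' \<subseteq> carrier T" using \<psi>T unfolding S'_def by blast
  have "variety_iso Gm_variety (subvariety TV S') \<psi>"
    unfolding variety_iso_def morphism_def points_Gm
  proof (intro conjI ballI)
    show "bij_betw \<psi> (UNIV - {0}) (points (subvariety TV S'))" using bijS by (simp add: subvariety_def)
    show "\<psi> \<in> UNIV - {0} \<rightarrow> points (subvariety TV S')" by (auto simp: subvariety_def S'_def)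
    show "inv_into (UNIV - {0}) \<psi> \<in> points (subvariety TV S') \<rightarrow> UNIV - {0}"
    proof (rule Pi_I)
      fix g assume "g \<in> points (subvariety TV S')"
      then have "g \<in> \<psi> ` (UNIV - {0})" by (simp add: subvariety_def S'_def)
      then show "inv_into (UNIV - {0}) \<psi> g \<in> UNIV - {0}" by (rule inv_into_into)
    qed
  next
    fix g assume "g \<in> regular (subvariety TV S')"
    then obtain f where f: "f \<in> regular TV" "g = restrict f S'" by (auto simp: subvariety_def)
    from regular_forward[OF f(1)] obtain I :: "(nat \<times> nat \<times> nat) set" and c w where
      I: "finite I" "\<forall>z\<in>torus. f (\<psi>0 z) = (\<Sum>i\<in>I. c i * cpow (w i) z)"
      by (elim exE conjE) (rule that)
    have "compose (UNIV - {0}) g \<psi> = (\<lambda>t\<in>UNIV - {0}. \<Sum>i\<in>I. c i * t powi dot q (w i))"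
      unfolding compose_def
    proof (rule restrict_ext)
      fix t :: complex assume "t \<in> UNIV - {0}"
      then have t: "t \<noteq> 0" by simp
      have "\<psi> t \<in> S'" using t by (simp add: S'_def)
      then have "g (\<psi> t) = f (\<psi>0 (z t))" by (simp add: f(2) \<psi>z)
      also have "\<dots> = (\<Sum>i\<in>I. c i * t powi dot q (w i))"
        unfolding bspec[OF I(2) zt[OF t]] cz[OF t] ..
      finally show "g (\<psi> t) = (\<Sum>i\<in>I. c i * t powi dot q (w i))" .
    qed
    then show "compose (UNIV - {0}) g \<psi> \<in> regular Gm_variety"
      using regular_Gm_I[OF I(1), of c "\<lambda>i. dot q (w i)"] by (simp only:)
  next
    fix g assume g: "g \<in> regular Gm_variety"
    from regular_Gm_E[OF g] obtain I :: "nat set" and c h where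
      I: "finite I" "\<forall>t. t \<noteq> 0 \<longrightarrow> g t = (\<Sum>i\<in>I. c i * t powi h i)" by (elim exE conjE) (rule that)
    from regular_backward[OF I(1), of c "\<lambda>i. smul (h i) (x, y)"]
    obtain f where f: "f \<in> regular TV" "\<forall>w\<in>torus. f (\<psi>0 w) = (\<Sum>i\<in>I. c i * cpow (smul (h i) (x, y)) w)" ..
    have "compose S' g (inv_into (UNIV - {0}) \<psi>) = restrict f S'"
      unfolding compose_def
    proof (rule restrict_ext)
      fix s assume "s \<in> S'"
      then obtain t where t: "t \<noteq> 0" "s = \<psi> t" unfolding S'_def by blast
      have "inv_into (UNIV - {0}) \<psi> s = t" unfolding t(2) by (rule inv_into_f_f[OF inj]) (use t in simp)
      then show "g (inv_into (UNIV - {0}) \<psi> s) = f s"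
        using I(2) t bspec[OF f(2) zt[OF t(1)]] by (simp add: \<psi>z kz flip: cpow_powi)
    qed
    then show "compose (points (subvariety TV S')) g (inv_into (UNIV - {0}) \<psi>) \<in> regular (subvariety TV S')"
      using f(1) by (simp add: subvariety_def)
  qed
  then show ?thesis
    unfolding parametrized_subtorus_def algebraic_group_iso_def S'_def[symmetric]
    using sub closed isoS by blast
qed

end

text \<open>
  Regular functions on a product are finite sums of products, so \<open>f\<close> of the action map is a combination
  of regular functions on \<open>V\<close> whose coefficients are regular functions on the acting group. These are
  pulled back to Laurent polynomials.
\<close>

lemma rational_action:
  fixes W :: "'g variety" and V :: "'a variety"
  assumes mor: "morphism (variety_prod W V) V (\<lambda>(g, x). \<sigma> g x)"
    and scale: "\<And>b c. b \<in> regular V \<Longrightarrow> (\<lambda>x\<in>points V. c * b x) \<in> regular V"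
    and \<psi>: "\<And>z. z \<in> torus \<Longrightarrow> \<psi> z \<in> points W"
    and pull: "\<And>a. a \<in> regular W \<Longrightarrow> \<exists>(I :: (nat \<times> nat \<times> nat) set) c w. finite I \<and>
        (\<forall>z\<in>torus. a (\<psi> z) = (\<Sum>i\<in>I. c i * cpow (w i) z))"
    and f: "f \<in> regular V"
  shows "\<exists>(I :: (nat \<times> nat \<times> nat \<times> nat) set) w h. finite I \<and> (\<forall>i\<in>I. h i \<in> regular V) \<and>
      (\<forall>z\<in>torus. \<forall>x\<in>points V. f (\<sigma> (\<psi> z) x) = (\<Sum>i\<in>I. cpow (w i) z * h i x))"
proof -
  let ?P = "points W \<times> points V"
  have "compose (points (variety_prod W V)) f (\<lambda>(g, x). \<sigma> g x) \<in> regular (variety_prod W V)"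
    using mor f by (simp add: morphism_def)
  then obtain n a b where ab: "\<forall>i<(n::nat). a i \<in> regular W" "\<forall>i<n. b i \<in> regular V"
    and eq: "compose (points (variety_prod W V)) f (\<lambda>(g, x). \<sigma> g x) = (\<lambda>z\<in>?P. \<Sum>i<n. a i (fst z) * b i (snd z))"
    unfolding variety_prod_def by auto
  have fs: "f (\<sigma> g x) = (\<Sum>i<n. a i g * b i x)" if "g \<in> points W" "x \<in> points V" for g x
    using fun_cong[OF eq, of "(g, x)"] that by (simp add: compose_def variety_prod_def)
  define Q where "Q i y \<longleftrightarrow> finite (fst y) \<and>
      (\<forall>z\<in>torus. a i (\<psi> z) = (\<Sum>j\<in>fst y. fst (snd y) j * cpow (snd (snd y) j) z))"
    for i and y :: "(nat \<times> nat \<times> nat) set \<times> (nat \<times> nat \<times> nat \<Rightarrow> complex) \<times> (nat \<times> nat \<times> nat \<Rightarrow> lattice)"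
  have "\<forall>i\<in>{..<n}. \<exists>y. Q i y"
  proof
    fix i assume "i \<in> {..<n}"
    then have "a i \<in> regular W" using ab(1) by simp
    from pull[OF this] obtain I :: "(nat \<times> nat \<times> nat) set" and c w where
      "finite I" "\<forall>z\<in>torus. a i (\<psi> z) = (\<Sum>j\<in>I. c j * cpow (w j) z)" by (elim exE conjE) (rule that)
    then show "\<exists>y. Q i y" by (intro exI[of _ "(I, c, w)"]) (simp add: Q_def del: mem_Sigma_iff)
  qed
  from bchoice[OF this] obtain Y where Y: "\<forall>i\<in>{..<n}. Q i (Y i)" ..
  define J where "J i = fst (Y i)" for i
  define c where "c i = fst (snd (Y i))" for i
  define w where "w i = snd (snd (Y i))" for i
  have J: "finite (J i)" "\<And>z. z \<in> torus \<Longrightarrow> a i (\<psi> z) = (\<Sum>j\<in>J i. c i j * cpow (w i j) z)" if "i < n" for i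
  proof -
    have "Q i (Y i)" using Y that by simp
    then show "finite (J i)" "\<And>z. z \<in> torus \<Longrightarrow> a i (\<psi> z) = (\<Sum>j\<in>J i. c i j * cpow (w i j) z)"
      unfolding Q_def J_def c_def w_def by blast+
  qed
  define h where "h p = (\<lambda>x\<in>points V. c (fst p) (snd p) * b (fst p) x)" for p
  have "f (\<sigma> (\<psi> z) x) = (\<Sum>p\<in>Sigma {..<n} J. cpow (w (fst p) (snd p)) z * h p x)"
    if z: "z \<in> torus" and x: "x \<in> points V" for z x
  proof -
    have "f (\<sigma> (\<psi> z) x) = (\<Sum>i<n. \<Sum>j\<in>J i. cpow (w i j) z * (c i j * b i x))"
      unfolding fs[OF \<psi>[OF z] x]
      by (rule sum.cong[OF refl]) (simp add: J(2)[OF _ z] sum_distrib_left mult_ac)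
    also have "\<dots> = (\<Sum>(i, j)\<in>Sigma {..<n} J. cpow (w i j) z * (c i j * b i x))"
      by (rule sum.Sigma) (use J(1) in simp_all)
    also have "\<dots> = (\<Sum>p\<in>Sigma {..<n} J. cpow (w (fst p) (snd p)) z * h p x)"
      by (rule sum.cong[OF refl]) (simp add: h_def x case_prod_beta)
    finally show ?thesis .
  qed
  moreover have "finite (Sigma {..<n} J)" by (rule finite_SigmaI) (simp_all add: J(1))
  moreover have "h p \<in> regular V" if "p \<in> Sigma {..<n} J" for p
    unfolding h_def by (rule scale) (use ab(2) that in auto)
  ultimately show ?thesis
    by (intro exI[of _ "Sigma {..<n} J"] exI[of _ "\<lambda>p. w (fst p) (snd p)"] exI[of _ h]) blast
qed

lemma (in group_action) action_laws:
  assumes "g \<in> carrier G"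
  shows "\<phi> g \<in> Bij E" "x \<in> E \<Longrightarrow> \<phi> g x \<in> E" "x \<in> E \<Longrightarrow> \<phi> \<one> x = x"
    "h \<in> carrier G \<Longrightarrow> x \<in> E \<Longrightarrow> \<phi> (g \<otimes> h) x = \<phi> g (\<phi> h x)"
proof -
  interpret group_hom G "BijGroup E" \<phi> by (rule group_hom)
  have B: "\<phi> g \<in> Bij E" if "g \<in> carrier G" for g using hom_closed[OF that] by (simp add: BijGroup_def)
  show "\<phi> g \<in> Bij E" by (rule B[OF assms])
  show "x \<in> E \<Longrightarrow> \<phi> g x \<in> E" using B[OF assms] by (auto simp: Bij_def bij_betw_def)
  show "x \<in> E \<Longrightarrow> \<phi> \<one> x = x" using hom_one by (simp add: BijGroup_def)
  show "h \<in> carrier G \<Longrightarrow> x \<in> E \<Longrightarrow> \<phi> (g \<otimes> h) x = \<phi> g (\<phi> h x)"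
    using hom_mult[OF assms, of h] B[OF assms] B[of h] by (simp add: BijGroup_def compose_def)
qed

lemma (in faithful_action) moves_point:
  assumes "g \<in> carrier G" "g \<noteq> \<one>" shows "\<exists>x\<in>E. \<phi> g x \<noteq> x"
proof (rule ccontr)
  interpret group_hom G "BijGroup E" \<phi> by (rule group_hom)
  assume "\<not> ?thesis"
  then have "\<phi> g = \<phi> \<one>"
    using action_laws(1)[OF assms(1)] action_laws(1)[OF G.one_closed] action_laws(3)[OF assms(1)]
    by (intro extensionalityI[of _ E]) (auto simp: Bij_def)
  then show False using inj_onD[OF faithful _ assms(1) G.one_closed] assms(2) by blast
qed

lemma variety_iso_inverse:
  assumes \<alpha>: "\<alpha> \<in> Bij (points V)" "variety_iso V V \<alpha>"
  shows "variety_iso V V (\<lambda>x\<in>points V. inv_into (points V) \<alpha> x)" (is "variety_iso V V ?\<beta>")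
proof -
  let ?X = "points V"
  have bij: "bij_betw \<alpha> ?X ?X" using \<alpha>(1) by (simp add: Bij_def)
  have m: "morphism V V \<alpha>" "morphism V V (inv_into ?X \<alpha>)" using \<alpha>(2) by (simp_all add: variety_iso_def)
  have bij\<beta>: "bij_betw ?\<beta> ?X ?X"
    using bij_betw_cong[of ?X ?\<beta> "inv_into ?X \<alpha>" ?X] bij_betw_inv_into[OF bij] by simp
  have inv\<beta>: "inv_into ?X ?\<beta> x = \<alpha> x" if "x \<in> ?X" for x
    by (rule inv_into_f_eq[OF bij_betw_imp_inj_on[OF bij\<beta>]])
      (use bij_betw_apply[OF bij that] bij_betw_inv_into_left[OF bij that] in simp_all)
  have cong: "morphism V V g" if "morphism V V f" "\<And>x. x \<in> ?X \<Longrightarrow> g x = f x" for f g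
  proof -
    have "compose ?X h g = compose ?X h f" for h :: "'a \<Rightarrow> complex"
      unfolding compose_def by (rule restrict_ext) (simp add: that(2))
    moreover have "g \<in> ?X \<rightarrow> ?X" using that by (auto simp: morphism_def Pi_iff)
    ultimately show ?thesis using that(1) by (simp add: morphism_def)
  qed
  show ?thesis unfolding variety_iso_def
    by (intro conjI bij\<beta> cong[OF m(2)] cong[OF m(1)]) (simp_all add: inv\<beta>)
qed

text \<open>
  The operations of the automorphism group are those of the group of all bijections, and so is the
  inverse, because the inverse of an isomorphism is one.
\<close>

lemma Aut_group_conjugate:
  assumes \<alpha>: "\<alpha> \<in> Bij (points V)" "variety_iso V V \<alpha>" and f: "f \<in> Bij (points V)" and g: "g \<in> Bij (points V)"
    and eq: "\<And>x. x \<in> points V \<Longrightarrow> \<alpha> (f x) = g (\<alpha> x)"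
  shows "\<alpha> \<otimes>\<^bsub>Aut_group V\<^esub> f \<otimes>\<^bsub>Aut_group V\<^esub> inv\<^bsub>Aut_group V\<^esub> \<alpha> = g"
proof -
  let ?X = "points V"
  define B where "B = BijGroup ?X"
  interpret B: group B unfolding B_def by (rule group_BijGroup)
  have cB: "carrier B = Bij ?X" by (simp add: B_def BijGroup_def)
  have A: "carrier (Aut_group V) = {\<alpha> \<in> Bij ?X. variety_iso V V \<alpha>}" "mult (Aut_group V) = mult B"
    "one (Aut_group V) = one B" by (simp_all add: Aut_group_def B_def)
  have inv: "inv\<^bsub>Aut_group V\<^esub> \<alpha> = inv\<^bsub>B\<^esub> \<alpha>"
    unfolding m_inv_def[of "Aut_group V"] A
  proof (rule the_equality)
    have "inv\<^bsub>B\<^esub> \<alpha> = (\<lambda>x\<in>?X. inv_into ?X \<alpha> x)" unfolding B_def by (rule inv_BijGroup[OF \<alpha>(1)])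
    then have "variety_iso V V (inv\<^bsub>B\<^esub> \<alpha>)" using variety_iso_inverse[OF \<alpha>] by (simp only:)
    then show "inv\<^bsub>B\<^esub> \<alpha> \<in> {\<alpha> \<in> Bij ?X. variety_iso V V \<alpha>} \<and>
        \<alpha> \<otimes>\<^bsub>B\<^esub> inv\<^bsub>B\<^esub> \<alpha> = \<one>\<^bsub>B\<^esub> \<and> inv\<^bsub>B\<^esub> \<alpha> \<otimes>\<^bsub>B\<^esub> \<alpha> = \<one>\<^bsub>B\<^esub>"
      using \<alpha>(1) B.inv_closed[of \<alpha>] by (simp add: cB)
  next
    fix y assume "y \<in> {\<alpha> \<in> Bij ?X. variety_iso V V \<alpha>} \<and> \<alpha> \<otimes>\<^bsub>B\<^esub> y = \<one>\<^bsub>B\<^esub> \<and> y \<otimes>\<^bsub>B\<^esub> \<alpha> = \<one>\<^bsub>B\<^esub>"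
    then show "y = inv\<^bsub>B\<^esub> \<alpha>" using B.inv_equality[of y \<alpha>] \<alpha>(1) by (simp add: cB)
  qed
  have "compose ?X \<alpha> f = compose ?X g \<alpha>" unfolding compose_def by (rule restrict_ext) (rule eq)
  then have comm: "\<alpha> \<otimes>\<^bsub>B\<^esub> f = g \<otimes>\<^bsub>B\<^esub> \<alpha>" using \<alpha>(1) f g by (simp add: B_def BijGroup_def)
  have "\<alpha> \<otimes>\<^bsub>B\<^esub> f \<otimes>\<^bsub>B\<^esub> inv\<^bsub>B\<^esub> \<alpha> = g"
  proof -
    have "\<alpha> \<in> carrier B" "g \<in> carrier B" using \<alpha>(1) g by (simp_all add: cB)
    then show ?thesis unfolding comm by (simp add: B.m_assoc)
  qed
  then show ?thesis unfolding inv A .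
qed

section \<open>Conjugation into the torus\<close>

theorem theorem4p5:
  fixes V :: "'a variety"
    and T :: "('t, 'm) monoid_scheme" and TV :: "'t variety"
    and \<sigma> :: "'t \<Rightarrow> 'a \<Rightarrow> 'a"
    and \<rho> :: "complex \<Rightarrow> 'a \<Rightarrow> 'a"
  assumes toric: "affine_toric_surface V T TV \<sigma>"
    and action: "effective_algebraic_action Gm_group Gm_variety V \<rho>"
  shows "\<exists>\<alpha> \<in> carrier (Aut_group V). \<exists>S \<psi>.
           parametrized_subtorus T TV S \<psi> \<and>
           (\<forall>t \<in> carrier Gm_group.
              \<alpha> \<otimes>\<^bsub>Aut_group V\<^esub> \<rho> t \<otimes>\<^bsub>Aut_group V\<^esub> inv\<^bsub>Aut_group V\<^esub> \<alpha> = \<sigma> (\<psi> t))"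
proof -
  have surf: "normal_affine_surface V" and tt: "two_torus T TV" and actT: "effective_algebraic_action T TV V \<sigma>"
    using toric by (simp_all add: affine_toric_surface_def)
  from tt obtain \<psi>0 where "coordinatized_torus T TV \<psi>0"
    unfolding two_torus_def coordinatized_torus_def by blast
  then interpret CT: coordinatized_torus T TV \<psi>0 .
  interpret FT: faithful_action T "points V" \<sigma> using actT by (simp add: effective_algebraic_action_def)
  interpret FG: faithful_action Gm_group "points V" \<rho> using action by (simp add: effective_algebraic_action_def)
  interpret A: variety_algebra V
    by (rule variety_algebra.intro) (use surf in \<open>simp_all add: normal_affine_surface_def normal_variety_def\<close>)
  have morT: "morphism (variety_prod TV V) V (\<lambda>(g, x). \<sigma> g x)"
    and morG: "morphism (variety_prod Gm_variety V) V (\<lambda>(g, x). \<rho> g x)"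
    using actT action by (simp_all add: effective_algebraic_action_def)
  define \<tau> where "\<tau> z = \<sigma> (\<psi>0 z)" for z
  interpret torus_rep V \<tau>
  proof
    fix z x assume z: "z \<in> torus" and x: "x \<in> points V"
    show "\<tau> z x \<in> points V" unfolding \<tau>_def by (rule FT.action_laws(2)[OF CT.\<psi>0_closed[OF z] x])
    fix w assume w: "w \<in> torus"
    show "\<tau> (fst z * fst w, snd z * snd w) x = \<tau> z (\<tau> w x)" unfolding \<tau>_def CT.\<psi>0_mult[OF z w]
      by (rule FT.action_laws(4)[OF CT.\<psi>0_closed[OF z] CT.\<psi>0_closed[OF w] x])
  next
    fix x assume x: "x \<in> points V"
    show "\<tau> (1, 1) x = x" unfolding \<tau>_def CT.\<psi>0_one
      by (rule FT.action_laws(3)[OF _ x, of "\<psi>0 (1, 1)"]) (rule CT.\<psi>0_closed, simp)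
  next
    fix f assume f: "f \<in> regular V"
    show "\<exists>(I :: (nat \<times> nat \<times> nat \<times> nat) set) w h. finite I \<and> (\<forall>i\<in>I. h i \<in> regular V) \<and>
      (\<forall>z\<in>torus. \<forall>x\<in>points V. f (\<tau> z x) = (\<Sum>i\<in>I. cpow (w i) z * h i x))"
      unfolding \<tau>_def by (rule rational_action[OF morT A.reg_scale _ CT.regular_forward f])
        (simp_all only: CT.points_TV CT.\<psi>0_closed)
  qed
  interpret toric_algebra V \<tau>
  proof
    fix z assume z: "z \<in> torus" "z \<noteq> (1, 1)"
    have "\<psi>0 z \<noteq> \<psi>0 (1, 1)" using inj_onD[OF bij_betw_imp_inj_on[OF CT.bij0], of z "(1, 1)"] z by auto
    then show "\<exists>x\<in>points V. \<tau> z x \<noteq> x" unfolding \<tau>_def CT.\<psi>0_one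
      by (rule FT.moves_point[OF CT.\<psi>0_closed[OF z(1)]])
  next
    have "Suc 2 = 3" by simp
    then show "\<nexists>F. alg_independent V 3 F" using surf
      by (simp only: normal_affine_surface_def has_dimension_def) blast
    show "integrally_closed (coordinate_ring V)"
      using surf by (simp add: normal_affine_surface_def normal_variety_def)
  qed
  from coordinates_exist obtain x0 \<chi> where "toric_coordinates V \<tau> x0 \<chi>" by (elim exE)
  then interpret C: toric_coordinates V \<tau> x0 \<chi> .
  interpret R: torus_rep V "\<lambda>z. \<rho> (fst z)"
  proof
    fix z x assume z: "z \<in> torus" and x: "x \<in> points V"
    have fz: "fst z \<in> carrier Gm_group" using z by (auto simp: carrier_Gm)
    show "\<rho> (fst z) x \<in> points V" by (rule FG.action_laws(2)[OF fz x])
    fix w assume w: "w \<in> torus"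
    have fw: "fst w \<in> carrier Gm_group" using w by (auto simp: carrier_Gm)
    show "\<rho> (fst (fst z * fst w, snd z * snd w)) x = \<rho> (fst z) (\<rho> (fst w) x)"
      using FG.action_laws(4)[OF fz fw x] by (simp add: Gm_group_def)
  next
    fix x assume x: "x \<in> points V"
    show "\<rho> (fst (1, 1 :: complex)) x = x"
      using FG.action_laws(3)[OF _ x, of 1] by (simp add: Gm_group_def)
  next
    fix f assume f: "f \<in> regular V"
    have pull: "\<exists>(I :: (nat \<times> nat \<times> nat) set) c w. finite I \<and>
        (\<forall>z\<in>torus. a (fst z) = (\<Sum>i\<in>I. c i * cpow (w i) z))" if a: "a \<in> regular Gm_variety" for a
    proof -
      from regular_Gm_E[OF a] obtain I :: "nat set" and c h where
        I: "finite I" "\<forall>t. t \<noteq> 0 \<longrightarrow> a t = (\<Sum>i\<in>I. c i * t powi h i)" by (elim exE conjE) (rule that)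
      let ?e = "\<lambda>i :: nat. (i, 0 :: nat, 0 :: nat)"
      have "a (fst z) = (\<Sum>j\<in>?e ` I. c (fst j) * cpow (h (fst j), 0) z)" if "z \<in> torus" for z
      proof -
        have "fst z \<noteq> 0" using that by auto
        then have "a (fst z) = (\<Sum>i\<in>I. c i * fst z powi h i)" using I(2) by blast
        also have "\<dots> = (\<Sum>j\<in>?e ` I. c (fst j) * cpow (h (fst j), 0) z)"
          by (subst sum.reindex) (simp_all add: inj_on_def cpow_def)
        finally show ?thesis .
      qed
      then show ?thesis using I(1)
        by (intro exI[of _ "?e ` I"] exI[of _ "\<lambda>j. c (fst j)"] exI[of _ "\<lambda>j. (h (fst j), 0)"]) blast
    qed
    show "\<exists>(I :: (nat \<times> nat \<times> nat \<times> nat) set) w h. finite I \<and> (\<forall>i\<in>I. h i \<in> regular V) \<and>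
      (\<forall>z\<in>torus. \<forall>x\<in>points V. f (\<rho> (fst z) x) = (\<Sum>i\<in>I. cpow (w i) z * h i x))"
      by (rule rational_action[OF morG A.reg_scale _ pull f]) (auto simp: points_Gm)
  qed
  interpret G: Gm_toric V \<tau> x0 \<chi> \<rho>
  proof
    fix t :: complex assume "t \<noteq> 0" "t \<noteq> 1"
    then show "\<exists>x\<in>points V. \<rho> t x \<noteq> x"
      by (intro FG.moves_point) (simp_all add: Gm_group_def)
  qed
  from G.conjugating_automorphism obtain \<alpha> q where \<alpha>: "\<alpha> \<in> Bij (points V)" "variety_iso V V \<alpha>"
    and q: "gcd (fst q) (snd q) = 1"
    and conj: "\<forall>t x. t \<noteq> 0 \<longrightarrow> x \<in> points V \<longrightarrow> \<alpha> (\<rho> t x) = \<tau> (t powi fst q, t powi snd q) (\<alpha> x)"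
    by (elim exE conjE) (rule that)
  define \<psi> where "\<psi> t = \<psi>0 (t powi fst q, t powi snd q)" for t
  have sub: "parametrized_subtorus T TV (\<psi> ` (UNIV - {0})) \<psi>"
    unfolding \<psi>_def by (rule CT.one_parameter_subtorus[OF q])
  have "\<alpha> \<otimes>\<^bsub>Aut_group V\<^esub> \<rho> t \<otimes>\<^bsub>Aut_group V\<^esub> inv\<^bsub>Aut_group V\<^esub> \<alpha> = \<sigma> (\<psi> t)"
    if t: "t \<in> carrier Gm_group" for t
  proof (rule Aut_group_conjugate[OF \<alpha> FG.action_laws(1)[OF t]])
    have t0: "t \<noteq> 0" using t by (simp add: carrier_Gm)
    then have "\<psi> t \<in> carrier T" unfolding \<psi>_def by (intro CT.\<psi>0_closed) simp
    then show "\<sigma> (\<psi> t) \<in> Bij (points V)" by (rule FT.action_laws(1))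
    fix x assume x: "x \<in> points V"
    show "\<alpha> (\<rho> t x) = \<sigma> (\<psi> t) (\<alpha> x)" using conj t0 x by (simp add: \<tau>_def \<psi>_def)
  qed
  then have all: "\<forall>t\<in>carrier Gm_group.
      \<alpha> \<otimes>\<^bsub>Aut_group V\<^esub> \<rho> t \<otimes>\<^bsub>Aut_group V\<^esub> inv\<^bsub>Aut_group V\<^esub> \<alpha> = \<sigma> (\<psi> t)" by (rule ballI)
  have "\<alpha> \<in> carrier (Aut_group V)" using \<alpha> by (simp add: Aut_group_def)
  then show ?thesis
    by (rule bexI[rotated]) (intro exI[of _ "\<psi> ` (UNIV - {0})"] exI[of _ \<psi>] conjI sub all)
qed

end
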